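(* Let $q$ be a power of an odd prime, $G(q)=\mathrm O_{2r}(q)$, $\mathcal X=\mathcal F^{\jmath}_{n,r}$ the $n$-step isotropic flag variety, and $S^{B}_{q,1}(n,r)=S^{B}_{\boldsymbol q,1}(n,r)\otimes_{\mathbb Z[\boldsymbol q]}\mathbb Z$ the specialization at $\boldsymbol q\mapsto q$. There is a $\mathbb Z$-algebra isomorphism $$S^{B}_{q,1}(n,r)\cong\mathfrak F_{G(q)}(\mathcal X\times\mathcal X)$$ sending $e_A|_{\boldsymbol q=q}$ to $f_{\mathcal O_A}$ for all $A\in\Xi_{N,2r}$, where $f_{\mathcal O_A}$ is the characteristic function of the $G(q)$-orbit $\mathcal O_A$.
   Context: Let $n\ge1$, $r\ge2$, $N=2n+1$, $[a,b]=\{x\in\mathbb Z:a\le x\le b\}$, $\mathcal A=\mathbb Z[\boldsymbol q]$ with $\boldsymbol q$ an indeterminate. Algebra. $W$ is the group of permutations $w$ of $[1,2r]$ with $w(i)+w(2r+1-i)=2r+1$ for all $i$ (Weyl group of type $B_r$), with Coxeter generators $s_i=(i,i+1)(2r-i,2r+1-i)$ ($1\le i<r$) and $s_r=(r,r+1)$. $H=H_{\boldsymbol q,1}$ is the $\mathcal A$-algebra generated by $T_1,\dots,T_r$ with relations $T_iT_j=T_jT_i$ ($|i-j|\ge2$), $T_jT_{j+1}T_j=T_{j+1}T_jT_{j+1}$ ($1\le j<r-1$), $T_{r-1}T_rT_{r-1}T_r=T_rT_{r-1}T_rT_{r-1}$, $T_i^2=(\boldsymbol q-1)T_i+\boldsymbol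 q$ ($i<r$), $T_r^2=1$; it has basis $\{T_w\}_{w\in W}$ defined via reduced expressions. $\Lambda(n+1,r)=\{\lambda\in\mathbb N^{n+1}:\sum\lambda_i=r\}$, $\widehat\lambda=(\lambda_1,\dots,\lambda_n,2\lambda_{n+1},\lambda_n,\dots,\lambda_1)$. $W_\lambda$ is generated by the $s_j$, $j\in[1,r]$, with $j\notin\{\lambda_1+\dots+\lambda_i: i\in[1,n]\}$; $x_\lambda=\sum_{w\in W_\lambda}T_w$. $S^{B}_{\boldsymbol q,1}(n,r)=\mathrm{End}_H(\bigoplus_{\lambda\in\Lambda(n+1,r)}x_\lambda H)$ (product is composition). $\Xi_{N,2r}$ is the set of $N\times N$ matrices $A=(a_{i,j})$ over $\mathbb N$ with $a_{i,j}=a_{N+1-i,N+1-j}$ and $\sum a_{i,j}=2r$. Let $R_i^{\widehat\lambda}$ ($1\le i\le N$) be the consecutive intervals of lengths $\widehat\lambda_i$ partitioning $[1,2r]$. The map $(\lambda,d,\mu)\mapsto(|R_i^{\widehat\lambda}\cap dR_j^{\widehat\mu}|)_{i,j}$, with $\lambda,\mu\in\Lambda(n+1,r)$ and $d$ a minimal length representative of a $W_\lambda$-$W_\mu$ double coset, is a bijection onto $\Xi_{N,2r}$; if $A$ is the image of $(\lambda,d,\mu)$, then $e_A\in S^{B}_{\boldsymbol q,1}(n,r)$ is defined by $e_A(x_\nu h)=\delta_{\mu,\nu}\big(\sum_{w\in W_\lambda dW_\mu}T_w\big)h$. The $e_A$ form an $\mathcal A$-basis. Geometry. On $\mathbb F_q^{2r}$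 take the form $\langle x,y\rangle=\sum_{i=1}^{2r}x_iy_{2r+1-i}$; $\mathrm O_{2r}(q)$ is its isometry group. $\mathcal F^{\jmath}_{n,r}$ is the set of flags $0=F_0\subseteq F_1\subseteq\dots\subseteq F_N=\mathbb F_q^{2r}$ with $F_i\subseteq F_i^\perp$ and $F_{N-i}=F_i^\perp$ for $i\in[1,n]$. For $(F,F')\in\mathcal X\times\mathcal X$ put $F_{i,j}=F_{i-1}+F_i\cap F'_j$ and $\mathfrak m(F,F')=(\dim F_{i,j}/F_{i,j-1})_{i,j\in[1,N]}$; $\mathfrak m$ induces a bijection from $G(q)$-orbits (diagonal action) on $\mathcal X\times\mathcal X$ to $\Xi_{N,2r}$, and $\mathcal O_A$ is the orbit mapped to $A$. $\mathfrak F_{G(q)}(\mathcal X\times\mathcal X)$ is the algebra of functions $f:\mathcal X\times\mathcal X\to\mathbb Z$ constant on $G(q)$-orbits with product $(f*f')(x,y)=\sum_{z\in\mathcal X}f(x,z)f'(z,y)$. *)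

theory Defs
  imports
    "HOL-Computational_Algebra.Polynomial"
    "HOL-Combinatorics.Permutations"
    "HOL-Library.Poly_Mapping"
    "HOL-Library.Function_Algebras"
    "HOL-Algebra.Group_Action"
    "HOL-Algebra.Generated_Groups"
    "HOL-Algebra.QuotRing"
    "HOL-Algebra.IntRing"
begin

section \<open>Monoid rings and tensor products of algebras\<close>

definition monoid_ring :: "('m, 'x) monoid_scheme \<Rightarrow> ('m \<Rightarrow>\<^sub>0 'c::comm_ring_1) ring" where
  "monoid_ring M =
    \<lparr>carrier = {f. Poly_Mapping.keys f \<subseteq> carrier M},
     mult = (\<lambda>f g. \<Sum>x\<in>Poly_Mapping.keys f. \<Sum>y\<in>Poly_Mapping.keys g.
               Poly_Mapping.single (x \<otimes>\<^bsub>M\<^esub> y) (Poly_Mapping.lookup f x * Poly_Mapping.lookup g y)),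
     one = Poly_Mapping.single \<one>\<^bsub>M\<^esub> 1,
     zero = 0,
     add = (+)\<rparr>"

text \<open>
  An algebra over a commutative ring \<open>'k\<close> is given by a ring \<open>S\<close> together with its structure map
  \<open>\<alpha> :: 'k \<Rightarrow> 'a\<close> into the centre of \<open>S\<close>.  The tensor product of two such algebras
  \<open>(S, \<alpha>)\<close> and \<open>(B, \<beta>)\<close> is the free abelian group on \<open>S \<times> B\<close> modulo the bilinearity relations,
  with \<open>(s \<otimes> b)(s' \<otimes> b') = ss' \<otimes> bb'\<close>.  The free abelian group with this product is the
  integral monoid ring of the multiplicative monoid \<open>S \<times> B\<close>.  Multiplying a bilinearity relation by
  a pair \<open>(s, b)\<close> on either side gives another one (the structure maps being central), so the
  two-sided ideal the relations generate is just the additive subgroup they generate.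
\<close>

definition tensor_relations ::
  "('a, 'x) ring_scheme \<Rightarrow> ('k \<Rightarrow> 'a) \<Rightarrow> ('b, 'y) ring_scheme \<Rightarrow> ('k \<Rightarrow> 'b) \<Rightarrow> ('a \<times> 'b \<Rightarrow>\<^sub>0 int) set" where
  "tensor_relations S \<alpha> B \<beta> =
     {Poly_Mapping.single (s \<oplus>\<^bsub>S\<^esub> s', b) 1 - Poly_Mapping.single (s, b) 1 - Poly_Mapping.single (s', b) 1
       | s s' b. s \<in> carrier S \<and> s' \<in> carrier S \<and> b \<in> carrier B}
   \<union> {Poly_Mapping.single (s, b \<oplus>\<^bsub>B\<^esub> b') 1 - Poly_Mapping.single (s, b) 1 - Poly_Mapping.single (s, b') 1
       | s b b'. s \<in> carrier S \<and> b \<in> carrier B \<and> b' \<in> carrier B}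
   \<union> {Poly_Mapping.single (\<alpha> a \<otimes>\<^bsub>S\<^esub> s, b) 1 - Poly_Mapping.single (s, \<beta> a \<otimes>\<^bsub>B\<^esub> b) 1
       | a s b. s \<in> carrier S \<and> b \<in> carrier B}"

definition tensor_ideal ::
  "('a, 'x) ring_scheme \<Rightarrow> ('k \<Rightarrow> 'a) \<Rightarrow> ('b, 'y) ring_scheme \<Rightarrow> ('k \<Rightarrow> 'b) \<Rightarrow> ('a \<times> 'b \<Rightarrow>\<^sub>0 int) set" where
  "tensor_ideal S \<alpha> B \<beta> = genideal (monoid_ring (S \<times>\<times> B)) (tensor_relations S \<alpha> B \<beta>)"

definition tensor_algebra ::
  "('a, 'x) ring_scheme \<Rightarrow> ('k \<Rightarrow> 'a) \<Rightarrow> ('b, 'y) ring_scheme \<Rightarrow> ('k \<Rightarrow> 'b) \<Rightarrow> ('a \<times> 'b \<Rightarrow>\<^sub>0 int) set ring" where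
  "tensor_algebra S \<alpha> B \<beta> = monoid_ring (S \<times>\<times> B) Quot tensor_ideal S \<alpha> B \<beta>"

definition pure_tensor ::
  "('a, 'x) ring_scheme \<Rightarrow> ('k \<Rightarrow> 'a) \<Rightarrow> ('b, 'y) ring_scheme \<Rightarrow> ('k \<Rightarrow> 'b) \<Rightarrow> 'a \<Rightarrow> 'b
    \<Rightarrow> ('a \<times> 'b \<Rightarrow>\<^sub>0 int) set" where
  "pure_tensor S \<alpha> B \<beta> s b =
     tensor_ideal S \<alpha> B \<beta> +>\<^bsub>monoid_ring (S \<times>\<times> B)\<^esub> Poly_Mapping.single (s, b) 1"


section \<open>The Weyl group of type B\<close>

definition weylB :: "nat \<Rightarrow> (nat \<Rightarrow> nat) monoid" where
  "weylB r =
    \<lparr>carrier = {w. w permutes {1..2*r} \<and> (\<forall>i\<in>{1..2*r}. w i + w (2*r + 1 - i) = 2*r + 1)},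
     mult = (\<circ>),
     one = id\<rparr>"

definition simple_refl :: "nat \<Rightarrow> nat \<Rightarrow> nat \<Rightarrow> nat" where
  "simple_refl r i =
    (if i < r then Transposition.transpose i (i + 1) \<circ> Transposition.transpose (2*r - i) (2*r + 1 - i)
     else Transposition.transpose r (r + 1))"

definition word_prod :: "nat \<Rightarrow> nat list \<Rightarrow> nat \<Rightarrow> nat" where
  "word_prod r is = foldr (\<lambda>i w. simple_refl r i \<circ> w) is id"

definition weyl_length :: "nat \<Rightarrow> (nat \<Rightarrow> nat) \<Rightarrow> nat" where
  "weyl_length r w = (LEAST k. \<exists>is\<in>lists {1..r}. word_prod r is = w \<and> length is = k)"

definition reduced_word :: "nat \<Rightarrow> (nat \<Rightarrow> nat) \<Rightarrow> nat list \<Rightarrow> bool" where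
  "reduced_word r w is \<longleftrightarrow> is \<in> lists {1..r} \<and> word_prod r is = w \<and> length is = weyl_length r w"


section \<open>The Hecke algebra by generators and relations\<close>

definition qvar :: "int poly" where
  "qvar = [:0, 1:]"

definition free_monoid :: "nat \<Rightarrow> nat list monoid" where
  "free_monoid r = \<lparr>carrier = lists {1..r}, mult = (@), one = []\<rparr>"

definition free_algebra :: "nat \<Rightarrow> (nat list \<Rightarrow>\<^sub>0 int poly) ring" where
  "free_algebra r = monoid_ring (free_monoid r)"

abbreviation word_mon :: "nat list \<Rightarrow> (nat list \<Rightarrow>\<^sub>0 int poly)" where
  "word_mon is \<equiv> Poly_Mapping.single is 1"

definition hecke_relations :: "nat \<Rightarrow> (nat list \<Rightarrow>\<^sub>0 int poly) set" where
  "hecke_relations r =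
     {word_mon [i, j] - word_mon [j, i]
       | i j. i \<in> {1..r} \<and> j \<in> {1..r} \<and> (i + 2 \<le> j \<or> j + 2 \<le> i)}
   \<union> {word_mon [j, j + 1, j] - word_mon [j + 1, j, j + 1] | j. 1 \<le> j \<and> j < r - 1}
   \<union> {word_mon [r - 1, r, r - 1, r] - word_mon [r, r - 1, r, r - 1]}
   \<union> {word_mon [i, i] - (Poly_Mapping.single [i] (qvar - 1) + Poly_Mapping.single [] qvar)
       | i. 1 \<le> i \<and> i < r}
   \<union> {word_mon [r, r] - word_mon []}"

definition hecke_ideal :: "nat \<Rightarrow> (nat list \<Rightarrow>\<^sub>0 int poly) set" where
  "hecke_ideal r = genideal (free_algebra r) (hecke_relations r)"

type_synonym hecke_elem = "(nat list \<Rightarrow>\<^sub>0 int poly) set"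

definition hecke :: "nat \<Rightarrow> hecke_elem ring" where
  "hecke r = free_algebra r Quot hecke_ideal r"

definition hecke_scalar :: "nat \<Rightarrow> int poly \<Rightarrow> hecke_elem" where
  "hecke_scalar r a = hecke_ideal r +>\<^bsub>free_algebra r\<^esub> Poly_Mapping.single [] a"

text \<open>The choice of reduced word is immaterial by the braid relations (Matsumoto).\<close>

definition hecke_T :: "nat \<Rightarrow> (nat \<Rightarrow> nat) \<Rightarrow> hecke_elem" where
  "hecke_T r w = hecke_ideal r +>\<^bsub>free_algebra r\<^esub> word_mon (SOME is. reduced_word r w is)"


section \<open>The q-Schur algebra\<close>

definition weights :: "nat \<Rightarrow> nat \<Rightarrow> (nat \<Rightarrow> nat) set" where
  "weights n r = {\<mu> \<in> {1..n + 1} \<rightarrow>\<^sub>E UNIV. (\<Sum>i = 1..n + 1. \<mu> i) = r}"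

definition weight_hat :: "nat \<Rightarrow> (nat \<Rightarrow> nat) \<Rightarrow> nat \<Rightarrow> nat" where
  "weight_hat n \<mu> i =
    (if i \<le> n then \<mu> i else if i = n + 1 then 2 * \<mu> (n + 1) else \<mu> (2*n + 2 - i))"

definition parabolic :: "nat \<Rightarrow> nat \<Rightarrow> (nat \<Rightarrow> nat) \<Rightarrow> (nat \<Rightarrow> nat) set" where
  "parabolic n r \<mu> =
     generate (weylB r) {simple_refl r j | j. j \<in> {1..r} \<and> j \<notin> {(\<Sum>k = 1..i. \<mu> k) | i. i \<in> {1..n}}}"

definition hecke_x :: "nat \<Rightarrow> nat \<Rightarrow> (nat \<Rightarrow> nat) \<Rightarrow> hecke_elem" where
  "hecke_x n r \<mu> = (\<Oplus>\<^bsub>hecke r\<^esub>w\<in>parabolic n r \<mu>. hecke_T r w)"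

text \<open>
  The right \<open>H\<close>-module \<open>\<Oplus>\<^sub>\<mu> x\<^sub>\<mu> H\<close>.  The index set is finite, so the external direct sum consists
  of all families \<open>m\<close> with \<open>m \<mu> \<in> x\<^sub>\<mu> H\<close>.
\<close>

type_synonym tspace_elem = "(nat \<Rightarrow> nat) \<Rightarrow> hecke_elem"

definition tspace :: "nat \<Rightarrow> nat \<Rightarrow> tspace_elem set" where
  "tspace n r = (\<Pi>\<^sub>E \<mu>\<in>weights n r. {hecke_x n r \<mu> \<otimes>\<^bsub>hecke r\<^esub> h | h. h \<in> carrier (hecke r)})"

definition tspace_add :: "nat \<Rightarrow> nat \<Rightarrow> tspace_elem \<Rightarrow> tspace_elem \<Rightarrow> tspace_elem" where
  "tspace_add n r m m' = (\<lambda>\<mu>\<in>weights n r. m \<mu> \<oplus>\<^bsub>hecke r\<^esub> m' \<mu>)"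

definition tspace_act :: "nat \<Rightarrow> nat \<Rightarrow> tspace_elem \<Rightarrow> hecke_elem \<Rightarrow> tspace_elem" where
  "tspace_act n r m h = (\<lambda>\<mu>\<in>weights n r. m \<mu> \<otimes>\<^bsub>hecke r\<^esub> h)"

definition tspace_inj :: "nat \<Rightarrow> nat \<Rightarrow> (nat \<Rightarrow> nat) \<Rightarrow> hecke_elem \<Rightarrow> tspace_elem" where
  "tspace_inj n r \<nu> y = (\<lambda>\<mu>\<in>weights n r. if \<mu> = \<nu> then y else \<zero>\<^bsub>hecke r\<^esub>)"

definition schurB :: "nat \<Rightarrow> nat \<Rightarrow> (tspace_elem \<Rightarrow> tspace_elem) ring" where
  "schurB n r =
    \<lparr>carrier = {f \<in> tspace n r \<rightarrow>\<^sub>E tspace n r.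
        (\<forall>m\<in>tspace n r. \<forall>m'\<in>tspace n r. f (tspace_add n r m m') = tspace_add n r (f m) (f m')) \<and>
        (\<forall>m\<in>tspace n r. \<forall>h\<in>carrier (hecke r). f (tspace_act n r m h) = tspace_act n r (f m) h)},
     mult = compose (tspace n r),
     one = (\<lambda>m\<in>tspace n r. m),
     zero = (\<lambda>m\<in>tspace n r. (\<lambda>\<mu>\<in>weights n r. \<zero>\<^bsub>hecke r\<^esub>)),
     add = (\<lambda>f g. \<lambda>m\<in>tspace n r. tspace_add n r (f m) (g m))\<rparr>"

definition schurB_scalar :: "nat \<Rightarrow> nat \<Rightarrow> int poly \<Rightarrow> tspace_elem \<Rightarrow> tspace_elem" where
  "schurB_scalar n r a = (\<lambda>m\<in>tspace n r. tspace_act n r m (hecke_scalar r a))"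

definition weight_block :: "nat \<Rightarrow> (nat \<Rightarrow> nat) \<Rightarrow> nat \<Rightarrow> nat set" where
  "weight_block n \<mu> i = {(\<Sum>k = 1..<i. weight_hat n \<mu> k) <.. (\<Sum>k = 1..i. weight_hat n \<mu> k)}"

text \<open>Matrices with rows and columns indexed from 1, as extensional functions on index pairs.\<close>

definition Xi :: "nat \<Rightarrow> nat \<Rightarrow> (nat \<times> nat \<Rightarrow> nat) set" where
  "Xi N k = {A \<in> {1..N} \<times> {1..N} \<rightarrow>\<^sub>E UNIV.
     (\<forall>i\<in>{1..N}. \<forall>j\<in>{1..N}. A (i, j) = A (N + 1 - i, N + 1 - j)) \<and>
     (\<Sum>i = 1..N. \<Sum>j = 1..N. A (i, j)) = k}"

definition double_coset :: "nat \<Rightarrow> nat \<Rightarrow> (nat \<Rightarrow> nat) \<Rightarrow> (nat \<Rightarrow> nat) \<Rightarrow> (nat \<Rightarrow> nat) \<Rightarrow> (nat \<Rightarrow> nat) set" where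
  "double_coset n r \<kappa> d \<mu> = {u \<circ> d \<circ> v | u v. u \<in> parabolic n r \<kappa> \<and> v \<in> parabolic n r \<mu>}"

definition min_double_coset_rep ::
  "nat \<Rightarrow> nat \<Rightarrow> (nat \<Rightarrow> nat) \<Rightarrow> (nat \<Rightarrow> nat) \<Rightarrow> (nat \<Rightarrow> nat) \<Rightarrow> bool" where
  "min_double_coset_rep n r \<kappa> d \<mu> \<longleftrightarrow>
     d \<in> carrier (weylB r) \<and> (\<forall>w\<in>double_coset n r \<kappa> d \<mu>. weyl_length r d \<le> weyl_length r w)"

definition coset_matrix :: "nat \<Rightarrow> (nat \<Rightarrow> nat) \<Rightarrow> (nat \<Rightarrow> nat) \<Rightarrow> (nat \<Rightarrow> nat) \<Rightarrow> nat \<times> nat \<Rightarrow> nat" where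
  "coset_matrix n \<kappa> d \<mu> =
     (\<lambda>(i, j)\<in>{1..2*n + 1} \<times> {1..2*n + 1}. card (weight_block n \<kappa> i \<inter> d ` weight_block n \<mu> j))"

text \<open>
  A matrix in \<open>Xi (2*n + 1) (2*r)\<close> determines the triple \<open>(\<kappa>, d, \<mu>)\<close> uniquely, and the elements
  \<open>x\<^sub>\<nu> h\<close> placed in the summands \<open>\<nu>\<close> generate the module additively, so the description is definite.
\<close>

definition schurB_basis :: "nat \<Rightarrow> nat \<Rightarrow> (nat \<times> nat \<Rightarrow> nat) \<Rightarrow> tspace_elem \<Rightarrow> tspace_elem" where
  "schurB_basis n r A =
    (THE f. \<exists>\<kappa>\<in>weights n r. \<exists>\<mu>\<in>weights n r. \<exists>d.
       min_double_coset_rep n r \<kappa> d \<mu> \<and> coset_matrix n \<kappa> d \<mu> = A \<and> f \<in> carrier (schurB n r) \<and>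
       (\<forall>\<nu>\<in>weights n r. \<forall>h\<in>carrier (hecke r).
          f (tspace_inj n r \<nu> (hecke_x n r \<nu> \<otimes>\<^bsub>hecke r\<^esub> h)) =
            tspace_inj n r \<kappa>
              (if \<mu> = \<nu>
               then (\<Oplus>\<^bsub>hecke r\<^esub>w\<in>double_coset n r \<kappa> d \<mu>. hecke_T r w) \<otimes>\<^bsub>hecke r\<^esub> h
               else \<zero>\<^bsub>hecke r\<^esub>)))"

text \<open>The base change along \<open>\<int>[q] \<rightarrow> \<int>\<close>, evaluating polynomials at the integer \<open>q\<close>.\<close>

definition schurB_spec :: "nat \<Rightarrow> nat \<Rightarrow> nat \<Rightarrow> ((tspace_elem \<Rightarrow> tspace_elem) \<times> int \<Rightarrow>\<^sub>0 int) set ring" where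
  "schurB_spec n r q = tensor_algebra (schurB n r) (schurB_scalar n r) \<Z> (\<lambda>a. poly a (int q))"

definition schurB_spec_basis ::
  "nat \<Rightarrow> nat \<Rightarrow> nat \<Rightarrow> (nat \<times> nat \<Rightarrow> nat) \<Rightarrow> ((tspace_elem \<Rightarrow> tspace_elem) \<times> int \<Rightarrow>\<^sub>0 int) set" where
  "schurB_spec_basis n r q A =
     pure_tensor (schurB n r) (schurB_scalar n r) \<Z> (\<lambda>a. poly a (int q)) (schurB_basis n r A) 1"


section \<open>Convolution algebras of invariant functions\<close>

definition diag_action :: "('g \<Rightarrow> 'x \<Rightarrow> 'x) \<Rightarrow> 'g \<Rightarrow> 'x \<times> 'x \<Rightarrow> 'x \<times> 'x" where
  "diag_action \<phi> g = map_prod (\<phi> g) (\<phi> g)"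

definition invariant_fun_ring ::
  "('g, 'y) monoid_scheme \<Rightarrow> 'x set \<Rightarrow> ('g \<Rightarrow> 'x \<Rightarrow> 'x) \<Rightarrow> ('x \<times> 'x \<Rightarrow> int) ring" where
  "invariant_fun_ring G X \<phi> =
    \<lparr>carrier = {f \<in> X \<times> X \<rightarrow>\<^sub>E UNIV.
       \<forall>C\<in>orbits G (X \<times> X) (diag_action \<phi>). \<forall>p\<in>C. \<forall>p'\<in>C. f p = f p'},
     mult = (\<lambda>f f'. \<lambda>(x, y)\<in>X \<times> X. \<Sum>z\<in>X. f (x, z) * f' (z, y)),
     one = (\<lambda>(x, y)\<in>X \<times> X. if x = y then 1 else 0),
     zero = (\<lambda>p\<in>X \<times> X. 0),
     add = (\<lambda>f f'. \<lambda>p\<in>X \<times> X. f p + f' p)\<rparr>"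

definition char_fun :: "'x set \<Rightarrow> ('x \<times> 'x) set \<Rightarrow> 'x \<times> 'x \<Rightarrow> int" where
  "char_fun X C = (\<lambda>p\<in>X \<times> X. if p \<in> C then 1 else 0)"


section \<open>Isotropic flags\<close>

definition fun_scale :: "'f::field \<Rightarrow> (nat \<Rightarrow> 'f) \<Rightarrow> nat \<Rightarrow> 'f" where
  "fun_scale c v = (\<lambda>i. c * v i)"

global_interpretation fun_space: vector_space "fun_scale :: 'f::field \<Rightarrow> (nat \<Rightarrow> 'f) \<Rightarrow> nat \<Rightarrow> 'f"
  by unfold_locales (auto simp: fun_scale_def fun_eq_iff algebra_simps)

definition coord_space :: "nat \<Rightarrow> (nat \<Rightarrow> 'f::field) set" where
  "coord_space d = {v. \<forall>i. i \<notin> {1..d} \<longrightarrow> v i = 0}"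

definition orth_form :: "nat \<Rightarrow> (nat \<Rightarrow> 'f::field) \<Rightarrow> (nat \<Rightarrow> 'f) \<Rightarrow> 'f" where
  "orth_form r x y = (\<Sum>i = 1..2*r. x i * y (2*r + 1 - i))"

definition perp :: "nat \<Rightarrow> (nat \<Rightarrow> 'f::field) set \<Rightarrow> (nat \<Rightarrow> 'f) set" where
  "perp r U = {y \<in> coord_space (2*r). \<forall>x\<in>U. orth_form r x y = 0}"

definition orth_group :: "nat \<Rightarrow> ((nat \<Rightarrow> 'f::field) \<Rightarrow> nat \<Rightarrow> 'f) monoid" where
  "orth_group r = (BijGroup (coord_space (2*r)))
    \<lparr>carrier := {g \<in> Bij (coord_space (2*r)).
       (\<forall>x\<in>coord_space (2*r). \<forall>y\<in>coord_space (2*r). g (x + y) = g x + g y) \<and>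
       (\<forall>c. \<forall>x\<in>coord_space (2*r). g (fun_scale c x) = fun_scale c (g x)) \<and>
       (\<forall>x\<in>coord_space (2*r). \<forall>y\<in>coord_space (2*r). orth_form r (g x) (g y) = orth_form r x y)}\<rparr>"

type_synonym 'f flag = "nat \<Rightarrow> (nat \<Rightarrow> 'f) set"

definition isotropic_flags :: "nat \<Rightarrow> nat \<Rightarrow> ('f::field) flag set" where
  "isotropic_flags n r =
    {F \<in> extensional {0..2*n + 1}.
       (\<forall>i\<in>{0..2*n + 1}. fun_space.subspace (F i)) \<and>
       F 0 = {0} \<and> F (2*n + 1) = coord_space (2*r) \<and>
       (\<forall>i\<in>{0..2*n}. F i \<subseteq> F (i + 1)) \<and>
       (\<forall>i\<in>{1..n}. F i \<subseteq> perp r (F i) \<and> F (2*n + 1 - i) = perp r (F i))}"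

definition flag_action :: "nat \<Rightarrow> ((nat \<Rightarrow> 'f) \<Rightarrow> nat \<Rightarrow> 'f) \<Rightarrow> 'f flag \<Rightarrow> 'f flag" where
  "flag_action n g F = (\<lambda>i\<in>{0..2*n + 1}. g ` F i)"

definition flag_cell :: "('f::field) flag \<Rightarrow> 'f flag \<Rightarrow> nat \<Rightarrow> nat \<Rightarrow> (nat \<Rightarrow> 'f) set" where
  "flag_cell F F' i j = {u + v | u v. u \<in> F (i - 1) \<and> v \<in> F i \<inter> F' j}"

text \<open>
  Since \<open>flag_cell F F' i (j - 1) \<subseteq> flag_cell F F' i j\<close>, the dimension of the quotient space is
  the difference of the dimensions.
\<close>

definition relative_position :: "nat \<Rightarrow> ('f::field) flag \<times> 'f flag \<Rightarrow> nat \<times> nat \<Rightarrow> nat" where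
  "relative_position n = (\<lambda>(F, F'). \<lambda>(i, j)\<in>{1..2*n + 1} \<times> {1..2*n + 1}.
     fun_space.dim (flag_cell F F' i j) - fun_space.dim (flag_cell F F' i (j - 1)))"

definition flag_orbit :: "nat \<Rightarrow> nat \<Rightarrow> (nat \<times> nat \<Rightarrow> nat) \<Rightarrow> (('f::field) flag \<times> 'f flag) set" where
  "flag_orbit n r A =
    (THE C. C \<in> orbits (orth_group r) (isotropic_flags n r \<times> isotropic_flags n r) (diag_action (flag_action n))
            \<and> (\<forall>p\<in>C. relative_position n p = A))"

end

theory Submission
 imports Defs
begin

text \<open>
 Both algebras are described by matrices, with rows and columns indexed by weights, of functions on
 the Weyl group \<open>W\<close> that are constant on double cosets of parabolic subgroups; the isomorphism
 evaluates the functions of the first description at the order of the field.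

 For the q-Schur algebra, right multiplication by the generators \<open>T\<^sub>i\<close> defines operators on the
 functions \<open>phi : W \<rightarrow> \<int>[q]\<close>, the coefficients of \<open>\<Sum>w. phi w T\<^sub>w\<close>.  They satisfy the defining relations,
 so the Hecke algebra acts on such functions (\<open>hecke_ideal_act\<close>), and by Matsumoto's theorem the \<open>T\<^sub>w\<close>
 span, so an element is the same as its coefficient function (\<open>heq_std_lift\<close>, \<open>hecke_coeff_inj\<close>).  The
 permutation modules become spaces of left invariant functions (\<open>left_inv_hecke_x\<close>).  An endomorphism
 of their sum becomes the matrix of the coefficient functions of the images of the generators, which
 are invariant on both sides, and every such matrix occurs (\<open>schur_exists\<close>): here one divides by the
 Poincare polynomial of a parabolic subgroup.  The basis element of a matrix \<open>A\<close> corresponds to the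
 indicator function of a double coset (\<open>schurB_basis_coeff\<close>).

 For the convolution algebra, complete isotropic flags are spanned by hyperbolic frames, and two of
 them have a common frame up to a permutation in \<open>W\<close>, their position (\<open>bruhat\<close>).  The flags in position
 \<open>s\<^sub>i\<close> to a given one form a family with \<open>q\<close> members, or a single one if \<open>i = r\<close>, because a hyperbolic
 plane has just two isotropic lines; this is the origin of the parameters \<open>q\<close> and \<open>1\<close>.  Summing a
 function of the position over this family is the operator of \<open>T\<^sub>i\<close> at \<open>q\<close> (\<open>neighbour_sum\<close>), so that the Hecke
 action is convolution over complete flags (\<open>hecke_convolution\<close>).  Partial flags are coarsenings of
 complete ones, their relative position is the matrix of the double coset of the position
 (\<open>relative_position_frame\<close>), and as isometries permute the hyperbolic frames transitively, the
 relative position classifies the orbits (\<open>flag_pair_orbit\<close>).  That a matrix determines weights and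
 double coset, and that all centrosymmetric matrices occur, is elementary counting
 (\<open>coset_matrix_eq_imp\<close>, \<open>coset_matrix_surj\<close>).

 Evaluation at \<open>q\<close> is multiplicative since convolution over partial flags unfolds to convolution over
 complete flags (\<open>schur_fun_mult\<close>).  It is onto (\<open>schur_fun_surj\<close>), and a matrix in its kernel is divisible
 by the linear polynomial vanishing at \<open>q\<close> (\<open>schur_fun_kernel\<close>).  Such a surjection identifies the base
 change of the q-Schur algebra (\<open>tensor_algebra_iso\<close>).
\<close>

abbreviation (input) srefl :: "nat => nat => nat => nat" where "srefl \<equiv> simple_refl"
abbreviation (input) single :: "'a => 'b => 'a \<Rightarrow>\<^sub>0 'b::zero" where "single \<equiv> Poly_Mapping.single"
abbreviation (input) keys :: "('a \<Rightarrow>\<^sub>0 'b::zero) => 'a set" where "keys \<equiv> Poly_Mapping.keys"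
abbreviation (input) lookup :: "('a \<Rightarrow>\<^sub>0 'b::zero) => 'a => 'b" where "lookup \<equiv> Poly_Mapping.lookup"

section \<open>Monoid rings\<close>

lemma keys_induct [consumes 1, case_names zero add]:
 fixes f :: "'m \<Rightarrow>\<^sub>0 'c::comm_ring_1"
 assumes "keys f \<subseteq> M"
  and "P 0"
  and "\<And>x c f. x \<in> M ==> keys f \<subseteq> M ==> P f ==> P (single x c + f)"
 shows "P f"
proof -
 have "\<forall>f. keys f = K \<longrightarrow> K \<subseteq> M \<longrightarrow> P f" if "finite K" for K
  using that
 proof (induction K rule: finite_induct)
  case empty
  thus ?case using assms(2) by auto
 next
  case (insert x K)
  show ?case
  proof (intro allI impI)
   fix f :: "'m \<Rightarrow>\<^sub>0 'c" assume f: "keys f = insert x K" and sub: "insert x K \<subseteq> M"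
   define g where "g = Poly_Mapping.update x 0 f"
   have "keys g = K" using f insert(2) by (auto simp: g_def keys_update)
   moreover have "f = single x (lookup f x) + g"
    by (rule poly_mapping_eqI) (auto simp: g_def lookup_add lookup_update lookup_single when_def)
   ultimately show "P f" using assms(3)[of x g] insert.IH sub by (metis insert_subset)
  qed
 qed
 from this[OF finite_keys] show ?thesis using assms(1) by blast
qed

definition linext :: "('m => 'c => 'b) => ('m \<Rightarrow>\<^sub>0 'c::comm_ring_1) => 'b::comm_monoid_add" where
 "linext F f = (\<Sum>x\<in>keys f. F x (lookup f x))"

lemma linext_superset:
 assumes "\<And>x. F x 0 = 0" "finite A" "keys f \<subseteq> A"
 shows "linext F f = (\<Sum>x\<in>A. F x (lookup f x))"
 unfolding linext_def
 using assms by (intro sum.mono_neutral_left) (auto simp: in_keys_iff)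

lemma linext_zero [simp]: "linext F 0 = 0"
 by (simp add: linext_def)

lemma linext_add:
 assumes "\<And>x. F x 0 = 0" "\<And>x a b. F x (a + b) = F x a + F x b"
 shows "linext F (f + g) = linext F f + linext F g"
proof -
 let ?A = "keys f \<union> keys g"
 have "keys (f + g) \<subseteq> ?A" by (rule keys_add)
 thus ?thesis
  using linext_superset[of F ?A] assms(1)
  by (simp add: lookup_add assms(2) sum.distrib)
qed

lemma linext_single:
 assumes "\<And>x. F x 0 = 0"
 shows "linext F (single x c) = F x c"
 using linext_superset[of F "{x}" "single x c"] assms
 by (simp)

lemma monoid_ring_simps [simp]:
 "carrier (monoid_ring M) = {f. keys f \<subseteq> carrier M}"
 "\<zero>\<^bsub>monoid_ring M\<^esub> = 0"
 "\<one>\<^bsub>monoid_ring M\<^esub> = single \<one>\<^bsub>M\<^esub> 1"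
 "f \<oplus>\<^bsub>monoid_ring M\<^esub> g = f + g"
 by (simp_all add: monoid_ring_def)

lemma monoid_ring_mult:
 "f \<otimes>\<^bsub>monoid_ring M\<^esub> g =
   linext (\<lambda>x a. linext (\<lambda>y b. single (x \<otimes>\<^bsub>M\<^esub> y) (a * b)) g) f"
 by (simp add: monoid_ring_def linext_def)

lemma monoid_ring_mult_zero [simp]:
 "0 \<otimes>\<^bsub>monoid_ring M\<^esub> g = 0" "f \<otimes>\<^bsub>monoid_ring M\<^esub> 0 = 0"
 by (simp_all add: monoid_ring_mult, simp add: linext_def)

lemma monoid_ring_mult_add_left:
 "(f + f') \<otimes>\<^bsub>monoid_ring M\<^esub> g = f \<otimes>\<^bsub>monoid_ring M\<^esub> g + f' \<otimes>\<^bsub>monoid_ring M\<^esub> g"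
 unfolding monoid_ring_mult
 by (rule linext_add)
  (simp_all add: linext_def distrib_right single_add sum.distrib)

lemma monoid_ring_mult_add_right:
 "f \<otimes>\<^bsub>monoid_ring M\<^esub> (g + g') = f \<otimes>\<^bsub>monoid_ring M\<^esub> g + f \<otimes>\<^bsub>monoid_ring M\<^esub> g'"
proof -
 have "linext (\<lambda>y b. single (x \<otimes>\<^bsub>M\<^esub> y) (a * b)) (g + g') =
   linext (\<lambda>y b. single (x \<otimes>\<^bsub>M\<^esub> y) (a * b)) g
   + linext (\<lambda>y b. single (x \<otimes>\<^bsub>M\<^esub> y) (a * b)) g'" for x a
  by (rule linext_add) (simp_all add: distrib_left single_add)
 thus ?thesis
  unfolding monoid_ring_mult by (simp add: linext_def sum.distrib)
qed

lemma monoid_ring_mult_single [simp]: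
 "single x a \<otimes>\<^bsub>monoid_ring M\<^esub> single y b = single (x \<otimes>\<^bsub>M\<^esub> y) (a * b)"
 unfolding monoid_ring_mult
 by (subst linext_single) (auto simp: linext_single linext_def)

lemma keys_add_subset:
 assumes "keys f \<subseteq> M" "keys g \<subseteq> M"
 shows "keys (f + g) \<subseteq> M"
 using keys_add[of f g] assms by blast

context
 fixes M :: "('m, 'x) monoid_scheme"
 assumes mon: "monoid M"
begin

lemma monoid_ring_mult_closed:
 assumes "keys (f :: 'm \<Rightarrow>\<^sub>0 'c::comm_ring_1) \<subseteq> carrier M" "keys g \<subseteq> carrier M"
 shows "keys (f \<otimes>\<^bsub>monoid_ring M\<^esub> g) \<subseteq> carrier M"
 using assms(1)
proof (induction f rule: keys_induct)
 case zero
 thus ?case by simp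
next
 case (add x c f)
 have "keys (single x c \<otimes>\<^bsub>monoid_ring M\<^esub> g) \<subseteq> carrier M"
  using assms(2)
  by (induction g rule: keys_induct)
   (simp_all add: monoid_ring_mult_add_right keys_add_subset add(1) monoid.m_closed[OF mon])
 thus ?case by (simp add: monoid_ring_mult_add_left keys_add_subset add)
qed

lemma monoid_ring_mult_assoc:
 assumes "keys (f :: 'm \<Rightarrow>\<^sub>0 'c::comm_ring_1) \<subseteq> carrier M" "keys g \<subseteq> carrier M"
  "keys h \<subseteq> carrier M"
 shows "(f \<otimes>\<^bsub>monoid_ring M\<^esub> g) \<otimes>\<^bsub>monoid_ring M\<^esub> h = f \<otimes>\<^bsub>monoid_ring M\<^esub> (g \<otimes>\<^bsub>monoid_ring M\<^esub> h)"
 using assms(1)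
proof (induction f rule: keys_induct)
 case (add x a f)
 have "(single x a \<otimes>\<^bsub>monoid_ring M\<^esub> g) \<otimes>\<^bsub>monoid_ring M\<^esub> h
   = single x a \<otimes>\<^bsub>monoid_ring M\<^esub> (g \<otimes>\<^bsub>monoid_ring M\<^esub> h)"
  using assms(2)
 proof (induction g rule: keys_induct)
  case (add y b g)
  have "(single x a \<otimes>\<^bsub>monoid_ring M\<^esub> single y b) \<otimes>\<^bsub>monoid_ring M\<^esub> h
    = single x a \<otimes>\<^bsub>monoid_ring M\<^esub> (single y b \<otimes>\<^bsub>monoid_ring M\<^esub> h)"
   using assms(3)
   by (induction h rule: keys_induct)
    (simp_all del: monoid_ring_mult_single
     add: monoid_ring_mult_add_right, simp add: monoid.m_assoc[OF mon \<open>x \<in> _\<close> \<open>y \<in> _\<close>] mult.assoc)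
  thus ?case using add by (simp add: monoid_ring_mult_add_right monoid_ring_mult_add_left)
 qed simp
 thus ?case using add by (simp add: monoid_ring_mult_add_left)
qed simp

lemma monoid_ring_one:
 assumes "keys (f :: 'm \<Rightarrow>\<^sub>0 'c::comm_ring_1) \<subseteq> carrier M"
 shows "single \<one>\<^bsub>M\<^esub> 1 \<otimes>\<^bsub>monoid_ring M\<^esub> f = f \<and> f \<otimes>\<^bsub>monoid_ring M\<^esub> single \<one>\<^bsub>M\<^esub> 1 = f"
 using assms
 by (induction f rule: keys_induct)
  (auto simp: monoid_ring_mult_add_left monoid_ring_mult_add_right monoid.l_one[OF mon] monoid.r_one[OF mon])

lemma ring_monoid_ring: "ring (monoid_ring M :: ('m \<Rightarrow>\<^sub>0 'c::comm_ring_1) ring)"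
proof (rule ringI)
 show "abelian_group (monoid_ring M :: ('m \<Rightarrow>\<^sub>0 'c) ring)"
 proof (rule abelian_groupI)
  fix x :: "'m \<Rightarrow>\<^sub>0 'c" assume "x \<in> carrier (monoid_ring M)"
  thus "\<exists>y\<in>carrier (monoid_ring M). y \<oplus>\<^bsub>monoid_ring M\<^esub> x = \<zero>\<^bsub>monoid_ring M\<^esub>"
   by (intro bexI[of _ "- x"]) (auto simp: in_keys_iff)
 qed (simp_all add: keys_add_subset add_ac)
 show "monoid (monoid_ring M :: ('m \<Rightarrow>\<^sub>0 'c) ring)"
 proof (rule monoidI)
  fix x y z :: "'m \<Rightarrow>\<^sub>0 'c"
  assume "x \<in> carrier (monoid_ring M)" "y \<in> carrier (monoid_ring M)" "z \<in> carrier (monoid_ring M)"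
  hence k: "keys x \<subseteq> carrier M" "keys y \<subseteq> carrier M" "keys z \<subseteq> carrier M"
   by simp_all
  show "x \<otimes>\<^bsub>monoid_ring M\<^esub> y \<in> carrier (monoid_ring M)"
   using monoid_ring_mult_closed[OF k(1,2)] by simp
  show "x \<otimes>\<^bsub>monoid_ring M\<^esub> y \<otimes>\<^bsub>monoid_ring M\<^esub> z = x \<otimes>\<^bsub>monoid_ring M\<^esub> (y \<otimes>\<^bsub>monoid_ring M\<^esub> z)"
   by (rule monoid_ring_mult_assoc[OF k])
  show "\<one>\<^bsub>monoid_ring M\<^esub> \<otimes>\<^bsub>monoid_ring M\<^esub> x = x" "x \<otimes>\<^bsub>monoid_ring M\<^esub> \<one>\<^bsub>monoid_ring M\<^esub> = x"
   using monoid_ring_one[OF k(1)] by simp_all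
 qed (simp add: monoid.one_closed[OF mon])
qed (simp_all add: monoid_ring_mult_add_left monoid_ring_mult_add_right)

end

lemma monoid_ring_uminus:
 assumes "monoid M" "keys (f :: 'm \<Rightarrow>\<^sub>0 'c::comm_ring_1) \<subseteq> carrier M"
 shows "\<ominus>\<^bsub>monoid_ring M\<^esub> f = - f"
proof -
 interpret ring "monoid_ring M :: ('m \<Rightarrow>\<^sub>0 'c) ring" using ring_monoid_ring[OF assms(1)] .
 have "- f \<in> carrier (monoid_ring M)" using assms(2) by (auto simp: in_keys_iff)
 thus ?thesis using assms(2) by (intro minus_equality) auto
qed

lemma ideal_uminus_diff:
 assumes "monoid M" "ideal I (monoid_ring M :: ('m \<Rightarrow>\<^sub>0 'c::comm_ring_1) ring)" "f \<in> I"
 shows "- f \<in> I" "g \<in> I ==> f - g \<in> I" "g \<in> I ==> f + g \<in> I"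
proof -
 interpret ideal I "monoid_ring M :: ('m \<Rightarrow>\<^sub>0 'c) ring" by (rule assms(2))
 have *: "- h \<in> I" if "h \<in> I" for h
  using additive_subgroup.a_inv_closed[OF additive_subgroup_axioms that] monoid_ring_uminus[OF assms(1), of h] Icarr[OF that] by simp
 have **: "h + h' \<in> I" if "h \<in> I" "h' \<in> I" for h h'
  using additive_subgroup.a_closed[OF additive_subgroup_axioms that] by simp
 show "- f \<in> I" "g \<in> I ==> f - g \<in> I" "g \<in> I ==> f + g \<in> I"
  using * ** assms(3) by (metis, metis diff_conv_add_uminus, metis)
qed

section \<open>Base change of an algebra along a quotient of its scalars\<close>

text \<open>
 Integers lift to scalars and can be moved across the tensor sign, so every tensor is some
 \<open>s \<otimes> 1\<close>.  The tensor product is therefore identified by any surjection \<open>psi\<close> of \<open>S\<close> that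
 kills nothing but multiples by scalars in the kernel of \<open>ev\<close>.
\<close>

lemma tensor_algebra_iso:
 fixes S :: "('a, 'x) ring_scheme" and \<alpha> :: "'k::comm_ring_1 => 'a" and ev :: "'k => int" and R :: "('b, 'y) ring_scheme"
 assumes mon: "monoid S" and add: "\<And>s s'. s \<in> carrier S ==> s' \<in> carrier S ==> s \<oplus>\<^bsub>S\<^esub> s' \<in> carrier S"
  and \<alpha>: "\<And>a. \<alpha> a \<in> carrier S"
  and R: "ring R"
  and psi: "psi \<in> ring_hom S R" and surj: "psi ` carrier S = carrier R"
  and scal: "\<And>a s. s \<in> carrier S ==> psi (\<alpha> a \<otimes>\<^bsub>S\<^esub> s) = add_pow R (ev a) (psi s)"
  and ev: "\<And>m. ev (of_int m) = m"
  and ker: "\<And>s. s \<in> carrier S ==> psi s = \<zero>\<^bsub>R\<^esub> ==> \<exists>a s'. ev a = 0 \<and> s' \<in> carrier S \<and> s = \<alpha> a \<otimes>\<^bsub>S\<^esub> s'"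
 shows "\<exists>\<Phi>\<in>ring_iso (tensor_algebra S \<alpha> \<Z> ev) R. \<forall>s\<in>carrier S. \<Phi> (pure_tensor S \<alpha> \<Z> ev s 1) = psi s"
proof -
 define M where "M = S \<times>\<times> \<Z>"
 define RM where "RM = (monoid_ring M :: ('a \<times> int \<Rightarrow>\<^sub>0 int) ring)"
 interpret R: ring R by (rule R)
 have monM: "monoid M" unfolding M_def using mon int.monoid_axioms
  by (metis DirProd_monoid int.is_monoid)
 interpret RM: ring RM unfolding RM_def by (rule ring_monoid_ring[OF monM])
 have cM: "carrier M = carrier S \<times> UNIV" by (auto simp: M_def)
 have cR: "carrier RM = {f. keys f \<subseteq> carrier M}" by (simp add: RM_def)
 have psic: "psi s \<in> carrier R" if "s \<in> carrier S" for s using surj that by blast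
 have psix: "psi (fst x) \<in> carrier R" if "x \<in> carrier M" for x
  using that psic by (auto simp: cM)
 have pow0: "add_pow R (0::int) x = \<zero>\<^bsub>R\<^esub>" for x by (simp add: add_pow_def)
 define \<Psi> where "\<Psi> f = (\<Oplus>\<^bsub>R\<^esub>x\<in>keys f. add_pow R (lookup f x * snd x) (psi (fst x)))"
  for f :: "'a \<times> int \<Rightarrow>\<^sub>0 int"
 have \<Psi>_sup: "\<Psi> f = (\<Oplus>\<^bsub>R\<^esub>x\<in>A. add_pow R (lookup f x * snd x) (psi (fst x)))"
  if "finite A" "keys f \<subseteq> A" "A \<subseteq> carrier M" for f A
  unfolding \<Psi>_def using that
  by (intro R.add.finprod_mono_neutral_cong_left)
   (auto simp: in_keys_iff pow0 intro!: R.add.int_pow_closed psix)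
 have \<Psi>c: "\<Psi> f \<in> carrier R" if "keys f \<subseteq> carrier M" for f
  unfolding \<Psi>_def using that by (intro R.finsum_closed) (auto intro!: R.add.int_pow_closed psix)
 have \<Psi>0: "\<Psi> 0 = \<zero>\<^bsub>R\<^esub>" by (simp add: \<Psi>_def)
 have \<Psi>_add: "\<Psi> (f + g) = \<Psi> f \<oplus>\<^bsub>R\<^esub> \<Psi> g"
  if f: "keys f \<subseteq> carrier M" and g: "keys g \<subseteq> carrier M" for f g
 proof -
  let ?A = "keys f \<union> keys g"
  have A: "finite ?A" "?A \<subseteq> carrier M" "keys (f + g) \<subseteq> ?A"
   using f g keys_add[of f g] by (simp_all)
  have "add_pow R (lookup (f + g) x * snd x) (psi (fst x))
    = add_pow R (lookup f x * snd x) (psi (fst x)) \<oplus>\<^bsub>R\<^esub> add_pow R (lookup g x * snd x) (psi (fst x))"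
   if "x \<in> ?A" for x
   unfolding lookup_add distrib_right
   by (rule R.add.int_pow_mult) (use that A(2) psix in blast)
  hence "\<Psi> (f + g) = (\<Oplus>\<^bsub>R\<^esub>x\<in>?A. add_pow R (lookup f x * snd x) (psi (fst x)) \<oplus>\<^bsub>R\<^esub> add_pow R (lookup g x * snd x) (psi (fst x)))"
   unfolding \<Psi>_sup[OF A(1,3,2)]
   by (intro R.finsum_cong') (use A(2) in \<open>auto intro!: R.add.int_pow_closed psix\<close>)
  also have "\<dots> = \<Psi> f \<oplus>\<^bsub>R\<^esub> \<Psi> g"
   unfolding \<Psi>_sup[OF A(1) Un_upper1 A(2)] \<Psi>_sup[OF A(1) Un_upper2 A(2)]
   by (intro R.finsum_addf) (use A(2) in \<open>auto intro!: R.add.int_pow_closed psix\<close>)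
  finally show ?thesis .
 qed
 have \<Psi>_single: "\<Psi> (single (s, b) c) = add_pow R (c * b) (psi s)" if "s \<in> carrier S" for s b c
 proof -
  have "\<Psi> (single (s, b) c) = (\<Oplus>\<^bsub>R\<^esub>x\<in>{(s, b)}. add_pow R (lookup (single (s, b) c) x * snd x) (psi (fst x)))"
   by (rule \<Psi>_sup) (use that in \<open>auto simp: cM split: if_splits\<close>)
  also have "\<dots> = add_pow R (c * b) (psi s)"
   using that by (simp add: psic R.add.int_pow_closed)
  finally show ?thesis .
 qed
 have pow_mult: "add_pow R (m * n) (x \<otimes>\<^bsub>R\<^esub> y) = add_pow R m x \<otimes>\<^bsub>R\<^esub> add_pow R n y"
  if "x \<in> carrier R" "y \<in> carrier R" for m n :: int and x y
 proof -
  have "add_pow R m x \<otimes>\<^bsub>R\<^esub> add_pow R n y = add_pow R n (add_pow R m x \<otimes>\<^bsub>R\<^esub> y)"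
   using that by (simp add: R.add_pow_rdistr_int)
  also have "\<dots> = add_pow R n (add_pow R m (x \<otimes>\<^bsub>R\<^esub> y))"
   using that by (simp add: R.add_pow_ldistr_int)
  also have "\<dots> = add_pow R (m * n) (x \<otimes>\<^bsub>R\<^esub> y)"
   using that R.add.int_pow_pow[of "x \<otimes>\<^bsub>R\<^esub> y" n m] by simp
  finally show ?thesis by simp
 qed
 have mult1: "\<Psi> (single x a \<otimes>\<^bsub>RM\<^esub> single y b) = \<Psi> (single x a) \<otimes>\<^bsub>R\<^esub> \<Psi> (single y b)"
  if xy: "x \<in> carrier M" "y \<in> carrier M" for x y a b
 proof -
  obtain s m s' n where eq: "x = (s, m)" "y = (s', n)" by fastforce
  have s: "s \<in> carrier S" "s' \<in> carrier S" using xy eq by (auto simp: cM)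
  have "\<Psi> (single x a \<otimes>\<^bsub>RM\<^esub> single y b) = add_pow R ((a * b) * (m * n)) (psi (s \<otimes>\<^bsub>S\<^esub> s'))"
   using s by (simp add: RM_def eq M_def \<Psi>_single monoid.m_closed[OF mon])
  also have "\<dots> = add_pow R ((a * m) * (b * n)) (psi s \<otimes>\<^bsub>R\<^esub> psi s')"
   using s psi by (simp add: ring_hom_mult mult_ac)
  also have "\<dots> = \<Psi> (single x a) \<otimes>\<^bsub>R\<^esub> \<Psi> (single y b)"
   unfolding pow_mult[OF psic psic, OF s] eq \<Psi>_single[OF s(1)] \<Psi>_single[OF s(2)] ..
  finally show ?thesis .
 qed
 have mult2: "\<Psi> (single x a \<otimes>\<^bsub>RM\<^esub> g) = \<Psi> (single x a) \<otimes>\<^bsub>R\<^esub> \<Psi> g"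
  if x: "x \<in> carrier M" and g: "keys g \<subseteq> carrier M" for x a g
  using g
 proof (induction g rule: keys_induct)
  case zero
  thus ?case using x \<Psi>c[of "single x a"] by (simp add: \<Psi>0 RM_def)
 next
  case (add y b g)
  have k: "keys (single x a \<otimes>\<^bsub>RM\<^esub> g') \<subseteq> carrier M"
   if "keys g' \<subseteq> carrier M" for g' :: "'a \<times> int \<Rightarrow>\<^sub>0 int"
   unfolding RM_def by (rule monoid_ring_mult_closed[OF monM]) (use x that in auto)
  have "\<Psi> (single x a \<otimes>\<^bsub>RM\<^esub> (single y b + g))
    = \<Psi> (single x a \<otimes>\<^bsub>RM\<^esub> single y b) \<oplus>\<^bsub>R\<^esub> \<Psi> (single x a \<otimes>\<^bsub>RM\<^esub> g)"
   using \<Psi>_add[OF k k, of "single y b" g] add(1,2)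
   by (simp add: RM_def monoid_ring_mult_add_right)
  also have "\<dots> = \<Psi> (single x a) \<otimes>\<^bsub>R\<^esub> \<Psi> (single y b + g)"
   unfolding mult1[OF x add(1)] add(3)
   by (subst \<Psi>_add) (use x add in \<open>auto simp: R.r_distr \<Psi>c\<close>)
  finally show ?case .
 qed
 have \<Psi>_mult: "\<Psi> (f \<otimes>\<^bsub>RM\<^esub> g) = \<Psi> f \<otimes>\<^bsub>R\<^esub> \<Psi> g"
  if f: "keys f \<subseteq> carrier M" and g: "keys g \<subseteq> carrier M" for f g
  using f
 proof (induction f rule: keys_induct)
  case zero
  thus ?case using g \<Psi>c[of g] by (simp add: \<Psi>0 RM_def)
 next
  case (add x a f)
  have k: "keys (f' \<otimes>\<^bsub>RM\<^esub> g) \<subseteq> carrier M"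
   if "keys f' \<subseteq> carrier M" for f' :: "'a \<times> int \<Rightarrow>\<^sub>0 int"
   unfolding RM_def by (rule monoid_ring_mult_closed[OF monM]) (use g that in auto)
  have "\<Psi> ((single x a + f) \<otimes>\<^bsub>RM\<^esub> g)
    = \<Psi> (single x a \<otimes>\<^bsub>RM\<^esub> g) \<oplus>\<^bsub>R\<^esub> \<Psi> (f \<otimes>\<^bsub>RM\<^esub> g)"
   using \<Psi>_add[OF k k, of "single x a" f] add(1,2)
   by (simp add: RM_def monoid_ring_mult_add_left)
  also have "\<dots> = \<Psi> (single x a + f) \<otimes>\<^bsub>R\<^esub> \<Psi> g"
   unfolding mult2[OF add(1) g] add(3)
   by (subst \<Psi>_add) (use g add in \<open>auto simp: R.l_distr \<Psi>c\<close>)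
  finally show ?case .
 qed
 have hom: "ring_hom_ring RM R \<Psi>"
 proof (rule ring_hom_ringI)
  show "\<Psi> \<one>\<^bsub>RM\<^esub> = \<one>\<^bsub>R\<^esub>"
   using \<Psi>_single[OF monoid.one_closed[OF mon], of 1 1] ring_hom_one[OF psi]
   by (simp add: RM_def M_def)
 qed (use \<Psi>_add \<Psi>_mult \<Psi>c in \<open>auto simp: cR RM.ring_axioms R\<close>, simp add: RM_def)
 interpret \<Psi>: ring_hom_ring RM R \<Psi> by (rule hom)
 let ?K = "a_kernel RM R \<Psi>"
 let ?I = "tensor_ideal S \<alpha> \<Z> ev"
 have mS: "\<alpha> a \<otimes>\<^bsub>S\<^esub> s \<in> carrier S" if "s \<in> carrier S" for a s using that \<alpha> monoid.m_closed[OF mon] by blast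
 have rel: "tensor_relations S \<alpha> \<Z> ev \<subseteq> carrier RM"
  unfolding tensor_relations_def
  using add mS by (auto simp: cR cM dest!: keys_diff[THEN subsetD] split: if_splits)
 have I: "ideal ?I RM"
  unfolding tensor_ideal_def M_def[symmetric] RM_def[symmetric]
  by (rule RM.genideal_ideal[OF rel])
 have relI: "tensor_relations S \<alpha> \<Z> ev \<subseteq> ?I"
  unfolding tensor_ideal_def M_def[symmetric] RM_def[symmetric]
  by (rule RM.genideal_self[OF rel])
 have \<Psi>_minus: "\<Psi> (f - g) = \<Psi> f \<ominus>\<^bsub>R\<^esub> \<Psi> g"
  if f: "keys f \<subseteq> carrier M" and g: "keys g \<subseteq> carrier M" for f g
 proof -
  have fg: "keys (f - g) \<subseteq> carrier M" using keys_diff[of f g] f g by blast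
  have "\<Psi> f = \<Psi> (f - g) \<oplus>\<^bsub>R\<^esub> \<Psi> g" using \<Psi>_add[OF fg g] by simp
  thus ?thesis using \<Psi>c[OF fg] \<Psi>c[OF g] by (simp add: R.minus_eq R.a_assoc R.r_neg)
 qed
 have kM: "keys (single (s, b) c) \<subseteq> carrier M" if "s \<in> carrier S" for s b c
  using that by (auto simp: cM split: if_splits)
 have kM2: "keys (single (s, b) c - single (s', b') c') \<subseteq> carrier M"
  if "s \<in> carrier S" "s' \<in> carrier S" for s b c s' b' c'
  using keys_diff[of "single (s, b) c" "single (s', b') c'"] kM that by blast
 have \<Psi>2: "\<Psi> (single (s, b) 1 - single (s', b') 1) = add_pow R b (psi s) \<ominus>\<^bsub>R\<^esub> add_pow R b' (psi s')"
  if s: "s \<in> carrier S" "s' \<in> carrier S" for s s' b b'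
  unfolding \<Psi>_minus[OF kM[OF s(1)] kM[OF s(2)]] \<Psi>_single[OF s(1)] \<Psi>_single[OF s(2)] by simp
 have \<Psi>3: "\<Psi> (single (s, b) 1 - single (s', b') 1 - single (s'', b'') 1)
   = add_pow R b (psi s) \<ominus>\<^bsub>R\<^esub> add_pow R b' (psi s') \<ominus>\<^bsub>R\<^esub> add_pow R b'' (psi s'')"
  if s: "s \<in> carrier S" "s' \<in> carrier S" "s'' \<in> carrier S" for s s' s'' b b' b''
  unfolding \<Psi>_minus[OF kM2[OF s(1,2)] kM[OF s(3)]] \<Psi>2[OF s(1,2)] \<Psi>_single[OF s(3)] by simp
 have cancel: "(x \<oplus>\<^bsub>R\<^esub> y) \<ominus>\<^bsub>R\<^esub> x \<ominus>\<^bsub>R\<^esub> y = \<zero>\<^bsub>R\<^esub>" if "x \<in> carrier R" "y \<in> carrier R" for x y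
  using that by (simp add: R.minus_eq R.a_comm[of x y] R.a_assoc R.r_neg)
 have relK: "tensor_relations S \<alpha> \<Z> ev \<subseteq> ?K"
 proof
  fix f assume f: "f \<in> tensor_relations S \<alpha> \<Z> ev"
  have z: "\<Psi> f = \<zero>\<^bsub>R\<^esub>"
   using f unfolding tensor_relations_def Un_iff
  proof (elim disjE)
   assume "f \<in> {single (s \<oplus>\<^bsub>S\<^esub> s', b) 1 - single (s, b) 1 - single (s', b) 1
    | s s' b. s \<in> carrier S \<and> s' \<in> carrier S \<and> b \<in> carrier \<Z>}"
   then obtain s s' b where s: "s \<in> carrier S" "s' \<in> carrier S"
    and f: "f = single (s \<oplus>\<^bsub>S\<^esub> s', b) 1 - single (s, b) 1 - single (s', b) 1" by blast
   have "\<Psi> f = (add_pow R b (psi s) \<oplus>\<^bsub>R\<^esub> add_pow R b (psi s')) \<ominus>\<^bsub>R\<^esub> add_pow R b (psi s) \<ominus>\<^bsub>R\<^esub> add_pow R b (psi s')"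
    unfolding f \<Psi>3[OF add[OF s] s] ring_hom_add[OF psi s] R.add.int_pow_distrib[OF psic[OF s(1)] psic[OF s(2)]] ..
   thus ?thesis using s by (simp add: cancel R.add.int_pow_closed psic)
  next
   assume "f \<in> {single (s, b \<oplus>\<^bsub>\<Z>\<^esub> b') 1 - single (s, b) 1 - single (s, b') 1
    | s b b'. s \<in> carrier S \<and> b \<in> carrier \<Z> \<and> b' \<in> carrier \<Z>}"
   then obtain s b b' where s: "s \<in> carrier S"
    and f: "f = single (s, b + b') 1 - single (s, b) 1 - single (s, b') 1" by auto
   have "\<Psi> f = (add_pow R b (psi s) \<oplus>\<^bsub>R\<^esub> add_pow R b' (psi s)) \<ominus>\<^bsub>R\<^esub> add_pow R b (psi s) \<ominus>\<^bsub>R\<^esub> add_pow R b' (psi s)"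
    unfolding f \<Psi>3[OF s s s] R.add.int_pow_mult[OF psic[OF s]] ..
   thus ?thesis using s by (simp add: cancel R.add.int_pow_closed psic)
  next
   assume "f \<in> {single (\<alpha> a \<otimes>\<^bsub>S\<^esub> s, b) 1 - single (s, ev a \<otimes>\<^bsub>\<Z>\<^esub> b) 1
    | a s b. s \<in> carrier S \<and> b \<in> carrier \<Z>}"
   then obtain a s b where s: "s \<in> carrier S"
    and f: "f = single (\<alpha> a \<otimes>\<^bsub>S\<^esub> s, b) 1 - single (s, ev a * b) 1" by auto
   have "\<Psi> f = add_pow R b (add_pow R (ev a) (psi s)) \<ominus>\<^bsub>R\<^esub> add_pow R (ev a * b) (psi s)"
    unfolding f \<Psi>2[OF mS[OF s] s] scal[OF s] ..
   thus ?thesis using s R.add.int_pow_pow[OF psic[OF s], of b "ev a"]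
    by (simp only: R.minus_eq R.r_neg[OF R.add.int_pow_closed[OF psic]])
  qed
  show "f \<in> ?K" unfolding a_kernel_def' using subsetD[OF rel f] z by (intro CollectI conjI)
 qed
 have IK: "?I \<subseteq> ?K"
  unfolding tensor_ideal_def M_def[symmetric] RM_def[symmetric]
  by (rule RM.genideal_minimal[OF \<Psi>.kernel_is_ideal relK])
 interpret I: ideal ?I RM by (rule I)
 note IU = ideal_uminus_diff[OF monM I[unfolded RM_def]]
 define eqv where "eqv f g \<longleftrightarrow> f - g \<in> ?I" for f g
 have I0: "0 \<in> ?I" using I.zero_closed by (simp add: RM_def)
 have eqv_refl: "eqv f f" for f using I0 by (simp add: eqv_def)
 have eqv_sym: "eqv f g ==> eqv g f" for f g unfolding eqv_def using IU(1) by fastforce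
 have eqv_trans: "eqv f g ==> eqv g h ==> eqv f h" for f g h
  unfolding eqv_def using IU(3)[of "f - g" "g - h"] by simp
 have eqv_add: "eqv f g ==> eqv f' g' ==> eqv (f + f') (g + g')" for f g f' g'
  unfolding eqv_def using IU(3)[of "f - g" "f' - g'"] by (simp add: algebra_simps)
 have r1: "eqv (single (s \<oplus>\<^bsub>S\<^esub> s', b) 1) (single (s, b) 1 + single (s', b) 1)"
  if "s \<in> carrier S" "s' \<in> carrier S" for s s' b
  unfolding eqv_def diff_diff_add[symmetric]
  by (rule subsetD[OF relI], unfold tensor_relations_def, rule UnI1, rule UnI1) (use that in blast)
 have r2: "eqv (single (s, b + b') 1) (single (s, b) 1 + single (s, b') 1)"
  if "s \<in> carrier S" for s b b'
  unfolding eqv_def diff_diff_add[symmetric]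
  by (rule subsetD[OF relI], unfold tensor_relations_def, rule UnI1, rule UnI2) (use that in force)
 have r3: "eqv (single (\<alpha> a \<otimes>\<^bsub>S\<^esub> s, b) 1) (single (s, ev a * b) 1)"
  if "s \<in> carrier S" for s b a
  unfolding eqv_def
  by (rule subsetD[OF relI], unfold tensor_relations_def, rule UnI2) (use that in force)
 have z: "eqv (single (s, 0) 1) 0" if "s \<in> carrier S" for s
 proof -
  have "eqv (single (s, 0) 1 + 0) (single (s, 0) 1 + single (s, 0) 1)"
   using r2[OF that, of 0 0] by simp
  thus ?thesis unfolding eqv_def using IU(1) by fastforce
 qed
 have neg: "eqv (single (s, - b) 1) (- single (s, b) 1)" if "s \<in> carrier S" for s b
  using eqv_trans[OF eqv_sym[OF r2[OF that, of "- b" b]], of 0] z[OF that]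
  by (simp add: eqv_def)
 (* An integer coefficient in the free abelian group can be absorbed into the second factor. *)
 have coef: "eqv (single (s, b) c) (single (s, c * b) 1)" if s: "s \<in> carrier S" for s b c
 proof -
  have nat: "eqv (single (s, b) (int k)) (single (s, int k * b) 1)" for k
  proof (induction k)
   case 0
   thus ?case using z[OF s] by (simp add: eqv_sym)
  next
   case (Suc k)
   have "eqv (single (s, int k * b) 1 + single (s, b) 1) (single (s, int k * b + b) 1)"
    using r2[OF s] eqv_sym by blast
   hence "eqv (single (s, b) (int k) + single (s, b) 1) (single (s, int k * b + b) 1)"
    using eqv_trans[OF eqv_add[OF Suc eqv_refl]] by blast
   thus ?case by (simp add: single_add[symmetric] algebra_simps)
  qed
  show ?thesis
  proof (cases "c \<ge> 0")
   case True
   thus ?thesis using nat[of "nat c"] by simp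
  next
   case False
   hence c: "c = - int (nat (- c))" by simp
   let ?k = "nat (- c)"
   have "eqv (- single (s, b) (int ?k)) (- single (s, int ?k * b) 1)"
    using IU(1)[OF nat[of ?k, unfolded eqv_def]] unfolding eqv_def by simp
   hence "eqv (single (s, b) (- int ?k)) (single (s, - (int ?k * b)) 1)"
    using eqv_trans[OF _ eqv_sym[OF neg[OF s]]] by (simp only: single_uminus)
   thus ?thesis using c by (metis mult_minus_left)
  qed
 qed
 (* The second factor is moved across as the scalar with the same image, and sums of s (x) 1 collected. *)
 have red: "\<exists>s\<in>carrier S. eqv f (single (s, 1) 1)" if "keys f \<subseteq> carrier M" for f
  using that
 proof (induction f rule: keys_induct)
  case zero
  have "eqv (single (\<alpha> 0 \<otimes>\<^bsub>S\<^esub> \<one>\<^bsub>S\<^esub>, 1) 1) 0"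
   using eqv_trans[OF r3[OF monoid.one_closed[OF mon], of 0 1]] z[OF monoid.one_closed[OF mon]] ev[of 0] by simp
  thus ?case using mS[OF monoid.one_closed[OF mon]] eqv_sym by blast
 next
  case (add x c f)
  obtain s b where x: "x = (s, b)" "s \<in> carrier S" using add(1) by (auto simp: cM)
  obtain s' where s': "s' \<in> carrier S" "eqv f (single (s', 1) 1)" using add by blast
  have "eqv (single (\<alpha> (of_int (c * b)) \<otimes>\<^bsub>S\<^esub> s, 1) 1) (single (s, c * b) 1)"
   using r3[OF x(2), of "of_int (c * b)" 1] ev[of "c * b"] by simp
  hence "eqv (single x c) (single (\<alpha> (of_int (c * b)) \<otimes>\<^bsub>S\<^esub> s, 1) 1)"
   unfolding x(1) by (rule eqv_trans[OF coef[OF x(2)] eqv_sym])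
  hence "eqv (single x c + f) (single (\<alpha> (of_int (c * b)) \<otimes>\<^bsub>S\<^esub> s \<oplus>\<^bsub>S\<^esub> s', 1) 1)"
   by (rule eqv_trans[OF eqv_add[OF _ s'(2)] eqv_sym[OF r1[OF mS[OF x(2)] s'(1)]]])
  thus ?case using add mS[OF x(2), of "of_int (c * b)"] s'(1) assms(2)[of "\<alpha> (of_int (c * b)) \<otimes>\<^bsub>S\<^esub> s" s'] by blast
 qed
 have KI: "?K \<subseteq> ?I"
 proof
  fix f assume "f \<in> ?K"
  hence fk: "f \<in> carrier RM" "\<Psi> f = \<zero>\<^bsub>R\<^esub>" unfolding a_kernel_def' by blast+
  hence f: "keys f \<subseteq> carrier M" unfolding cR by blast
  obtain s where s: "s \<in> carrier S" and e: "eqv f (single (s, 1) 1)" using red f by blast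
  have "f - single (s, 1) 1 \<in> ?K" using e IK unfolding eqv_def by blast
  hence "\<Psi> (f - single (s, 1) 1) = \<zero>\<^bsub>R\<^esub>" unfolding a_kernel_def' by blast
  hence "\<Psi> f \<ominus>\<^bsub>R\<^esub> psi s = \<zero>\<^bsub>R\<^esub>"
   unfolding \<Psi>_minus[OF f(1) kM[OF s]] \<Psi>_single[OF s] by (simp add: psic[OF s])
  hence "psi s = \<zero>\<^bsub>R\<^esub>" using fk(2) psic[OF s] by (simp add: R.minus_eq)
  then obtain a s' where a: "ev a = 0" "s' \<in> carrier S" "s = \<alpha> a \<otimes>\<^bsub>S\<^esub> s'" using ker s by blast
  have "eqv (single (s, 1) 1) 0"
   using r3[OF a(2), of a 1] eqv_trans[OF _ z[OF a(2)]] unfolding a(1,3) by simp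
  hence "eqv f 0" using e eqv_trans by blast
  thus "f \<in> ?I" by (simp add: eqv_def)
 qed
 have eq: "?I = ?K" using IK KI by blast
 have surj\<Psi>: "\<Psi> ` carrier RM = carrier R"
 proof
  show "\<Psi> ` carrier RM \<subseteq> carrier R" using \<Psi>c by (auto simp: cR)
  show "carrier R \<subseteq> \<Psi> ` carrier RM"
  proof
   fix y assume "y \<in> carrier R"
   then obtain s where s: "s \<in> carrier S" "y = psi s" using surj by blast
   hence "y = \<Psi> (single (s, 1) 1)" using \<Psi>_single[of s 1 1] psic[of s] by simp
   thus "y \<in> \<Psi> ` carrier RM" using kM[OF s(1), of 1 1] by (intro image_eqI[of _ _ "single (s, 1) 1"]) (simp_all only: cR mem_Collect_eq)
  qed
 qed
 have "(\<lambda>X. the_elem (\<Psi> ` X)) \<in> ring_iso (RM Quot ?K) R"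
  by (rule \<Psi>.FactRing_iso_set[OF surj\<Psi>])
 moreover have "the_elem (\<Psi> ` pure_tensor S \<alpha> \<Z> ev s 1) = psi s" if "s \<in> carrier S" for s
 proof -
  have "the_elem (\<Psi> ` pure_tensor S \<alpha> \<Z> ev s 1) = \<Psi> (single (s, 1) 1)"
   unfolding pure_tensor_def eq M_def[symmetric] RM_def[symmetric]
   by (rule \<Psi>.the_elem_simp) (use kM[OF that, of 1 1] in \<open>simp only: cR mem_Collect_eq\<close>)
  thus ?thesis using \<Psi>_single[OF that, of 1 1] psic[OF that] by simp
 qed
 moreover have "tensor_algebra S \<alpha> \<Z> ev = RM Quot ?K"
  unfolding tensor_algebra_def M_def[symmetric] RM_def[symmetric] eq ..
 ultimately show ?thesis by (intro bexI[of _ "\<lambda>X. the_elem (\<Psi> ` X)"] ballI) simp_all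
qed

section \<open>The Weyl group of type B and its words\<close>

abbreviation WB :: "nat => (nat => nat) set" where
 "WB r \<equiv> carrier (weylB r)"

abbreviation perm_inv :: "(nat => nat) => nat => nat" where
 "perm_inv \<equiv> inv_into UNIV"

lemma WB_iff: "w \<in> WB r \<longleftrightarrow> w permutes {1..2*r} \<and> (\<forall>i\<in>{1..2*r}. w i + w (2*r + 1 - i) = 2*r + 1)"
 by (simp add: weylB_def)

lemma WB_permutes: "w \<in> WB r ==> w permutes {1..2*r}"
 by (simp add: WB_iff)

lemma WB_mirror:
 assumes "w \<in> WB r" "1 \<le> i" "i \<le> 2*r"
 shows "w (2*r + 1 - i) = 2*r + 1 - w i" "w i + w (2*r + 1 - i) = 2*r + 1"
proof -
 have "w i + w (2*r + 1 - i) = 2*r + 1" using assms by (simp add: WB_iff)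
 thus "w (2*r + 1 - i) = 2*r + 1 - w i" "w i + w (2*r + 1 - i) = 2*r + 1" by auto
qed

lemma WB_range:
 assumes "w \<in> WB r" "1 \<le> i" "i \<le> 2*r"
 shows "1 \<le> w i" "w i \<le> 2*r"
 using permutes_in_image[OF WB_permutes[OF assms(1)], of i] assms(2,3) by auto

lemma WB_inj: "w \<in> WB r ==> w i = w j \<longleftrightarrow> i = j"
 using permutes_inj[OF WB_permutes] by (auto simp: inj_def)

lemma WB_outside: "w \<in> WB r ==> i \<notin> {1..2*r} ==> w i = i"
 using permutes_not_in[OF WB_permutes] by blast

lemma id_WB [simp]: "id \<in> WB r"
 by (auto simp: WB_iff permutes_id)

lemma comp_WB:
 assumes "v \<in> WB r" "w \<in> WB r"
 shows "v o w \<in> WB r"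
 unfolding WB_iff
proof (intro conjI ballI)
 show "v o w permutes {1..2*r}"
  using permutes_compose[OF WB_permutes[OF assms(2)] WB_permutes[OF assms(1)]] .
 fix i assume i: "i \<in> {1..2*r}"
 hence wi: "w (2*r + 1 - i) = 2*r + 1 - w i" "1 \<le> w i" "w i \<le> 2*r"
  using WB_mirror(1)[OF assms(2)] WB_range[OF assms(2)] by auto
 show "(v o w) i + (v o w) (2*r + 1 - i) = 2*r + 1"
  using WB_mirror(2)[OF assms(1) wi(2,3)] by (simp only: comp_apply wi(1))
qed

lemma inv_WB:
 assumes "w \<in> WB r"
 shows "perm_inv w \<in> WB r"
 unfolding WB_iff
proof (intro conjI ballI)
 show p: "perm_inv w permutes {1..2*r}" by (rule permutes_inv[OF WB_permutes[OF assms]])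
 fix i assume i: "i \<in> {1..2*r}"
 define j where "j = perm_inv w i"
 have wj: "w j = i" unfolding j_def using permutes_inverses(1)[OF WB_permutes[OF assms]] .
 have "j \<in> {1..2*r}" unfolding j_def using permutes_in_image[OF p] i by simp
 hence "w (2*r + 1 - j) = 2*r + 1 - i" "j \<le> 2*r + 1" using WB_mirror(1)[OF assms, of j] wj by auto
 hence "perm_inv w (2*r + 1 - i) = 2*r + 1 - j"
  using permutes_inverses(2)[OF WB_permutes[OF assms]] by metis
 thus "perm_inv w i + perm_inv w (2*r + 1 - i) = 2*r + 1"
  using \<open>j \<le> 2*r + 1\<close> by (simp add: j_def[symmetric])
qed

lemma inv_WB_comp:
 assumes "w \<in> WB r"
 shows "perm_inv w o w = id" "w o perm_inv w = id" "perm_inv w (w x) = x" "w (perm_inv w x) = x"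
 using permutes_inv_o[OF WB_permutes[OF assms]] permutes_inverses[OF WB_permutes[OF assms]] by auto

lemma finite_WB [simp]: "finite (WB r)"
 by (rule finite_subset[OF _ finite_permutations[of "{1..2*r}"]]) (auto simp: WB_iff)

lemma weylB_simps [simp]: "v \<otimes>\<^bsub>weylB r\<^esub> w = v o w" "\<one>\<^bsub>weylB r\<^esub> = id"
 by (simp_all add: weylB_def)

lemma group_weylB: "group (weylB r)"
 by (rule groupI) (auto intro!: comp_WB bexI[OF _ inv_WB] simp: comp_assoc inv_WB_comp)

lemma simple_refl_apply_add:
 assumes "1 \<le> i" "r = i + k"
 shows "srefl r i a = (if a = i then i + 1 else if a = i + 1 then i
   else if a = i + 2*k then i + 2*k + 1 else if a = i + 2*k + 1 then i + 2*k else a)"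
proof (cases "k = 0")
 case True
 thus ?thesis using assms by (simp add: simple_refl_def Transposition.transpose_def)
next
 case False
 hence "2*r - i = i + 2*k" "2*r + 1 - i = i + 2*k + 1" "i < r" using assms by auto
 thus ?thesis using False unfolding simple_refl_def
  by (simp add: Transposition.transpose_def)
qed

lemma simple_refl_apply:
 assumes "i \<in> {1..r}"
 shows "srefl r i j = (if j = i then i + 1 else if j = i + 1 then i
  else if j = 2*r - i then 2*r + 1 - i else if j = 2*r + 1 - i then 2*r - i else j)"
proof -
 obtain k where k: "r = i + k" using assms by (auto simp: le_iff_add)
 hence "2*r - i = i + 2*k" "2*r + 1 - i = i + 2*k + 1" by auto
 thus ?thesis using simple_refl_apply_add[of i r k j] k assms by simp
qed

lemma simple_refl_involution:
 assumes "i \<in> {1..r}"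
 shows "srefl r i (srefl r i j) = j"
proof -
 obtain k where "r = i + k" using assms by (auto simp: le_iff_add)
 hence s: "srefl r i a = (if a = i then i + 1 else if a = i + 1 then i
   else if a = i + 2*k then i + 2*k + 1 else if a = i + 2*k + 1 then i + 2*k else a)" for a
  using simple_refl_apply_add[of i r k] assms by simp
 consider "j = i" | "j = i + 1" | "j = i + 2*k" "k \<noteq> 0" | "j = i + 2*k + 1" "k \<noteq> 0"
  | "j \<noteq> i" "j \<noteq> i + 1" "j \<noteq> i + 2*k" "j \<noteq> i + 2*k + 1" by fastforce
 thus ?thesis by cases (simp_all add: s)
qed

lemma simple_refl_comp_self: "i \<in> {1..r} ==> srefl r i o srefl r i = id"
 by (auto simp: fun_eq_iff simple_refl_involution)

lemma simple_refl_WB: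
 assumes "i \<in> {1..r}"
 shows "srefl r i \<in> WB r"
 unfolding WB_iff
proof (intro conjI ballI)
 show "srefl r i permutes {1..2*r}"
 proof -
  have m: "r + 1 \<in> {1..2*r}" "r \<in> {1..2*r}" "i \<in> {1..2*r}" "i < r ==> i + 1 \<in> {1..2*r}"
   "i < r ==> 2*r - i \<in> {1..2*r}" "i < r ==> 2*r + 1 - i \<in> {1..2*r}"
   using assms by auto
  show ?thesis
  proof (cases "i < r")
   case True
   show ?thesis unfolding simple_refl_def if_P[OF True]
    using permutes_compose[OF permutes_swap_id[OF m(5,6)[OF True]] permutes_swap_id[OF m(3) m(4)[OF True]]] .
  next
   case False
   show ?thesis unfolding simple_refl_def if_not_P[OF False] using permutes_swap_id[OF m(2,1)] .
  qed
 qed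
 fix j assume j: "j \<in> {1..2*r}"
 obtain k where k: "r = i + k" using assms by (auto simp: le_iff_add)
 hence s: "srefl r i a = (if a = i then i + 1 else if a = i + 1 then i
   else if a = i + 2*k then i + 2*k + 1 else if a = i + 2*k + 1 then i + 2*k else a)" for a
  using simple_refl_apply_add[of i r k] assms by simp
 have r2: "2*r = 2*i + 2*k" using k by simp
 obtain j' where j': "j + j' = 2*r + 1" "2*r + 1 - j = j'" using j by (metis atLeastAtMost_iff le_add_diff_inverse trans_le_add1)
 consider "j = i" | "j = i + 1" | "j = i + 2*k" "k \<noteq> 0" | "j = i + 2*k + 1" "k \<noteq> 0"
  | "j \<noteq> i" "j \<noteq> i + 1" "j \<noteq> i + 2*k" "j \<noteq> i + 2*k + 1" by fastforce
 hence "srefl r i j + srefl r i j' = 2*r + 1"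
 proof cases
  case 1
  hence "j' = i + 2*k + 1" using j' k by linarith
  thus ?thesis using 1 r2 by (simp add: s)
 next
  case 2
  hence "j' = i + 2*k" using j' k by linarith
  thus ?thesis using 2 r2 by (simp add: s)
 next
  case 3
  hence "j' = i + 1" using j' k by linarith
  thus ?thesis using 3 r2 by (simp add: s)
 next
  case 4
  hence "j' = i" using j' k by linarith
  thus ?thesis using 4 r2 by (simp add: s)
 next
  case 5
  hence "j' \<noteq> i" "j' \<noteq> i + 1" "j' \<noteq> i + 2*k" "j' \<noteq> i + 2*k + 1" using j'(1) k by linarith+
  thus ?thesis using 5 j' by (simp add: s)
 qed
 thus "srefl r i j + srefl r i (2*r + 1 - j) = 2*r + 1" using j'(2) by simp
qed

lemma WB_refl: "w \<in> WB r ==> i \<in> {1..r} ==> w o srefl r i \<in> WB r"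
 by (simp add: comp_WB simple_refl_WB)

lemma comp_refl_refl: "i \<in> {1..r} ==> w o srefl r i o srefl r i = w"
 by (simp add: comp_assoc simple_refl_comp_self)

lemma comp_refl_values:
 assumes "i \<in> {1..r}"
 shows "(w o srefl r i) i = w (i + 1)" "(w o srefl r i) (i + 1) = w i"
 using assms by (auto simp: simple_refl_apply)

lemma descent_or_ascent:
 assumes "w \<in> WB r" "i \<in> {1..r}"
 shows "\<not> w i < w (i + 1) \<longleftrightarrow> w (i + 1) < w i"
 using WB_inj[OF assms(1), of i "i + 1"] by auto

lemma word_prod_simps [simp]:
 "word_prod r [] = id" "word_prod r (i # is) = srefl r i o word_prod r is"
 by (simp_all add: word_prod_def)

lemma word_prod_append: "word_prod r (is @ js) = word_prod r is o word_prod r js"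
 by (induction "is") (auto simp: comp_assoc)

lemma word_prod_WB: "is \<in> lists {1..r} ==> word_prod r is \<in> WB r"
 by (induction rule: lists.induct) (simp_all only: word_prod_simps comp_WB simple_refl_WB id_WB)

text \<open>
 The exchange property in its rank-one form.  A simple reflection acting on values reverses the
 order of only two consecutive pairs, mirror images of each other; if the values at \<open>i\<close> and \<open>i + 1\<close>
 change their order, they are such a pair.
\<close>

lemma refl_exchange:
 assumes u: "u \<in> WB r" and l: "l \<in> {1..r}" and i: "i \<in> {1..r}"
  and asc: "u i < u (i + 1)" and desc: "srefl r l (u i) > srefl r l (u (i + 1))"
 shows "srefl r l o u = u o srefl r i"
proof -
 obtain m where m: "r = l + m" using l by (auto simp: le_iff_add)
 obtain k where k: "r = i + k" using i by (auto simp: le_iff_add)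
 have sl: "srefl r l a = (if a = l then l + 1 else if a = l + 1 then l
   else if a = l + 2*m then l + 2*m + 1 else if a = l + 2*m + 1 then l + 2*m else a)" for a
  using simple_refl_apply_add[of l r m a] l m by simp
 have si: "srefl r i a = (if a = i then i + 1 else if a = i + 1 then i
   else if a = i + 2*k then i + 2*k + 1 else if a = i + 2*k + 1 then i + 2*k else a)" for a
  using simple_refl_apply_add[of i r k a] i k by simp
 have i1: "1 \<le> i" "i \<le> 2*r" "1 \<le> i + 1" "i + 1 \<le> 2*r" using i by auto
 have e: "2*r + 1 - i = i + 2*k + 1" "2*r + 1 - (i + 1) = i + 2*k" using k by linarith+
 have m1: "u i + u (i + 2*k + 1) = 2*l + 2*m + 1" using WB_mirror(2)[OF u i1(1,2)] m unfolding e(1) by linarith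
 have m2: "u (i + 1) + u (i + 2*k) = 2*l + 2*m + 1" using WB_mirror(2)[OF u i1(3,4)] m unfolding e(2) by linarith
 have cases: "u i = l \<and> u (i + 1) = l + 1 \<or> u i = l + 2*m \<and> u (i + 1) = l + 2*m + 1"
 proof -
  have f1: "srefl r l a \<le> a + 1" "a \<le> srefl r l a + 1"
   "srefl r l a = a + 1 ==> a = l \<or> a = l + 2*m" for a
  proof -
   consider "a = l" | "a = l + 1" | "a = l + 2*m" "m \<noteq> 0" | "a = l + 2*m + 1" "m \<noteq> 0"
    | "a \<noteq> l" "a \<noteq> l + 1" "a \<noteq> l + 2*m" "a \<noteq> l + 2*m + 1" by fastforce
   hence "srefl r l a \<le> a + 1 \<and> a \<le> srefl r l a + 1
    \<and> (srefl r l a = a + 1 \<longrightarrow> a = l \<or> a = l + 2*m)"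
    by cases (simp_all add: sl)
   thus "srefl r l a \<le> a + 1" "a \<le> srefl r l a + 1"
    "srefl r l a = a + 1 ==> a = l \<or> a = l + 2*m" by blast+
  qed
  have "srefl r l (u i) = u i + 1" "u (i + 1) = u i + 1"
   using f1(1)[of "u i"] f1(2)[of "u (i + 1)"] asc desc by linarith+
  thus ?thesis using f1(3)[of "u i"] by auto
 qed
 show ?thesis
 proof
  fix x
  have notin: "u x \<noteq> u y" if "x \<noteq> y" for y using that WB_inj[OF u] by blast
  have mk: "m = 0 \<longleftrightarrow> k = 0"
  proof -
   have "m = 0 \<longleftrightarrow> u i = u (i + 2*k)" using cases m1 m2 by auto
   thus ?thesis using WB_inj[OF u] by simp
  qed
  consider "x = i" | "x = i + 1" | "x = i + 2*k" "k \<noteq> 0" | "x = i + 2*k + 1" "k \<noteq> 0"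
   | "x \<noteq> i" "x \<noteq> i + 1" "x \<noteq> i + 2*k" "x \<noteq> i + 2*k + 1" by fastforce
  thus "(srefl r l o u) x = (u o srefl r i) x"
  proof cases
   case 5
   hence "srefl r i x = x" by (simp add: si)
   moreover have "u x \<noteq> l" "u x \<noteq> l + 1" "u x \<noteq> l + 2*m" "u x \<noteq> l + 2*m + 1"
    using cases m1 m2 notin[OF 5(1)] notin[OF 5(2)] notin[OF 5(3)] notin[OF 5(4)] by linarith+
   hence "srefl r l (u x) = u x" by (simp add: sl)
   ultimately show ?thesis by simp
  next
   case 1
   thus ?thesis using cases mk by (auto simp: sl si)
  next
   case 2
   thus ?thesis using cases mk by (auto simp: sl si)
  next
   case 3
   have "u (i + 2*k) = l + 2*m \<and> u (i + 2*k + 1) = l + 2*m + 1 \<or> u (i + 2*k) = l \<and> u (i + 2*k + 1) = l + 1"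
    using cases m1 m2 by auto
   moreover have "srefl r i x = i + 2*k + 1" unfolding si using 3 by simp
   ultimately show ?thesis using 3 mk by (auto simp: sl)
  next
   case 4
   have "u (i + 2*k) = l + 2*m \<and> u (i + 2*k + 1) = l + 2*m + 1 \<or> u (i + 2*k) = l \<and> u (i + 2*k + 1) = l + 1"
    using cases m1 m2 by auto
   moreover have "srefl r i x = i + 2*k" unfolding si using 4 by simp
   ultimately show ?thesis using 4 mk by (auto simp: sl)
  qed
 qed
qed

text \<open>
 Somewhere along the word the values at \<open>i\<close> and \<open>i + 1\<close> get out of order; by the exchange
 property the letter responsible can be traded for \<open>s\<^sub>i\<close> on the right.
\<close>

lemma word_deletion:
 assumes "is \<in> lists {1..r}" "i \<in> {1..r}" "word_prod r is i > word_prod r is (i + 1)"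
 shows "\<exists>js\<in>lists {1..r}. length is = Suc (length js) \<and> word_prod r js = word_prod r is o srefl r i"
 using assms
proof (induction "is" rule: list.induct)
 case Nil
 thus ?case by simp
next
 case (Cons l "is")
 let ?u = "word_prod r is"
 have l: "l \<in> {1..r}" and isl: "is \<in> lists {1..r}" using Cons.prems(1) unfolding Cons_in_lists_iff by blast+
 have u: "?u \<in> WB r" using word_prod_WB[OF isl] .
 show ?case
 proof (cases "?u i < ?u (i + 1)")
  case True
  have "srefl r l o ?u = ?u o srefl r i"
   using refl_exchange[OF u l Cons.prems(2) True] Cons.prems(3) by simp
  hence "word_prod r (l # is) o srefl r i = ?u"
   by (simp add: comp_refl_refl[OF Cons.prems(2)])
  thus ?thesis using isl by (intro bexI[of _ "is"] conjI) (simp_all only: list.size Suc_eq_plus1)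
 next
  case False
  hence "?u (i + 1) < ?u i" using descent_or_ascent[OF u Cons.prems(2)] by simp
  then obtain js where "js \<in> lists {1..r}" "length is = Suc (length js)" "word_prod r js = ?u o srefl r i"
   using Cons.IH isl Cons.prems by blast
  thus ?thesis using l by (intro bexI[of _ "l # js"]) (simp_all add: comp_assoc)
 qed
qed

text \<open>The values \<open>w 1, \<dots>, w r\<close> increase, and \<open>w r < w (r + 1) = 2*r + 1 - w r\<close> bounds them by \<open>r\<close>.\<close>

lemma no_descent_imp_id:
 assumes w: "w \<in> WB r" and asc: "\<And>i. i \<in> {1..r} ==> w i < w (i + 1)"
 shows "w = id"
proof -
 have low: "i \<le> w i" if "1 \<le> i" "i \<le> r" for i
  using that
 proof (induction i rule: dec_induct)
  case base
  thus ?case using WB_range[OF w, of 1] that by simp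
 next
  case (step k)
  thus ?case using asc[of k] by simp
 qed
 have up: "w i \<le> i" if "1 \<le> i" "i \<le> r" for i
  using that(2,1)
 proof (induction i rule: inc_induct)
  case base
  thus ?case using asc[of r] WB_mirror(2)[OF w, of r] that by simp
 next
  case (step k)
  thus ?case using asc[of k] by simp
 qed
 have half: "w i = i" if "1 \<le> i" "i \<le> r" for i using low[OF that] up[OF that] by simp
 show ?thesis
 proof
  fix i
  consider "i \<notin> {1..2*r}" | "1 \<le> i" "i \<le> r" | "r < i" "i \<le> 2*r" by fastforce
  thus "w i = id i"
  proof cases
   case 3
   hence "w (2*r + 1 - i) = 2*r + 1 - i" by (intro half) auto
   thus ?thesis using WB_mirror(2)[OF w, of i] 3 by simp
  qed (use half WB_outside[OF w] in auto)
 qed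
qed

text \<open>
 Sorting the window \<open>w 1, \<dots>, w r\<close> terminates: with weights decreasing along the window, every
 removal of a descent lowers the weighted sum of its entries.
\<close>

lemma WB_descent_induct [consumes 1, case_names id descent]:
 assumes "w \<in> WB r"
  and "P id"
  and "\<And>w i. w \<in> WB r ==> i \<in> {1..r} ==> w (i + 1) < w i ==> P (w o srefl r i) ==> P w"
 shows "P w"
 using assms(1)
proof (induction "\<Sum>j = 1..r. (r + 1 - j) * w j" arbitrary: w rule: less_induct)
 case less
 show ?case
 proof (cases "\<exists>i\<in>{1..r}. w (i + 1) < w i")
  case False
  hence "w = id" using descent_or_ascent[OF less.prems] by (intro no_descent_imp_id[OF less.prems]) blast
  thus ?thesis using assms(2) by simp
 next
  case True
  then obtain i where i: "i \<in> {1..r}" and d: "w (i + 1) < w i" by blast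
  let ?v = "w o srefl r i"
  let ?f = "\<lambda>w j. (r + 1 - j) * w j"
  have "(\<Sum>j = 1..r. ?f ?v j) < (\<Sum>j = 1..r. ?f w j)"
  proof (cases "i = r")
   case True
   have "(\<Sum>j\<in>{1..r} - {r}. ?f ?v j) = (\<Sum>j\<in>{1..r} - {r}. ?f w j)"
    using True i by (intro sum.cong) (auto simp: simple_refl_apply)
   moreover have "?f ?v r < ?f w r" using True d i by (simp add: simple_refl_apply)
   ultimately show ?thesis using i True
    by (subst (1 2) sum.remove[of "{1..r}" r]) auto
  next
   case False
   hence ir: "i < r" "1 \<le> i" using i by auto
   have "(\<Sum>j\<in>{1..r} - {i} - {i + 1}. ?f ?v j) = (\<Sum>j\<in>{1..r} - {i} - {i + 1}. ?f w j)"
    using ir by (intro sum.cong) (auto simp: simple_refl_apply)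
   moreover have "?f ?v i + ?f ?v (i + 1) < ?f w i + ?f w (i + 1)"
   proof -
    obtain k where k: "r = i + 1 + k" using ir by (metis less_imp_Suc_add add.commute add_Suc_right Suc_eq_plus1 add.assoc)
    have "(k + 2) * w (i + 1) + (k + 1) * w i < (k + 2) * w i + (k + 1) * w (i + 1)"
     using d by (simp add: algebra_simps)
    moreover have "r + 1 - i = k + 2" "r + 1 - (i + 1) = k + 1" using k by auto
    ultimately show ?thesis unfolding comp_refl_values[OF i] by simp
   qed
   moreover have "(\<Sum>j = 1..r. g j) = g i + (g (i + 1) + (\<Sum>j\<in>{1..r} - {i} - {i + 1}. g j))" for g :: "nat => nat"
    using ir by (subst sum.remove[of "{1..r}" i], simp, simp, subst sum.remove[of "{1..r} - {i}" "i + 1"]) auto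
   ultimately show ?thesis by (simp add: add.assoc[symmetric])
  qed
  hence "P ?v" using less.hyps WB_refl[OF less.prems i] by blast
  thus ?thesis using assms(3)[OF less.prems i d] by blast
 qed
qed

lemma WB_word:
 assumes "w \<in> WB r"
 shows "\<exists>is\<in>lists {1..r}. word_prod r is = w"
 using assms
proof (induction rule: WB_descent_induct)
 case id
 show ?case by (intro bexI[of _ "[]"]) auto
next
 case (descent w i)
 then obtain js where "js \<in> lists {1..r}" "word_prod r js = w o srefl r i" by blast
 hence "word_prod r (js @ [i]) = w" by (simp add: word_prod_append comp_refl_refl[OF descent(2)])
 thus ?case using \<open>js \<in> _\<close> descent(2) by (intro bexI[of _ "js @ [i]"]) auto
qed

lemma reduced_word_exists:
 assumes "w \<in> WB r"
 shows "\<exists>is. reduced_word r w is"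
proof -
 obtain js where "js \<in> lists {1..r}" "word_prod r js = w" using WB_word[OF assms] by blast
 hence "\<exists>k. \<exists>is\<in>lists {1..r}. word_prod r is = w \<and> length is = k" by blast
 from LeastI_ex[OF this] show ?thesis by (auto simp: reduced_word_def weyl_length_def)
qed

lemma weyl_length_le: "is \<in> lists {1..r} ==> weyl_length r (word_prod r is) \<le> length is"
 unfolding weyl_length_def by (rule Least_le) blast

lemma weyl_length_step:
 assumes "w \<in> WB r" "i \<in> {1..r}"
 shows "weyl_length r (w o srefl r i) \<le> weyl_length r w + 1"
proof -
 obtain "is" where "is": "reduced_word r w is" using reduced_word_exists[OF assms(1)] by blast
 thus ?thesis
  using weyl_length_le[of "is @ [i]" r] assms(2) by (auto simp: reduced_word_def word_prod_append)
qed

lemma weyl_length_descent: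
 assumes w: "w \<in> WB r" and i: "i \<in> {1..r}" and d: "w (i + 1) < w i"
 shows "weyl_length r w = weyl_length r (w o srefl r i) + 1"
proof -
 obtain "is" where "is": "reduced_word r w is" using reduced_word_exists[OF w] by blast
 then obtain js where "js \<in> lists {1..r}" "length is = Suc (length js)" "word_prod r js = w o srefl r i"
  using word_deletion[of "is" r i] i d by (auto simp: reduced_word_def)
 hence "weyl_length r (w o srefl r i) + 1 \<le> weyl_length r w"
  using weyl_length_le[of js r] "is" by (simp add: reduced_word_def)
 moreover have "weyl_length r w \<le> weyl_length r (w o srefl r i) + 1"
  using weyl_length_step[OF WB_refl[OF w i] i] by (simp only: comp_refl_refl[OF i])
 ultimately show ?thesis by simp
qed

lemma weyl_length_ascent:
 assumes w: "w \<in> WB r" and i: "i \<in> {1..r}" and a: "w i < w (i + 1)"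
 shows "weyl_length r (w o srefl r i) = weyl_length r w + 1"
 using weyl_length_descent[OF WB_refl[OF w i] i] a by (simp only: comp_refl_refl[OF i] comp_refl_values[OF i])

lemma reduced_word_snoc:
 assumes "reduced_word r w is" "i \<in> {1..r}" "w i < w (i + 1)"
 shows "reduced_word r (w o srefl r i) (is @ [i])"
proof -
 have "w \<in> WB r" using assms(1) word_prod_WB by (auto simp: reduced_word_def)
 thus ?thesis
  using assms weyl_length_ascent[of w r i] by (auto simp: reduced_word_def word_prod_append)
qed

lemma reduced_word_snocD:
 assumes "reduced_word r w (is @ [i])"
 shows "i \<in> {1..r}" "w (i + 1) < w i" "reduced_word r (w o srefl r i) is"
proof -
 have l: "is \<in> lists {1..r}" and i: "i \<in> {1..r}" and w': "w = word_prod r is o srefl r i"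
  and len: "weyl_length r w = length is + 1"
  using assms by (auto simp: reduced_word_def word_prod_append)
 have w: "w \<in> WB r" using word_prod_WB[OF l] WB_refl i w' by blast
 have ws: "w o srefl r i = word_prod r is" by (simp only: comp_refl_refl[OF i] w')
 have le: "weyl_length r (w o srefl r i) \<le> length is" using weyl_length_le[OF l] ws by simp
 show d: "w (i + 1) < w i"
  using weyl_length_ascent[OF w i] le len descent_or_ascent[OF w i] by fastforce
 show "reduced_word r (w o srefl r i) is"
  using weyl_length_descent[OF w i d] l ws len by (simp add: reduced_word_def)
 show "i \<in> {1..r}" by fact
qed

lemma reduced_word_id: "reduced_word r id is ==> is = []"
 using weyl_length_le[of "[]" r] by (simp add: reduced_word_def)

section \<open>Parabolic subgroups as stabilizers\<close>

definition psum :: "(nat => nat) => nat => nat" where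
 "psum mu k = (\<Sum>j = 1..k. mu j)"

lemma psum_0 [simp]: "psum mu 0 = 0" by (simp add: psum_def)

lemma psum_Suc: "psum mu (Suc k) = psum mu k + mu (Suc k)" by (simp add: psum_def)

lemma psum_mono: "i \<le> j ==> psum mu i \<le> psum mu j"
 unfolding psum_def by (rule sum_mono2) auto

lemma weights_psum:
 assumes "mu \<in> weights n r"
 shows "psum mu (n + 1) = r" "k \<le> n + 1 ==> psum mu k \<le> r"
proof -
 show a: "psum mu (n + 1) = r" using assms by (simp add: weights_def psum_def)
 show "k \<le> n + 1 ==> psum mu k \<le> r" using psum_mono[of k "n + 1" mu] a by simp
qed

lemma refl_preserves_initial:
 assumes "i \<in> {1..r}" "d \<le> r" "d \<noteq> i"
 shows "srefl r i ` {1..d} = {1..d}"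
proof -
 have sub: "srefl r i ` {1..d} \<subseteq> {1..d}"
  using assms by (auto simp: simple_refl_apply)
 moreover have "inj_on (srefl r i) {1..d}"
  by (rule inj_on_inverseI[of _ "srefl r i"]) (rule simple_refl_involution[OF assms(1)])
 ultimately show ?thesis by (simp add: endo_inj_surj)
qed

lemma descent_not_stable:
 assumes w: "w \<in> WB r" and i: "i \<in> {1..r}" and d: "w (i + 1) < w i"
 shows "w ` {1..i} \<noteq> {1..i}"
proof
 assume st: "w ` {1..i} = {1..i}"
 have "w i \<in> {1..i}" using st i by auto
 moreover have "1 \<le> w (i + 1)" using WB_range[OF w, of "i + 1"] i by simp
 ultimately have "w (i + 1) \<in> w ` {1..i}" using d st by auto
 thus False using WB_inj[OF w] by auto
qed

definition segment_stab :: "nat => nat => (nat => nat) => (nat => nat) set" where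
 "segment_stab n r mu = {w. w \<in> WB r \<and> (\<forall>k. 1 \<le> k \<longrightarrow> k \<le> n \<longrightarrow> w ` {1..psum mu k} = {1..psum mu k})}"

lemma initial_stabilizerI:
 "w \<in> WB r ==> (\<And>k. 1 \<le> k ==> k \<le> n ==> w ` {1..psum mu k} = {1..psum mu k}) ==> w \<in> segment_stab n r mu"
 unfolding segment_stab_def by blast

lemma initial_stabilizerD:
 assumes "w \<in> segment_stab n r mu"
 shows "w \<in> WB r" "1 \<le> k ==> k \<le> n ==> w ` {1..psum mu k} = {1..psum mu k}"
 using assms unfolding segment_stab_def by blast+

lemma segment_stab_id: "id \<in> segment_stab n r mu"
 by (intro initial_stabilizerI id_WB) auto

lemma segment_stab_comp:
 assumes "v \<in> segment_stab n r mu" "w \<in> segment_stab n r mu"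
 shows "v o w \<in> segment_stab n r mu"
 by (intro initial_stabilizerI comp_WB)
  (simp_all only: image_comp[symmetric] initial_stabilizerD[OF assms(1)] initial_stabilizerD[OF assms(2)])

lemma segment_stab_inv:
 assumes "w \<in> segment_stab n r mu"
 shows "perm_inv w \<in> segment_stab n r mu"
proof (intro initial_stabilizerI)
 have w: "w \<in> WB r" using initial_stabilizerD[OF assms] by blast
 show "perm_inv w \<in> WB r" by (rule inv_WB[OF w])
 fix k assume "1 \<le> k" "k \<le> n"
 hence e: "w ` {1..psum mu k} = {1..psum mu k}" using initial_stabilizerD[OF assms] by blast
 hence "perm_inv w ` {1..psum mu k} = perm_inv w ` (w ` {1..psum mu k})" by simp
 also have "\<dots> = {1..psum mu k}" unfolding image_comp inv_WB_comp(1)[OF w] by simp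
 finally show "perm_inv w ` {1..psum mu k} = {1..psum mu k}" .
qed

lemma segment_stab_refl:
 assumes mu: "mu \<in> weights n r" and i: "i \<in> {1..r}"
 shows "srefl r i \<in> segment_stab n r mu \<longleftrightarrow> (\<forall>k\<in>{1..n}. i \<noteq> psum mu k)"
proof
 assume s: "srefl r i \<in> segment_stab n r mu"
 show "\<forall>k\<in>{1..n}. i \<noteq> psum mu k"
 proof (intro ballI notI)
  fix k assume "k \<in> {1..n}" "i = psum mu k"
  hence "srefl r i ` {1..i} = {1..i}" using initial_stabilizerD(2)[OF s, of k] by simp
  moreover have "srefl r i i \<in> srefl r i ` {1..i}" using i by (intro imageI) simp
  ultimately have "srefl r i i \<in> {1..i}" by simp
  thus False unfolding simple_refl_apply[OF i] by simp
 qed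
next
 assume k: "\<forall>k\<in>{1..n}. i \<noteq> psum mu k"
 show "srefl r i \<in> segment_stab n r mu"
 proof (intro initial_stabilizerI simple_refl_WB[OF i] refl_preserves_initial[OF i])
  fix j assume j: "1 \<le> j" "j \<le> n"
  thus "psum mu j \<le> r" using weights_psum(2)[OF mu, of j] by simp
  show "psum mu j \<noteq> i" using k j by auto
 qed
qed

lemma segment_stab_descent:
 assumes mu: "mu \<in> weights n r" and w: "w \<in> segment_stab n r mu" and i: "i \<in> {1..r}" and d: "w (i + 1) < w i"
 shows "srefl r i \<in> segment_stab n r mu"
 unfolding segment_stab_refl[OF mu i]
proof (intro ballI notI)
 fix k assume "k \<in> {1..n}" "i = psum mu k"
 hence "w ` {1..i} = {1..i}" using initial_stabilizerD(2)[OF w, of k] by simp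
 thus False using descent_not_stable[OF initial_stabilizerD(1)[OF w] i d] by blast
qed

text \<open>
 A descent of a permutation that stabilizes the initial segments cannot lie at the end of one of
 them, so the descents can be removed by the generators of the parabolic subgroup alone.
\<close>

lemma parabolic_stabilizer:
 assumes mu: "mu \<in> weights n r"
 shows "parabolic n r mu = segment_stab n r mu"
proof -
 let ?J = "{srefl r j | j. j \<in> {1..r} \<and> j \<notin> {psum mu i | i. i \<in> {1..n}}}"
 interpret group "weylB r" by (rule group_weylB)
 have P: "parabolic n r mu = generate (weylB r) ?J" by (simp add: parabolic_def psum_def)
 have J: "s \<in> ?J \<longleftrightarrow> (\<exists>j\<in>{1..r}. s = srefl r j \<and> srefl r j \<in> segment_stab n r mu)" for s
  using segment_stab_refl[OF mu] by blast
 have inv_eq: "inv\<^bsub>weylB r\<^esub> s = s" if "s \<in> ?J" for s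
 proof -
  obtain j where "j \<in> {1..r}" "s = srefl r j" using \<open>s \<in> ?J\<close> unfolding J by blast
  thus ?thesis using simple_refl_comp_self[of j r] simple_refl_WB[of j r] by (intro inv_equality) simp_all
 qed
 have gen: "w \<in> segment_stab n r mu" if "w \<in> generate (weylB r) ?J" for w
  using that
 proof (rule generate.induct)
  show "\<one>\<^bsub>weylB r\<^esub> \<in> segment_stab n r mu" unfolding weylB_simps by (rule segment_stab_id)
  show "h \<in> segment_stab n r mu" if "h \<in> ?J" for h using that unfolding J by blast
  show "inv\<^bsub>weylB r\<^esub> h \<in> segment_stab n r mu" if "h \<in> ?J" for h
   unfolding inv_eq[OF that] using that unfolding J by blast
  show "h \<otimes>\<^bsub>weylB r\<^esub> h' \<in> segment_stab n r mu"
   if "h \<in> segment_stab n r mu" "h' \<in> segment_stab n r mu" for h h'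
   unfolding weylB_simps by (rule segment_stab_comp[OF that])
 qed
 have "w \<in> segment_stab n r mu \<longrightarrow> w \<in> generate (weylB r) ?J" if "w \<in> WB r" for w
  using that
 proof (rule WB_descent_induct)
  show "id \<in> segment_stab n r mu \<longrightarrow> id \<in> generate (weylB r) ?J"
   using generate.one[of "weylB r" ?J] unfolding weylB_simps by blast
  fix w i
  assume w: "w \<in> WB r" and i: "i \<in> {1..r}" and d: "w (i + 1) < w i"
   and IH: "w o srefl r i \<in> segment_stab n r mu \<longrightarrow> w o srefl r i \<in> generate (weylB r) ?J"
  show "w \<in> segment_stab n r mu \<longrightarrow> w \<in> generate (weylB r) ?J"
  proof
   assume st: "w \<in> segment_stab n r mu"
   have s: "srefl r i \<in> segment_stab n r mu"
    by (rule segment_stab_descent[OF mu st i d])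
   hence sJ: "srefl r i \<in> ?J" using J i by blast
   have "w o srefl r i \<in> generate (weylB r) ?J" using IH segment_stab_comp[OF st s] by blast
   from generate.eng[OF this generate.incl[OF sJ]]
   show "w \<in> generate (weylB r) ?J" unfolding weylB_simps comp_refl_refl[OF i] .
  qed
 qed
 thus ?thesis unfolding P using gen initial_stabilizerD(1) by blast
qed

lemma parabolic_WB: "mu \<in> weights n r ==> w \<in> parabolic n r mu ==> w \<in> WB r"
 using initial_stabilizerD(1) parabolic_stabilizer by blast

lemma parabolic_id: "mu \<in> weights n r ==> id \<in> parabolic n r mu"
 using segment_stab_id parabolic_stabilizer by blast

lemma parabolic_comp: "mu \<in> weights n r ==> v \<in> parabolic n r mu ==> w \<in> parabolic n r mu ==> v o w \<in> parabolic n r mu"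
 using segment_stab_comp parabolic_stabilizer by blast

lemma parabolic_inv: "mu \<in> weights n r ==> w \<in> parabolic n r mu ==> perm_inv w \<in> parabolic n r mu"
 using segment_stab_inv parabolic_stabilizer by blast

lemma parabolic_descent_induct [consumes 2, case_names id descent]:
 assumes mu: "mu \<in> weights n r" and w: "w \<in> parabolic n r mu"
  and base: "P id"
  and step: "\<And>w i. w \<in> parabolic n r mu ==> i \<in> {1..r} ==> srefl r i \<in> parabolic n r mu ==> w (i + 1) < w i
    ==> w o srefl r i \<in> parabolic n r mu ==> P (w o srefl r i) ==> P w"
 shows "P w"
proof -
 have "w \<in> parabolic n r mu \<longrightarrow> P w"
  using parabolic_WB[OF mu w]
 proof (rule WB_descent_induct)
  show "id \<in> parabolic n r mu \<longrightarrow> P id" using base by blast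
  fix w i
  assume "w \<in> WB r" and i: "i \<in> {1..r}" and d: "w (i + 1) < w i"
   and IH: "w o srefl r i \<in> parabolic n r mu \<longrightarrow> P (w o srefl r i)"
  show "w \<in> parabolic n r mu \<longrightarrow> P w"
  proof
   assume w: "w \<in> parabolic n r mu"
   have s: "srefl r i \<in> parabolic n r mu"
    using segment_stab_descent[OF mu _ i d] w unfolding parabolic_stabilizer[OF mu] .
   have "w o srefl r i \<in> parabolic n r mu" by (rule parabolic_comp[OF mu w s])
   thus "P w" using step[OF w i s d] IH by blast
  qed
 qed
 thus ?thesis using w by blast
qed

section \<open>Double cosets and matrices\<close>

lemma card_filter_remove_two:
 assumes "finite S" "a \<in> S" "b \<in> S" "a \<noteq> b"
 shows "card {x\<in>S. f x = u} = card {x\<in>S - {a, b}. f x = u} + (if f a = u then 1 else 0) + (if f b = u then 1 else 0)"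
proof -
 have c: "card {x\<in>T. f x = u} = (\<Sum>x\<in>T. if f x = u then 1 else 0)" if "finite T" for T
  using that by (simp add: sum.If_cases Int_def)
 have e: "S - {a} - {b} = S - {a, b}" by blast
 have "(\<Sum>x\<in>S. if f x = u then 1 else 0::nat) = (if f a = u then 1 else 0) + ((if f b = u then 1 else 0) + (\<Sum>x\<in>S - {a, b}. if f x = u then 1 else 0))"
  using assms sum.remove[of S a "\<lambda>x. if f x = u then 1 else 0::nat"]
   sum.remove[of "S - {a}" b "\<lambda>x. if f x = u then 1 else 0::nat"] unfolding e by simp
 thus ?thesis unfolding c[OF assms(1)] c[OF finite_Diff[OF assms(1)]] by simp
qed

text \<open>
 Two finite sets with fixed-point-free involutions, labelled compatibly with an operation on the
 labels, are equivariantly isomorphic over the labels as soon as all fibres have equal size: match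
 one orbit \<open>{a, \<iota> a}\<close> at a time with an orbit of equal label.
\<close>

lemma equivariant_bijection:
 assumes "finite S" "finite S'"
  and "\<And>x. x \<in> S ==> \<iota> x \<in> S \<and> \<iota> (\<iota> x) = x \<and> \<iota> x \<noteq> x \<and> \<tau> (\<iota> x) = \<sigma> (\<tau> x)"
  and "\<And>x. x \<in> S' ==> \<iota>' x \<in> S' \<and> \<iota>' (\<iota>' x) = x \<and> \<iota>' x \<noteq> x \<and> \<tau>' (\<iota>' x) = \<sigma> (\<tau>' x)"
  and "\<And>t. card {x\<in>S. \<tau> x = t} = card {x\<in>S'. \<tau>' x = t}"
 shows "\<exists>\<beta>. bij_betw \<beta> S S' \<and> (\<forall>x\<in>S. \<beta> (\<iota> x) = \<iota>' (\<beta> x) \<and> \<tau>' (\<beta> x) = \<tau> x)"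
 using assms
proof (induction "card S" arbitrary: S S' rule: less_induct)
 case less
 note fin = less.prems(1,2) and inv = less.prems(3) and inv' = less.prems(4) and cnt = less.prems(5)
 show ?case
 proof (cases "S = {}")
  case True
  have "S' = {}"
  proof (rule ccontr)
   assume "S' \<noteq> {}"
   then obtain b where "b \<in> S'" by blast
   hence "card {x\<in>S'. \<tau>' x = \<tau>' b} \<noteq> 0" using fin by auto
   thus False using cnt[of "\<tau>' b"] True by simp
  qed
  thus ?thesis using True by (auto simp: bij_betw_def)
 next
  case False
  then obtain a where a: "a \<in> S" by blast
  hence "card {x\<in>S. \<tau> x = \<tau> a} \<noteq> 0" using fin by auto
  hence "{x\<in>S'. \<tau>' x = \<tau> a} \<noteq> {}" using cnt[of "\<tau> a"] by (metis card.empty)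
  then obtain b where b: "b \<in> S'" "\<tau>' b = \<tau> a" by blast
  have a2: "\<iota> a \<in> S" "\<iota> (\<iota> a) = a" "a \<noteq> \<iota> a" "\<tau> (\<iota> a) = \<sigma> (\<tau> a)" using inv[OF a] by auto
  have b2: "\<iota>' b \<in> S'" "\<iota>' (\<iota>' b) = b" "b \<noteq> \<iota>' b" "\<tau>' (\<iota>' b) = \<sigma> (\<tau> a)" using inv'[OF b(1)] b(2) by auto
  let ?S = "S - {a, \<iota> a}" and ?S' = "S' - {b, \<iota>' b}"
  have "\<exists>\<beta>. bij_betw \<beta> ?S ?S' \<and> (\<forall>x\<in>?S. \<beta> (\<iota> x) = \<iota>' (\<beta> x) \<and> \<tau>' (\<beta> x) = \<tau> x)"
  proof (rule less.hyps)
   show "card ?S < card S" using a fin by (intro psubset_card_mono) auto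
   show "finite ?S" "finite ?S'" using fin by auto
   show "\<iota> x \<in> ?S \<and> \<iota> (\<iota> x) = x \<and> \<iota> x \<noteq> x \<and> \<tau> (\<iota> x) = \<sigma> (\<tau> x)" if "x \<in> ?S" for x
    using inv[of x] that a2(2) by auto
   show "\<iota>' x \<in> ?S' \<and> \<iota>' (\<iota>' x) = x \<and> \<iota>' x \<noteq> x \<and> \<tau>' (\<iota>' x) = \<sigma> (\<tau>' x)" if "x \<in> ?S'" for x
    using inv'[of x] that b2(2) by auto
   show "card {x\<in>?S. \<tau> x = t} = card {x\<in>?S'. \<tau>' x = t}" for t
    using cnt[of t] card_filter_remove_two[OF fin(1) a a2(1,3), of \<tau> t]
     card_filter_remove_two[OF fin(2) b(1) b2(1,3), of \<tau>' t] a2(4) b2(4) b(2) by simp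
  qed
  then obtain \<beta> where \<beta>: "bij_betw \<beta> ?S ?S'" "\<And>x. x \<in> ?S ==> \<beta> (\<iota> x) = \<iota>' (\<beta> x) \<and> \<tau>' (\<beta> x) = \<tau> x" by blast
  define \<gamma> where "\<gamma> = \<beta>(a := b, \<iota> a := \<iota>' b)"
  have g: "\<gamma> a = b" "\<gamma> (\<iota> a) = \<iota>' b" "\<And>x. x \<in> ?S ==> \<gamma> x = \<beta> x" using a2(3) by (auto simp: \<gamma>_def)
  have "bij_betw \<gamma> ?S ?S'" by (rule bij_betw_cong[THEN iffD1, OF _ \<beta>(1)]) (simp only: g(3))
  hence "bij_betw \<gamma> (?S \<union> {a}) (?S' \<union> {\<gamma> a})"
   by (rule notIn_Un_bij_betw[rotated 2]) (use g in auto)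
  hence "bij_betw \<gamma> (?S \<union> {a} \<union> {\<iota> a}) (?S' \<union> {\<gamma> a} \<union> {\<gamma> (\<iota> a)})"
   by (rule notIn_Un_bij_betw[rotated 2]) (use g a2 b2 in auto)
  moreover have "?S \<union> {a} \<union> {\<iota> a} = S" "?S' \<union> {\<gamma> a} \<union> {\<gamma> (\<iota> a)} = S'" using g a a2 b b2 by auto
  ultimately have "bij_betw \<gamma> S S'" by simp
  moreover have "\<gamma> (\<iota> x) = \<iota>' (\<gamma> x) \<and> \<tau>' (\<gamma> x) = \<tau> x" if x: "x \<in> S" for x
  proof -
   consider "x = a" | "x = \<iota> a" | "x \<in> ?S" using x by blast
   thus ?thesis
   proof cases
    case 3
    hence "\<iota> x \<in> ?S" using inv[of x] a2(2) by auto
    thus ?thesis using 3 \<beta>(2) g(3) by simp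
   qed (use g a2 b2 b in auto)
  qed
  ultimately show ?thesis by blast
 qed
qed

definition hat_sum :: "nat => (nat => nat) => nat => nat" where
 "hat_sum n mu i = (\<Sum>k = 1..i. weight_hat n mu k)"

lemma hat_sum_0 [simp]: "hat_sum n mu 0 = 0" by (simp add: hat_sum_def)

lemma hat_sum_Suc: "hat_sum n mu (Suc i) = hat_sum n mu i + weight_hat n mu (Suc i)"
 by (simp add: hat_sum_def)

lemma hat_sum_mono: "i \<le> j ==> hat_sum n mu i \<le> hat_sum n mu j"
 unfolding hat_sum_def by (rule sum_mono2) auto

lemma weight_block_hat_sum:
 assumes "1 \<le> i"
 shows "weight_block n mu i = {hat_sum n mu (i - 1)<..hat_sum n mu i}"
proof -
 have "{1..<i} = {1..i - 1}" using assms by auto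
 thus ?thesis by (simp add: weight_block_def hat_sum_def)
qed

lemma card_weight_block: "1 \<le> i ==> card (weight_block n mu i) = weight_hat n mu i"
 using hat_sum_Suc[of n mu "i - 1"] by (simp add: weight_block_hat_sum)

lemma hat_sum_low: "i \<le> n ==> hat_sum n mu i = psum mu i"
 by (simp add: hat_sum_def psum_def weight_hat_def)

context
 fixes n r :: nat and mu :: "nat => nat"
 assumes mu: "mu \<in> weights n r"
begin

lemma hat_sum_mirror_low: "i \<le> n ==> hat_sum n mu (2*n + 1 - i) + psum mu i = 2*r"
proof (induction i rule: inc_induct)
 case base
 have "2*n + 1 - n = Suc n" by simp
 thus ?case using weights_psum(1)[OF mu] psum_Suc[of mu n]
  by (simp add: hat_sum_Suc hat_sum_low) (simp add: weight_hat_def)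
next
 case (step i)
 have e: "2*n + 1 - i = Suc (2*n + 1 - Suc i)" using step by simp
 have "weight_hat n mu (Suc (2*n + 1 - Suc i)) = mu (Suc i)"
 proof -
  have "\<not> 2*n + 1 - i \<le> n" "2*n + 1 - i \<noteq> n + 1" "2*n + 2 - (2*n + 1 - i) = Suc i" using step by auto
  thus ?thesis unfolding e[symmetric] weight_hat_def by simp
 qed
 thus ?case using step.IH psum_Suc[of mu i] unfolding e hat_sum_Suc by linarith
qed

lemma hat_sum_mirror:
 assumes "i \<le> 2*n + 1"
 shows "hat_sum n mu i + hat_sum n mu (2*n + 1 - i) = 2*r"
proof (cases "i \<le> n")
 case True
 thus ?thesis using hat_sum_mirror_low[of i] hat_sum_low[of i n mu] by simp
next
 case False
 hence "2*n + 1 - i \<le> n" "2*n + 1 - (2*n + 1 - i) = i" using assms by auto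
 thus ?thesis using hat_sum_mirror_low[of "2*n + 1 - i"] hat_sum_low[of "2*n + 1 - i" n mu] by simp
qed

lemma hat_sum_total: "hat_sum n mu (2*n + 1) = 2*r"
 using hat_sum_mirror[of "2*n + 1"] by simp

lemma hat_sum_le: "i \<le> 2*n + 1 ==> hat_sum n mu i \<le> 2*r"
 using hat_sum_mirror[of i] by simp

end

definition block :: "nat => (nat => nat) => nat => nat" where
 "block n mu a = (LEAST i. a \<le> hat_sum n mu i)"

lemma block_le_iff:
 assumes "mu \<in> weights n r" "a \<le> 2*r"
 shows "block n mu a \<le> i \<longleftrightarrow> a \<le> hat_sum n mu i"
proof
 assume "block n mu a \<le> i"
 moreover have "a \<le> hat_sum n mu (block n mu a)"
  unfolding block_def by (rule LeastI[of _ "2*n + 1"]) (use hat_sum_total[OF assms(1)] assms(2) in simp)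
 ultimately show "a \<le> hat_sum n mu i" using hat_sum_mono le_trans by blast
next
 assume "a \<le> hat_sum n mu i"
 thus "block n mu a \<le> i" unfolding block_def by (rule Least_le)
qed

lemma block_range:
 assumes "mu \<in> weights n r" "1 \<le> a" "a \<le> 2*r"
 shows "1 \<le> block n mu a" "block n mu a \<le> 2*n + 1"
proof -
 show "1 \<le> block n mu a" using block_le_iff[OF assms(1,3), of 0] assms(2) by simp
 show "block n mu a \<le> 2*n + 1"
  using block_le_iff[OF assms(1,3), of "2*n + 1"] hat_sum_total[OF assms(1)] assms(3) by simp
qed

lemma weight_block_index:
 assumes "mu \<in> weights n r" "1 \<le> i" "i \<le> 2*n + 1"
 shows "weight_block n mu i = {a\<in>{1..2*r}. block n mu a = i}"
proof (rule Set.set_eqI)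
 fix a
 have le: "hat_sum n mu i \<le> 2*r" using hat_sum_le[OF assms(1,3)] .
 show "a \<in> weight_block n mu i \<longleftrightarrow> a \<in> {a\<in>{1..2*r}. block n mu a = i}"
 proof (cases "1 \<le> a \<and> a \<le> 2*r")
  case True
  thus ?thesis
   using block_le_iff[OF assms(1), of a i] block_le_iff[OF assms(1), of a "i - 1"] assms(2)
   by (auto simp: weight_block_hat_sum)
 next
  case False
  thus ?thesis using le assms(2) by (auto simp: weight_block_hat_sum)
 qed
qed

lemma block_mirror:
 assumes "mu \<in> weights n r" "1 \<le> a" "a \<le> 2*r"
 shows "block n mu (2*r + 1 - a) = 2*n + 2 - block n mu a"
proof -
 have "block n mu (2*r + 1 - a) \<le> i \<longleftrightarrow> 2*n + 2 - block n mu a \<le> i" if i: "i \<le> 2*n + 1" for i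
 proof -
  have "block n mu (2*r + 1 - a) \<le> i \<longleftrightarrow> 2*r + 1 - a \<le> hat_sum n mu i"
   by (rule block_le_iff[OF assms(1)]) (use assms in simp)
  also have "\<dots> \<longleftrightarrow> \<not> a \<le> hat_sum n mu (2*n + 1 - i)"
   using hat_sum_mirror[OF assms(1) i] assms(2,3) by auto
  also have "\<dots> \<longleftrightarrow> \<not> block n mu a \<le> 2*n + 1 - i"
   using block_le_iff[OF assms(1,3)] by simp
  also have "\<dots> \<longleftrightarrow> 2*n + 2 - block n mu a \<le> i"
   using i by auto
  finally show ?thesis .
 qed
 note * = this
 have r: "1 \<le> block n mu a" using block_range[OF assms] by simp
 have r': "block n mu (2*r + 1 - a) \<le> 2*n + 1" by (rule block_range(2)[OF assms(1)]) (use assms in auto)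
 show ?thesis using *[of "block n mu (2*r + 1 - a)"] *[of "2*n + 2 - block n mu a"] r r' by simp
qed

text \<open>
 The defining condition only concerns the initial segments of length at most \<open>r\<close>; the mirror
 symmetry of \<open>w\<close> extends it to all blocks.
\<close>

lemma parabolic_block_index:
 assumes mu: "mu \<in> weights n r"
 shows "w \<in> parabolic n r mu \<longleftrightarrow> w \<in> WB r \<and> (\<forall>a\<in>{1..2*r}. block n mu (w a) = block n mu a)"
proof
 assume "w \<in> parabolic n r mu"
 hence w: "w \<in> WB r" and st: "\<And>k. 1 \<le> k ==> k \<le> n ==> w ` {1..psum mu k} = {1..psum mu k}"
  unfolding parabolic_stabilizer[OF mu] using initial_stabilizerD by blast+
 have low: "w a \<le> hat_sum n mu k \<longleftrightarrow> a \<le> hat_sum n mu k" if a: "1 \<le> a" "a \<le> 2*r" and k: "k \<le> n" for a k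
 proof (cases "k = 0")
  case True
  thus ?thesis using a WB_range[OF w a] by simp
 next
  case False
  hence s: "w ` {1..hat_sum n mu k} = {1..hat_sum n mu k}" using st[of k] k hat_sum_low[of k n mu] by simp
  have "w a \<in> w ` {1..hat_sum n mu k} \<longleftrightarrow> a \<in> {1..hat_sum n mu k}"
   by (rule inj_image_mem_iff[OF permutes_inj[OF WB_permutes[OF w]]])
  thus ?thesis unfolding s using a WB_range[OF w a] by simp
 qed
 have all: "w a \<le> hat_sum n mu k \<longleftrightarrow> a \<le> hat_sum n mu k" if a: "1 \<le> a" "a \<le> 2*r" and k: "k \<le> 2*n + 1" for a k
 proof (cases "k \<le> n")
  case True
  thus ?thesis using low a by blast
 next
  case False
  hence kn: "2*n + 1 - k \<le> n" by simp
  have "w (2*r + 1 - a) \<le> hat_sum n mu (2*n + 1 - k) \<longleftrightarrow> 2*r + 1 - a \<le> hat_sum n mu (2*n + 1 - k)"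
   by (rule low[OF _ _ kn]) (use a in auto)
  thus ?thesis using WB_mirror(2)[OF w a] hat_sum_mirror[OF mu k] a by auto
 qed
 have "block n mu (w a) = block n mu a" if "a \<in> {1..2*r}" for a
 proof -
  have a: "1 \<le> a" "a \<le> 2*r" "1 \<le> w a" "w a \<le> 2*r" using that WB_range[OF w] by auto
  have "block n mu (w a) \<le> k \<longleftrightarrow> block n mu a \<le> k" if "k \<le> 2*n + 1" for k
   using all[OF a(1,2) that] block_le_iff[OF mu a(2)] block_le_iff[OF mu a(4)] by simp
  from this[OF block_range(2)[OF mu a(1,2)]] this[OF block_range(2)[OF mu a(3,4)]]
  show ?thesis by simp
 qed
 thus "w \<in> WB r \<and> (\<forall>a\<in>{1..2*r}. block n mu (w a) = block n mu a)" using w by blast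
next
 assume a: "w \<in> WB r \<and> (\<forall>a\<in>{1..2*r}. block n mu (w a) = block n mu a)"
 hence w: "w \<in> WB r" by blast
 show "w \<in> parabolic n r mu"
  unfolding parabolic_stabilizer[OF mu]
 proof (rule initial_stabilizerI[OF w])
  fix k assume k: "1 \<le> k" "k \<le> n"
  have ps: "hat_sum n mu k = psum mu k" using hat_sum_low k by simp
  have le: "psum mu k \<le> r" using weights_psum(2)[OF mu, of k] k by simp
  have "w ` {1..psum mu k} \<subseteq> {1..psum mu k}"
  proof (rule image_subsetI)
   fix x assume x: "x \<in> {1..psum mu k}"
   hence x2: "1 \<le> x" "x \<le> 2*r" using le by auto
   have "block n mu x \<le> k" using block_le_iff[OF mu x2(2)] x ps by simp
   hence "block n mu (w x) \<le> k" using a x2 by simp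
   thus "w x \<in> {1..psum mu k}"
    using block_le_iff[OF mu WB_range(2)[OF w x2], of k] WB_range[OF w x2] ps by simp
  qed
  moreover have "inj_on w {1..psum mu k}" by (rule inj_onI) (simp add: WB_inj[OF w])
  ultimately show "w ` {1..psum mu k} = {1..psum mu k}" by (simp add: endo_inj_surj)
 qed
qed

lemma WB_image_iff: "w \<in> WB r ==> a \<in> w ` T \<longleftrightarrow> perm_inv w a \<in> T"
 using inv_WB_comp(3,4)[of w r] by (metis imageE imageI)

lemma coset_matrix_apply:
 assumes ka: "ka \<in> weights n r" and mu: "mu \<in> weights n r" and d: "d \<in> WB r"
  and i: "1 \<le> i" "i \<le> 2*n + 1" and j: "1 \<le> j" "j \<le> 2*n + 1"
 shows "coset_matrix n ka d mu (i, j) = card {a\<in>{1..2*r}. block n ka a = i \<and> block n mu (perm_inv d a) = j}"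
proof -
 have "weight_block n ka i \<inter> d ` weight_block n mu j
   = {a\<in>{1..2*r}. block n ka a = i \<and> block n mu (perm_inv d a) = j}"
  unfolding weight_block_index[OF ka i] weight_block_index[OF mu j]
 proof (rule Set.set_eqI)
  fix a
  have "a \<in> d ` {a \<in> {1..2*r}. block n mu a = j} \<longleftrightarrow> perm_inv d a \<in> {a \<in> {1..2*r}. block n mu a = j}"
   by (rule WB_image_iff[OF d])
  moreover have "perm_inv d a \<in> {1..2*r} \<longleftrightarrow> a \<in> {1..2*r}"
   by (rule permutes_in_image[OF WB_permutes[OF inv_WB[OF d]]])
  ultimately show "a \<in> {a \<in> {1..2*r}. block n ka a = i} \<inter> d ` {a \<in> {1..2*r}. block n mu a = j} \<longleftrightarrow>
    a \<in> {a\<in>{1..2*r}. block n ka a = i \<and> block n mu (perm_inv d a) = j}"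
   by blast
 qed
 thus ?thesis using i j by (simp add: coset_matrix_def)
qed

lemma sum_card_fibres:
 assumes "finite S" "finite T" "f ` S \<subseteq> T"
 shows "(\<Sum>y\<in>T. card {x\<in>S. f x = y}) = card S"
 using sum.group[OF assms, of "\<lambda>_. 1::nat"] by simp

lemma bij_betw_WB: "w \<in> WB r ==> bij_betw w {1..2*r} {1..2*r}"
 by (rule permutes_imp_bij[OF WB_permutes])

lemma coset_matrix_row_sum:
 assumes ka: "ka \<in> weights n r" and mu: "mu \<in> weights n r" and d: "d \<in> WB r" and i: "1 \<le> i" "i \<le> 2*n + 1"
 shows "(\<Sum>j = 1..2*n + 1. coset_matrix n ka d mu (i, j)) = weight_hat n ka i"
proof -
 let ?S = "{a\<in>{1..2*r}. block n ka a = i}"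
 have "(\<Sum>j = 1..2*n + 1. coset_matrix n ka d mu (i, j)) = (\<Sum>j = 1..2*n + 1. card {a\<in>?S. block n mu (perm_inv d a) = j})"
  by (intro sum.cong refl) (simp add: coset_matrix_apply[OF ka mu d i] conj_assoc)
 also have "\<dots> = card ?S"
 proof (rule sum_card_fibres)
  show "(\<lambda>a. block n mu (perm_inv d a)) ` ?S \<subseteq> {1..2*n + 1}"
  proof (rule image_subsetI)
   fix a assume "a \<in> ?S"
   hence "1 \<le> perm_inv d a" "perm_inv d a \<le> 2*r" using WB_range[OF inv_WB[OF d], of a] by auto
   thus "block n mu (perm_inv d a) \<in> {1..2*n + 1}" using block_range[OF mu] by simp
  qed
 qed auto
 also have "\<dots> = weight_hat n ka i"
  by (simp only: card_weight_block[OF i(1), symmetric] weight_block_index[OF ka i])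
 finally show ?thesis .
qed

lemma coset_matrix_column_sum:
 assumes ka: "ka \<in> weights n r" and mu: "mu \<in> weights n r" and d: "d \<in> WB r" and j: "1 \<le> j" "j \<le> 2*n + 1"
 shows "(\<Sum>i = 1..2*n + 1. coset_matrix n ka d mu (i, j)) = weight_hat n mu j"
proof -
 let ?S = "d ` weight_block n mu j"
 have S: "?S \<subseteq> {1..2*r}" using WB_range[OF d] unfolding weight_block_index[OF mu j] by auto
 have "(\<Sum>i = 1..2*n + 1. coset_matrix n ka d mu (i, j)) = (\<Sum>i = 1..2*n + 1. card {a\<in>?S. block n ka a = i})"
 proof (rule sum.cong[OF refl])
  fix i assume i: "i \<in> {1..2*n + 1}"
  have "weight_block n ka i \<inter> ?S = {a\<in>?S. block n ka a = i}" using weight_block_index[OF ka, of i] i S by auto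
  thus "coset_matrix n ka d mu (i, j) = card {a\<in>?S. block n ka a = i}" using i j by (simp add: coset_matrix_def)
 qed
 also have "\<dots> = card ?S"
  by (rule sum_card_fibres) (use S block_range[OF ka] finite_subset[OF S] in auto)
 also have "\<dots> = weight_hat n mu j"
  unfolding card_weight_block[OF j(1), symmetric] by (rule card_image) (simp add: inj_on_def WB_inj[OF d])
 finally show ?thesis .
qed

lemma weight_eqI:
 assumes "mu \<in> weights n r" "nu \<in> weights n r" "\<And>i. 1 \<le> i ==> i \<le> 2*n + 1 ==> weight_hat n mu i = weight_hat n nu i"
 shows "mu = nu"
proof
 fix i
 show "mu i = nu i"
 proof (cases "i \<in> {1..n + 1}")
  case True
  hence "i \<le> n \<or> i = n + 1" "1 \<le> i" "i \<le> 2*n + 1" by auto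
  thus ?thesis using assms(3)[of i] by (auto simp: weight_hat_def)
 next
  case False
  thus ?thesis using assms(1,2) PiE_arb[of mu "{1..n + 1}" "\<lambda>_. UNIV" i] PiE_arb[of nu "{1..n + 1}" "\<lambda>_. UNIV" i]
   by (simp add: weights_def)
 qed
qed

lemma double_coset_WB:
 assumes "ka \<in> weights n r" "mu \<in> weights n r" "d \<in> WB r" "w \<in> double_coset n r ka d mu"
 shows "w \<in> WB r"
 using assms parabolic_WB comp_WB unfolding double_coset_def by blast

lemma parabolic_weight_block:
 assumes mu: "mu \<in> weights n r" and u: "u \<in> parabolic n r mu" and i: "1 \<le> i" "i \<le> 2*n + 1"
 shows "u ` weight_block n mu i = weight_block n mu i"
proof -
 have sub: "v ` weight_block n mu i \<subseteq> weight_block n mu i" if v: "v \<in> parabolic n r mu" for v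
  using v[unfolded parabolic_block_index[OF mu]] WB_range[of v r] unfolding weight_block_index[OF mu i] by auto
 have "a \<in> u ` weight_block n mu i" if "a \<in> weight_block n mu i" for a
  unfolding WB_image_iff[OF parabolic_WB[OF mu u]] using sub[OF parabolic_inv[OF mu u]] that by blast
 thus ?thesis using sub[OF u] by blast
qed

lemma coset_matrix_double_coset:
 assumes ka: "ka \<in> weights n r" and mu: "mu \<in> weights n r" and d: "d \<in> WB r" and w: "w \<in> double_coset n r ka d mu"
 shows "coset_matrix n ka w mu = coset_matrix n ka d mu"
proof -
 obtain u v where u: "u \<in> parabolic n r ka" and v: "v \<in> parabolic n r mu" and weq: "w = u o d o v"
  using w by (auto simp: double_coset_def)
 have inj: "inj u" by (simp add: inj_def WB_inj[OF parabolic_WB[OF ka u]])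
 show ?thesis
  unfolding coset_matrix_def
 proof (rule restrict_ext, clarify)
  fix i j :: nat assume "i \<in> {1..2*n + 1}" "j \<in> {1..2*n + 1}"
  hence i: "1 \<le> i" "i \<le> 2*n + 1" and j: "1 \<le> j" "j \<le> 2*n + 1" by auto
  have "w ` weight_block n mu j = u ` d ` weight_block n mu j"
   unfolding weq image_comp[symmetric] parabolic_weight_block[OF mu v j] ..
  hence "weight_block n ka i \<inter> w ` weight_block n mu j = u ` (weight_block n ka i \<inter> d ` weight_block n mu j)"
   unfolding image_Int[OF inj] parabolic_weight_block[OF ka u i] by simp
  thus "card (weight_block n ka i \<inter> w ` weight_block n mu j) = card (weight_block n ka i \<inter> d ` weight_block n mu j)"
   using card_image[OF inj_on_subset[OF inj subset_UNIV]] by simp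
 qed
qed

text \<open>
 Label an index by its row block and by the column block of its preimage; the matrix counts the
 indices with a given label.  Permutations with equal matrices thus give equivariantly isomorphic
 labelled sets, and the isomorphism is the factor of \<open>d'\<close> in the row subgroup.
\<close>

lemma coset_matrix_eq_imp:
 assumes ka: "ka \<in> weights n r" and mu: "mu \<in> weights n r" and d: "d \<in> WB r"
  and ka': "ka' \<in> weights n r" and mu': "mu' \<in> weights n r" and d': "d' \<in> WB r"
  and eq: "coset_matrix n ka d mu = coset_matrix n ka' d' mu'"
 shows "ka' = ka" "mu' = mu" "d' \<in> double_coset n r ka d mu"
proof -
 show k: "ka' = ka"
  by (rule weight_eqI[OF ka' ka]) (metis coset_matrix_row_sum[OF ka mu d] coset_matrix_row_sum[OF ka' mu' d'] eq)
 show m: "mu' = mu"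
  by (rule weight_eqI[OF mu' mu]) (metis coset_matrix_column_sum[OF ka mu d] coset_matrix_column_sum[OF ka' mu' d'] eq)
 let ?S = "{1..2*r}"
 let ?\<tau> = "\<lambda>d a. (block n ka a, block n mu (perm_inv d a))"
 let ?\<iota> = "\<lambda>a. 2*r + 1 - a"
 let ?\<sigma> = "\<lambda>(i, j). (2*n + 2 - i, 2*n + 2 - j)"
 have inv: "?\<iota> x \<in> ?S \<and> ?\<iota> (?\<iota> x) = x \<and> ?\<iota> x \<noteq> x \<and> ?\<tau> d (?\<iota> x) = ?\<sigma> (?\<tau> d x)" if x: "x \<in> ?S" and d: "d \<in> WB r" for x d
 proof -
  have x2: "1 \<le> x" "x \<le> 2*r" using x by auto
  have "2*r + 1 \<noteq> 2*x" by arith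
  hence "?\<iota> x \<noteq> x" using x2 by simp
  moreover have "perm_inv d (?\<iota> x) = ?\<iota> (perm_inv d x)" by (rule WB_mirror(1)[OF inv_WB[OF d] x2])
  moreover have "block n mu (?\<iota> (perm_inv d x)) = 2*n + 2 - block n mu (perm_inv d x)"
   by (rule block_mirror[OF mu WB_range[OF inv_WB[OF d] x2]])
  moreover have "block n ka (?\<iota> x) = 2*n + 2 - block n ka x" by (rule block_mirror[OF ka x2])
  ultimately show ?thesis using x2 by auto
 qed
 have cnt: "card {x\<in>?S. ?\<tau> d x = t} = card {x\<in>?S. ?\<tau> d' x = t}" for t
 proof -
  obtain i j where t: "t = (i, j)" by fastforce
  show ?thesis
  proof (cases "(1 \<le> i \<and> i \<le> 2*n + 1) \<and> (1 \<le> j \<and> j \<le> 2*n + 1)")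
   case True
   thus ?thesis
    using coset_matrix_apply[OF ka mu d, of i j] coset_matrix_apply[OF ka mu d', of i j] eq k m t by simp
  next
   case False
   have emp: "{x\<in>?S. ?\<tau> e x = t} = {}" if e: "e \<in> WB r" for e
   proof (rule ccontr)
    assume "{x\<in>?S. ?\<tau> e x = t} \<noteq> {}"
    then obtain x where x: "1 \<le> x" "x \<le> 2*r" "block n ka x = i" "block n mu (perm_inv e x) = j"
     using t by auto
    thus False
     using False block_range[OF ka x(1,2)] block_range[OF mu WB_range[OF inv_WB[OF e] x(1,2)]] by simp
   qed
   show ?thesis unfolding emp[OF d] emp[OF d'] ..
  qed
 qed
 have "\<exists>\<beta>. bij_betw \<beta> ?S ?S \<and> (\<forall>x\<in>?S. \<beta> (?\<iota> x) = ?\<iota> (\<beta> x) \<and> ?\<tau> d' (\<beta> x) = ?\<tau> d x)"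
  by (rule equivariant_bijection[where \<sigma> = ?\<sigma>]) (use inv[OF _ d] inv[OF _ d'] cnt in auto)
 then obtain \<beta> where \<beta>: "bij_betw \<beta> ?S ?S" and eqv: "\<And>x. x \<in> ?S ==> \<beta> (?\<iota> x) = ?\<iota> (\<beta> x)"
  and lab: "\<And>x. x \<in> ?S ==> ?\<tau> d' (\<beta> x) = ?\<tau> d x" by blast
 define u where "u x = (if x \<in> ?S then \<beta> x else x)" for x
 have u\<beta>: "u x = \<beta> x" if "x \<in> ?S" for x using that by (simp add: u_def)
 have uW: "u \<in> WB r"
  unfolding WB_iff
 proof (intro conjI ballI)
  have "bij_betw u ?S ?S" by (rule bij_betw_cong[THEN iffD1, OF _ \<beta>]) (simp only: u\<beta>)
  thus "u permutes ?S" by (rule bij_imp_permutes) (simp only: u_def if_False)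
  fix x assume x: "x \<in> ?S"
  hence x': "?\<iota> x \<in> ?S" "\<beta> x \<in> ?S" using \<beta> by (auto simp: bij_betw_def)
  show "u x + u (?\<iota> x) = 2*r + 1" using u\<beta>[OF x] u\<beta>[OF x'(1)] eqv[OF x] x'(2) by simp
 qed
 have up: "u \<in> parabolic n r ka"
  unfolding parabolic_block_index[OF ka] using uW lab u\<beta> by simp
 define v where "v = perm_inv d o perm_inv u o d'"
 have vW: "v \<in> WB r" unfolding v_def by (intro comp_WB inv_WB d d' uW)
 have vp: "v \<in> parabolic n r mu"
  unfolding parabolic_block_index[OF mu]
 proof (intro conjI vW ballI)
  fix x assume x: "x \<in> ?S"
  define a where "a = perm_inv u (d' x)"
  have "d' x \<in> ?S" using WB_range[OF d', of x] x by simp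
  hence a: "a \<in> ?S" unfolding a_def using WB_range[OF inv_WB[OF uW], of "d' x"] by simp
  have "u a = d' x" unfolding a_def by (rule inv_WB_comp(4)[OF uW])
  hence "?\<tau> d' (d' x) = ?\<tau> d a" using lab[OF a] u\<beta>[OF a] by simp
  hence "block n mu x = block n mu (perm_inv d a)" using inv_WB_comp(3)[OF d'] by simp
  thus "block n mu (v x) = block n mu x" by (simp add: v_def a_def)
 qed
 have "d' = u o d o v"
  unfolding v_def by (simp add: fun_eq_iff inv_WB_comp(3,4)[OF d] inv_WB_comp(3,4)[OF uW])
 thus "d' \<in> double_coset n r ka d mu" unfolding double_coset_def using up vp by blast
qed

lemma sum_symmetric_odd:
 fixes f :: "nat => nat"
 assumes "\<And>i. i \<in> {1..2*n + 1} ==> f i = f (2*n + 2 - i)"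
 shows "(\<Sum>i = 1..2*n + 1. f i) = f (n + 1) + 2 * (\<Sum>i = 1..n. f i)"
proof -
 have "{1..2*n + 1} = {1..n} \<union> {n + 1} \<union> {n + 2..2*n + 1}" by auto
 hence "(\<Sum>i = 1..2*n + 1. f i) = (\<Sum>i = 1..n. f i) + f (n + 1) + (\<Sum>i = n + 2..2*n + 1. f i)"
  by (simp add: sum.union_disjoint)
 also have "(\<Sum>i = n + 2..2*n + 1. f i) = (\<Sum>i = 1..n. f i)"
  by (rule sum.reindex_bij_witness[of _ "\<lambda>i. 2*n + 2 - i" "\<lambda>i. 2*n + 2 - i"]) (auto simp: assms)
 finally show ?thesis by simp
qed

text \<open>An entry \<open>m\<close> is replaced by \<open>m\<close> cells, among which a permutation can be chosen.\<close>

definition cells :: "nat => (nat \<times> nat => nat) => (nat \<times> nat \<times> nat) set" where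
 "cells n A = {(i, j, k). i \<in> {1..2*n + 1} \<and> j \<in> {1..2*n + 1} \<and> k < A (i, j)}"

text \<open>The central symmetry; it moves every cell once the central entry of the matrix is even.\<close>

definition cell_mirror :: "nat => (nat \<times> nat => nat) => nat \<times> nat \<times> nat => nat \<times> nat \<times> nat" where
 "cell_mirror n A = (\<lambda>(i, j, k). (2*n + 2 - i, 2*n + 2 - j, A (i, j) - 1 - k))"

lemma card_cells_fibre:
 assumes "i \<in> {1..2*n + 1}" "j \<in> {1..2*n + 1}"
 shows "card {e\<in>cells n A. fst e = i \<and> fst (snd e) = j} = A (i, j)"
proof -
 have "{e\<in>cells n A. fst e = i \<and> fst (snd e) = j} = (\<lambda>k. (i, j, k)) ` {..<A (i, j)}"
  using assms by (auto simp: cells_def)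
 thus ?thesis by (simp add: card_image inj_on_def)
qed

lemma finite_cells: "finite (cells n A)"
proof -
 have "cells n A = (SIGMA i:{1..2*n + 1}. SIGMA j:{1..2*n + 1}. {..<A (i, j)})"
  by (auto simp: cells_def)
 thus ?thesis by simp
qed

lemma card_cells_row:
 assumes "i \<in> {1..2*n + 1}"
 shows "card {e\<in>cells n A. fst e = i} = (\<Sum>j = 1..2*n + 1. A (i, j))"
proof -
 have "(\<Sum>j = 1..2*n + 1. card {e\<in>{e\<in>cells n A. fst e = i}. fst (snd e) = j}) = card {e\<in>cells n A. fst e = i}"
  by (rule sum_card_fibres) (auto simp: finite_cells, auto simp: cells_def)
 thus ?thesis using card_cells_fibre[OF assms, of _ A] by (simp add: conj_assoc)
qed

lemma card_cells_column:
 assumes "j \<in> {1..2*n + 1}"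
 shows "card {e\<in>cells n A. fst (snd e) = j} = (\<Sum>i = 1..2*n + 1. A (i, j))"
proof -
 have "(\<Sum>i = 1..2*n + 1. card {e\<in>{e\<in>cells n A. fst (snd e) = j}. fst e = i}) = card {e\<in>cells n A. fst (snd e) = j}"
  by (rule sum_card_fibres) (auto simp: finite_cells, auto simp: cells_def)
 moreover have "{e\<in>{e\<in>cells n A. fst (snd e) = j}. fst e = i} = {e\<in>cells n A. fst e = i \<and> fst (snd e) = j}" for i
  by blast
 ultimately show ?thesis using card_cells_fibre[OF _ assms, of _ A] by simp
qed

text \<open>The middle marginal of a centrosymmetric matrix with even sum is even, so halving loses nothing.\<close>

definition half_margin :: "nat => (nat => nat) => nat => nat" where
 "half_margin n f = (\<lambda>i\<in>{1..n + 1}. if i = n + 1 then f (n + 1) div 2 else f i)"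

lemma half_margin_weight:
 assumes sym: "\<And>i. i \<in> {1..2*n + 1} ==> f i = f (2*n + 2 - i)" and tot: "(\<Sum>i = 1..2*n + 1. f i) = 2*r"
 shows "half_margin n f \<in> weights n r" "i \<in> {1..2*n + 1} ==> weight_hat n (half_margin n f) i = f i"
  "even (f (n + 1))"
proof -
 have s: "f (n + 1) + 2 * (\<Sum>i = 1..n. f i) = 2*r" using sum_symmetric_odd[of n f, OF sym] tot by simp
 thus ev: "even (f (n + 1))" by presburger
 have "(\<Sum>i = 1..n. half_margin n f i) = (\<Sum>i = 1..n. f i)"
  by (intro sum.cong) (auto simp: half_margin_def)
 hence "(\<Sum>i = 1..n + 1. half_margin n f i) = r"
  using s by (simp add: half_margin_def)
 thus "half_margin n f \<in> weights n r" by (auto simp: weights_def half_margin_def)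
 show "weight_hat n (half_margin n f) i = f i" if i: "i \<in> {1..2*n + 1}"
 proof -
  consider "i \<le> n" | "i = n + 1" | "n + 2 \<le> i" by linarith
  thus ?thesis
  proof cases
   case 1
   thus ?thesis using i by (simp add: weight_hat_def half_margin_def)
  next
   case 2
   thus ?thesis using ev by (simp add: weight_hat_def half_margin_def)
  next
   case 3
   hence "2*n + 2 - i \<in> {1..n}" using i by auto
   thus ?thesis using 3 sym[OF i] by (simp add: weight_hat_def half_margin_def)
  qed
 qed
qed

lemma Xi_mirror:
 assumes "A \<in> Xi (2*n + 1) k" "i \<in> {1..2*n + 1}" "j \<in> {1..2*n + 1}"
 shows "A (2*n + 2 - i, 2*n + 2 - j) = A (i, j)"
 using assms by (auto simp: Xi_def)

lemma sum_mirror: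
 fixes f :: "nat => nat"
 shows
 "(\<Sum>i = 1..2*n + 1. f (2*n + 2 - i)) = (\<Sum>i = 1..2*n + 1. f i)"
 by (rule sum.reindex_bij_witness[of _ "\<lambda>i. 2*n + 2 - i" "\<lambda>i. 2*n + 2 - i"]) auto

text \<open>
 The cells of the matrix, listed row by row, carry the blocks of the row weight; listed column by
 column, those of the column weight.  The permutation relating the two listings has the given matrix.
\<close>

lemma coset_matrix_surj:
 assumes A: "A \<in> Xi (2*n + 1) (2*r)"
 shows "\<exists>ka\<in>weights n r. \<exists>mu\<in>weights n r. \<exists>d\<in>WB r. coset_matrix n ka d mu = A"
proof -
 let ?N = "{1..2*n + 1}"
 define f g where "f i = (\<Sum>j = 1..2*n + 1. A (i, j))" and "g j = (\<Sum>i = 1..2*n + 1. A (i, j))" for i j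
 have mir: "2*n + 2 - i \<in> ?N" "2*n + 2 - (2*n + 2 - i) = i" if "i \<in> ?N" for i using that by auto
 have fsym: "f i = f (2*n + 2 - i)" if "i \<in> ?N" for i
 proof -
  have "f (2*n + 2 - i) = (\<Sum>j = 1..2*n + 1. A (2*n + 2 - i, 2*n + 2 - j))"
   unfolding f_def by (rule sum_mirror[symmetric])
  also have "\<dots> = f i" unfolding f_def by (intro sum.cong refl Xi_mirror[OF A that])
  finally show ?thesis by simp
 qed
 have gsym: "g j = g (2*n + 2 - j)" if "j \<in> ?N" for j
 proof -
  have "g (2*n + 2 - j) = (\<Sum>i = 1..2*n + 1. A (2*n + 2 - i, 2*n + 2 - j))"
   unfolding g_def by (rule sum_mirror[symmetric])
  also have "\<dots> = g j" unfolding g_def by (intro sum.cong refl Xi_mirror[OF A _ that])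
  finally show ?thesis by simp
 qed
 have ftot: "(\<Sum>i = 1..2*n + 1. f i) = 2*r" using A unfolding Xi_def f_def by blast
 have gtot: "(\<Sum>j = 1..2*n + 1. g j) = 2*r"
  using ftot unfolding f_def g_def by (subst sum.swap)
 let ?ka = "half_margin n f" and ?mu = "half_margin n g"
 have ka: "?ka \<in> weights n r" "\<And>i. i \<in> ?N ==> weight_hat n ?ka i = f i" "even (f (n + 1))"
  using half_margin_weight[of n f r] fsym ftot by blast+
 have mu: "?mu \<in> weights n r" "\<And>i. i \<in> ?N ==> weight_hat n ?mu i = g i"
  using half_margin_weight[of n g r] gsym gtot by blast+
 have mid: "even (A (n + 1, n + 1))"
 proof -
  have "A (n + 1, j) = A (n + 1, 2*n + 2 - j)" if "j \<in> ?N" for j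
   using Xi_mirror[OF A _ that, of "n + 1"] by simp
  from sum_symmetric_odd[of n "\<lambda>j. A (n + 1, j)", OF this] have "f (n + 1) = A (n + 1, n + 1) + 2 * (\<Sum>j = 1..n. A (n + 1, j))"
   by (simp only: f_def)
  thus ?thesis using ka(3) by presburger
 qed
 let ?E = "cells n A" and ?\<iota>' = "cell_mirror n A"
 let ?S = "{1..2*r}" and ?\<iota> = "\<lambda>a. 2*r + 1 - a"
 have E: "?\<iota>' e \<in> ?E \<and> ?\<iota>' (?\<iota>' e) = e \<and> ?\<iota>' e \<noteq> e \<and> fst (?\<iota>' e) = 2*n + 2 - fst e \<and> fst (snd (?\<iota>' e)) = 2*n + 2 - fst (snd e)"
  if "e \<in> ?E" for e
 proof -
  obtain i j k where e: "e = (i, j, k)" and ijk: "i \<in> ?N" "j \<in> ?N" "k < A (i, j)"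
   using \<open>e \<in> ?E\<close> unfolding cells_def by blast
  have m: "A (2*n + 2 - i, 2*n + 2 - j) = A (i, j)" by (rule Xi_mirror[OF A ijk(1,2)])
  have "?\<iota>' e \<noteq> e"
  proof
   assume "?\<iota>' e = e"
   hence "2*n + 2 - i = i" "2*n + 2 - j = j" and k: "A (i, j) - 1 - k = k"
    by (auto simp: e cell_mirror_def)
   hence "i = n + 1" "j = n + 1" by auto
   moreover have "A (i, j) = 2*k + 1" using k ijk(3) by simp
   ultimately show False using mid by simp
  qed
  moreover have "?\<iota>' e = (2*n + 2 - i, 2*n + 2 - j, A (i, j) - 1 - k)" by (simp add: e cell_mirror_def)
  moreover have "?\<iota>' (2*n + 2 - i, 2*n + 2 - j, A (i, j) - 1 - k) = e"
   unfolding cell_mirror_def e using m mir[OF ijk(1)] mir[OF ijk(2)] ijk(3) by simp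
  moreover have "(2*n + 2 - i, 2*n + 2 - j, A (i, j) - 1 - k) \<in> ?E"
   unfolding cells_def using m mir[OF ijk(1)] mir[OF ijk(2)] ijk(3) by simp
  ultimately show ?thesis by (simp add: e)
 qed
 have S: "?\<iota> x \<in> ?S \<and> ?\<iota> (?\<iota> x) = x \<and> ?\<iota> x \<noteq> x \<and> block n nu (?\<iota> x) = 2*n + 2 - block n nu x"
  if "x \<in> ?S" "nu \<in> weights n r" for x nu
 proof -
  have x2: "1 \<le> x" "x \<le> 2*r" using that by auto
  have "2*r + 1 \<noteq> 2*x" by arith
  hence "?\<iota> x \<noteq> x" using x2 by simp
  thus ?thesis using x2 block_mirror[OF that(2) x2] by auto
 qed
 have cntS: "card {x\<in>?S. block n nu x = t} = (if t \<in> ?N then weight_hat n nu t else 0)" if nu: "nu \<in> weights n r" for nu t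
 proof (cases "t \<in> ?N")
  case True
  thus ?thesis using card_weight_block[of t n nu] weight_block_index[OF nu, of t] by simp
 next
  case False
  hence "{x\<in>?S. block n nu x = t} = {}" using block_range[OF nu] by fastforce
  thus ?thesis using False by (simp only: card.empty if_False)
 qed
 have cntE: "card {e\<in>?E. fst e = t} = (if t \<in> ?N then f t else 0)" "card {e\<in>?E. fst (snd e) = t} = (if t \<in> ?N then g t else 0)" for t
 proof -
  have out: "{e\<in>?E. fst e = t} = {}" "{e\<in>?E. fst (snd e) = t} = {}" if "t \<notin> ?N" using that by (auto simp: cells_def)
  show "card {e\<in>?E. fst e = t} = (if t \<in> ?N then f t else 0)"
  proof (cases "t \<in> ?N")
   case True
   show ?thesis unfolding if_P[OF True] f_def by (rule card_cells_row[OF True])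
  next
   case False
   show ?thesis unfolding if_not_P[OF False] out(1)[OF False] by (rule card.empty)
  qed
  show "card {e\<in>?E. fst (snd e) = t} = (if t \<in> ?N then g t else 0)"
  proof (cases "t \<in> ?N")
   case True
   show ?thesis unfolding if_P[OF True] g_def by (rule card_cells_column[OF True])
  next
   case False
   show ?thesis unfolding if_not_P[OF False] out(2)[OF False] by (rule card.empty)
  qed
 qed
 have "\<exists>\<beta>. bij_betw \<beta> ?S ?E \<and> (\<forall>x\<in>?S. \<beta> (?\<iota> x) = ?\<iota>' (\<beta> x) \<and> fst (\<beta> x) = block n ?ka x)"
 proof (rule equivariant_bijection[where \<sigma> = "\<lambda>i. 2*n + 2 - i"])
  show "card {x\<in>?S. block n ?ka x = t} = card {e\<in>?E. fst e = t}" for t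
   by (rule trans[OF cntS[OF ka(1)]], rule sym, rule trans[OF cntE(1)], rule if_cong) (simp_all only: ka(2))
 qed (use S[OF _ ka(1)] E finite_cells in blast)+
 then obtain \<alpha> where \<alpha>: "bij_betw \<alpha> ?S ?E" "\<And>x. x \<in> ?S ==> \<alpha> (?\<iota> x) = ?\<iota>' (\<alpha> x)"
  "\<And>x. x \<in> ?S ==> fst (\<alpha> x) = block n ?ka x" by blast
 have "\<exists>\<beta>. bij_betw \<beta> ?S ?E \<and> (\<forall>x\<in>?S. \<beta> (?\<iota> x) = ?\<iota>' (\<beta> x) \<and> fst (snd (\<beta> x)) = block n ?mu x)"
 proof (rule equivariant_bijection[where \<sigma> = "\<lambda>i. 2*n + 2 - i" and \<tau>' = "\<lambda>e. fst (snd e)"])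
  show "card {x\<in>?S. block n ?mu x = t} = card {e\<in>?E. fst (snd e) = t}" for t
   by (rule trans[OF cntS[OF mu(1)]], rule sym, rule trans[OF cntE(2)], rule if_cong) (simp_all only: mu(2))
 qed (use S[OF _ mu(1)] E finite_cells in blast)+
 then obtain \<beta> where \<beta>: "bij_betw \<beta> ?S ?E" "\<And>x. x \<in> ?S ==> \<beta> (?\<iota> x) = ?\<iota>' (\<beta> x)"
  "\<And>x. x \<in> ?S ==> fst (snd (\<beta> x)) = block n ?mu x" by blast
 (* Both alpha and beta list the cells; d takes the column listing to the row listing. *)
 define d where "d x = (if x \<in> ?S then inv_into ?S \<alpha> (\<beta> x) else x)" for x
 have \<alpha>S: "\<alpha> x \<in> ?E" if "x \<in> ?S" for x using \<alpha>(1) that by (auto simp: bij_betw_def)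
 have \<beta>S: "\<beta> x \<in> ?E" if "x \<in> ?S" for x using \<beta>(1) that by (auto simp: bij_betw_def)
 have dS: "d x \<in> ?S" and \<alpha>d: "\<alpha> (d x) = \<beta> x" if "x \<in> ?S" for x
 proof -
  have im: "\<beta> x \<in> \<alpha> ` ?S" using \<beta>S[OF that] \<alpha>(1) by (simp add: bij_betw_def)
  have "d x = inv_into ?S \<alpha> (\<beta> x)" using that by (simp only: d_def if_True)
  thus "d x \<in> ?S" "\<alpha> (d x) = \<beta> x" using inv_into_into[OF im] f_inv_into_f[OF im] by simp_all
 qed
 have dW: "d \<in> WB r"
  unfolding WB_iff
 proof (intro conjI ballI)
  have "bij_betw (inv_into ?S \<alpha> o \<beta>) ?S ?S" by (rule bij_betw_trans[OF \<beta>(1) bij_betw_inv_into[OF \<alpha>(1)]])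
  hence "bij_betw d ?S ?S" by (rule bij_betw_cong[THEN iffD1, rotated]) (simp add: d_def)
  thus "d permutes ?S" by (rule bij_imp_permutes) (simp only: d_def if_False)
  fix x assume x: "x \<in> ?S"
  have x': "?\<iota> x \<in> ?S" and dx': "?\<iota> (d x) \<in> ?S" using S[OF x ka(1)] S[OF dS[OF x] ka(1)] by blast+
  have "\<alpha> (d (?\<iota> x)) = \<alpha> (?\<iota> (d x))"
   unfolding \<alpha>d[OF x'] \<beta>(2)[OF x] \<alpha>(2)[OF dS[OF x]] \<alpha>d[OF x] ..
  hence "d (?\<iota> x) = ?\<iota> (d x)" by (rule inj_onD[OF bij_betw_imp_inj_on[OF \<alpha>(1)] _ dS[OF x'] dx'])
  thus "d x + d (?\<iota> x) = 2*r + 1" using dS[OF x] by simp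
 qed
 have "coset_matrix n ?ka d ?mu p = A p" for p
 proof (cases "p \<in> ?N \<times> ?N")
  case True
  then obtain i j where p: "p = (i, j)" and ij: "i \<in> ?N" "j \<in> ?N" by blast
  let ?B = "{a\<in>?S. block n ?ka a = i \<and> block n ?mu (perm_inv d a) = j}"
  have lab: "block n ?mu (perm_inv d a) = fst (snd (\<alpha> a))" if a: "a \<in> ?S" for a
  proof -
   have "perm_inv d a \<in> ?S" using WB_range[OF inv_WB[OF dW], of a] a by simp
   from \<beta>(3)[OF this] \<alpha>d[OF this] show ?thesis by (simp add: inv_WB_comp(4)[OF dW])
  qed
  have im: "\<alpha> ` ?B = {e\<in>?E. fst e = i \<and> fst (snd e) = j}"
  proof (intro equalityI subsetI)
   fix e assume "e \<in> \<alpha> ` ?B"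
   then obtain a where "a \<in> ?S" "e = \<alpha> a" "block n ?ka a = i" "block n ?mu (perm_inv d a) = j" by blast
   thus "e \<in> {e\<in>?E. fst e = i \<and> fst (snd e) = j}" using \<alpha>S \<alpha>(3) lab by simp
  next
   fix e assume e: "e \<in> {e\<in>?E. fst e = i \<and> fst (snd e) = j}"
   hence "e \<in> \<alpha> ` ?S" using \<alpha>(1) by (simp add: bij_betw_def)
   then obtain a where a: "a \<in> ?S" "e = \<alpha> a" by blast
   hence "a \<in> ?B" using e \<alpha>(3)[OF a(1)] lab[OF a(1)] by simp
   thus "e \<in> \<alpha> ` ?B" using a(2) by blast
  qed
  have "inj_on \<alpha> ?B" by (rule inj_on_subset[OF bij_betw_imp_inj_on[OF \<alpha>(1)]]) blast
  from card_image[OF this] have "card ?B = A (i, j)" unfolding im card_cells_fibre[OF ij] by (rule sym)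
  thus ?thesis using coset_matrix_apply[OF ka(1) mu(1) dW] ij p by simp
 next
  case False
  thus ?thesis using A PiE_arb[of A "?N \<times> ?N" "\<lambda>_. UNIV" p] by (simp add: coset_matrix_def Xi_def)
 qed
 thus ?thesis using ka(1) mu(1) dW by blast
qed

section \<open>The regular representation of the generic Hecke algebra\<close>

(* Functions are treated as vectors here, to be evaluated at a point on demand only. *)
declare plus_fun_apply [simp del] zero_fun_apply [simp del]
lemmas fun_apply = plus_fun_apply zero_fun_apply

lemma refl_fix_low:
 assumes "i \<in> {1..r}" "j \<le> r" "j \<noteq> i" "j \<noteq> i + 1"
 shows "srefl r i j = j"
proof -
 have "j \<noteq> 2*r - i" "j \<noteq> 2*r + 1 - i" using assms by auto
 thus ?thesis using assms(3,4) unfolding simple_refl_apply[OF assms(1)] by simp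
qed

lemma refl_fix_mid:
 assumes "i \<in> {1..r}" "i + 1 < r" "j \<le> r + 1" "j \<noteq> i" "j \<noteq> i + 1"
 shows "srefl r i j = j"
proof -
 have "j \<noteq> 2*r - i" "j \<noteq> 2*r + 1 - i" using assms by auto
 thus ?thesis using assms(4,5) unfolding simple_refl_apply[OF assms(1)] by simp
qed

lemma refl_values:
 assumes "i \<in> {1..r}"
 shows "srefl r i i = i + 1" "srefl r i (i + 1) = i"
 using assms by (simp_all add: simple_refl_apply)

lemma refl_values_middle:
 assumes "2 \<le> r"
 shows "srefl r (r - 1) (r + 1) = r + 2" "srefl r (r - 1) (r + 2) = r + 1"
  "srefl r r (r - 1) = r - 1" "srefl r r (r + 2) = r + 2"
  "srefl r (r - 1) (r - 1) = r" "srefl r (r - 1) r = r - 1"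
  "srefl r r r = r + 1" "srefl r r (r + 1) = r"
proof -
 have r: "r - 1 \<in> {1..r}" "r \<in> {1..r}" using assms by auto
 have e: "2*r - (r - 1) = r + 1" "2*r + 1 - (r - 1) = r + 2" "2*r - r = r" "2*r + 1 - r = r + 1" "r - 1 + 1 = r"
  using assms by auto
 show "srefl r (r - 1) (r + 1) = r + 2" "srefl r (r - 1) (r + 2) = r + 1"
  "srefl r r (r - 1) = r - 1" "srefl r r (r + 2) = r + 2"
  "srefl r (r - 1) (r - 1) = r" "srefl r (r - 1) r = r - 1"
  "srefl r r r = r + 1" "srefl r r (r + 1) = r"
  unfolding simple_refl_apply[OF r(1)] simple_refl_apply[OF r(2)] e using assms by auto
qed

lemma refl_commute:
 assumes "i \<in> {1..r}" "j \<in> {1..r}" "i + 2 \<le> j"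
 shows "srefl r i o srefl r j = srefl r j o srefl r i"
proof -
 have v: "srefl r j i = i" "srefl r j (i + 1) = i + 1"
  using assms by (auto intro!: refl_fix_low)
 have "srefl r j i < srefl r j (i + 1)"
  "srefl r i (srefl r j (i + 1)) < srefl r i (srefl r j i)"
  unfolding v refl_values[OF assms(1)] by simp_all
 thus ?thesis by (rule refl_exchange[OF simple_refl_WB[OF assms(2)] assms(1,1)])
qed

lemma refl_braid:
 assumes "1 \<le> j" "j + 1 < r"
 shows "srefl r (j + 1) o (srefl r j o srefl r (j + 1))
  = srefl r j o srefl r (j + 1) o srefl r j"
proof -
 have j: "j \<in> {1..r}" "j + 1 \<in> {1..r}" using assms by auto
 have v: "srefl r (j + 1) j = j" "srefl r j (j + 2) = j + 2"
  using assms j by (auto intro!: refl_fix_low)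
 have w: "srefl r (j + 1) (j + 1) = j + 2" "srefl r (j + 1) (j + 2) = j + 1"
  using refl_values[OF j(2)] by simp_all
 have "(srefl r j o srefl r (j + 1)) j < (srefl r j o srefl r (j + 1)) (j + 1)"
  "srefl r (j + 1) ((srefl r j o srefl r (j + 1)) (j + 1))
   < srefl r (j + 1) ((srefl r j o srefl r (j + 1)) j)"
  unfolding comp_apply v w refl_values[OF j(1)] by simp_all
 thus ?thesis
  by (rule refl_exchange[OF comp_WB[OF simple_refl_WB[OF j(1)] simple_refl_WB[OF j(2)]] j(2,1)])
qed

lemma refl_braid_B:
 assumes "2 \<le> r"
 shows "srefl r r o (srefl r (r - 1) o srefl r r o srefl r (r - 1))
  = srefl r (r - 1) o srefl r r o srefl r (r - 1) o srefl r r"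
proof -
 have r: "r - 1 \<in> {1..r}" "r \<in> {1..r}" using assms by auto
 let ?u = "srefl r (r - 1) o srefl r r o srefl r (r - 1)"
 have "?u r < ?u (r + 1)" "srefl r r (?u (r + 1)) < srefl r r (?u r)"
  unfolding comp_apply refl_values_middle[OF assms] by simp_all
 thus ?thesis
  by (rule refl_exchange[OF comp_WB[OF comp_WB[OF simple_refl_WB[OF r(1)] simple_refl_WB[OF r(2)]] simple_refl_WB[OF r(1)]] r(2,2)])
qed

definition par :: "nat => nat => int poly" where
 "par r i = (if i < r then qvar else 1)"

text \<open>Right multiplication by \<open>T\<^sub>i\<close> on the coefficient functions \<open>phi\<close> of \<open>\<Sum>w. phi w T\<^sub>w\<close>.\<close>

definition refl_op :: "nat => nat => ((nat => nat) => int poly) => (nat => nat) => int poly" where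
 "refl_op r i phi = (\<lambda>w. if w \<in> WB r then
   (if w i < w (i + 1) then par r i * phi (w o srefl r i)
   else phi (w o srefl r i) + (par r i - 1) * phi w) else 0)"

definition coeffs :: "nat => ((nat => nat) => int poly) set" where
 "coeffs r = {phi. \<forall>w. w \<notin> WB r \<longrightarrow> phi w = 0}"

definition word_op :: "nat => nat list => ((nat => nat) => int poly) => (nat => nat) => int poly" where
 "word_op r is = fold (refl_op r) is"

lemma word_op_simps [simp]:
 "word_op r [] phi = phi" "word_op r (i # is) phi = word_op r is (refl_op r i phi)"
 "word_op r (is @ js) phi = word_op r js (word_op r is phi)"
 by (simp_all add: word_op_def)

definition basis_fun :: "(nat => nat) => (nat => nat) => int poly" where
 "basis_fun w v = (if v = w then 1 else 0)"

lemma basis_fun_space: "w \<in> WB r ==> basis_fun w \<in> coeffs r"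
 by (auto simp: coeffs_def basis_fun_def)

lemma refl_op_apply:
 assumes "w \<in> WB r"
 shows "refl_op r i phi w = (if w i < w (i + 1) then par r i * phi (w o srefl r i)
   else phi (w o srefl r i) + (par r i - 1) * phi w)"
 unfolding refl_op_def if_P[OF assms] ..

lemma refl_op_space: "refl_op r i phi \<in> coeffs r"
 by (simp add: coeffs_def refl_op_def)

lemma word_op_space: "phi \<in> coeffs r ==> word_op r is phi \<in> coeffs r"
 by (induction "is" arbitrary: phi) (simp_all add: refl_op_space)

lemma coeffs_eqI:
 assumes "phi \<in> coeffs r" "psi \<in> coeffs r" "\<And>w. w \<in> WB r ==> phi w = psi w"
 shows "phi = psi"
proof
 fix w
 show "phi w = psi w" using assms by (cases "w \<in> WB r") (auto simp: coeffs_def)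
qed

lemma coeffs_add: "phi \<in> coeffs r ==> psi \<in> coeffs r ==> phi + psi \<in> coeffs r"
 by (simp add: coeffs_def fun_apply)

lemma coeffs_scale: "phi \<in> coeffs r ==> (\<lambda>w. c * phi w) \<in> coeffs r"
 by (simp add: coeffs_def)

lemma coeffs_zero: "0 \<in> coeffs r"
 by (simp add: coeffs_def fun_apply)

lemma refl_op_add: "refl_op r i (phi + psi) = refl_op r i phi + refl_op r i psi"
 by (simp add: refl_op_def fun_eq_iff fun_apply algebra_simps)

lemma refl_op_scale: "refl_op r i (\<lambda>w. c * phi w) = (\<lambda>w. c * refl_op r i phi w)"
 by (simp add: refl_op_def fun_eq_iff fun_apply algebra_simps)

lemma refl_op_zero: "refl_op r i 0 = 0"
 by (simp add: refl_op_def fun_eq_iff fun_apply)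

lemma word_op_add: "word_op r is (phi + psi) = word_op r is phi + word_op r is psi"
 by (induction "is" arbitrary: phi psi) (simp_all add: refl_op_add)

lemma word_op_scale: "word_op r is (\<lambda>w. c * phi w) = (\<lambda>w. c * word_op r is phi w)"
 by (induction "is" arbitrary: phi) (simp_all add: refl_op_scale)

lemma word_op_zero: "word_op r is 0 = 0"
 by (induction "is") (simp_all add: refl_op_zero)

lemma refl_op_quadratic:
 assumes phi: "phi \<in> coeffs r" and i: "i \<in> {1..r}"
 shows "refl_op r i (refl_op r i phi) = (\<lambda>w. (par r i - 1) * refl_op r i phi w + par r i * phi w)"
proof (rule coeffs_eqI)
 show "refl_op r i (refl_op r i phi) \<in> coeffs r" by (rule refl_op_space)
 show "(\<lambda>w. (par r i - 1) * refl_op r i phi w + par r i * phi w) \<in> coeffs r"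
  using phi refl_op_space[of r i phi] by (simp add: coeffs_def)
 fix w assume w: "w \<in> WB r"
 have ws: "w o srefl r i \<in> WB r" by (rule WB_refl[OF w i])
 show "refl_op r i (refl_op r i phi) w = (par r i - 1) * refl_op r i phi w + par r i * phi w"
  unfolding refl_op_apply[OF w] refl_op_apply[OF ws] comp_refl_refl[OF i] comp_refl_values[OF i]
  using descent_or_ascent[OF w i] by (auto simp: algebra_simps)
qed

lemma refl_op_commute:
 assumes i: "i \<in> {1..r}" and j: "j \<in> {1..r}" and ij: "i + 2 \<le> j"
 shows "refl_op r i (refl_op r j phi) = refl_op r j (refl_op r i phi)"
proof (rule coeffs_eqI[OF refl_op_space refl_op_space])
 fix w assume w: "w \<in> WB r"
 note ws = WB_refl[OF w i] WB_refl[OF w j]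
 have c: "w o srefl r i o srefl r j = w o srefl r j o srefl r i"
  using refl_commute[OF i j ij] by (simp add: comp_assoc)
 have v: "(w o srefl r i) j = w j" "(w o srefl r i) (j + 1) = w (j + 1)"
  "(w o srefl r j) i = w i" "(w o srefl r j) (i + 1) = w (i + 1)"
 proof -
  have ir: "i + 1 < r" using ij j by simp
  show "(w o srefl r i) j = w j" "(w o srefl r i) (j + 1) = w (j + 1)"
   using refl_fix_mid[OF i ir, of j] refl_fix_mid[OF i ir, of "j + 1"] ij j by auto
  show "(w o srefl r j) i = w i" "(w o srefl r j) (i + 1) = w (i + 1)"
   using refl_fix_low[OF j, of i] refl_fix_low[OF j, of "i + 1"] ij j by auto
 qed
 show "refl_op r i (refl_op r j phi) w = refl_op r j (refl_op r i phi) w"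
  unfolding refl_op_apply[OF w] refl_op_apply[OF ws(1)] refl_op_apply[OF ws(2)] v c
  by (auto simp: algebra_simps)
qed

text \<open>
 The operators only compare the values at \<open>j\<close>, \<open>j + 1\<close> and \<open>j + 2\<close>, so the relation can be
 verified for each relative order of these three.
\<close>

lemma refl_op_braid:
 assumes j: "1 \<le> j" "j + 1 < r"
 shows "refl_op r j (refl_op r (j + 1) (refl_op r j phi)) = refl_op r (j + 1) (refl_op r j (refl_op r (j + 1) phi))"
proof (rule coeffs_eqI[OF refl_op_space refl_op_space])
 fix w assume w: "w \<in> WB r"
 define s t where "s = srefl r j" and "t = srefl r (j + 1)"
 have jr: "j \<in> {1..r}" "j + 1 \<in> {1..r}" using j by auto
 have W: "x o s \<in> WB r" "x o t \<in> WB r" if "x \<in> WB r" for x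
  using WB_refl[OF that] jr by (simp_all add: s_def t_def)
 have c: "x o s o s = x" "x o t o t = x" for x :: "nat => nat"
  unfolding s_def t_def by (rule comp_refl_refl[OF jr(1)], rule comp_refl_refl[OF jr(2)])
 have br: "x o t o s o t = x o s o t o s" for x :: "nat => nat"
  using refl_braid[OF j] by (simp add: s_def t_def comp_assoc)
 have v: "s j = Suc j" "s (Suc j) = j" "s (Suc (Suc j)) = Suc (Suc j)" "t j = j" "t (Suc j) = Suc (Suc j)" "t (Suc (Suc j)) = Suc j"
  using refl_values[OF jr(1)] refl_values[OF jr(2)] refl_fix_low[OF jr(1), of "j + 2"] refl_fix_low[OF jr(2), of j] j
  by (auto simp: s_def t_def)
 have S: "refl_op r j psi x = (if x j < x (Suc j) then qvar * psi (x o s) else psi (x o s) + (qvar - 1) * psi x)"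
  if "x \<in> WB r" for x psi using refl_op_apply[OF that, of j psi] j by (simp add: par_def s_def)
 have T: "refl_op r (Suc j) psi x = (if x (Suc j) < x (Suc (Suc j)) then qvar * psi (x o t) else psi (x o t) + (qvar - 1) * psi x)"
  if "x \<in> WB r" for x psi using refl_op_apply[OF that, of "j + 1" psi] j by (simp add: par_def t_def)
 note W' = w W[OF w] W[OF W(1)[OF w]] W[OF W(2)[OF w]]
 have ne: "w j \<noteq> w (Suc j)" "w j \<noteq> w (Suc (Suc j))" "w (Suc j) \<noteq> w (Suc (Suc j))"
  by (simp_all add: WB_inj[OF w])
 have "(w j < w (Suc j) \<or> w (Suc j) < w j) \<and> (w j < w (Suc (Suc j)) \<or> w (Suc (Suc j)) < w j)
   \<and> (w (Suc j) < w (Suc (Suc j)) \<or> w (Suc (Suc j)) < w (Suc j))" using ne by linarith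
 thus "refl_op r j (refl_op r (j + 1) (refl_op r j phi)) w = refl_op r (j + 1) (refl_op r j (refl_op r (j + 1) phi)) w"
  by (elim conjE disjE) (simp_all add: S[OF W'(1)] S[OF W'(2)] S[OF W'(3)] S[OF W'(5)] S[OF W'(6)]
    T[OF W'(1)] T[OF W'(2)] T[OF W'(3)] T[OF W'(5)] T[OF W'(6)] v c br algebra_simps)
qed

text \<open>
 As \<open>T\<^sub>r\<close> has parameter \<open>1\<close>, only \<open>T\<close> at \<open>r - 1\<close> compares values, and the mirror symmetry leaves two
 independent comparisons among the four middle values.
\<close>

lemma refl_op_braid_B:
 assumes r: "2 \<le> r"
 shows "refl_op r r (refl_op r (r - 1) (refl_op r r (refl_op r (r - 1) phi)))
  = refl_op r (r - 1) (refl_op r r (refl_op r (r - 1) (refl_op r r phi)))"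
proof (rule coeffs_eqI[OF refl_op_space refl_op_space])
 fix w assume w: "w \<in> WB r"
 obtain j where j: "r = Suc j" "1 \<le> j" using r by (cases r) auto
 define s t where "s = srefl r j" and "t = srefl r r"
 have jr: "j \<in> {1..r}" "r \<in> {1..r}" using j by auto
 have W: "x o s \<in> WB r" "x o t \<in> WB r" if "x \<in> WB r" for x
  using WB_refl[OF that] jr by (simp_all add: s_def t_def)
 have c: "x o s o s = x" "x o t o t = x" for x :: "nat => nat"
  unfolding s_def t_def by (rule comp_refl_refl[OF jr(1)], rule comp_refl_refl[OF jr(2)])
 have br: "x o t o s o t o s = x o s o t o s o t" for x :: "nat => nat"
  using refl_braid_B[OF r] j by (simp add: s_def t_def comp_assoc)
 let ?a = j and ?b = "Suc j" and ?c = "Suc (Suc j)" and ?d = "Suc (Suc (Suc j))"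
 have v: "s ?a = ?b" "s ?b = ?a" "s ?c = ?d" "s ?d = ?c" "t ?a = ?a" "t ?b = ?c" "t ?c = ?b" "t ?d = ?d"
  using refl_values_middle[OF r] j by (simp_all add: s_def t_def)
 have S: "refl_op r (r - Suc 0) psi x = (if x ?a < x ?b then qvar * psi (x o s) else psi (x o s) + (qvar - 1) * psi x)"
  if "x \<in> WB r" for x psi using refl_op_apply[OF that, of j psi] j by (simp add: par_def s_def)
 have T: "refl_op r r psi x = psi (x o t)"
  if "x \<in> WB r" for x psi using refl_op_apply[OF that, of r psi] j by (simp add: par_def t_def)
 note W1 = W[OF w]
 note W2 = W[OF W1(1)] W[OF W1(2)]
 note W3 = W[OF W2(1)] W[OF W2(2)] W[OF W2(3)] W[OF W2(4)]
 have m: "w ?a + w ?d = 2*r + 1" "w ?b + w ?c = 2*r + 1"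
 proof -
  have e: "2*r + 1 - j = ?d" "2*r + 1 - ?b = ?c" using j by simp_all
  show "w ?a + w ?d = 2*r + 1" "w ?b + w ?c = 2*r + 1"
   using WB_mirror(2)[OF w, of j] WB_mirror(2)[OF w, of "?b"] j unfolding e by simp_all
 qed
 have ne: "w ?a \<noteq> w ?b" "w ?a \<noteq> w ?c" "w ?b \<noteq> w ?c" "w ?a \<noteq> w ?d"
  by (simp_all add: WB_inj[OF w])
 have "(w ?a < w ?b \<and> w ?c < w ?d \<or> w ?b < w ?a \<and> w ?d < w ?c) \<and> (w ?a < w ?c \<and> w ?b < w ?d \<or> w ?c < w ?a \<and> w ?d < w ?b)"
  using ne m by linarith
 thus "refl_op r r (refl_op r (r - 1) (refl_op r r (refl_op r (r - 1) phi))) w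
  = refl_op r (r - 1) (refl_op r r (refl_op r (r - 1) (refl_op r r phi))) w"
  by (elim conjE disjE) (simp_all add: S[OF w] S[OF W1(1)] S[OF W1(2)] S[OF W2(1)] S[OF W2(2)] S[OF W2(3)] S[OF W2(4)]
    S[OF W3(1)] S[OF W3(2)] S[OF W3(3)] S[OF W3(4)] S[OF W3(5)] S[OF W3(6)] S[OF W3(7)] S[OF W3(8)]
    T[OF w] T[OF W1(1)] T[OF W1(2)] T[OF W2(1)] T[OF W2(2)] T[OF W2(3)] T[OF W2(4)]
    T[OF W3(1)] T[OF W3(2)] T[OF W3(3)] T[OF W3(4)] T[OF W3(5)] T[OF W3(6)] T[OF W3(7)] T[OF W3(8)] v c br algebra_simps)
qed

definition free_act :: "nat => (nat list \<Rightarrow>\<^sub>0 int poly) => ((nat => nat) => int poly) => (nat => nat) => int poly" where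
 "free_act r f phi = linext (\<lambda>is a. (\<lambda>w. a * word_op r is phi w)) f"

lemma free_act_zero [simp]: "free_act r 0 phi = 0"
 by (simp add: free_act_def)

lemma free_act_add: "free_act r (f + g) phi = free_act r f phi + free_act r g phi"
 unfolding free_act_def by (rule linext_add) (simp_all add: fun_eq_iff fun_apply algebra_simps)

lemma free_act_single: "free_act r (single is a) phi = (\<lambda>w. a * word_op r is phi w)"
 unfolding free_act_def by (rule linext_single) (simp add: fun_eq_iff fun_apply)

lemma free_act_uminus: "free_act r (- f) phi = - free_act r f phi"
 using free_act_add[of r f "- f" phi] by (metis add.right_inverse add_eq_0_iff free_act_zero)

lemma free_act_diff: "free_act r (f - g) phi = free_act r f phi - free_act r g phi"
 using free_act_add[of r f "- g" phi] by (simp add: free_act_uminus)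

lemma single_add_induct [case_names zero add]:
 assumes "P 0" "\<And>x c f. P f ==> P (single x c + f)"
 shows "P (f :: 'm \<Rightarrow>\<^sub>0 'c::comm_ring_1)"
 by (rule keys_induct[of f UNIV P]) (use assms in auto)

lemma free_act_add_right: "free_act r f (phi + psi) = free_act r f phi + free_act r f psi"
 by (induction f rule: single_add_induct)
  (simp_all only: free_act_zero free_act_add free_act_single word_op_add, simp_all add: fun_eq_iff fun_apply algebra_simps)

lemma free_act_scale_right: "free_act r f (\<lambda>w. c * phi w) = (\<lambda>w. c * free_act r f phi w)"
 by (induction f rule: single_add_induct)
  (simp_all add: free_act_add free_act_single word_op_scale fun_eq_iff fun_apply algebra_simps)

lemma free_act_zero_right: "free_act r f 0 = 0"
 by (induction f rule: single_add_induct)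
  (simp_all only: free_act_zero free_act_add free_act_single word_op_zero, simp_all add: fun_eq_iff fun_apply)

lemma free_act_space: "phi \<in> coeffs r ==> free_act r f phi \<in> coeffs r"
 by (induction f rule: single_add_induct)
  (simp_all add: free_act_add free_act_single coeffs_add coeffs_scale word_op_space coeffs_zero)

lemma free_algebra_mult_act: "free_act r (f \<otimes>\<^bsub>free_algebra r\<^esub> g) phi = free_act r g (free_act r f phi)"
proof -
 have s: "free_act r (single is a \<otimes>\<^bsub>free_algebra r\<^esub> g) phi = free_act r g (\<lambda>w. a * word_op r is phi w)" for "is" a
  by (induction g rule: single_add_induct)
   (simp_all add: free_algebra_def monoid_ring_mult_add_right free_act_add free_act_single free_monoid_def
    word_op_scale word_op_add fun_eq_iff fun_apply algebra_simps)
 show ?thesis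
  by (induction f rule: single_add_induct)
   (simp_all add: s[unfolded free_algebra_def] free_algebra_def monoid_ring_mult_add_left free_act_add free_act_single free_act_add_right free_act_zero_right)
qed

lemma monoid_free_monoid: "monoid (free_monoid r)"
 by (rule monoidI) (auto simp: free_monoid_def)

lemma ring_free_algebra: "ring (free_algebra r)"
 unfolding free_algebra_def by (rule ring_monoid_ring[OF monoid_free_monoid])

lemma free_algebra_carrier: "carrier (free_algebra r) = {f. keys f \<subseteq> lists {1..r}}"
 by (simp add: free_algebra_def free_monoid_def)

lemma free_algebra_simps [simp]:
 "f \<oplus>\<^bsub>free_algebra r\<^esub> g = f + g" "\<zero>\<^bsub>free_algebra r\<^esub> = 0" "\<one>\<^bsub>free_algebra r\<^esub> = single [] 1"
 "single is a \<otimes>\<^bsub>free_algebra r\<^esub> single js b = single (is @ js) (a * b)"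
 by (simp_all add: free_algebra_def) (simp_all add: free_monoid_def)

lemma single_carrier: "is \<in> lists {1..r} ==> single is a \<in> carrier (free_algebra r)"
 by (simp add: free_algebra_carrier)

lemma free_add_carrier: "f \<in> carrier (free_algebra r) ==> g \<in> carrier (free_algebra r) ==> f + g \<in> carrier (free_algebra r)"
 using ring.ring_simprules(1)[OF ring_free_algebra[of r], of f g] by simp

lemma free_diff_carrier:
 assumes "f \<in> carrier (free_algebra r)" "g \<in> carrier (free_algebra r)"
 shows "f - g \<in> carrier (free_algebra r)"
 using assms keys_diff[of f g] unfolding free_algebra_carrier by blast

context
 fixes r :: nat
 assumes r2: "2 \<le> r"
begin

text \<open>The quadratic relations take a common form, with parameter \<open>q\<close> or \<open>1\<close>.\<close>

lemma hecke_relations_cases: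
 assumes "f \<in> hecke_relations r"
 obtains (comm) i j where "i \<in> {1..r}" "j \<in> {1..r}" "i + 2 \<le> j \<or> j + 2 \<le> i" "f = word_mon [i, j] - word_mon [j, i]"
  | (braid) j where "1 \<le> j" "j + 1 < r" "f = word_mon [j, j + 1, j] - word_mon [j + 1, j, j + 1]"
  | (braidB) "f = word_mon [r - 1, r, r - 1, r] - word_mon [r, r - 1, r, r - 1]"
  | (quad) i where "i \<in> {1..r}"
   "f = word_mon [i, i] - (single [i] (par r i - 1) + single [] (par r i))"
proof -
 consider "\<exists>i j. f = word_mon [i, j] - word_mon [j, i] \<and> i \<in> {1..r} \<and> j \<in> {1..r} \<and> (i + 2 \<le> j \<or> j + 2 \<le> i)"
  | "\<exists>j. f = word_mon [j, j + 1, j] - word_mon [j + 1, j, j + 1] \<and> 1 \<le> j \<and> j < r - 1"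
  | "f = word_mon [r - 1, r, r - 1, r] - word_mon [r, r - 1, r, r - 1]"
  | "\<exists>i. f = word_mon [i, i] - (single [i] (qvar - 1) + single [] qvar) \<and> 1 \<le> i \<and> i < r"
  | "f = word_mon [r, r] - word_mon []"
  using assms unfolding hecke_relations_def by blast
 thus ?thesis
 proof cases
  case 1
  thus ?thesis using comm by blast
 next
  case 2
  thus ?thesis using braid by (metis less_diff_conv)
 next
  case 3
  thus ?thesis using braidB by blast
 next
  case 4
  then obtain i where i: "f = word_mon [i, i] - (single [i] (qvar - 1) + single [] qvar)" "1 \<le> i" "i < r"
   by blast
  thus ?thesis using quad[of i] by (simp add: par_def)
 next
  case 5
  thus ?thesis using quad[of r] r2 by (simp add: par_def)
 qed
qed

lemma hecke_relations_carrier: "hecke_relations r \<subseteq> carrier (free_algebra r)"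
proof
 fix f assume "f \<in> hecke_relations r"
 thus "f \<in> carrier (free_algebra r)"
 proof (cases rule: hecke_relations_cases)
  case (comm i j)
  thus ?thesis by (auto intro!: free_diff_carrier single_carrier)
 next
  case (braid j)
  thus ?thesis by (auto intro!: free_diff_carrier single_carrier)
 next
  case braidB
  thus ?thesis using r2 by (auto intro!: free_diff_carrier single_carrier)
 next
  case (quad i)
  thus ?thesis by (auto intro!: free_diff_carrier free_add_carrier single_carrier)
 qed
qed

lemma hecke_relations_act:
 assumes "f \<in> hecke_relations r" "phi \<in> coeffs r"
 shows "free_act r f phi = 0"
 using assms(1)
proof (cases rule: hecke_relations_cases)
 case (comm i j)
 thus ?thesis
  using refl_op_commute[of i r j phi] refl_op_commute[of j r i phi] by (auto simp: free_act_diff free_act_single)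
next
 case (braid j)
 thus ?thesis using refl_op_braid[of j r phi] by (simp add: free_act_diff free_act_single)
next
 case braidB
 thus ?thesis using refl_op_braid_B[OF r2, of phi] by (simp add: free_act_diff free_act_single)
next
 case (quad i)
 thus ?thesis using refl_op_quadratic[OF assms(2), of i]
  by (simp add: free_act_diff free_act_add free_act_single fun_eq_iff fun_apply)
qed

lemma hecke_ideal_ideal: "ideal (hecke_ideal r) (free_algebra r)"
 unfolding hecke_ideal_def by (rule ring.genideal_ideal[OF ring_free_algebra hecke_relations_carrier])

lemma hecke_relations_ideal: "hecke_relations r \<subseteq> hecke_ideal r"
 unfolding hecke_ideal_def by (rule ring.genideal_self[OF ring_free_algebra hecke_relations_carrier])

text \<open>The elements acting by zero form an ideal, which contains the relations.\<close>

lemma hecke_ideal_act: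
 assumes "f \<in> hecke_ideal r" "phi \<in> coeffs r"
 shows "free_act r f phi = 0"
proof -
 let ?I = "{f \<in> carrier (free_algebra r). \<forall>phi\<in>coeffs r. free_act r f phi = 0}"
 interpret ring "free_algebra r" by (rule ring_free_algebra)
 have "ideal ?I (free_algebra r)"
 proof (rule idealI[OF ring_free_algebra])
  show "subgroup ?I (add_monoid (free_algebra r))"
  proof (rule add.subgroupI)
   show "?I \<subseteq> carrier (free_algebra r)" by blast
   show "?I \<noteq> {}" using zero_closed by auto
   fix f assume f: "f \<in> ?I"
   have "\<ominus>\<^bsub>free_algebra r\<^esub> f = - f"
    using monoid_ring_uminus[OF monoid_free_monoid, of f r] f unfolding free_algebra_def[symmetric]
    by (simp add: free_algebra_carrier free_monoid_def)
   moreover have "- f \<in> carrier (free_algebra r)" using free_diff_carrier[OF zero_closed, of f] f by simp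
   ultimately show "\<ominus>\<^bsub>free_algebra r\<^esub> f \<in> ?I" using f by (simp add: free_act_uminus)
   fix g assume g: "g \<in> ?I"
   show "f \<oplus>\<^bsub>free_algebra r\<^esub> g \<in> ?I" using f g free_add_carrier[of f r g] by (simp add: free_act_add)
  qed
  fix a x assume a: "a \<in> ?I" and x: "x \<in> carrier (free_algebra r)"
  show "x \<otimes>\<^bsub>free_algebra r\<^esub> a \<in> ?I"
   using a x by (simp add: free_algebra_mult_act free_act_space m_closed)
  show "a \<otimes>\<^bsub>free_algebra r\<^esub> x \<in> ?I"
   using a x by (simp add: free_algebra_mult_act free_act_zero_right m_closed)
 qed
 moreover have "hecke_relations r \<subseteq> ?I" using hecke_relations_carrier hecke_relations_act by blast
 ultimately have "hecke_ideal r \<subseteq> ?I" unfolding hecke_ideal_def by (rule genideal_minimal)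
 thus ?thesis using assms by blast
qed

section \<open>Matsumoto's theorem and the standard basis\<close>

definition heq :: "(nat list \<Rightarrow>\<^sub>0 int poly) => (nat list \<Rightarrow>\<^sub>0 int poly) => bool" where
 "heq f g \<longleftrightarrow> f - g \<in> hecke_ideal r"

lemmas hecke_ideal_closed = ideal_uminus_diff[OF monoid_free_monoid hecke_ideal_ideal[unfolded free_algebra_def]]

lemma hecke_ideal_zero: "0 \<in> hecke_ideal r"
 using additive_subgroup.zero_closed[OF ideal.axioms(1)[OF hecke_ideal_ideal]] by simp

lemma heq_refl: "heq f f" by (simp add: heq_def hecke_ideal_zero)

lemma heq_sym: "heq f g ==> heq g f"
 unfolding heq_def using hecke_ideal_closed(1)[of "f - g"] by simp

lemma heq_trans: "heq f g ==> heq g h ==> heq f h"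
 unfolding heq_def using hecke_ideal_closed(3)[of "f - g" "g - h"] by simp

lemma heq_add: "heq f g ==> heq f' g' ==> heq (f + f') (g + g')"
 unfolding heq_def using hecke_ideal_closed(3)[of "f - g" "f' - g'"] by (simp add: algebra_simps)

lemma heq_mult_right:
 assumes "heq f g" "f \<in> carrier (free_algebra r)" "g \<in> carrier (free_algebra r)" "h \<in> carrier (free_algebra r)"
 shows "heq (f \<otimes>\<^bsub>free_algebra r\<^esub> h) (g \<otimes>\<^bsub>free_algebra r\<^esub> h)"
proof -
 have "f \<otimes>\<^bsub>free_algebra r\<^esub> h = (f - g) \<otimes>\<^bsub>free_algebra r\<^esub> h + g \<otimes>\<^bsub>free_algebra r\<^esub> h"
  unfolding free_algebra_def monoid_ring_mult_add_left[symmetric] by simp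
 thus ?thesis using ideal.I_r_closed[OF hecke_ideal_ideal, of "f - g" h] assms by (simp add: heq_def)
qed

lemma heq_mult_left:
 assumes "heq f g" "f \<in> carrier (free_algebra r)" "g \<in> carrier (free_algebra r)" "h \<in> carrier (free_algebra r)"
 shows "heq (h \<otimes>\<^bsub>free_algebra r\<^esub> f) (h \<otimes>\<^bsub>free_algebra r\<^esub> g)"
proof -
 have "h \<otimes>\<^bsub>free_algebra r\<^esub> f = h \<otimes>\<^bsub>free_algebra r\<^esub> (f - g) + h \<otimes>\<^bsub>free_algebra r\<^esub> g"
  unfolding free_algebra_def monoid_ring_mult_add_right[symmetric] by simp
 thus ?thesis using ideal.I_l_closed[OF hecke_ideal_ideal, of "f - g" h] assms by (simp add: heq_def)
qed

lemma heq_relation: "f - g \<in> hecke_relations r ==> heq f g"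
 unfolding heq_def using hecke_relations_ideal by blast

lemma heq_word_left:
 assumes "heq (word_mon is) (word_mon js)" "is \<in> lists {1..r}" "js \<in> lists {1..r}" "ks \<in> lists {1..r}"
 shows "heq (word_mon (ks @ is)) (word_mon (ks @ js))"
 using heq_mult_left[OF assms(1) single_carrier[OF assms(2)] single_carrier[OF assms(3)] single_carrier[OF assms(4), of 1]]
 by simp

lemma heq_word_right:
 assumes "heq (word_mon is) (word_mon js)" "is \<in> lists {1..r}" "js \<in> lists {1..r}" "ks \<in> lists {1..r}"
 shows "heq (word_mon (is @ ks)) (word_mon (js @ ks))"
 using heq_mult_right[OF assms(1) single_carrier[OF assms(2)] single_carrier[OF assms(3)] single_carrier[OF assms(4), of 1]]
 by simp

lemma relation_comm: "i \<in> {1..r} ==> j \<in> {1..r} ==> i + 2 \<le> j \<or> j + 2 \<le> i ==> heq (word_mon [i, j]) (word_mon [j, i])"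
 by (rule heq_relation) (unfold hecke_relations_def, blast)

lemma relation_braid: "1 \<le> j ==> j + 1 < r ==> heq (word_mon [j, j + 1, j]) (word_mon [j + 1, j, j + 1])"
 by (rule heq_relation) (unfold hecke_relations_def less_diff_conv[symmetric], blast)

lemma relation_braid_B: "heq (word_mon [r - 1, r, r - 1, r]) (word_mon [r, r - 1, r, r - 1])"
 by (rule heq_relation) (unfold hecke_relations_def, blast)

lemma relation_quad:
 assumes "i \<in> {1..r}"
 shows "heq (word_mon [i, i]) (single [i] (par r i - 1) + single [] (par r i))"
proof (rule heq_relation, cases "i < r")
 case True
 thus "word_mon [i, i] - (single [i] (par r i - 1) + single [] (par r i)) \<in> hecke_relations r"
  unfolding par_def if_P[OF True] hecke_relations_def using assms by auto
next
 case False
 thus "word_mon [i, i] - (single [i] (par r i - 1) + single [] (par r i)) \<in> hecke_relations r"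
  unfolding par_def if_not_P[OF False] hecke_relations_def using assms by auto
qed

lemma reduced_word_WB: "reduced_word r w is ==> w \<in> WB r \<and> is \<in> lists {1..r}"
 using word_prod_WB by (auto simp: reduced_word_def)

text \<open>
 The longest element of the dihedral subgroup generated by \<open>s\<^sub>i\<close> and \<open>s\<^sub>j\<close> splits off on the right of \<open>w\<close>
 with lengths adding up.  Its two reduced words, equal by a braid relation, end in \<open>i\<close> and in \<open>j\<close>.
\<close>

lemma two_descents:
 assumes w: "w \<in> WB r" and i: "i \<in> {1..r}" and j: "j \<in> {1..r}" and ij: "i < j"
  and di: "w (i + 1) < w i" and dj: "w (j + 1) < w j"
 shows "\<exists>u p p'. reduced_word r w (u @ p @ [i]) \<and> reduced_word r w (u @ p' @ [j])
  \<and> heq (word_mon (u @ p @ [i])) (word_mon (u @ p' @ [j]))"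
proof -
 consider (far) "i + 2 \<le> j" | (adj) "j = i + 1" "i + 1 < r" | (mid) "i = r - 1" "j = r"
  using ij j by fastforce
 thus ?thesis
 proof cases
  case far
  let ?x = "w o srefl r j o srefl r i"
  have ir: "i + 1 < r" using far j by simp
  have v: "srefl r j i = i" "srefl r j (i + 1) = i + 1" "srefl r i j = j" "srefl r i (j + 1) = j + 1"
   using refl_fix_low[OF j, of i] refl_fix_low[OF j, of "i + 1"] refl_fix_mid[OF i ir, of j] refl_fix_mid[OF i ir, of "j + 1"] far j
   by auto
  note vv = v refl_values[OF i] refl_values[OF j]
  have xW: "?x \<in> WB r" by (intro WB_refl w i j)
  obtain u where u: "reduced_word r ?x u" using reduced_word_exists[OF xW] by blast
  have eq: "?x o srefl r j o srefl r i = w"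
  proof -
   have "?x = w o srefl r i o srefl r j" using refl_commute[OF i j far] by (simp add: comp_assoc)
   thus ?thesis using comp_refl_refl[OF j] comp_refl_refl[OF i] by metis
  qed
  have eq': "?x o srefl r i o srefl r j = w" by (simp only: comp_refl_refl[OF i] comp_refl_refl[OF j])
  have 1: "reduced_word r (?x o srefl r j) (u @ [j])"
   by (rule reduced_word_snoc[OF u j]) (simp only: comp_apply vv dj)
  have 2: "reduced_word r (?x o srefl r j o srefl r i) (u @ [j] @ [i])"
   using reduced_word_snoc[OF 1 i] by (simp only: comp_apply vv di append_assoc)
  have 3: "reduced_word r (?x o srefl r i) (u @ [i])"
   by (rule reduced_word_snoc[OF u i]) (simp only: comp_apply vv di)
  have 4: "reduced_word r (?x o srefl r i o srefl r j) (u @ [i] @ [j])"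
   using reduced_word_snoc[OF 3 j] by (simp only: comp_apply vv dj append_assoc)
  have "heq (word_mon (u @ [j, i])) (word_mon (u @ [i, j]))"
   by (rule heq_word_left[OF relation_comm[OF j i]]) (use far i j reduced_word_WB[OF u] in auto)
  thus ?thesis using 2 4 unfolding eq eq' by (intro exI[of _ u] exI[of _ "[j]"] exI[of _ "[i]"]) simp
 next
  case adj
  let ?s = "srefl r i" and ?t = "srefl r (i + 1)"
  have i1: "1 \<le> i" using i by simp
  have j': "i + 1 \<in> {1..r}" using j adj by simp
  have vv: "?t i = i" "?s (i + 2) = i + 2" "?s i = i + 1" "?s (i + 1) = i" "?t (i + 1) = i + 2" "?t (i + 2) = i + 1"
   using refl_fix_low[OF j', of i] refl_fix_low[OF i, of "i + 2"] adj refl_values[OF i] refl_values[OF j'] by auto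
  have plus: "i + 1 + 1 = i + 2" by simp
  let ?x = "w o ?s o ?t o ?s"
  have xW: "?x \<in> WB r" by (intro WB_refl w i j')
  have x': "?x = w o ?t o ?s o ?t" using refl_braid[OF i1 adj(2)] by (simp add: comp_assoc)
  obtain u where u: "reduced_word r ?x u" using reduced_word_exists[OF xW] by blast
  have d: "w (i + 1) < w i" "w (i + 2) < w (i + 1)" "w (i + 2) < w i" using di dj adj by auto
  have 1: "reduced_word r (?x o ?s) (u @ [i])"
   by (rule reduced_word_snoc[OF u i]) (simp only: comp_apply vv plus d)
  have 2: "reduced_word r (?x o ?s o ?t) (u @ [i, i + 1])"
   using reduced_word_snoc[OF 1 j'] by (simp only: comp_apply vv plus d append_assoc append.simps)
  have 3: "reduced_word r (?x o ?s o ?t o ?s) (u @ [i, i + 1, i])"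
   using reduced_word_snoc[OF 2 i] by (simp only: comp_apply vv plus d append_assoc append.simps)
  have 4: "reduced_word r (?x o ?t) (u @ [i + 1])"
   by (rule reduced_word_snoc[OF u j']) (simp only: comp_apply vv plus d)
  have 5: "reduced_word r (?x o ?t o ?s) (u @ [i + 1, i])"
   using reduced_word_snoc[OF 4 i] by (simp only: comp_apply vv plus d append_assoc append.simps)
  have 6: "reduced_word r (?x o ?t o ?s o ?t) (u @ [i + 1, i, i + 1])"
   using reduced_word_snoc[OF 5 j'] by (simp only: comp_apply vv plus d append_assoc append.simps)
  have e1: "?x o ?s o ?t o ?s = w" by (simp only: comp_refl_refl[OF i] comp_refl_refl[OF j'])
  have e2: "?x o ?t o ?s o ?t = w" unfolding x' by (simp only: comp_refl_refl[OF i] comp_refl_refl[OF j'])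
  have "heq (word_mon (u @ [i, i + 1, i])) (word_mon (u @ [i + 1, i, i + 1]))"
   by (rule heq_word_left[OF relation_braid[OF i1 adj(2)]]) (use i j' reduced_word_WB[OF u] in auto)
  thus ?thesis using 3 6 unfolding e1 e2 adj(1)
   by (intro exI[of _ u] exI[of _ "[i, i + 1]"] exI[of _ "[i + 1, i]"]) simp
 next
  case mid
  let ?s = "srefl r (r - 1)" and ?t = "srefl r r"
  have i': "r - 1 \<in> {1..r}" and j': "r \<in> {1..r}" using r2 by auto
  note vv = refl_values_middle[OF r2]
  have plus: "r - 1 + 1 = r" using r2 by simp
  let ?x = "w o ?s o ?t o ?s o ?t"
  have xW: "?x \<in> WB r" by (intro WB_refl w i' j')
  have x': "?x = w o ?t o ?s o ?t o ?s" using refl_braid_B[OF r2] by (simp add: comp_assoc)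
  obtain u where u: "reduced_word r ?x u" using reduced_word_exists[OF xW] by blast
  have d: "w r < w (r - 1)" "w (r + 1) < w r" using di dj mid plus by auto
  have m: "w (r - 1) + w (r + 2) = 2*r + 1" "w r + w (r + 1) = 2*r + 1"
  proof -
   have e: "2*r + 1 - (r - 1) = r + 2" "2*r + 1 - r = r + 1" using r2 by auto
   show "w (r - 1) + w (r + 2) = 2*r + 1" "w r + w (r + 1) = 2*r + 1"
    using WB_mirror(2)[OF w, of "r - 1"] WB_mirror(2)[OF w, of r] r2 unfolding e by auto
  qed
  have d': "w (r + 2) < w (r + 1)" "w (r + 1) < w (r - 1)" "w (r + 2) < w r" "w (r + 2) < w (r - 1)" using d m by linarith+
  have 1: "reduced_word r (?x o ?t) (u @ [r])"
   by (rule reduced_word_snoc[OF u j']) (simp only: comp_apply vv plus d d')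
  have 2: "reduced_word r (?x o ?t o ?s) (u @ [r, r - 1])"
   using reduced_word_snoc[OF 1 i'] by (simp only: comp_apply vv plus d d' append_assoc append.simps)
  have 3: "reduced_word r (?x o ?t o ?s o ?t) (u @ [r, r - 1, r])"
   using reduced_word_snoc[OF 2 j'] by (simp only: comp_apply vv plus d d' append_assoc append.simps)
  have 4: "reduced_word r (?x o ?t o ?s o ?t o ?s) (u @ [r, r - 1, r, r - 1])"
   using reduced_word_snoc[OF 3 i'] by (simp only: comp_apply vv plus d d' append_assoc append.simps)
  have 5: "reduced_word r (?x o ?s) (u @ [r - 1])"
   by (rule reduced_word_snoc[OF u i']) (simp only: comp_apply vv plus d d')
  have 6: "reduced_word r (?x o ?s o ?t) (u @ [r - 1, r])"
   using reduced_word_snoc[OF 5 j'] by (simp only: comp_apply vv plus d d' append_assoc append.simps)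
  have 7: "reduced_word r (?x o ?s o ?t o ?s) (u @ [r - 1, r, r - 1])"
   using reduced_word_snoc[OF 6 i'] by (simp only: comp_apply vv plus d d' append_assoc append.simps)
  have 8: "reduced_word r (?x o ?s o ?t o ?s o ?t) (u @ [r - 1, r, r - 1, r])"
   using reduced_word_snoc[OF 7 j'] by (simp only: comp_apply vv plus d d' append_assoc append.simps)
  have e1: "?x o ?t o ?s o ?t o ?s = w" by (simp only: comp_refl_refl[OF i'] comp_refl_refl[OF j'])
  have e2: "?x o ?s o ?t o ?s o ?t = w" unfolding x' by (simp only: comp_refl_refl[OF i'] comp_refl_refl[OF j'])
  have "heq (word_mon (u @ [r, r - 1, r, r - 1])) (word_mon (u @ [r - 1, r, r - 1, r]))"
   by (rule heq_word_left[OF heq_sym[OF relation_braid_B]]) (use i' j' reduced_word_WB[OF u] in auto)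
  thus ?thesis using 4 8 unfolding e1 e2 mid
   by (intro exI[of _ u] exI[of _ "[r, r - 1, r]"] exI[of _ "[r - 1, r, r - 1]"]) simp
 qed
qed

text \<open>
 Reduced words with the same last letter are compared by induction on the length; if the last
 letters differ, the two words of \<open>two_descents\<close> are interposed.
\<close>

lemma matsumoto:
 assumes "reduced_word r w is" "reduced_word r w js"
 shows "heq (word_mon is) (word_mon js)"
 using assms
proof (induction "weyl_length r w" arbitrary: w "is" js rule: less_induct)
 case less
 note w = reduced_word_WB[OF less.prems(1)]
 show ?case
 proof (cases "is" rule: rev_cases)
  case Nil
  moreover have "length js = length is" using less.prems unfolding reduced_word_def by linarith
  ultimately have "length js = 0" by simp
  thus ?thesis using Nil heq_refl by simp
 next
  case (snoc is' i)
  hence "js \<noteq> []" using less.prems by (auto simp: reduced_word_def)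
  then obtain js' j where js: "js = js' @ [j]" using rev_exhaust by blast
  note I = reduced_word_snocD[OF less.prems(1)[unfolded snoc]]
  note J = reduced_word_snocD[OF less.prems(2)[unfolded js]]
  have step: "heq (word_mon (a @ [k])) (word_mon (b @ [k]))"
   if "reduced_word r w (a @ [k])" "reduced_word r w (b @ [k])" for a b k
  proof -
   note A = reduced_word_snocD[OF that(1)] and B = reduced_word_snocD[OF that(2)]
   have "weyl_length r (w o srefl r k) < weyl_length r w"
    using weyl_length_descent[OF conjunct1[OF w] A(1,2)] by simp
   from less.hyps[OF this A(3) B(3)]
   show ?thesis by (rule heq_word_right) (use reduced_word_WB[OF A(3)] reduced_word_WB[OF B(3)] A(1) in auto)
  qed
  have diff: "heq (word_mon (a @ [k])) (word_mon (b @ [l]))"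
   if a: "reduced_word r w (a @ [k])" and b: "reduced_word r w (b @ [l])" and kl: "k < l" for a b k l
  proof -
   note A = reduced_word_snocD[OF a] and B = reduced_word_snocD[OF b]
   obtain u p p' where u: "reduced_word r w (u @ p @ [k])" "reduced_word r w (u @ p' @ [l])"
    "heq (word_mon (u @ p @ [k])) (word_mon (u @ p' @ [l]))"
    using two_descents[OF conjunct1[OF w] A(1) B(1) kl A(2) B(2)] by blast
   have "heq (word_mon (a @ [k])) (word_mon ((u @ p) @ [k]))" by (rule step) (use a u in auto)
   moreover have "heq (word_mon ((u @ p') @ [l])) (word_mon (b @ [l]))" by (rule step) (use b u in auto)
   ultimately show ?thesis using u(3) heq_trans unfolding append_assoc by blast
  qed
  note red = less.prems(1)[unfolded snoc] less.prems(2)[unfolded js]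
  consider "i = j" | "i < j" | "j < i" by linarith
  thus ?thesis unfolding snoc js
  proof cases
   case 1
   show "heq (word_mon (is' @ [i])) (word_mon (js' @ [j]))" using step[OF red(1)] red(2) 1 by blast
  next
   case 2
   show "heq (word_mon (is' @ [i])) (word_mon (js' @ [j]))" by (rule diff[OF red 2])
  next
   case 3
   show "heq (word_mon (is' @ [i])) (word_mon (js' @ [j]))" by (rule heq_sym[OF diff[OF red(2,1) 3]])
  qed
 qed
qed

definition std_word :: "(nat => nat) => nat list" where
 "std_word w = (SOME is. reduced_word r w is)"

lemma std_word: "w \<in> WB r ==> reduced_word r w (std_word w)"
 unfolding std_word_def by (rule someI_ex[OF reduced_word_exists])

lemma std_word_lists: "w \<in> WB r ==> std_word w \<in> lists {1..r}"
 using reduced_word_WB[OF std_word] by blast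

text \<open>The combination \<open>\<Sum>w. phi w T\<^sub>w\<close> in terms of the chosen reduced words.\<close>

definition std_lift :: "((nat => nat) => int poly) => (nat list \<Rightarrow>\<^sub>0 int poly)" where
 "std_lift phi = (\<Sum>w\<in>WB r. single (std_word w) (phi w))"

lemma std_lift_add: "std_lift (phi + psi) = std_lift phi + std_lift psi"
 by (simp add: std_lift_def single_add sum.distrib fun_apply)

lemma std_lift_zero: "std_lift 0 = 0"
 by (simp add: std_lift_def fun_apply)

lemma free_mult_add_left: "(f + f') \<otimes>\<^bsub>free_algebra r\<^esub> g = f \<otimes>\<^bsub>free_algebra r\<^esub> g + f' \<otimes>\<^bsub>free_algebra r\<^esub> g"
 and free_mult_add_right: "f \<otimes>\<^bsub>free_algebra r\<^esub> (g + g') = f \<otimes>\<^bsub>free_algebra r\<^esub> g + f \<otimes>\<^bsub>free_algebra r\<^esub> g'"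
 and free_mult_zero: "0 \<otimes>\<^bsub>free_algebra r\<^esub> g = 0" "f \<otimes>\<^bsub>free_algebra r\<^esub> 0 = 0"
 by (simp_all add: free_algebra_def monoid_ring_mult_add_left monoid_ring_mult_add_right)

lemma std_lift_basis:
 assumes "w \<in> WB r"
 shows "std_lift (\<lambda>v. c * basis_fun w v) = single (std_word w) c"
proof -
 have "std_lift (\<lambda>v. c * basis_fun w v) = (\<Sum>v\<in>WB r. if v = w then single (std_word w) c else 0)"
  unfolding std_lift_def by (intro sum.cong) (auto simp: basis_fun_def)
 thus ?thesis using assms by simp
qed

lemma std_lift_carrier: "std_lift phi \<in> carrier (free_algebra r)"
proof -
 have "(\<Sum>w\<in>S. single (std_word w) (phi w)) \<in> carrier (free_algebra r)" if "S \<subseteq> WB r" for S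
  using finite_subset[OF that finite_WB] that
 proof (induction S rule: finite_induct)
  case empty
  thus ?case by (simp add: free_algebra_carrier)
 next
  case (insert x F)
  have "single (std_word x) (phi x) \<in> carrier (free_algebra r)"
   by (rule single_carrier[OF std_word_lists]) (use insert.prems in simp)
  thus ?case using insert by (simp add: free_add_carrier)
 qed
 thus ?thesis by (simp add: std_lift_def)
qed

lemma refl_op_basis:
 assumes w: "w \<in> WB r" and i: "i \<in> {1..r}"
 shows "w i < w (i + 1) ==> refl_op r i (basis_fun w) = basis_fun (w o srefl r i)"
  and "w (i + 1) < w i ==> refl_op r i (basis_fun w)
   = (\<lambda>v. par r i * basis_fun (w o srefl r i) v) + (\<lambda>v. (par r i - 1) * basis_fun w v)"
proof -
 have ws: "w o srefl r i \<in> WB r" by (rule WB_refl[OF w i])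
 have key: "v o srefl r i = w \<longleftrightarrow> v = w o srefl r i" for v
  using comp_refl_refl[OF i] by metis
 have ne: "w \<noteq> w o srefl r i"
 proof
  assume "w = w o srefl r i"
  hence "w i = w (i + 1)" using comp_refl_values(1)[OF i, of w] by metis
  thus False using WB_inj[OF w] by simp
 qed
 show "refl_op r i (basis_fun w) = basis_fun (w o srefl r i)" if asc: "w i < w (i + 1)"
 proof (rule coeffs_eqI[OF refl_op_space basis_fun_space[OF ws]])
  fix v assume v: "v \<in> WB r"
  show "refl_op r i (basis_fun w) v = basis_fun (w o srefl r i) v"
   unfolding refl_op_apply[OF v] basis_fun_def key
   using asc ne comp_refl_values[OF i, of w] by auto
 qed
 show "refl_op r i (basis_fun w)
   = (\<lambda>v. par r i * basis_fun (w o srefl r i) v) + (\<lambda>v. (par r i - 1) * basis_fun w v)"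
  if desc: "w (i + 1) < w i"
 proof (rule coeffs_eqI[OF refl_op_space coeffs_add[OF coeffs_scale[OF basis_fun_space[OF ws]] coeffs_scale[OF basis_fun_space[OF w]]]])
  fix v assume v: "v \<in> WB r"
  show "refl_op r i (basis_fun w) v = ((\<lambda>v. par r i * basis_fun (w o srefl r i) v) + (\<lambda>v. (par r i - 1) * basis_fun w v)) v"
   unfolding refl_op_apply[OF v] basis_fun_def key plus_fun_apply
   using desc ne comp_refl_values[OF i, of w] by auto
 qed
qed

lemma word_op_reduced: "reduced_word r w is ==> word_op r is (basis_fun id) = basis_fun w"
proof (induction "is" arbitrary: w rule: rev_induct)
 case Nil
 hence "w = id" by (simp add: reduced_word_def)
 thus ?case by simp
next
 case (snoc i "is")
 note I = reduced_word_snocD[OF snoc.prems]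
 have w: "w o srefl r i \<in> WB r" using reduced_word_WB[OF I(3)] by blast
 have "refl_op r i (basis_fun (w o srefl r i)) = basis_fun (w o srefl r i o srefl r i)"
  by (rule refl_op_basis(1)[OF w I(1)]) (simp only: comp_refl_values[OF I(1)] I(2))
 thus ?case by (simp only: word_op_simps snoc.IH[OF I(3)] comp_refl_refl[OF I(1)])
qed

lemma heq_scale_word:
 assumes "heq (word_mon is) f" "is \<in> lists {1..r}" "f \<in> carrier (free_algebra r)"
 shows "heq (single is c) (single [] c \<otimes>\<^bsub>free_algebra r\<^esub> f)"
 using heq_mult_left[OF assms(1) single_carrier[OF assms(2)] assms(3), of "single [] c"]
  single_carrier[of "[]" r c] by simp

text \<open>
 If the length grows, the word is compared with the chosen one by Matsumoto's theorem; otherwise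
 a reduced word of \<open>w\<close> ending in \<open>i\<close> is used and the quadratic relation applies.
\<close>

lemma std_word_mult:
 assumes w: "w \<in> WB r" and i: "i \<in> {1..r}"
 shows "heq (single (std_word w @ [i]) c) (std_lift (refl_op r i (\<lambda>v. c * basis_fun w v)))"
proof -
 let ?ws = "w o srefl r i"
 have ws: "?ws \<in> WB r" by (rule WB_refl[OF w i])
 have l: "std_word w \<in> lists {1..r}" "std_word ?ws \<in> lists {1..r}" using std_word_lists w ws by blast+
 have i': "[i] \<in> lists {1..r}" using i by simp
 show ?thesis
 proof (cases "w i < w (i + 1)")
  case True
  have "heq (word_mon (std_word w @ [i])) (word_mon (std_word ?ws))"
   by (rule matsumoto[OF reduced_word_snoc[OF std_word[OF w] i True] std_word[OF ws]])
  hence "heq (single (std_word w @ [i]) c) (single (std_word ?ws) c)"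
   using heq_scale_word[of "std_word w @ [i]" "word_mon (std_word ?ws)" c] l i' single_carrier[OF l(2)] by simp
  thus ?thesis unfolding refl_op_scale refl_op_basis(1)[OF w i True] std_lift_basis[OF ws] .
 next
  case False
  hence d: "w (i + 1) < w i" using descent_or_ascent[OF w i] by blast
  have "?ws i < ?ws (i + 1)" using d by (simp only: comp_refl_values[OF i])
  from reduced_word_snoc[OF std_word[OF ws] i this] have red: "reduced_word r w (std_word ?ws @ [i])"
   unfolding comp_refl_refl[OF i] .
  have h1: "heq (word_mon (std_word w)) (word_mon (std_word ?ws @ [i]))" by (rule matsumoto[OF std_word[OF w] red])
  let ?q = "par r i"
  have a: "heq (word_mon (std_word w @ [i])) (word_mon (std_word ?ws @ [i, i]))"
   using heq_word_right[OF h1 l(1) _ i'] l i' by simp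
  have b: "heq (word_mon (std_word ?ws @ [i, i])) (single (std_word ?ws @ [i]) (?q - 1) + single (std_word ?ws) ?q)"
  proof -
   have "heq (word_mon (std_word ?ws) \<otimes>\<^bsub>free_algebra r\<^esub> word_mon [i, i])
    (word_mon (std_word ?ws) \<otimes>\<^bsub>free_algebra r\<^esub> (single [i] (?q - 1) + single [] ?q))"
    by (rule heq_mult_left[OF relation_quad[OF i]]) (use l i' i in \<open>auto intro!: free_add_carrier single_carrier\<close>)
   moreover have "word_mon (std_word ?ws) \<otimes>\<^bsub>free_algebra r\<^esub> (single [i] (?q - 1) + single [] ?q)
    = single (std_word ?ws @ [i]) (?q - 1) + single (std_word ?ws) ?q"
    unfolding free_mult_add_right by simp
   ultimately show ?thesis by simp
  qed
  have c: "heq (single (std_word ?ws @ [i]) (?q - 1)) (single (std_word w) (?q - 1))"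
   using heq_scale_word[OF heq_sym[OF h1], of "?q - 1"] l i' single_carrier[OF l(1)] by simp
  have h2: "heq (word_mon (std_word w @ [i])) (single (std_word w) (?q - 1) + single (std_word ?ws) ?q)"
   by (rule heq_trans[OF a heq_trans[OF b heq_add[OF c heq_refl]]])
  have "heq (single (std_word w @ [i]) c)
   (single [] c \<otimes>\<^bsub>free_algebra r\<^esub> (single (std_word w) (?q - 1) + single (std_word ?ws) ?q))"
   by (rule heq_scale_word[OF h2]) (use l i' in \<open>auto intro!: free_add_carrier single_carrier\<close>)
  moreover have "single [] c \<otimes>\<^bsub>free_algebra r\<^esub> (single (std_word w) (?q - 1) + single (std_word ?ws) ?q)
   = single (std_word w) (c * (?q - 1)) + single (std_word ?ws) (c * ?q)"
   unfolding free_mult_add_right by simp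
  moreover have "std_lift (refl_op r i (\<lambda>v. c * basis_fun w v))
   = single (std_word ?ws) (c * ?q) + single (std_word w) (c * (?q - 1))"
  proof -
   have "refl_op r i (\<lambda>v. c * basis_fun w v) = (\<lambda>v. (c * ?q) * basis_fun ?ws v) + (\<lambda>v. (c * (?q - 1)) * basis_fun w v)"
    unfolding refl_op_scale refl_op_basis(2)[OF w i d] by (simp add: fun_eq_iff fun_apply algebra_simps)
   thus ?thesis by (simp only: std_lift_add std_lift_basis[OF ws] std_lift_basis[OF w])
  qed
  ultimately show ?thesis by (simp add: add.commute)
 qed
qed

lemma coeffs_basis_sum:
 assumes "phi \<in> coeffs r"
 shows "phi = (\<Sum>w\<in>WB r. (\<lambda>v. phi w * basis_fun w v))"
proof
 fix v
 have s: "(\<Sum>w\<in>S. f w) v = (\<Sum>w\<in>S. f w v)" for S and f :: "(nat => nat) => (nat => nat) => int poly"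
  by (induction S rule: infinite_finite_induct) (simp_all add: fun_apply)
 have "(\<Sum>w\<in>WB r. phi w * basis_fun w v) = (\<Sum>w\<in>WB r. if w = v then phi v else 0)"
  by (intro sum.cong) (auto simp: basis_fun_def)
 also have "\<dots> = phi v" using assms by (simp add: coeffs_def)
 finally show "phi v = (\<Sum>w\<in>WB r. (\<lambda>v. phi w * basis_fun w v)) v" by (simp add: s)
qed

lemma std_lift_mult:
 assumes i: "i \<in> {1..r}" and phi: "phi \<in> coeffs r"
 shows "heq (std_lift phi \<otimes>\<^bsub>free_algebra r\<^esub> word_mon [i]) (std_lift (refl_op r i phi))"
proof -
 have "heq ((\<Sum>w\<in>S. single (std_word w) (phi w)) \<otimes>\<^bsub>free_algebra r\<^esub> word_mon [i])
   (std_lift (refl_op r i (\<Sum>w\<in>S. (\<lambda>v. phi w * basis_fun w v))))" if "S \<subseteq> WB r" for S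
  using finite_subset[OF that finite_WB] that
 proof (induction S rule: finite_induct)
  case empty
  show ?case by (simp only: sum.empty free_mult_zero refl_op_zero std_lift_zero heq_refl)
 next
  case (insert x F)
  have "heq (single (std_word x @ [i]) (phi x)) (std_lift (refl_op r i (\<lambda>v. phi x * basis_fun x v)))"
   by (rule std_word_mult[OF _ i]) (use insert.prems in simp)
  from heq_add[OF this insert.IH] insert.prems show ?case
   unfolding sum.insert[OF insert.hyps] refl_op_add std_lift_add free_mult_add_left free_algebra_simps mult_1_right by simp
 qed
 from this[OF subset_refl] show ?thesis
  using coeffs_basis_sum[OF phi] by (simp add: std_lift_def)
qed

lemma heq_std_lift_word:
 "is \<in> lists {1..r} ==> heq (word_mon is) (std_lift (word_op r is (basis_fun id)))"
proof (induction "is" rule: rev_induct)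
 case Nil
 have "std_word id = []" using reduced_word_id[OF std_word[OF id_WB]] .
 hence "std_lift (basis_fun id) = word_mon []" using std_lift_basis[OF id_WB, of 1] by simp
 thus ?case by (simp only: word_op_simps heq_refl)
next
 case (snoc i "is")
 let ?phi = "word_op r is (basis_fun id)"
 have l: "is \<in> lists {1..r}" "i \<in> {1..r}" using snoc.prems by auto
 have "heq (word_mon is \<otimes>\<^bsub>free_algebra r\<^esub> word_mon [i]) (std_lift ?phi \<otimes>\<^bsub>free_algebra r\<^esub> word_mon [i])"
  by (rule heq_mult_right[OF snoc.IH[OF l(1)]]) (use l in \<open>auto intro!: single_carrier std_lift_carrier\<close>)
 moreover have "heq (std_lift ?phi \<otimes>\<^bsub>free_algebra r\<^esub> word_mon [i]) (std_lift (refl_op r i ?phi))"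
  by (rule std_lift_mult[OF l(2)]) (intro word_op_space basis_fun_space id_WB)
 ultimately have "heq (word_mon is \<otimes>\<^bsub>free_algebra r\<^esub> word_mon [i]) (std_lift (refl_op r i ?phi))" by (rule heq_trans)
 thus ?case by (simp only: word_op_simps free_algebra_simps mult_1_right)
qed

lemma std_lift_scale:
 "single [] c \<otimes>\<^bsub>free_algebra r\<^esub> std_lift phi = std_lift (\<lambda>w. c * phi w)"
proof -
 have "single [] c \<otimes>\<^bsub>free_algebra r\<^esub> (\<Sum>w\<in>S. single (std_word w) (phi w))
   = (\<Sum>w\<in>S. single (std_word w) (c * phi w))" for S
  by (induction S rule: infinite_finite_induct)
   (simp_all add: free_algebra_def monoid_ring_mult_add_right free_monoid_def)
 thus ?thesis by (simp add: std_lift_def)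
qed

text \<open>The elements \<open>T\<^sub>w\<close> span, with coefficients read off from the regular representation.\<close>

lemma heq_std_lift:
 assumes "f \<in> carrier (free_algebra r)"
 shows "heq f (std_lift (free_act r f (basis_fun id)))"
proof -
 have "keys f \<subseteq> lists {1..r}" using assms by (simp add: free_algebra_carrier)
 thus ?thesis
 proof (induction f rule: keys_induct)
  case zero
  show ?case by (simp only: free_act_zero std_lift_zero heq_refl)
 next
  case (add "is" c f)
  have "heq (single is c) (single [] c \<otimes>\<^bsub>free_algebra r\<^esub> std_lift (word_op r is (basis_fun id)))"
   by (rule heq_scale_word[OF heq_std_lift_word[OF add(1)] add(1) std_lift_carrier])
  hence "heq (single is c) (std_lift (free_act r (single is c) (basis_fun id)))"
   unfolding std_lift_scale free_act_single .
  from heq_add[OF this add(3)] show ?case by (simp only: free_act_add std_lift_add)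
 qed
qed

end

section \<open>Coefficients of elements of the Hecke algebra\<close>

definition hecke_class :: "nat => (nat list \<Rightarrow>\<^sub>0 int poly) => hecke_elem" where
 "hecke_class r f = hecke_ideal r +>\<^bsub>free_algebra r\<^esub> f"

definition hecke_rep :: "nat => hecke_elem => (nat list \<Rightarrow>\<^sub>0 int poly)" where
 "hecke_rep r h = (SOME f. f \<in> carrier (free_algebra r) \<and> hecke_class r f = h)"

definition hecke_act :: "nat => hecke_elem => ((nat => nat) => int poly) => (nat => nat) => int poly" where
 "hecke_act r h phi = free_act r (hecke_rep r h) phi"

definition hecke_coeff :: "nat => hecke_elem => (nat => nat) => int poly" where
 "hecke_coeff r h = hecke_act r h (basis_fun id)"

definition set_fun :: "(nat => nat) set => (nat => nat) => int poly" where
 "set_fun S w = (if w \<in> S then 1 else 0)"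

lemma set_fun_space: "S \<subseteq> WB r ==> set_fun S \<in> coeffs r"
 by (auto simp: set_fun_def coeffs_def)

definition left_inv :: "nat => nat => (nat => nat) => ((nat => nat) => int poly) set" where
 "left_inv n r mu = {phi \<in> coeffs r. \<forall>l\<in>{1..r}. srefl r l \<in> parabolic n r mu \<longrightarrow>
   (\<forall>w\<in>WB r. phi (srefl r l o w) = phi w)}"

definition right_inv :: "nat => nat => (nat => nat) => ((nat => nat) => int poly) set" where
 "right_inv n r mu = {phi \<in> coeffs r. \<forall>l\<in>{1..r}. srefl r l \<in> parabolic n r mu \<longrightarrow>
   (\<forall>w\<in>WB r. phi (w o srefl r l) = phi w)}"

lemma left_invD: "phi \<in> left_inv n r mu ==> l \<in> {1..r} ==> srefl r l \<in> parabolic n r mu ==> w \<in> WB r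
  ==> phi (srefl r l o w) = phi w"
 and left_inv_space: "phi \<in> left_inv n r mu ==> phi \<in> coeffs r"
 by (auto simp: left_inv_def)

lemma right_invD: "phi \<in> right_inv n r mu ==> l \<in> {1..r} ==> srefl r l \<in> parabolic n r mu ==> w \<in> WB r
  ==> phi (w o srefl r l) = phi w"
 and right_inv_space: "phi \<in> right_inv n r mu ==> phi \<in> coeffs r"
 by (auto simp: right_inv_def)

lemma left_inv_parabolic:
 assumes mu: "mu \<in> weights n r" and phi: "phi \<in> left_inv n r mu" and u: "u \<in> parabolic n r mu" and w: "w \<in> WB r"
 shows "phi (u o w) = phi w"
proof -
 have "\<forall>w\<in>WB r. phi (u o w) = phi w"
  using mu u
 proof (rule parabolic_descent_induct)
  show "\<forall>w\<in>WB r. phi (id o w) = phi w" by simp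
  fix u i
  assume i: "i \<in> {1..r}" and s: "srefl r i \<in> parabolic n r mu"
   and IH: "\<forall>w\<in>WB r. phi (u o srefl r i o w) = phi w"
  show "\<forall>w\<in>WB r. phi (u o w) = phi w"
  proof
   fix w assume w: "w \<in> WB r"
   have sw: "srefl r i o w \<in> WB r" by (rule comp_WB[OF simple_refl_WB[OF i] w])
   have "u o srefl r i o (srefl r i o w) = u o srefl r i o srefl r i o w"
    by (simp only: comp_assoc)
   also have "\<dots> = u o w" by (simp only: comp_refl_refl[OF i])
   finally have "phi (u o w) = phi (srefl r i o w)" using IH sw by metis
   also have "\<dots> = phi w" by (rule left_invD[OF phi i s w])
   finally show "phi (u o w) = phi w" .
  qed
 qed
 thus ?thesis using w by blast
qed

lemma right_inv_parabolic:
 assumes mu: "mu \<in> weights n r" and phi: "phi \<in> right_inv n r mu" and u: "u \<in> parabolic n r mu" and w: "w \<in> WB r"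
 shows "phi (w o u) = phi w"
proof -
 have "phi (w o u) = phi w"
  using mu u
 proof (rule parabolic_descent_induct)
  show "phi (w o id) = phi w" by simp
  fix u i
  assume u: "u \<in> parabolic n r mu" and i: "i \<in> {1..r}" and s: "srefl r i \<in> parabolic n r mu"
   and IH: "phi (w o (u o srefl r i)) = phi w"
  have "phi (w o u o srefl r i) = phi (w o u)"
   by (rule right_invD[OF phi i s comp_WB[OF w parabolic_WB[OF mu u]]])
  thus "phi (w o u) = phi w" using IH by (simp only: comp_assoc)
 qed
 thus ?thesis .
qed

lemma right_invI:
 assumes "phi \<in> coeffs r" "\<And>u w. u \<in> parabolic n r mu ==> w \<in> WB r ==> phi (w o u) = phi w"
 shows "phi \<in> right_inv n r mu"
 using assms by (auto simp: right_inv_def)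

lemma left_invI:
 assumes "phi \<in> coeffs r" "\<And>u w. u \<in> parabolic n r mu ==> w \<in> WB r ==> phi (u o w) = phi w"
 shows "phi \<in> left_inv n r mu"
 using assms by (auto simp: left_inv_def)

lemma left_inv_add: "phi \<in> left_inv n r mu ==> psi \<in> left_inv n r mu ==> phi + psi \<in> left_inv n r mu"
 by (simp add: left_inv_def coeffs_add fun_apply)

lemma left_inv_scale: "phi \<in> left_inv n r mu ==> (\<lambda>w. c * phi w) \<in> left_inv n r mu"
 by (simp add: left_inv_def coeffs_scale)

lemma left_inv_zero: "0 \<in> left_inv n r mu"
 by (simp add: left_inv_def coeffs_zero fun_apply)

lemma left_inv_sum: "(\<And>x. x \<in> S ==> phi x \<in> left_inv n r mu) ==> (\<Sum>x\<in>S. phi x) \<in> left_inv n r mu"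
 by (induction S rule: infinite_finite_induct) (simp_all add: left_inv_zero left_inv_add)

text \<open>
 Left multiplication by a simple reflection either preserves the relative order of two adjacent
 values or amounts to right multiplication; so right multiplication by \<open>T\<^sub>i\<close> respects left invariance.
\<close>

lemma left_inv_refl_op:
 assumes phi: "phi \<in> left_inv n r mu" and i: "i \<in> {1..r}"
 shows "refl_op r i phi \<in> left_inv n r mu"
proof -
 have key: "refl_op r i phi (srefl r l o w) = refl_op r i phi w"
  if l: "l \<in> {1..r}" "srefl r l \<in> parabolic n r mu" and w: "w \<in> WB r" for l w
 proof -
  let ?s = "srefl r l" and ?t = "srefl r i"
  have sw: "?s o w \<in> WB r" by (rule comp_WB[OF simple_refl_WB[OF l(1)] w])
  have wt: "w o ?t \<in> WB r" by (rule WB_refl[OF w i])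
  have inv: "phi (?s o w) = phi w" "phi (?s o w o ?t) = phi (w o ?t)"
   using left_invD[OF phi l w] left_invD[OF phi l wt] by (simp_all only: comp_assoc)
  show ?thesis
  proof (cases "w i < w (i + 1) \<longleftrightarrow> (?s o w) i < (?s o w) (i + 1)")
   case True
   thus ?thesis unfolding refl_op_apply[OF w] refl_op_apply[OF sw] inv by simp
  next
   case False
   have c: "?s o w = w o ?t"
   proof (cases "w i < w (i + 1)")
    case True
    have "?s (w (i + 1)) < ?s (w i)" using False True descent_or_ascent[OF sw i] by (simp only: comp_apply) blast
    thus ?thesis by (rule refl_exchange[OF w l(1) i True])
   next
    case wd: False
    hence a: "(?s o w) i < (?s o w) (i + 1)" using False by blast
    have ssw: "?s o (?s o w) = w" unfolding comp_assoc[symmetric] simple_refl_comp_self[OF l(1)] by simp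
    have "?s ((?s o w) (i + 1)) < ?s ((?s o w) i)"
     using wd descent_or_ascent[OF w i] fun_cong[OF ssw, of i] fun_cong[OF ssw, of "i + 1"] by (simp only: comp_apply)
    from refl_exchange[OF sw l(1) i a this] have "w = ?s o w o ?t" unfolding ssw .
    thus ?thesis using comp_refl_refl[OF i, of "?s o w"] by metis
   qed
   have e: "phi (w o ?t) = phi w" using inv(1) unfolding c .
   have v: "(?s o w) i = w (i + 1)" "(?s o w) (i + 1) = w i" unfolding c by (rule comp_refl_values[OF i])+
   show ?thesis unfolding refl_op_apply[OF w] refl_op_apply[OF sw] inv e v
    using descent_or_ascent[OF w i] by (auto simp: algebra_simps)
  qed
 qed
 thus ?thesis using refl_op_space[of r i phi] by (auto simp only: left_inv_def mem_Collect_eq)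
qed

text \<open>The Poincare polynomial of the parabolic subgroup, with unequal parameters.\<close>

definition parabolic_par :: "nat => nat => (nat => nat) => int poly" where
 "parabolic_par n r mu = (\<Sum>w\<in>parabolic n r mu. prod_list (map (par r) (std_word r w)))"

lemma poly_prod_list: "poly (prod_list ps) x = prod_list (map (\<lambda>p. poly p x) ps)"
 by (induction ps) auto

lemma finite_parabolic: "mu \<in> weights n r ==> finite (parabolic n r mu)"
 by (rule finite_subset[OF _ finite_WB]) (use parabolic_WB in blast)

lemma parabolic_par_pos:
 assumes "mu \<in> weights n r" "x > 0"
 shows "poly (parabolic_par n r mu) x > 0"
proof -
 have "poly (prod_list (map (par r) is)) x > 0" for "is"
  unfolding poly_prod_list using assms(2) by (induction "is") (auto simp: par_def qvar_def)
 thus ?thesis unfolding parabolic_par_def poly_sum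
  using finite_parabolic[OF assms(1)] parabolic_id[OF assms(1)] by (intro sum_pos) auto
qed

lemma parabolic_par_nonzero: "mu \<in> weights n r ==> parabolic_par n r mu \<noteq> 0"
 using parabolic_par_pos[of mu n r 1] by auto

lemma par_nonzero: "par r i \<noteq> 0"
 by (simp add: par_def qvar_def)

text \<open>The eigenvectors of \<open>T\<^sub>i\<close> for its parameter are the functions invariant under \<open>s\<^sub>i\<close>.\<close>

lemma right_inv_iff:
 assumes phi: "phi \<in> coeffs r" and i: "i \<in> {1..r}"
 shows "refl_op r i phi = (\<lambda>w. par r i * phi w) \<longleftrightarrow> (\<forall>w\<in>WB r. phi (w o srefl r i) = phi w)"
proof
 assume e: "refl_op r i phi = (\<lambda>w. par r i * phi w)"
 have asc: "phi (w o srefl r i) = phi w" if w: "w \<in> WB r" and a: "w i < w (i + 1)" for w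
 proof -
  have "par r i * phi (w o srefl r i) = par r i * phi w"
   using fun_cong[OF e, of w] unfolding refl_op_apply[OF w] if_P[OF a] .
  thus ?thesis using par_nonzero by simp
 qed
 show "\<forall>w\<in>WB r. phi (w o srefl r i) = phi w"
 proof
  fix w assume w: "w \<in> WB r"
  show "phi (w o srefl r i) = phi w"
  proof (cases "w i < w (i + 1)")
   case True
   thus ?thesis by (rule asc[OF w])
  next
   case False
   hence "w (i + 1) < w i" using descent_or_ascent[OF w i] by blast
   hence "(w o srefl r i) i < (w o srefl r i) (i + 1)" unfolding comp_refl_values[OF i] .
   from asc[OF WB_refl[OF w i] this] show ?thesis unfolding comp_refl_refl[OF i] by (rule sym)
  qed
 qed
next
 assume e: "\<forall>w\<in>WB r. phi (w o srefl r i) = phi w"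
 show "refl_op r i phi = (\<lambda>w. par r i * phi w)"
 proof (rule coeffs_eqI[OF refl_op_space coeffs_scale[OF phi]])
  fix w assume w: "w \<in> WB r"
  hence inv: "phi (w o srefl r i) = phi w" using e by blast
  show "refl_op r i phi w = par r i * phi w" unfolding refl_op_apply[OF w] inv by (simp add: algebra_simps)
 qed
qed

lemma right_inv_word_op:
 assumes mu: "mu \<in> weights n r" and phi: "phi \<in> right_inv n r mu"
 shows "w \<in> parabolic n r mu ==> reduced_word r w is ==> word_op r is phi = (\<lambda>v. prod_list (map (par r) is) * phi v)"
proof (induction "is" arbitrary: w rule: rev_induct)
 case Nil
 thus ?case by simp
next
 case (snoc i "is")
 note I = reduced_word_snocD[OF snoc.prems(2)]
 have s: "srefl r i \<in> parabolic n r mu"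
  using segment_stab_descent[OF mu _ I(1,2)] snoc.prems(1) unfolding parabolic_stabilizer[OF mu] .
 have IH: "word_op r is phi = (\<lambda>v. prod_list (map (par r) is) * phi v)"
  by (rule snoc.IH[OF parabolic_comp[OF mu snoc.prems(1) s] I(3)])
 have "refl_op r i phi = (\<lambda>w. par r i * phi w)"
  unfolding right_inv_iff[OF right_inv_space[OF phi] I(1)] using right_invD[OF phi I(1) s] by blast
 thus ?case by (simp only: word_op_simps IH refl_op_scale) (simp add: mult_ac)
qed

context
 fixes r :: nat
 assumes r2: "2 \<le> r"
begin

abbreviation (input) hecke_times (infixl "\<odot>" 70) where "x \<odot> y \<equiv> x \<otimes>\<^bsub>hecke r\<^esub> y"

lemma ring_hecke: "ring (hecke r)"
 unfolding hecke_def by (rule ideal.quotient_is_ring[OF hecke_ideal_ideal[OF r2]])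

lemma hecke_class_hom: "hecke_class r \<in> ring_hom (free_algebra r) (hecke r)"
 using ideal.rcos_ring_hom[OF hecke_ideal_ideal[OF r2]] unfolding hecke_def hecke_class_def .

lemma hecke_class_closed: "f \<in> carrier (free_algebra r) ==> hecke_class r f \<in> carrier (hecke r)"
 by (rule ring_hom_closed[OF hecke_class_hom])

lemma hecke_class_add: "f \<in> carrier (free_algebra r) ==> g \<in> carrier (free_algebra r) ==>
  hecke_class r (f + g) = hecke_class r f \<oplus>\<^bsub>hecke r\<^esub> hecke_class r g"
 using ring_hom_add[OF hecke_class_hom, of f g] by simp

lemma hecke_class_mult: "f \<in> carrier (free_algebra r) ==> g \<in> carrier (free_algebra r) ==>
  hecke_class r (f \<otimes>\<^bsub>free_algebra r\<^esub> g) = hecke_class r f \<odot> hecke_class r g"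
 by (rule ring_hom_mult[OF hecke_class_hom])

lemma hecke_class_one: "hecke_class r (word_mon []) = \<one>\<^bsub>hecke r\<^esub>"
 using ring_hom_one[OF hecke_class_hom] by simp

lemma hecke_class_zero: "hecke_class r 0 = \<zero>\<^bsub>hecke r\<^esub>"
proof -
 interpret ring_hom_ring "free_algebra r" "hecke r" "hecke_class r"
  by (rule ring_hom_ringI2[OF ring_free_algebra ring_hecke hecke_class_hom])
 show ?thesis using hom_zero by simp
qed

lemma hecke_class_eq:
 assumes "f \<in> carrier (free_algebra r)" "g \<in> carrier (free_algebra r)"
 shows "hecke_class r f = hecke_class r g \<longleftrightarrow> heq r f g"
proof -
 interpret ring "free_algebra r" by (rule ring_free_algebra)
 have "\<ominus>\<^bsub>free_algebra r\<^esub> g = - g"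
  using monoid_ring_uminus[OF monoid_free_monoid, of g r] assms(2) unfolding free_algebra_def[symmetric]
  by (simp add: free_algebra_carrier free_monoid_def)
 hence "f \<ominus>\<^bsub>free_algebra r\<^esub> g = f - g" by (simp add: a_minus_def)
 thus ?thesis using quotient_eq_iff_same_a_r_cos[OF hecke_ideal_ideal[OF r2] assms]
  by (simp add: heq_def[OF r2] hecke_class_def)
qed

lemma hecke_class_surj:
 assumes "h \<in> carrier (hecke r)"
 shows "\<exists>f\<in>carrier (free_algebra r). hecke_class r f = h"
 using assms unfolding hecke_def FactRing_def A_RCOSETS_def' hecke_class_def by auto

lemma hecke_rep:
 assumes "h \<in> carrier (hecke r)"
 shows "hecke_rep r h \<in> carrier (free_algebra r)" "hecke_class r (hecke_rep r h) = h"
 using someI_ex[of "\<lambda>f. f \<in> carrier (free_algebra r) \<and> hecke_class r f = h"] hecke_class_surj[OF assms]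
 unfolding hecke_rep_def by blast+

lemma heq_act:
 assumes "heq r f g" "phi \<in> coeffs r"
 shows "free_act r f phi = free_act r g phi"
 using hecke_ideal_act[OF r2 _ assms(2), of "f - g"] assms(1) by (simp add: heq_def[OF r2] free_act_diff)

lemma hecke_act_class:
 assumes "f \<in> carrier (free_algebra r)" "phi \<in> coeffs r"
 shows "hecke_act r (hecke_class r f) phi = free_act r f phi"
proof -
 note R = hecke_rep[OF hecke_class_closed[OF assms(1)]]
 have "heq r (hecke_rep r (hecke_class r f)) f" using hecke_class_eq[OF R(1) assms(1)] R(2) by simp
 thus ?thesis unfolding hecke_act_def by (rule heq_act[OF _ assms(2)])
qed

lemma basis_id_space: "basis_fun id \<in> coeffs r"
 by (rule basis_fun_space[OF id_WB])

lemma hecke_act_space: "phi \<in> coeffs r ==> hecke_act r h phi \<in> coeffs r"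
 unfolding hecke_act_def by (rule free_act_space)

lemma hecke_coeff_space: "hecke_coeff r h \<in> coeffs r"
 unfolding hecke_coeff_def by (rule hecke_act_space[OF basis_id_space])

lemma hecke_act_add:
 assumes "h \<in> carrier (hecke r)" "h' \<in> carrier (hecke r)" "phi \<in> coeffs r"
 shows "hecke_act r (h \<oplus>\<^bsub>hecke r\<^esub> h') phi = hecke_act r h phi + hecke_act r h' phi"
proof -
 note R = hecke_rep[OF assms(1)] hecke_rep[OF assms(2)]
 have "h \<oplus>\<^bsub>hecke r\<^esub> h' = hecke_class r (hecke_rep r h + hecke_rep r h')"
  using hecke_class_add[OF R(1,3)] R(2,4) by simp
 thus ?thesis using hecke_act_class[OF free_add_carrier[OF R(1,3)] assms(3)]
  by (simp add: free_act_add hecke_act_def)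
qed

lemma hecke_act_mult:
 assumes "h \<in> carrier (hecke r)" "h' \<in> carrier (hecke r)" "phi \<in> coeffs r"
 shows "hecke_act r (h \<odot> h') phi = hecke_act r h' (hecke_act r h phi)"
proof -
 note R = hecke_rep[OF assms(1)] hecke_rep[OF assms(2)]
 have "h \<odot> h' = hecke_class r (hecke_rep r h \<otimes>\<^bsub>free_algebra r\<^esub> hecke_rep r h')"
  using hecke_class_mult[OF R(1,3)] R(2,4) by simp
 thus ?thesis
  using hecke_act_class[OF ring.ring_simprules(5)[OF ring_free_algebra R(1,3)] assms(3)]
  by (simp add: free_algebra_mult_act hecke_act_def)
qed

lemma hecke_act_add_right: "hecke_act r h (phi + psi) = hecke_act r h phi + hecke_act r h psi"
 unfolding hecke_act_def by (rule free_act_add_right)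

lemma hecke_act_scale_right: "hecke_act r h (\<lambda>w. c * phi w) = (\<lambda>w. c * hecke_act r h phi w)"
 unfolding hecke_act_def by (rule free_act_scale_right)

lemma hecke_act_zero_right: "hecke_act r h 0 = 0"
 unfolding hecke_act_def by (rule free_act_zero_right)

lemma hecke_act_sum_right: "hecke_act r h (\<Sum>x\<in>S. phi x) = (\<Sum>x\<in>S. hecke_act r h (phi x))"
 by (induction S rule: infinite_finite_induct)
  (simp_all only: sum.infinite sum.empty sum.insert hecke_act_zero_right hecke_act_add_right not_False_eq_True)

lemma hecke_coeff_add:
 "h \<in> carrier (hecke r) ==> h' \<in> carrier (hecke r) ==> hecke_coeff r (h \<oplus>\<^bsub>hecke r\<^esub> h') = hecke_coeff r h + hecke_coeff r h'"
 unfolding hecke_coeff_def by (rule hecke_act_add[OF _ _ basis_id_space])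

lemma hecke_coeff_mult:
 "h \<in> carrier (hecke r) ==> h' \<in> carrier (hecke r) ==> hecke_coeff r (h \<odot> h') = hecke_act r h' (hecke_coeff r h)"
 unfolding hecke_coeff_def by (rule hecke_act_mult[OF _ _ basis_id_space])

lemma hecke_coeff_zero: "hecke_coeff r \<zero>\<^bsub>hecke r\<^esub> = 0"
proof -
 have "0 \<in> carrier (free_algebra r)" by (simp add: free_algebra_carrier)
 from hecke_act_class[OF this basis_id_space] show ?thesis
  unfolding hecke_coeff_def hecke_class_zero by (simp only: free_act_zero)
qed

text \<open>An element is recovered from its coefficients as a combination of the spanning set of the \<open>T\<^sub>w\<close>.\<close>

lemma hecke_coeff_inj:
 assumes h: "h \<in> carrier (hecke r)" "h' \<in> carrier (hecke r)" and eq: "hecke_coeff r h = hecke_coeff r h'"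
 shows "h = h'"
proof -
 note R = hecke_rep[OF h(1)] hecke_rep[OF h(2)]
 have "heq r (hecke_rep r h) (std_lift r (hecke_coeff r h))"
  using heq_std_lift[OF r2 R(1)] by (simp add: hecke_coeff_def hecke_act_def)
 moreover have "heq r (hecke_rep r h') (std_lift r (hecke_coeff r h'))"
  using heq_std_lift[OF r2 R(3)] by (simp add: hecke_coeff_def hecke_act_def)
 ultimately have "heq r (hecke_rep r h) (hecke_rep r h')"
  unfolding eq using heq_trans[OF r2] heq_sym[OF r2] by blast
 thus ?thesis using hecke_class_eq[OF R(1,3)] R(2,4) by simp
qed

lemma hecke_T_class: "hecke_T r w = hecke_class r (word_mon (std_word r w))"
 unfolding hecke_T_def hecke_class_def std_word_def[OF r2] ..

lemma hecke_T_closed: "w \<in> WB r ==> hecke_T r w \<in> carrier (hecke r)"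
 unfolding hecke_T_class by (intro hecke_class_closed single_carrier std_word_lists[OF r2])

lemma hecke_T_act: "w \<in> WB r ==> phi \<in> coeffs r ==> hecke_act r (hecke_T r w) phi = word_op r (std_word r w) phi"
 unfolding hecke_T_class
 using hecke_act_class[OF single_carrier[OF std_word_lists[OF r2]], of w phi 1] by (simp add: free_act_single)

lemma hecke_coeff_T: "w \<in> WB r ==> hecke_coeff r (hecke_T r w) = basis_fun w"
 unfolding hecke_coeff_def using hecke_T_act[OF _ basis_id_space] word_op_reduced[OF r2 std_word[OF r2]] by simp

lemma hecke_scalar_class: "hecke_scalar r a = hecke_class r (single [] a)"
 by (simp add: hecke_scalar_def hecke_class_def)

lemma hecke_scalar_closed: "hecke_scalar r a \<in> carrier (hecke r)"
 unfolding hecke_scalar_class by (intro hecke_class_closed single_carrier) simp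

lemma hecke_scalar_act: "phi \<in> coeffs r ==> hecke_act r (hecke_scalar r a) phi = (\<lambda>w. a * phi w)"
 unfolding hecke_scalar_class using hecke_act_class[OF single_carrier[of "[]" r a]] by (simp add: free_act_single)

definition hecke_gen :: "nat => hecke_elem" where
 "hecke_gen i = hecke_class r (word_mon [i])"

lemma hecke_gen_closed: "i \<in> {1..r} ==> hecke_gen i \<in> carrier (hecke r)"
 unfolding hecke_gen_def by (intro hecke_class_closed single_carrier) simp

lemma hecke_gen_act: "i \<in> {1..r} ==> phi \<in> coeffs r ==> hecke_act r (hecke_gen i) phi = refl_op r i phi"
 unfolding hecke_gen_def using hecke_act_class[OF single_carrier[of "[i]" r 1]] by (simp add: free_act_single)

lemma hecke_coeff_finsum_T:
 assumes "S \<subseteq> WB r"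
 shows "(\<Oplus>\<^bsub>hecke r\<^esub>w\<in>S. hecke_T r w) \<in> carrier (hecke r)"
  "hecke_coeff r (\<Oplus>\<^bsub>hecke r\<^esub>w\<in>S. hecke_T r w) = set_fun S"
  "phi \<in> coeffs r ==> hecke_act r (\<Oplus>\<^bsub>hecke r\<^esub>w\<in>S. hecke_T r w) phi = (\<Sum>w\<in>S. hecke_act r (hecke_T r w) phi)"
proof -
 interpret ring "hecke r" by (rule ring_hecke)
 have fin: "finite S" using assms finite_WB finite_subset by blast
 show "(\<Oplus>\<^bsub>hecke r\<^esub>w\<in>S. hecke_T r w) \<in> carrier (hecke r)"
  by (rule finsum_closed) (use assms hecke_T_closed in blast)
 have act: "hecke_act r (\<Oplus>\<^bsub>hecke r\<^esub>w\<in>S. hecke_T r w) phi = (\<Sum>w\<in>S. hecke_act r (hecke_T r w) phi)" if phi: "phi \<in> coeffs r" for phi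
  using fin assms
 proof (induction S rule: finite_induct)
  case empty
  have "0 \<in> carrier (free_algebra r)" by (simp add: free_algebra_carrier)
  from hecke_act_class[OF this phi] show ?case unfolding finsum_empty hecke_class_zero by (simp only: free_act_zero sum.empty)
 next
  case (insert w S)
  have Tc: "hecke_T r ` insert w S \<subseteq> carrier (hecke r)" using insert.prems hecke_T_closed by blast
  have fs: "(\<Oplus>\<^bsub>hecke r\<^esub>w\<in>S. hecke_T r w) \<in> carrier (hecke r)" by (rule finsum_closed) (use Tc in blast)
  have wc: "hecke_T r w \<in> carrier (hecke r)" using Tc by blast
  have "(\<Oplus>\<^bsub>hecke r\<^esub>w\<in>insert w S. hecke_T r w) = hecke_T r w \<oplus>\<^bsub>hecke r\<^esub> (\<Oplus>\<^bsub>hecke r\<^esub>w\<in>S. hecke_T r w)"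
   by (rule finsum_insert[OF insert.hyps]) (use Tc in blast)+
  thus ?case using insert.IH insert.prems unfolding sum.insert[OF insert.hyps]
   by (simp only: hecke_act_add[OF wc fs phi] insert_subset)
 qed
 thus "phi \<in> coeffs r ==> hecke_act r (\<Oplus>\<^bsub>hecke r\<^esub>w\<in>S. hecke_T r w) phi = (\<Sum>w\<in>S. hecke_act r (hecke_T r w) phi)" .
 have "(\<Sum>w\<in>S. hecke_act r (hecke_T r w) (basis_fun id)) = (\<Sum>w\<in>S. basis_fun w)"
  using assms hecke_coeff_T unfolding hecke_coeff_def by (intro sum.cong) auto
 also have "\<dots> = set_fun S"
  using fin
 proof (induction S rule: finite_induct)
  case empty
  show ?case by (simp add: fun_eq_iff set_fun_def fun_apply)
 next
  case (insert w S)
  show ?case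
  proof
   fix v
   show "(\<Sum>w\<in>insert w S. basis_fun w) v = set_fun (insert w S) v"
    unfolding sum.insert[OF insert.hyps] insert.IH fun_apply using insert.hyps(2) by (simp add: set_fun_def basis_fun_def)
  qed
 qed
 finally show "hecke_coeff r (\<Oplus>\<^bsub>hecke r\<^esub>w\<in>S. hecke_T r w) = set_fun S"
  unfolding hecke_coeff_def act[OF basis_id_space] .
qed

lemma hecke_act_closed:
 assumes "0 \<in> P" and "\<And>phi psi. phi \<in> P ==> psi \<in> P ==> phi + psi \<in> P" and "\<And>c phi. phi \<in> P ==> (\<lambda>w. c * phi w) \<in> P"
  and "\<And>i phi. i \<in> {1..r} ==> phi \<in> P ==> refl_op r i phi \<in> P"
  and phi: "phi \<in> P" and h: "h \<in> carrier (hecke r)"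
 shows "hecke_act r h phi \<in> P"
proof -
 have w: "word_op r is psi \<in> P" if "is \<in> lists {1..r}" "psi \<in> P" for "is" psi
  using that by (induction "is" arbitrary: psi) (simp_all add: assms(4))
 have "keys (hecke_rep r h) \<subseteq> lists {1..r}" using hecke_rep(1)[OF h] by (simp add: free_algebra_carrier)
 hence "free_act r (hecke_rep r h) phi \<in> P"
 proof (induction rule: keys_induct)
  case zero
  show ?case by (simp only: free_act_zero assms(1))
 next
  case (add x c f)
  show ?case unfolding free_act_add free_act_single by (intro assms(2,3) w[OF add(1) phi] add(3))
 qed
 thus ?thesis by (simp add: hecke_act_def)
qed

lemma left_inv_act: "phi \<in> left_inv n r mu ==> h \<in> carrier (hecke r) ==> hecke_act r h phi \<in> left_inv n r mu"
 by (rule hecke_act_closed) (simp_all only: left_inv_zero left_inv_add left_inv_scale left_inv_refl_op)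

section \<open>Permutation modules of the Hecke algebra\<close>

context
 fixes n :: nat and mu :: "nat => nat"
 assumes mu: "mu \<in> weights n r"
begin

lemma parabolic_subset: "parabolic n r mu \<subseteq> WB r"
 using parabolic_WB[OF mu] by blast

lemma hecke_x_closed: "hecke_x n r mu \<in> carrier (hecke r)"
 unfolding hecke_x_def by (rule hecke_coeff_finsum_T(1)[OF parabolic_subset])

lemma hecke_x_coeff: "hecke_coeff r (hecke_x n r mu) = set_fun (parabolic n r mu)"
 unfolding hecke_x_def by (rule hecke_coeff_finsum_T(2)[OF parabolic_subset])

lemma parabolic_cancel_left: "u \<in> parabolic n r mu ==> u o w \<in> parabolic n r mu \<longleftrightarrow> w \<in> parabolic n r mu"
proof
 assume u: "u \<in> parabolic n r mu" and uw: "u o w \<in> parabolic n r mu"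
 have "perm_inv u o (u o w) = w" unfolding comp_assoc[symmetric] inv_WB_comp(1)[OF parabolic_WB[OF mu u]] by simp
 thus "w \<in> parabolic n r mu" using parabolic_comp[OF mu parabolic_inv[OF mu u] uw] by simp
qed (rule parabolic_comp[OF mu])

lemma parabolic_cancel_right: "u \<in> parabolic n r mu ==> w o u \<in> parabolic n r mu \<longleftrightarrow> w \<in> parabolic n r mu"
proof
 assume u: "u \<in> parabolic n r mu" and uw: "w o u \<in> parabolic n r mu"
 have "w o u o perm_inv u = w" unfolding comp_assoc inv_WB_comp(2)[OF parabolic_WB[OF mu u]] by simp
 thus "w \<in> parabolic n r mu" using parabolic_comp[OF mu uw parabolic_inv[OF mu u]] by simp
qed (use parabolic_comp[OF mu] in blast)

definition right_coset :: "(nat => nat) => (nat => nat) set" where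
 "right_coset d = {u o d | u. u \<in> parabolic n r mu}"

lemma right_coset_iff:
 assumes d: "d \<in> WB r"
 shows "w \<in> right_coset d \<longleftrightarrow> w o perm_inv d \<in> parabolic n r mu"
proof
 assume "w \<in> right_coset d"
 then obtain u where u: "u \<in> parabolic n r mu" "w = u o d" by (auto simp: right_coset_def)
 have "w o perm_inv d = u" unfolding u(2) comp_assoc inv_WB_comp(2)[OF d] by simp
 thus "w o perm_inv d \<in> parabolic n r mu" using u(1) by simp
next
 assume a: "w o perm_inv d \<in> parabolic n r mu"
 have "w = w o perm_inv d o d" unfolding comp_assoc inv_WB_comp(1)[OF d] by simp
 thus "w \<in> right_coset d" using a unfolding right_coset_def by blast
qed

lemma right_coset_subset: "d \<in> WB r ==> right_coset d \<subseteq> WB r"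
 using parabolic_WB[OF mu] comp_WB unfolding right_coset_def by blast

lemma right_coset_self: "d \<in> WB r ==> d \<in> right_coset d"
 using right_coset_iff[of d d] inv_WB_comp(2)[of d r] parabolic_id[OF mu] by simp

lemma right_coset_left: "d \<in> WB r ==> u \<in> parabolic n r mu ==> u o w \<in> right_coset d \<longleftrightarrow> w \<in> right_coset d"
 unfolding right_coset_iff comp_assoc by (rule parabolic_cancel_left)

lemma right_coset_eq:
 assumes d: "d \<in> WB r" and e: "e \<in> right_coset d"
 shows "right_coset e = right_coset d"
proof -
 obtain u where u: "u \<in> parabolic n r mu" "e = u o d" using e by (auto simp: right_coset_def)
 have eW: "e \<in> WB r" using right_coset_subset[OF d] e by blast
 show ?thesis
 proof (rule Set.set_eqI)
  fix w
  have inv: "perm_inv e = perm_inv d o perm_inv u"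
  proof
   fix x
   have "e ((perm_inv d o perm_inv u) x) = x"
    by (simp add: u(2) inv_WB_comp(4)[OF d] inv_WB_comp(4)[OF parabolic_WB[OF mu u(1)]])
   thus "perm_inv e x = (perm_inv d o perm_inv u) x" using inv_WB_comp(3)[OF eW] by metis
  qed
  show "w \<in> right_coset e \<longleftrightarrow> w \<in> right_coset d"
   unfolding right_coset_iff[OF d] right_coset_iff[OF eW] inv comp_assoc[symmetric]
   by (rule parabolic_cancel_right[OF parabolic_inv[OF mu u(1)]])
 qed
qed

lemma right_coset_refl: "d \<in> WB r ==> i \<in> {1..r} ==> w o srefl r i \<in> right_coset (d o srefl r i) \<longleftrightarrow> w \<in> right_coset d"
proof -
 assume d: "d \<in> WB r" and i: "i \<in> {1..r}"
 have "w o srefl r i = u o (d o srefl r i) \<longleftrightarrow> w = u o d" for u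
  using comp_refl_refl[OF i] by (metis comp_assoc)
 thus ?thesis unfolding right_coset_def by auto
qed

lemma set_fun_right_coset_left_inv: "d \<in> WB r ==> set_fun (right_coset d) \<in> left_inv n r mu"
 by (intro left_invI set_fun_space right_coset_subset) (simp_all add: set_fun_def right_coset_left)

text \<open>
 Multiplying along a reduced word of the shortest element \<open>d\<close> meets ascents only on the whole coset,
 so that the sum of the subgroup is carried to the sum of the coset.
\<close>

lemma hecke_x_min_coset:
 assumes "d \<in> WB r" "\<And>e. e \<in> right_coset d ==> weyl_length r d \<le> weyl_length r e"
 shows "reduced_word r d is ==> word_op r is (set_fun (parabolic n r mu)) = set_fun (right_coset d)"
 using assms
proof (induction "is" arbitrary: d rule: rev_induct)
 case Nil
 hence d: "d = id" by (simp add: reduced_word_def)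
 have "right_coset id = parabolic n r mu" unfolding right_coset_def by simp
 thus ?case by (simp only: word_op_simps d)
next
 case (snoc i "is")
 note I = reduced_word_snocD[OF snoc.prems(1)] and d = snoc.prems(2)
 let ?e = "d o srefl r i"
 have e: "?e \<in> WB r" by (rule WB_refl[OF d I(1)])
 have es: "?e o srefl r i = d" by (rule comp_refl_refl[OF I(1)])
 have lde: "weyl_length r d = weyl_length r ?e + 1" by (rule weyl_length_descent[OF d I(1,2)])
 have mem: "w o srefl r i \<in> right_coset d \<longleftrightarrow> w \<in> right_coset ?e" for w
  using right_coset_refl[OF e I(1), of w] unfolding es .
 have mem': "w o srefl r i \<in> right_coset ?e \<longleftrightarrow> w \<in> right_coset d" for w
  by (rule right_coset_refl[OF d I(1)])
 have min: "weyl_length r ?e \<le> weyl_length r w" if w: "w \<in> right_coset ?e" for w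
 proof -
  have wW: "w \<in> WB r" using right_coset_subset[OF e] w by blast
  have "weyl_length r d \<le> weyl_length r (w o srefl r i)" using snoc.prems(3) mem w by blast
  thus ?thesis using weyl_length_step[OF wW I(1)] lde by linarith
 qed
 have disj: "w \<notin> right_coset ?e" if w: "w \<in> right_coset d" for w
 proof
  assume "w \<in> right_coset ?e"
  hence "right_coset d = right_coset ?e" using right_coset_eq[OF d w] right_coset_eq[OF e] by blast
  hence "?e \<in> right_coset d" using right_coset_self[OF e] by blast
  from snoc.prems(3)[OF this] show False using lde by linarith
 qed
 let ?f = "set_fun (right_coset ?e)"
 have IH: "word_op r is (set_fun (parabolic n r mu)) = ?f" by (rule snoc.IH[OF I(3) e min])
 have li: "refl_op r i ?f \<in> left_inv n r mu"
  by (rule left_inv_refl_op[OF set_fun_right_coset_left_inv[OF e] I(1)])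
 have "refl_op r i ?f = set_fun (right_coset d)"
 proof (rule coeffs_eqI[OF refl_op_space set_fun_space[OF right_coset_subset[OF d]]])
  fix w assume w: "w \<in> WB r"
  consider (d) "w \<in> right_coset d" | (e) "w \<in> right_coset ?e" "w \<notin> right_coset d" | (o) "w \<notin> right_coset d" "w \<notin> right_coset ?e" by blast
  thus "refl_op r i ?f w = set_fun (right_coset d) w"
  proof cases
   case d: d
   then obtain u where u: "u \<in> parabolic n r mu" "w = u o d" by (auto simp: right_coset_def)
   have "refl_op r i ?f w = refl_op r i ?f d" unfolding u(2) by (rule left_inv_parabolic[OF mu li u(1) snoc.prems(2)])
   also have "\<dots> = 1"
    unfolding refl_op_apply[OF snoc.prems(2)] set_fun_def
    using I(2) right_coset_self[OF e] disj[OF right_coset_self[OF snoc.prems(2)]] by simp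
   finally show ?thesis using d by (simp add: set_fun_def)
  next
   case ee: e
   then obtain u where u: "u \<in> parabolic n r mu" "w = u o ?e" by (auto simp: right_coset_def)
   have asc: "?e i < ?e (i + 1)" using I(2) unfolding comp_refl_values[OF I(1)] .
   have "refl_op r i ?f w = refl_op r i ?f ?e" unfolding u(2) by (rule left_inv_parabolic[OF mu li u(1) e])
   also have "\<dots> = 0"
    unfolding refl_op_apply[OF e] set_fun_def es
    using asc disj[OF right_coset_self[OF d]] by simp
   finally show ?thesis using ee by (simp add: set_fun_def)
  next
   case o
   thus ?thesis unfolding refl_op_apply[OF w] set_fun_def mem' by simp
  qed
 qed
 thus ?case by (simp only: word_op_simps IH)
qed

lemma right_coset_min_exists:
 assumes "w \<in> WB r"
 shows "\<exists>d\<in>right_coset w. \<forall>e\<in>right_coset w. weyl_length r d \<le> weyl_length r e"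
proof -
 obtain d where "d \<in> right_coset w" "\<And>e. e \<in> right_coset w ==> weyl_length r d \<le> weyl_length r e"
  using ex_min_if_finite[of "weyl_length r ` right_coset w"] arg_min_nat_lemma[of "\<lambda>d. d \<in> right_coset w" w "weyl_length r"]
   right_coset_self[OF assms] by blast
 thus ?thesis by blast
qed

lemma hecke_x_right_coset:
 assumes w: "w \<in> WB r"
 shows "\<exists>h\<in>carrier (hecke r). hecke_coeff r (hecke_x n r mu \<odot> h) = set_fun (right_coset w)"
proof -
 obtain d where d: "d \<in> right_coset w" "\<And>e. e \<in> right_coset w ==> weyl_length r d \<le> weyl_length r e"
  using right_coset_min_exists[OF w] by blast
 have dW: "d \<in> WB r" using right_coset_subset[OF w] d by blast
 have eq: "right_coset d = right_coset w" by (rule right_coset_eq[OF w d(1)])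
 have "hecke_coeff r (hecke_x n r mu \<odot> hecke_T r d) = set_fun (right_coset d)"
  unfolding hecke_coeff_mult[OF hecke_x_closed hecke_T_closed[OF dW]] hecke_x_coeff
   hecke_T_act[OF dW set_fun_space[OF parabolic_subset]]
  by (rule hecke_x_min_coset[OF dW _ std_word[OF r2 dW]]) (use d(2) eq in blast)
 thus ?thesis using hecke_T_closed[OF dW] unfolding eq by blast
qed

lemma hecke_x_mult_left_inv:
 assumes "h \<in> carrier (hecke r)"
 shows "hecke_coeff r (hecke_x n r mu \<odot> h) \<in> left_inv n r mu"
proof -
 have "set_fun (parabolic n r mu) \<in> left_inv n r mu"
  by (intro left_invI set_fun_space parabolic_subset) (simp add: set_fun_def parabolic_cancel_left)
 thus ?thesis
  unfolding hecke_coeff_mult[OF hecke_x_closed assms] hecke_x_coeff by (rule left_inv_act[OF _ assms])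
qed

text \<open>
 A left invariant function is a combination of indicator functions of right cosets, and these are
 the coefficient functions of the products of the generator with the \<open>T\<^sub>d\<close>.
\<close>

lemma left_inv_hecke_x:
 assumes "phi \<in> left_inv n r mu"
 shows "\<exists>h\<in>carrier (hecke r). hecke_coeff r (hecke_x n r mu \<odot> h) = phi"
 using assms
proof (induction "card {w\<in>WB r. phi w \<noteq> 0}" arbitrary: phi rule: less_induct)
 case less
 interpret ring "hecke r" by (rule ring_hecke)
 let ?x = "hecke_x n r mu"
 have xc: "?x \<in> carrier (hecke r)" by (rule hecke_x_closed)
 have sp: "phi \<in> coeffs r" by (rule left_inv_space[OF less.prems])
 show ?case
 proof (cases "\<exists>w\<in>WB r. phi w \<noteq> 0")
  case False
  have "phi = 0" by (rule coeffs_eqI[OF sp coeffs_zero]) (use False in \<open>simp add: fun_apply\<close>)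
  thus ?thesis using r_null[OF xc] hecke_coeff_zero by (intro bexI[of _ "\<zero>\<^bsub>hecke r\<^esub>"]) simp_all
 next
  case True
  then obtain w where w: "w \<in> WB r" "phi w \<noteq> 0" by blast
  let ?c = "set_fun (right_coset w)"
  define psi where "psi = phi + (\<lambda>v. (- phi w) * ?c v)"
  have cli: "?c \<in> left_inv n r mu" by (rule set_fun_right_coset_left_inv[OF w(1)])
  have psili: "psi \<in> left_inv n r mu" unfolding psi_def by (intro left_inv_add less.prems left_inv_scale cli)
  have psiw: "psi w = 0" using right_coset_self[OF w(1)] by (simp add: psi_def fun_apply set_fun_def)
  have const: "phi v = phi w" if "v \<in> right_coset w" for v
  proof -
   obtain u where "u \<in> parabolic n r mu" "v = u o w" using \<open>v \<in> right_coset w\<close> unfolding right_coset_def by blast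
   thus ?thesis using left_inv_parabolic[OF mu less.prems _ w(1)] by simp
  qed
  have "{v\<in>WB r. psi v \<noteq> 0} \<subset> {v\<in>WB r. phi v \<noteq> 0}"
  proof (rule psubsetI)
   show "{v\<in>WB r. psi v \<noteq> 0} \<subseteq> {v\<in>WB r. phi v \<noteq> 0}"
    using const w(2) by (auto simp: psi_def fun_apply set_fun_def split: if_splits)
   show "{v\<in>WB r. psi v \<noteq> 0} \<noteq> {v\<in>WB r. phi v \<noteq> 0}" using w psiw by blast
  qed
  hence "card {v\<in>WB r. psi v \<noteq> 0} < card {v\<in>WB r. phi v \<noteq> 0}" by (intro psubset_card_mono) simp_all
  from less.hyps[OF this psili] obtain h where h: "h \<in> carrier (hecke r)" "hecke_coeff r (?x \<odot> h) = psi" by blast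
  obtain g where g: "g \<in> carrier (hecke r)" "hecke_coeff r (?x \<odot> g) = ?c" using hecke_x_right_coset[OF w(1)] by blast
  let ?a = "hecke_scalar r (phi w)"
  have ac: "?a \<in> carrier (hecke r)" by (rule hecke_scalar_closed)
  have "?x \<odot> (h \<oplus>\<^bsub>hecke r\<^esub> g \<odot> ?a) = ?x \<odot> h \<oplus>\<^bsub>hecke r\<^esub> ?x \<odot> g \<odot> ?a"
   using xc h(1) g(1) ac by (simp add: r_distr m_assoc)
  hence "hecke_coeff r (?x \<odot> (h \<oplus>\<^bsub>hecke r\<^esub> g \<odot> ?a)) = psi + (\<lambda>v. phi w * ?c v)"
   using xc h g ac hecke_scalar_act[OF left_inv_space[OF cli], of "phi w"]
   by (simp add: hecke_coeff_add hecke_coeff_mult[of "?x \<odot> g"])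
  also have "\<dots> = phi" by (simp add: psi_def fun_eq_iff fun_apply)
  finally show ?thesis using h(1) g(1) ac by (intro bexI[of _ "h \<oplus>\<^bsub>hecke r\<^esub> g \<odot> ?a"]) simp_all
 qed
qed

lemma hecke_x_right_inv: "set_fun (parabolic n r mu) \<in> right_inv n r mu"
 by (intro right_invI set_fun_space parabolic_subset) (simp add: set_fun_def parabolic_cancel_right)

lemma hecke_x_mult_gen:
 assumes i: "i \<in> {1..r}" and s: "srefl r i \<in> parabolic n r mu"
 shows "hecke_x n r mu \<odot> hecke_gen i = hecke_x n r mu \<odot> hecke_scalar r (par r i)"
proof (rule hecke_coeff_inj)
 interpret ring "hecke r" by (rule ring_hecke)
 show "hecke_x n r mu \<odot> hecke_gen i \<in> carrier (hecke r)"
  "hecke_x n r mu \<odot> hecke_scalar r (par r i) \<in> carrier (hecke r)"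
  by (intro m_closed hecke_x_closed hecke_gen_closed[OF i] hecke_scalar_closed)+
 have sp: "set_fun (parabolic n r mu) \<in> coeffs r" by (rule set_fun_space[OF parabolic_subset])
 have "refl_op r i (set_fun (parabolic n r mu)) = (\<lambda>w. par r i * set_fun (parabolic n r mu) w)"
  unfolding right_inv_iff[OF sp i] using right_invD[OF hecke_x_right_inv i s] by blast
 thus "hecke_coeff r (hecke_x n r mu \<odot> hecke_gen i) = hecke_coeff r (hecke_x n r mu \<odot> hecke_scalar r (par r i))"
  by (simp only: hecke_coeff_mult[OF hecke_x_closed hecke_gen_closed[OF i]] hecke_coeff_mult[OF hecke_x_closed hecke_scalar_closed]
    hecke_x_coeff hecke_gen_act[OF i sp] hecke_scalar_act[OF sp])
qed

lemma hecke_act_x_right_inv: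
 assumes phi: "phi \<in> right_inv n r mu"
 shows "hecke_act r (hecke_x n r mu) phi = (\<lambda>v. parabolic_par n r mu * phi v)"
proof -
 have sp: "phi \<in> coeffs r" by (rule right_inv_space[OF phi])
 have s: "(\<Sum>w\<in>S. f w) v = (\<Sum>w\<in>S. f w v)" for S v and f :: "(nat => nat) => (nat => nat) => int poly"
  by (induction S rule: infinite_finite_induct) (simp_all add: fun_apply)
 have "hecke_act r (hecke_x n r mu) phi = (\<Sum>w\<in>parabolic n r mu. hecke_act r (hecke_T r w) phi)"
  unfolding hecke_x_def by (rule hecke_coeff_finsum_T(3)[OF parabolic_subset sp])
 also have "\<dots> = (\<Sum>w\<in>parabolic n r mu. (\<lambda>v. prod_list (map (par r) (std_word r w)) * phi v))"
 proof (intro sum.cong refl)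
  fix w assume w: "w \<in> parabolic n r mu"
  hence wW: "w \<in> WB r" using parabolic_subset by blast
  show "hecke_act r (hecke_T r w) phi = (\<lambda>v. prod_list (map (par r) (std_word r w)) * phi v)"
   unfolding hecke_T_act[OF wW sp] by (rule right_inv_word_op[OF mu phi w std_word[OF r2 wW]])
 qed
 also have "\<dots> = (\<lambda>v. parabolic_par n r mu * phi v)"
  by (simp add: fun_eq_iff s parabolic_par_def sum_distrib_right)
 finally show ?thesis .
qed

text \<open>
 The generator of the permutation module multiplies a right invariant \<open>phi\<close> by a Poincare
 polynomial, which is not a zero divisor in \<open>\<int>[q]\<close>; so \<open>phi h\<close> depends only on the product of the
 generator with \<open>h\<close>.
\<close>

lemma right_inv_well_defined:
 assumes phi: "phi \<in> right_inv n r mu" and h: "h \<in> carrier (hecke r)" "h' \<in> carrier (hecke r)"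
  and eq: "hecke_x n r mu \<odot> h = hecke_x n r mu \<odot> h'"
 shows "hecke_act r h phi = hecke_act r h' phi"
proof -
 have sp: "phi \<in> coeffs r" by (rule right_inv_space[OF phi])
 have "(\<lambda>v. parabolic_par n r mu * hecke_act r g phi v) = hecke_act r (hecke_x n r mu \<odot> g) phi" if g: "g \<in> carrier (hecke r)" for g
  unfolding hecke_act_mult[OF hecke_x_closed g sp] hecke_act_x_right_inv[OF phi] hecke_act_scale_right ..
 from this[OF h(1)] this[OF h(2)] have "parabolic_par n r mu * hecke_act r h phi v = parabolic_par n r mu * hecke_act r h' phi v" for v
  unfolding eq by metis
 thus ?thesis using parabolic_par_nonzero[OF mu] by (simp add: fun_eq_iff)
qed

end

end

section \<open>Endomorphisms of the sum of permutation modules\<close>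

lemma finite_weights: "finite (weights n r)"
proof -
 have "weights n r \<subseteq> {1..n + 1} \<rightarrow>\<^sub>E {..r}"
 proof
  fix mu assume mu: "mu \<in> weights n r"
  have "mu i \<le> r" if "i \<in> {1..n + 1}" for i
   using member_le_sum[of i "{1..n + 1}" mu] that mu by (simp add: weights_def)
  thus "mu \<in> {1..n + 1} \<rightarrow>\<^sub>E {..r}" using mu by (auto simp: weights_def PiE_def Pi_def)
 qed
 thus ?thesis by (rule finite_subset) (intro finite_PiE; simp)
qed

definition schur_coeff :: "nat => nat => (tspace_elem => tspace_elem) => (nat => nat) => (nat => nat) => (nat => nat) => int poly" where
 "schur_coeff n r s ka mu = hecke_coeff r (s (tspace_inj n r mu (hecke_x n r mu)) ka)"

lemma schurB_simps [simp]:
 "s \<otimes>\<^bsub>schurB n r\<^esub> s' = compose (tspace n r) s s'"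
 "\<one>\<^bsub>schurB n r\<^esub> = (\<lambda>m\<in>tspace n r. m)"
 "s \<oplus>\<^bsub>schurB n r\<^esub> s' = (\<lambda>m\<in>tspace n r. tspace_add n r (s m) (s' m))"
 by (simp_all add: schurB_def)

lemma schurB_carrier:
 "s \<in> carrier (schurB n r) \<longleftrightarrow> s \<in> tspace n r \<rightarrow>\<^sub>E tspace n r \<and>
  (\<forall>m\<in>tspace n r. \<forall>m'\<in>tspace n r. s (tspace_add n r m m') = tspace_add n r (s m) (s m')) \<and>
  (\<forall>m\<in>tspace n r. \<forall>h\<in>carrier (hecke r). s (tspace_act n r m h) = tspace_act n r (s m) h)"
 by (simp add: schurB_def)

lemma schurB_maps: "s \<in> carrier (schurB n r) ==> m \<in> tspace n r ==> s m \<in> tspace n r"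
 unfolding schurB_carrier by (auto simp: PiE_def Pi_def)

lemma schurB_add_hom: "s \<in> carrier (schurB n r) ==> m \<in> tspace n r ==> m' \<in> tspace n r
  ==> s (tspace_add n r m m') = tspace_add n r (s m) (s m')"
 unfolding schurB_carrier by blast

lemma schurB_act_hom: "s \<in> carrier (schurB n r) ==> m \<in> tspace n r ==> h \<in> carrier (hecke r)
  ==> s (tspace_act n r m h) = tspace_act n r (s m) h"
 unfolding schurB_carrier by blast

lemma sum_fun_eval: "(\<Sum>x\<in>S. f x) w = (\<Sum>x\<in>S. f x w)" for f :: "'i => 'a => int poly"
 by (induction S rule: infinite_finite_induct) (simp_all add: fun_apply)

context
 fixes n r :: nat
 assumes r2: "2 \<le> r"
begin

abbreviation (input) module_times (infixl "\<odot>" 70) where "x \<odot> y \<equiv> x \<otimes>\<^bsub>hecke r\<^esub> y"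

interpretation H: ring "hecke r" by (rule ring_hecke[OF r2])

abbreviation (input) xx :: "(nat => nat) => hecke_elem" where "xx \<equiv> hecke_x n r"

lemma xx_closed: "mu \<in> weights n r ==> xx mu \<in> carrier (hecke r)"
 by (rule hecke_x_closed[OF r2])

lemma tspaceI:
 assumes "\<And>mu. mu \<in> weights n r ==> \<exists>h\<in>carrier (hecke r). m mu = xx mu \<odot> h"
  "m \<in> extensional (weights n r)"
 shows "m \<in> tspace n r"
 unfolding tspace_def using assms by (auto simp: PiE_def)

lemma tspaceD:
 assumes "m \<in> tspace n r"
 shows "mu \<in> weights n r ==> \<exists>h\<in>carrier (hecke r). m mu = xx mu \<odot> h" "m \<in> extensional (weights n r)"
 using assms unfolding tspace_def by (auto simp: PiE_def Pi_def)

lemma tspace_choose: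
 assumes "m \<in> tspace n r"
 obtains h where "\<And>mu. mu \<in> weights n r ==> h mu \<in> carrier (hecke r)"
  "\<And>mu. mu \<in> weights n r ==> m mu = xx mu \<odot> h mu"
proof -
 have "\<exists>h. \<forall>mu\<in>weights n r. h mu \<in> carrier (hecke r) \<and> m mu = xx mu \<odot> h mu"
  by (rule bchoice) (use tspaceD(1)[OF assms] in blast)
 thus ?thesis using that by blast
qed

lemma tspace_closed: "m \<in> tspace n r ==> mu \<in> weights n r ==> m mu \<in> carrier (hecke r)"
 using tspaceD(1)[of m mu] xx_closed[of mu] H.m_closed by fastforce

lemma tspace_eqI:
 assumes "m \<in> tspace n r" "m' \<in> tspace n r" "\<And>mu. mu \<in> weights n r ==> hecke_coeff r (m mu) = hecke_coeff r (m' mu)"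
 shows "m = m'"
 by (rule extensionalityI[OF tspaceD(2)[OF assms(1)] tspaceD(2)[OF assms(2)]])
  (use hecke_coeff_inj[OF r2 tspace_closed[OF assms(1)] tspace_closed[OF assms(2)]] assms(3) in blast)

lemma tspace_add_apply: "mu \<in> weights n r ==> tspace_add n r m m' mu = m mu \<oplus>\<^bsub>hecke r\<^esub> m' mu"
 and tspace_act_apply: "mu \<in> weights n r ==> tspace_act n r m h mu = m mu \<odot> h"
 and tspace_inj_apply: "mu \<in> weights n r ==> tspace_inj n r nu y mu = (if mu = nu then y else \<zero>\<^bsub>hecke r\<^esub>)"
 by (simp_all add: tspace_add_def tspace_act_def tspace_inj_def)

lemma tspace_add_closed:
 assumes "m \<in> tspace n r" "m' \<in> tspace n r"
 shows "tspace_add n r m m' \<in> tspace n r"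
proof (rule tspaceI)
 fix mu assume mu: "mu \<in> weights n r"
 obtain h h' where h: "h \<in> carrier (hecke r)" "m mu = xx mu \<odot> h" "h' \<in> carrier (hecke r)" "m' mu = xx mu \<odot> h'"
  using tspaceD(1)[OF assms(1) mu] tspaceD(1)[OF assms(2) mu] by blast
 hence "tspace_add n r m m' mu = xx mu \<odot> (h \<oplus>\<^bsub>hecke r\<^esub> h')"
  using xx_closed[OF mu] by (simp add: tspace_add_apply[OF mu] H.r_distr)
 thus "\<exists>h\<in>carrier (hecke r). tspace_add n r m m' mu = xx mu \<odot> h" using h by blast
qed (simp add: tspace_add_def)

lemma tspace_act_closed:
 assumes "m \<in> tspace n r" "g \<in> carrier (hecke r)"
 shows "tspace_act n r m g \<in> tspace n r"
proof (rule tspaceI)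
 fix mu assume mu: "mu \<in> weights n r"
 obtain h where h: "h \<in> carrier (hecke r)" "m mu = xx mu \<odot> h" using tspaceD(1)[OF assms(1) mu] by blast
 hence "tspace_act n r m g mu = xx mu \<odot> (h \<odot> g)"
  using xx_closed[OF mu] assms(2) by (simp add: tspace_act_apply[OF mu] H.m_assoc)
 thus "\<exists>h\<in>carrier (hecke r). tspace_act n r m g mu = xx mu \<odot> h" using h assms(2) by blast
qed (simp add: tspace_act_def)

lemma tspace_inj_closed:
 assumes "nu \<in> weights n r" "h \<in> carrier (hecke r)"
 shows "tspace_inj n r nu (xx nu \<odot> h) \<in> tspace n r"
proof (rule tspaceI)
 fix mu assume mu: "mu \<in> weights n r"
 show "\<exists>g\<in>carrier (hecke r). tspace_inj n r nu (xx nu \<odot> h) mu = xx mu \<odot> g"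
 proof (cases "mu = nu")
  case True
  thus ?thesis using assms(2) unfolding tspace_inj_apply[OF mu] by (intro bexI[of _ h]) simp_all
 next
  case False
  thus ?thesis using H.r_null[OF xx_closed[OF mu]] unfolding tspace_inj_apply[OF mu]
   by (intro bexI[of _ "\<zero>\<^bsub>hecke r\<^esub>"]) simp_all
 qed
qed (simp add: tspace_inj_def)

lemma tspace_inj_x: "nu \<in> weights n r ==> tspace_inj n r nu (xx nu) \<in> tspace n r"
 using tspace_inj_closed[of nu "\<one>\<^bsub>hecke r\<^esub>"] xx_closed[of nu] by simp

lemma tspace_inj_act:
 assumes "nu \<in> weights n r" "h \<in> carrier (hecke r)"
 shows "tspace_inj n r nu (xx nu \<odot> h) = tspace_act n r (tspace_inj n r nu (xx nu)) h"
 unfolding tspace_inj_def tspace_act_def using assms(2) by (auto simp: fun_eq_iff restrict_def)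

lemma schur_coeff_inj:
 assumes s: "s \<in> carrier (schurB n r)" and mu: "mu \<in> weights n r" and ka: "ka \<in> weights n r" and h: "h \<in> carrier (hecke r)"
 shows "hecke_coeff r (s (tspace_inj n r mu (xx mu \<odot> h)) ka) = hecke_act r h (schur_coeff n r s ka mu)"
proof -
 have c: "s (tspace_inj n r mu (xx mu)) ka \<in> carrier (hecke r)"
  by (rule tspace_closed[OF schurB_maps[OF s tspace_inj_x[OF mu]] ka])
 show ?thesis
  unfolding tspace_inj_act[OF mu h] schurB_act_hom[OF s tspace_inj_x[OF mu] h] tspace_act_apply[OF ka]
   hecke_coeff_mult[OF r2 c h] schur_coeff_def ..
qed

text \<open>
 Endomorphisms are additive for two summands only, so the decomposition into components is built up
 one weight at a time.
\<close>

lemma schur_sum: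
 assumes s: "s \<in> carrier (schurB n r)" and m: "m \<in> tspace n r" and ka: "ka \<in> weights n r"
  and S: "S \<subseteq> weights n r"
 shows "hecke_coeff r (s (\<lambda>mu\<in>weights n r. if mu \<in> S then m mu else \<zero>\<^bsub>hecke r\<^esub>) ka)
  = (\<Sum>mu\<in>S. hecke_coeff r (s (tspace_inj n r mu (m mu)) ka))"
 using finite_subset[OF S finite_weights] S
proof (induction S rule: finite_induct)
 let ?r = "\<lambda>S. (\<lambda>mu\<in>weights n r. if mu \<in> S then m mu else \<zero>\<^bsub>hecke r\<^esub>)"
 have rc: "?r S \<in> tspace n r" for S
 proof (rule tspaceI)
  fix mu assume mu: "mu \<in> weights n r"
  show "\<exists>h\<in>carrier (hecke r). ?r S mu = xx mu \<odot> h"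
  proof (cases "mu \<in> S")
   case True
   thus ?thesis using tspaceD(1)[OF m mu] mu by simp
  next
   case False
   thus ?thesis using H.r_null[OF xx_closed[OF mu]] mu by (intro bexI[of _ "\<zero>\<^bsub>hecke r\<^esub>"]) simp_all
  qed
 qed simp
 {
  case empty
  have e: "tspace_add n r (?r {}) (?r {}) = ?r {}"
   unfolding tspace_add_def by (auto simp: fun_eq_iff restrict_def)
  have c: "s (?r {}) ka \<in> carrier (hecke r)" by (rule tspace_closed[OF schurB_maps[OF s rc] ka])
  have "s (?r {}) ka = s (?r {}) ka \<oplus>\<^bsub>hecke r\<^esub> s (?r {}) ka"
  proof -
   have "s (?r {}) = tspace_add n r (s (?r {})) (s (?r {}))"
    using schurB_add_hom[OF s rc[of "{}"] rc[of "{}"]] unfolding e .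
   from fun_cong[OF this, of ka] show ?thesis unfolding tspace_add_apply[OF ka] .
  qed
  hence "s (?r {}) ka = \<zero>\<^bsub>hecke r\<^esub>" using H.add.r_cancel_one'[OF c c] by simp
  thus ?case using hecke_coeff_zero[OF r2] by (simp only: sum.empty)
 next
  case (insert nu S)
  have nu: "nu \<in> weights n r" using insert.prems by blast
  obtain h where h: "h \<in> carrier (hecke r)" "m nu = xx nu \<odot> h" using tspaceD(1)[OF m nu] by blast
  have ic: "tspace_inj n r nu (m nu) \<in> tspace n r" unfolding h(2) by (rule tspace_inj_closed[OF nu h(1)])
  have e: "?r (insert nu S) = tspace_add n r (tspace_inj n r nu (m nu)) (?r S)"
  proof (rule extensionalityI[of _ "weights n r"])
   fix mu assume mu: "mu \<in> weights n r"
   show "?r (insert nu S) mu = tspace_add n r (tspace_inj n r nu (m nu)) (?r S) mu"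
    unfolding tspace_add_apply[OF mu] tspace_inj_apply[OF mu]
    using insert.hyps(2) tspace_closed[OF m mu] mu by (cases "mu = nu") simp_all
  qed (simp_all add: tspace_add_def)
  have c: "s (tspace_inj n r nu (m nu)) ka \<in> carrier (hecke r)" "s (?r S) ka \<in> carrier (hecke r)"
   by (rule tspace_closed[OF schurB_maps[OF s ic] ka], rule tspace_closed[OF schurB_maps[OF s rc] ka])
  have IH: "hecke_coeff r (s (?r S) ka) = (\<Sum>mu\<in>S. hecke_coeff r (s (tspace_inj n r mu (m mu)) ka))"
   using insert by blast
  show ?case
   unfolding e schurB_add_hom[OF s ic rc] tspace_add_apply[OF ka] hecke_coeff_add[OF r2 c] sum.insert[OF insert.hyps] IH ..
 }
qed

text \<open>
 The generators determine an endomorphism; its values elsewhere are given by the Hecke action on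
 the coefficient functions.
\<close>

lemma schur_apply:
 assumes s: "s \<in> carrier (schurB n r)" and m: "m \<in> tspace n r" and ka: "ka \<in> weights n r"
  and h: "\<And>mu. mu \<in> weights n r ==> h mu \<in> carrier (hecke r)" "\<And>mu. mu \<in> weights n r ==> m mu = xx mu \<odot> h mu"
 shows "hecke_coeff r (s m ka) = (\<Sum>mu\<in>weights n r. hecke_act r (h mu) (schur_coeff n r s ka mu))"
proof -
 have e: "(\<lambda>mu\<in>weights n r. if mu \<in> weights n r then m mu else \<zero>\<^bsub>hecke r\<^esub>) = m"
  by (rule extensionalityI[OF _ tspaceD(2)[OF m]]) simp_all
 have "hecke_coeff r (s m ka) = (\<Sum>mu\<in>weights n r. hecke_coeff r (s (tspace_inj n r mu (m mu)) ka))"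
  using schur_sum[OF s m ka subset_refl] unfolding e .
 also have "\<dots> = (\<Sum>mu\<in>weights n r. hecke_act r (h mu) (schur_coeff n r s ka mu))"
  by (intro sum.cong refl) (simp only: h(2) schur_coeff_inj[OF s _ ka h(1)])
 finally show ?thesis .
qed

lemma schur_eqI:
 assumes s: "s \<in> carrier (schurB n r)" "s' \<in> carrier (schurB n r)"
  and eq: "\<And>ka mu. ka \<in> weights n r ==> mu \<in> weights n r ==> schur_coeff n r s ka mu = schur_coeff n r s' ka mu"
 shows "s = s'"
proof (rule extensionalityI[of s "tspace n r"])
 show "s \<in> extensional (tspace n r)" "s' \<in> extensional (tspace n r)"
  using s unfolding schurB_carrier by (auto simp: PiE_def)
 fix m assume m: "m \<in> tspace n r"
 obtain h where h: "\<And>mu. mu \<in> weights n r ==> h mu \<in> carrier (hecke r)"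
  "\<And>mu. mu \<in> weights n r ==> m mu = xx mu \<odot> h mu" using tspace_choose[OF m] by blast
 show "s m = s' m"
 proof (rule tspace_eqI[OF schurB_maps[OF s(1) m] schurB_maps[OF s(2) m]])
  fix ka assume ka: "ka \<in> weights n r"
  show "hecke_coeff r (s m ka) = hecke_coeff r (s' m ka)"
  proof -
   have "(\<Sum>mu\<in>weights n r. hecke_act r (h mu) (schur_coeff n r s ka mu)) = (\<Sum>mu\<in>weights n r. hecke_act r (h mu) (schur_coeff n r s' ka mu))"
    by (rule sum.cong[OF refl]) (simp only: eq[OF ka])
   thus ?thesis using schur_apply[OF s(1) m ka h] schur_apply[OF s(2) m ka h] by simp
  qed
 qed
qed

lemma schur_coeff_left_inv:
 assumes s: "s \<in> carrier (schurB n r)" and mu: "mu \<in> weights n r" and ka: "ka \<in> weights n r"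
 shows "schur_coeff n r s ka mu \<in> left_inv n r ka"
proof -
 obtain h where h: "h \<in> carrier (hecke r)" "s (tspace_inj n r mu (xx mu)) ka = xx ka \<odot> h"
  using tspaceD(1)[OF schurB_maps[OF s tspace_inj_x[OF mu]] ka] by blast
 show ?thesis unfolding schur_coeff_def h(2) by (rule hecke_x_mult_left_inv[OF r2 ka h(1)])
qed

text \<open>
 For \<open>s\<^sub>i\<close> in the parabolic subgroup, \<open>T\<^sub>i\<close> multiplies the generator by its parameter, hence also
 the image of the generator.
\<close>

lemma schur_coeff_right_inv:
 assumes s: "s \<in> carrier (schurB n r)" and mu: "mu \<in> weights n r" and ka: "ka \<in> weights n r"
 shows "schur_coeff n r s ka mu \<in> right_inv n r mu"
proof -
 have sp: "schur_coeff n r s ka mu \<in> coeffs r" by (rule left_inv_space[OF schur_coeff_left_inv[OF assms]])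
 have "\<forall>w\<in>WB r. schur_coeff n r s ka mu (w o srefl r i) = schur_coeff n r s ka mu w"
  if i: "i \<in> {1..r}" and p: "srefl r i \<in> parabolic n r mu" for i
 proof -
  have "hecke_act r (hecke_gen r i) (schur_coeff n r s ka mu) = hecke_act r (hecke_scalar r (par r i)) (schur_coeff n r s ka mu)"
   using schur_coeff_inj[OF s mu ka hecke_gen_closed[OF r2 i]] schur_coeff_inj[OF s mu ka hecke_scalar_closed[OF r2, of "par r i"]]
   unfolding hecke_x_mult_gen[OF r2 mu i p] by simp
  thus ?thesis
   unfolding hecke_gen_act[OF r2 i sp] hecke_scalar_act[OF r2 sp] right_inv_iff[OF sp i] .
 qed
 thus ?thesis using sp unfolding right_inv_def by blast
qed

lemma hecke_act_zero: "phi \<in> coeffs r ==> hecke_act r \<zero>\<^bsub>hecke r\<^esub> phi = 0"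
proof -
 assume phi: "phi \<in> coeffs r"
 have "0 \<in> carrier (free_algebra r)" by (simp add: free_algebra_carrier)
 from hecke_act_class[OF r2 this phi] show ?thesis unfolding hecke_class_zero[OF r2] by (simp only: free_act_zero)
qed

lemma hecke_act_one: "phi \<in> coeffs r ==> hecke_act r \<one>\<^bsub>hecke r\<^esub> phi = phi"
 using hecke_act_class[OF r2 single_carrier[of "[]" r 1]] unfolding hecke_class_one[OF r2] by (simp add: free_act_single)

text \<open>
 The components of the endomorphism send the product of a generator with \<open>h\<close> to \<open>phi h\<close>: right
 invariance makes this well defined, left invariance places it in the permutation module.
\<close>

lemma schur_exists:
 assumes phi: "\<And>ka mu. ka \<in> weights n r ==> mu \<in> weights n r ==> phi ka mu \<in> left_inv n r ka \<and> phi ka mu \<in> right_inv n r mu"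
 shows "\<exists>s\<in>carrier (schurB n r). \<forall>ka\<in>weights n r. \<forall>mu\<in>weights n r. schur_coeff n r s ka mu = phi ka mu"
proof -
 let ?L = "weights n r"
 (* hs selects a factor h for each component; its image under phi does not depend on the selection. *)
 define hs where "hs m mu = (SOME h. h \<in> carrier (hecke r) \<and> m mu = xx mu \<odot> h)" for m :: tspace_elem and mu
 have hs: "hs m mu \<in> carrier (hecke r)" "m mu = xx mu \<odot> hs m mu" if "m \<in> tspace n r" "mu \<in> ?L" for m mu
  using someI_ex[of "\<lambda>h. h \<in> carrier (hecke r) \<and> m mu = xx mu \<odot> h"] tspaceD(1)[OF that] unfolding hs_def by blast+
 define \<Theta> where "\<Theta> m ka = (\<Sum>mu\<in>?L. hecke_act r (hs m mu) (phi ka mu))" for m ka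
 have sp: "phi ka mu \<in> coeffs r" if "ka \<in> ?L" "mu \<in> ?L" for ka mu using phi[OF that] left_inv_space by blast
 have \<Theta>: "\<Theta> m ka = (\<Sum>mu\<in>?L. hecke_act r (h mu) (phi ka mu))"
  if m: "m \<in> tspace n r" and ka: "ka \<in> ?L" and h: "\<And>mu. mu \<in> ?L ==> h mu \<in> carrier (hecke r)" "\<And>mu. mu \<in> ?L ==> m mu = xx mu \<odot> h mu" for m ka h
  unfolding \<Theta>_def
 proof (intro sum.cong refl)
  fix mu assume mu: "mu \<in> ?L"
  have "xx mu \<odot> hs m mu = xx mu \<odot> h mu" using hs(2)[OF m mu] h(2)[OF mu] by simp
  thus "hecke_act r (hs m mu) (phi ka mu) = hecke_act r (h mu) (phi ka mu)"
   using right_inv_well_defined[OF r2 mu _ hs(1)[OF m mu] h(1)[OF mu]] phi[OF ka mu] by blast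
 qed
 have \<Theta>li: "\<Theta> m ka \<in> left_inv n r ka" if m: "m \<in> tspace n r" and ka: "ka \<in> ?L" for m ka
  unfolding \<Theta>_def
 proof (rule left_inv_sum)
  fix mu assume mu: "mu \<in> ?L"
  show "hecke_act r (hs m mu) (phi ka mu) \<in> left_inv n r ka"
   by (rule left_inv_act[OF r2 _ hs(1)[OF m mu]]) (use phi[OF ka mu] in blast)
 qed
 define y where "y m ka = (SOME z. (\<exists>h\<in>carrier (hecke r). z = xx ka \<odot> h) \<and> hecke_coeff r z = \<Theta> m ka)" for m ka
 have y: "\<exists>h\<in>carrier (hecke r). y m ka = xx ka \<odot> h" "hecke_coeff r (y m ka) = \<Theta> m ka"
  if m: "m \<in> tspace n r" and ka: "ka \<in> ?L" for m ka
 proof -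
  have "\<exists>z. (\<exists>h\<in>carrier (hecke r). z = xx ka \<odot> h) \<and> hecke_coeff r z = \<Theta> m ka"
   using left_inv_hecke_x[OF r2 ka \<Theta>li[OF m ka]] by blast
  from someI_ex[OF this] show "\<exists>h\<in>carrier (hecke r). y m ka = xx ka \<odot> h" "hecke_coeff r (y m ka) = \<Theta> m ka"
   unfolding y_def by blast+
 qed
 define s where "s = (\<lambda>m\<in>tspace n r. \<lambda>ka\<in>?L. y m ka)"
 have sm: "s m ka = y m ka" if "m \<in> tspace n r" "ka \<in> ?L" for m ka using that by (simp add: s_def)
 have smc: "s m \<in> tspace n r" if m: "m \<in> tspace n r" for m
  by (rule tspaceI) (use y(1)[OF m] sm[OF m] m in \<open>simp_all add: s_def\<close>)
 have sc: "hecke_coeff r (s m ka) = \<Theta> m ka" if "m \<in> tspace n r" "ka \<in> ?L" for m ka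
  using sm[OF that] y(2)[OF that] by simp
 have carrier: "s \<in> carrier (schurB n r)"
  unfolding schurB_carrier
 proof (intro conjI ballI)
  show "s \<in> tspace n r \<rightarrow>\<^sub>E tspace n r" using smc by (auto simp: PiE_def s_def)
  fix m assume m: "m \<in> tspace n r"
  show "s (tspace_add n r m m') = tspace_add n r (s m) (s m')" if m': "m' \<in> tspace n r" for m'
  proof (rule tspace_eqI[OF smc[OF tspace_add_closed[OF m m']] tspace_add_closed[OF smc[OF m] smc[OF m']]])
   fix ka assume ka: "ka \<in> ?L"
   have "hecke_coeff r (s (tspace_add n r m m') ka) = (\<Sum>mu\<in>?L. hecke_act r (hs m mu \<oplus>\<^bsub>hecke r\<^esub> hs m' mu) (phi ka mu))"
    unfolding sc[OF tspace_add_closed[OF m m'] ka]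
   proof (rule \<Theta>[OF tspace_add_closed[OF m m'] ka])
    fix mu assume mu: "mu \<in> ?L"
    show "hs m mu \<oplus>\<^bsub>hecke r\<^esub> hs m' mu \<in> carrier (hecke r)" using hs(1)[OF m mu] hs(1)[OF m' mu] by simp
    show "tspace_add n r m m' mu = xx mu \<odot> (hs m mu \<oplus>\<^bsub>hecke r\<^esub> hs m' mu)"
     unfolding H.r_distr[OF hs(1)[OF m mu] hs(1)[OF m' mu] xx_closed[OF mu]] tspace_add_apply[OF mu]
     using hs(2)[OF m mu] hs(2)[OF m' mu] by simp
   qed
   also have "\<dots> = \<Theta> m ka + \<Theta> m' ka"
    unfolding \<Theta>_def sum.distrib[symmetric]
    by (intro sum.cong refl hecke_act_add[OF r2] hs(1)[OF m] hs(1)[OF m'] sp[OF ka])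
   also have "\<dots> = hecke_coeff r (tspace_add n r (s m) (s m') ka)"
    unfolding tspace_add_apply[OF ka] hecke_coeff_add[OF r2 tspace_closed[OF smc[OF m] ka] tspace_closed[OF smc[OF m'] ka]]
     sc[OF m ka] sc[OF m' ka] ..
   finally show "hecke_coeff r (s (tspace_add n r m m') ka) = hecke_coeff r (tspace_add n r (s m) (s m') ka)" .
  qed
  show "s (tspace_act n r m g) = tspace_act n r (s m) g" if g: "g \<in> carrier (hecke r)" for g
  proof (rule tspace_eqI[OF smc[OF tspace_act_closed[OF m g]] tspace_act_closed[OF smc[OF m] g]])
   fix ka assume ka: "ka \<in> ?L"
   have "hecke_coeff r (s (tspace_act n r m g) ka) = (\<Sum>mu\<in>?L. hecke_act r (hs m mu \<odot> g) (phi ka mu))"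
    unfolding sc[OF tspace_act_closed[OF m g] ka]
   proof (rule \<Theta>[OF tspace_act_closed[OF m g] ka])
    fix mu assume mu: "mu \<in> ?L"
    show "hs m mu \<odot> g \<in> carrier (hecke r)" using hs(1)[OF m mu] g by simp
    show "tspace_act n r m g mu = xx mu \<odot> (hs m mu \<odot> g)"
     unfolding H.m_assoc[OF xx_closed[OF mu] hs(1)[OF m mu] g, symmetric] tspace_act_apply[OF mu]
     using hs(2)[OF m mu] by simp
   qed
   also have "\<dots> = hecke_act r g (\<Theta> m ka)"
    unfolding \<Theta>_def hecke_act_sum_right[OF r2]
    by (intro sum.cong refl hecke_act_mult[OF r2] hs(1)[OF m] g sp[OF ka])
   also have "\<dots> = hecke_coeff r (tspace_act n r (s m) g ka)"
    unfolding tspace_act_apply[OF ka] hecke_coeff_mult[OF r2 tspace_closed[OF smc[OF m] ka] g] sc[OF m ka] ..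
   finally show "hecke_coeff r (s (tspace_act n r m g) ka) = hecke_coeff r (tspace_act n r (s m) g ka)" .
  qed
 qed
 have "schur_coeff n r s ka mu = phi ka mu" if ka: "ka \<in> ?L" and mu: "mu \<in> ?L" for ka mu
 proof -
  let ?h = "\<lambda>nu. if nu = mu then \<one>\<^bsub>hecke r\<^esub> else \<zero>\<^bsub>hecke r\<^esub>"
  have "schur_coeff n r s ka mu = (\<Sum>nu\<in>?L. hecke_act r (?h nu) (phi ka nu))"
   unfolding schur_coeff_def sc[OF tspace_inj_x[OF mu] ka]
  proof (rule \<Theta>[OF tspace_inj_x[OF mu] ka])
   fix nu assume nu: "nu \<in> ?L"
   show "?h nu \<in> carrier (hecke r)" by simp
   show "tspace_inj n r mu (xx mu) nu = xx nu \<odot> ?h nu"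
    unfolding tspace_inj_apply[OF nu] using H.r_one[OF xx_closed[OF nu]] H.r_null[OF xx_closed[OF nu]]
    by (cases "nu = mu") simp_all
  qed
  also have "\<dots> = (\<Sum>nu\<in>?L. if nu = mu then phi ka nu else 0)"
  proof (rule sum.cong[OF refl])
   fix nu assume nu: "nu \<in> ?L"
   show "hecke_act r (?h nu) (phi ka nu) = (if nu = mu then phi ka nu else 0)"
    using hecke_act_one[OF sp[OF ka nu]] hecke_act_zero[OF sp[OF ka nu]] by (cases "nu = mu") simp_all
  qed
  also have "\<dots> = phi ka mu" using mu finite_weights by simp
  finally show ?thesis .
 qed
 thus ?thesis using carrier by blast
qed

lemma schurB_mult_closed:
 assumes "s \<in> carrier (schurB n r)" "s' \<in> carrier (schurB n r)"
 shows "s \<otimes>\<^bsub>schurB n r\<^esub> s' \<in> carrier (schurB n r)"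
 unfolding schurB_carrier schurB_simps
proof (intro conjI ballI)
 note sm = schurB_maps[OF assms(1)] schurB_maps[OF assms(2)]
 show "compose (tspace n r) s s' \<in> tspace n r \<rightarrow>\<^sub>E tspace n r" using sm by (auto simp: compose_def)
 fix m assume m: "m \<in> tspace n r"
 show "compose (tspace n r) s s' (tspace_add n r m m') = tspace_add n r (compose (tspace n r) s s' m) (compose (tspace n r) s s' m')"
  if m': "m' \<in> tspace n r" for m'
  using m m' sm by (simp add: compose_def tspace_add_closed schurB_add_hom[OF assms(1)] schurB_add_hom[OF assms(2)])
 show "compose (tspace n r) s s' (tspace_act n r m h) = tspace_act n r (compose (tspace n r) s s' m) h"
  if h: "h \<in> carrier (hecke r)" for h
  using m h sm by (simp add: compose_def tspace_act_closed schurB_act_hom[OF assms(1)] schurB_act_hom[OF assms(2)])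
qed

lemma schurB_one_closed: "\<one>\<^bsub>schurB n r\<^esub> \<in> carrier (schurB n r)"
 unfolding schurB_carrier by (simp add: tspace_add_closed tspace_act_closed)

lemma monoid_schurB: "monoid (schurB n r)"
proof (rule monoidI)
 fix s s' s'' assume c: "s \<in> carrier (schurB n r)" "s' \<in> carrier (schurB n r)" "s'' \<in> carrier (schurB n r)"
 show "s \<otimes>\<^bsub>schurB n r\<^esub> s' \<in> carrier (schurB n r)" by (rule schurB_mult_closed[OF c(1,2)])
 show "s \<otimes>\<^bsub>schurB n r\<^esub> s' \<otimes>\<^bsub>schurB n r\<^esub> s'' = s \<otimes>\<^bsub>schurB n r\<^esub> (s' \<otimes>\<^bsub>schurB n r\<^esub> s'')"
  using schurB_maps[OF c(3)] by (auto simp: compose_def fun_eq_iff restrict_def)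
 have e: "s \<in> extensional (tspace n r)" using c(1) unfolding schurB_carrier by (auto simp: PiE_def)
 show "\<one>\<^bsub>schurB n r\<^esub> \<otimes>\<^bsub>schurB n r\<^esub> s = s"
  by (rule extensionalityI[OF _ e]) (simp_all add: compose_def schurB_maps[OF c(1)])
 show "s \<otimes>\<^bsub>schurB n r\<^esub> \<one>\<^bsub>schurB n r\<^esub> = s"
  by (rule extensionalityI[OF _ e]) (simp_all add: compose_def)
qed (rule schurB_one_closed)

lemma tspace_add_swap:
 assumes "a \<in> tspace n r" "b \<in> tspace n r" "c \<in> tspace n r" "d \<in> tspace n r"
 shows "tspace_add n r (tspace_add n r a b) (tspace_add n r c d) = tspace_add n r (tspace_add n r a c) (tspace_add n r b d)"
 unfolding tspace_add_def
proof (rule restrict_ext)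
 fix mu assume mu: "mu \<in> weights n r"
 note cl = tspace_closed[OF assms(1) mu] tspace_closed[OF assms(2) mu] tspace_closed[OF assms(3) mu] tspace_closed[OF assms(4) mu]
 show "(\<lambda>mu\<in>weights n r. a mu \<oplus>\<^bsub>hecke r\<^esub> b mu) mu \<oplus>\<^bsub>hecke r\<^esub> (\<lambda>mu\<in>weights n r. c mu \<oplus>\<^bsub>hecke r\<^esub> d mu) mu
  = (\<lambda>mu\<in>weights n r. a mu \<oplus>\<^bsub>hecke r\<^esub> c mu) mu \<oplus>\<^bsub>hecke r\<^esub> (\<lambda>mu\<in>weights n r. b mu \<oplus>\<^bsub>hecke r\<^esub> d mu) mu"
  using mu cl by (simp add: H.a_ac)
qed

lemma schurB_add_closed:
 assumes "s \<in> carrier (schurB n r)" "s' \<in> carrier (schurB n r)"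
 shows "s \<oplus>\<^bsub>schurB n r\<^esub> s' \<in> carrier (schurB n r)"
 unfolding schurB_carrier schurB_simps
proof (intro conjI ballI)
 note sm = schurB_maps[OF assms(1)] schurB_maps[OF assms(2)]
 let ?t = "\<lambda>m\<in>tspace n r. tspace_add n r (s m) (s' m)"
 show "?t \<in> tspace n r \<rightarrow>\<^sub>E tspace n r" using sm tspace_add_closed by auto
 fix m assume m: "m \<in> tspace n r"
 show "?t (tspace_add n r m m') = tspace_add n r (?t m) (?t m')" if m': "m' \<in> tspace n r" for m'
  using m m' sm by (simp add: tspace_add_closed schurB_add_hom[OF assms(1)] schurB_add_hom[OF assms(2)] tspace_add_swap)
 show "?t (tspace_act n r m h) = tspace_act n r (?t m) h" if h: "h \<in> carrier (hecke r)" for h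
 proof -
  have "tspace_add n r (tspace_act n r (s m) h) (tspace_act n r (s' m) h) = tspace_act n r (tspace_add n r (s m) (s' m)) h"
   unfolding tspace_add_def tspace_act_def
   using h tspace_closed[OF sm(1)[OF m]] tspace_closed[OF sm(2)[OF m]] by (auto simp: fun_eq_iff restrict_def H.l_distr)
  thus ?thesis using m h sm
   by (simp add: tspace_act_closed schurB_act_hom[OF assms(1)] schurB_act_hom[OF assms(2)])
 qed
qed

lemma hecke_scalar_central: "h \<in> carrier (hecke r) ==> hecke_scalar r a \<odot> h = h \<odot> hecke_scalar r a"
proof (rule hecke_coeff_inj[OF r2])
 assume h: "h \<in> carrier (hecke r)"
 note sc = hecke_scalar_closed[OF r2, of a] and b = basis_id_space
 show "hecke_scalar r a \<odot> h \<in> carrier (hecke r)" "h \<odot> hecke_scalar r a \<in> carrier (hecke r)"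
  using h sc by auto
 show "hecke_coeff r (hecke_scalar r a \<odot> h) = hecke_coeff r (h \<odot> hecke_scalar r a)"
  unfolding hecke_coeff_mult[OF r2 sc h] hecke_coeff_mult[OF r2 h sc] hecke_scalar_act[OF r2 hecke_coeff_space[OF r2]]
  unfolding hecke_coeff_def hecke_scalar_act[OF r2 basis_id_space[OF r2]] hecke_act_scale_right[OF r2] ..
qed

lemma schurB_scalar_closed: "schurB_scalar n r a \<in> carrier (schurB n r)"
 unfolding schurB_carrier schurB_scalar_def
proof (intro conjI ballI)
 note sc = hecke_scalar_closed[OF r2, of a]
 let ?t = "\<lambda>m\<in>tspace n r. tspace_act n r m (hecke_scalar r a)"
 show "?t \<in> tspace n r \<rightarrow>\<^sub>E tspace n r" using tspace_act_closed[OF _ sc] by auto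
 fix m assume m: "m \<in> tspace n r"
 show "?t (tspace_add n r m m') = tspace_add n r (?t m) (?t m')" if m': "m' \<in> tspace n r" for m'
  using m m' tspace_add_closed[OF m m'] sc tspace_closed[OF m] tspace_closed[OF m']
  by (auto simp: fun_eq_iff tspace_add_def tspace_act_def restrict_def H.l_distr)
 show "?t (tspace_act n r m h) = tspace_act n r (?t m) h" if h: "h \<in> carrier (hecke r)" for h
  using m tspace_act_closed[OF m h] sc h tspace_closed[OF m] hecke_scalar_central[OF h, of a]
  by (auto simp: fun_eq_iff tspace_act_def restrict_def H.m_assoc)
qed

text \<open>
 The components of the image of a generator under \<open>s'\<close> are products of generators with elements
 \<open>h nu\<close>; composing with \<open>s\<close> lets these act on the coefficient functions of \<open>s\<close>.
\<close>

lemma schur_coeff_mult: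
 assumes s: "s \<in> carrier (schurB n r)" "s' \<in> carrier (schurB n r)" and ka: "ka \<in> weights n r" and mu: "mu \<in> weights n r"
 obtains h where "\<And>nu. nu \<in> weights n r ==> h nu \<in> carrier (hecke r)"
  "\<And>nu. nu \<in> weights n r ==> schur_coeff n r s' nu mu = hecke_act r (h nu) (set_fun (parabolic n r nu))"
  "schur_coeff n r (s \<otimes>\<^bsub>schurB n r\<^esub> s') ka mu = (\<Sum>nu\<in>weights n r. hecke_act r (h nu) (schur_coeff n r s ka nu))"
proof -
 let ?m = "s' (tspace_inj n r mu (xx mu))"
 have m: "?m \<in> tspace n r" by (rule schurB_maps[OF s(2) tspace_inj_x[OF mu]])
 obtain h where h: "\<And>nu. nu \<in> weights n r ==> h nu \<in> carrier (hecke r)"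
  "\<And>nu. nu \<in> weights n r ==> ?m nu = xx nu \<odot> h nu" using tspace_choose[OF m] by blast
 show ?thesis
 proof (rule that[OF h(1)])
  fix nu assume nu: "nu \<in> weights n r"
  show "schur_coeff n r s' nu mu = hecke_act r (h nu) (set_fun (parabolic n r nu))"
   unfolding schur_coeff_def h(2)[OF nu] hecke_coeff_mult[OF r2 xx_closed[OF nu] h(1)[OF nu]] hecke_x_coeff[OF r2 nu] ..
 next
  show "schur_coeff n r (s \<otimes>\<^bsub>schurB n r\<^esub> s') ka mu = (\<Sum>nu\<in>weights n r. hecke_act r (h nu) (schur_coeff n r s ka nu))"
  proof -
   have "schur_coeff n r (s \<otimes>\<^bsub>schurB n r\<^esub> s') ka mu = hecke_coeff r (s ?m ka)"
    using tspace_inj_x[OF mu] by (simp add: schur_coeff_def compose_def)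
   thus ?thesis using schur_apply[OF s(1) m ka h] by simp
  qed
 qed
qed

lemma schur_coeff_one:
 assumes "ka \<in> weights n r" "mu \<in> weights n r"
 shows "schur_coeff n r \<one>\<^bsub>schurB n r\<^esub> ka mu = (if ka = mu then set_fun (parabolic n r mu) else 0)"
 using tspace_inj_x[OF assms(2)] hecke_x_coeff[OF r2 assms(2)] hecke_coeff_zero[OF r2]
 by (simp add: schur_coeff_def tspace_inj_apply[OF assms(1)])

lemma schur_coeff_add:
 assumes "s \<in> carrier (schurB n r)" "s' \<in> carrier (schurB n r)" "ka \<in> weights n r" "mu \<in> weights n r"
 shows "schur_coeff n r (s \<oplus>\<^bsub>schurB n r\<^esub> s') ka mu = schur_coeff n r s ka mu + schur_coeff n r s' ka mu"
 using tspace_inj_x[OF assms(4)] tspace_closed[OF schurB_maps[OF assms(1) tspace_inj_x[OF assms(4)]] assms(3)]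
  tspace_closed[OF schurB_maps[OF assms(2) tspace_inj_x[OF assms(4)]] assms(3)]
 by (simp add: schur_coeff_def tspace_add_apply[OF assms(3)] hecke_coeff_add[OF r2])

lemma schur_coeff_scalar:
 assumes "s \<in> carrier (schurB n r)" "ka \<in> weights n r" "mu \<in> weights n r"
 shows "schur_coeff n r (schurB_scalar n r a \<otimes>\<^bsub>schurB n r\<^esub> s) ka mu = (\<lambda>w. a * schur_coeff n r s ka mu w)"
proof -
 note m = tspace_inj_x[OF assms(3)]
 have c: "s (tspace_inj n r mu (xx mu)) ka \<in> carrier (hecke r)"
  by (rule tspace_closed[OF schurB_maps[OF assms(1) m] assms(2)])
 have "schur_coeff n r (schurB_scalar n r a \<otimes>\<^bsub>schurB n r\<^esub> s) ka mu
   = hecke_coeff r (s (tspace_inj n r mu (xx mu)) ka \<odot> hecke_scalar r a)"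
  using m schurB_maps[OF assms(1) m] by (simp add: schur_coeff_def schurB_scalar_def compose_def tspace_act_apply[OF assms(2)])
 also have "\<dots> = (\<lambda>w. a * schur_coeff n r s ka mu w)"
  unfolding hecke_coeff_mult[OF r2 c hecke_scalar_closed[OF r2]] hecke_scalar_act[OF r2 hecke_coeff_space[OF r2]] schur_coeff_def ..
 finally show ?thesis .
qed

section \<open>The standard basis of the q-Schur algebra\<close>

lemma double_coset_cancel:
 assumes ka: "ka \<in> weights n r" and mu: "mu \<in> weights n r" and d: "d \<in> WB r"
 shows "u \<in> parabolic n r ka ==> u o w \<in> double_coset n r ka d mu \<longleftrightarrow> w \<in> double_coset n r ka d mu"
  and "v \<in> parabolic n r mu ==> w o v \<in> double_coset n r ka d mu \<longleftrightarrow> w \<in> double_coset n r ka d mu"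
proof -
 have l: "u o w \<in> double_coset n r ka d mu" if u: "u \<in> parabolic n r ka" and w: "w \<in> double_coset n r ka d mu" for u w
 proof -
  obtain u' v where "u' \<in> parabolic n r ka" "v \<in> parabolic n r mu" "w = u' o d o v" using w unfolding double_coset_def by blast
  hence "u o w = (u o u') o d o v" "u o u' \<in> parabolic n r ka" "v \<in> parabolic n r mu"
   using parabolic_comp[OF ka u] by (simp_all add: comp_assoc)
  thus ?thesis unfolding double_coset_def by blast
 qed
 have rr: "w o v \<in> double_coset n r ka d mu" if v: "v \<in> parabolic n r mu" and w: "w \<in> double_coset n r ka d mu" for v w
 proof -
  obtain u v' where "u \<in> parabolic n r ka" "v' \<in> parabolic n r mu" "w = u o d o v'" using w unfolding double_coset_def by blast
  hence "w o v = u o d o (v' o v)" "u \<in> parabolic n r ka" "v' o v \<in> parabolic n r mu"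
   using parabolic_comp[OF mu _ v] by (simp_all add: comp_assoc)
  thus ?thesis unfolding double_coset_def by blast
 qed
 show "u o w \<in> double_coset n r ka d mu \<longleftrightarrow> w \<in> double_coset n r ka d mu" if u: "u \<in> parabolic n r ka"
 proof
  assume "u o w \<in> double_coset n r ka d mu"
  from l[OF parabolic_inv[OF ka u] this] show "w \<in> double_coset n r ka d mu"
   unfolding comp_assoc[symmetric] inv_WB_comp(1)[OF parabolic_WB[OF ka u]] by simp
 qed (rule l[OF u])
 show "w o v \<in> double_coset n r ka d mu \<longleftrightarrow> w \<in> double_coset n r ka d mu" if v: "v \<in> parabolic n r mu"
 proof
  assume "w o v \<in> double_coset n r ka d mu"
  from rr[OF parabolic_inv[OF mu v] this] show "w \<in> double_coset n r ka d mu"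
   unfolding comp_assoc inv_WB_comp(2)[OF parabolic_WB[OF mu v]] by simp
 qed (rule rr[OF v])
qed

lemma double_coset_eq:
 assumes ka: "ka \<in> weights n r" and mu: "mu \<in> weights n r" and d: "d \<in> WB r" and e: "e \<in> double_coset n r ka d mu"
 shows "double_coset n r ka e mu = double_coset n r ka d mu"
proof -
 obtain u v where u: "u \<in> parabolic n r ka" and v: "v \<in> parabolic n r mu" and ee: "e = u o d o v" using e unfolding double_coset_def by blast
 have eW: "e \<in> WB r" by (rule double_coset_WB[OF assms])
 have self: "d \<in> double_coset n r ka d mu" for d
  unfolding double_coset_def
  by (intro CollectI exI[of _ id] conjI parabolic_id[OF ka] parabolic_id[OF mu]) simp
 have "d \<in> double_coset n r ka e mu"
  using self[of e] double_coset_cancel[OF ka mu eW] u v unfolding ee by blast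
 have sub: "double_coset n r ka a mu \<subseteq> double_coset n r ka b mu" if b: "b \<in> WB r" and "a \<in> double_coset n r ka b mu" for a b
 proof
  fix w assume "w \<in> double_coset n r ka a mu"
  then obtain u v where "u \<in> parabolic n r ka" "v \<in> parabolic n r mu" "w = u o a o v" unfolding double_coset_def by blast
  thus "w \<in> double_coset n r ka b mu" using that double_coset_cancel[OF ka mu b] by simp
 qed
 show ?thesis using sub[OF d e] sub[OF eW \<open>d \<in> double_coset n r ka e mu\<close>] by blast
qed

lemma double_coset_inv:
 assumes ka: "ka \<in> weights n r" and mu: "mu \<in> weights n r" and d: "d \<in> WB r"
 shows "set_fun (double_coset n r ka d mu) \<in> left_inv n r ka" "set_fun (double_coset n r ka d mu) \<in> right_inv n r mu"
proof -
 have sp: "set_fun (double_coset n r ka d mu) \<in> coeffs r"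
  by (rule set_fun_space) (use double_coset_WB[OF assms] in blast)
 show "set_fun (double_coset n r ka d mu) \<in> left_inv n r ka" "set_fun (double_coset n r ka d mu) \<in> right_inv n r mu"
  using sp double_coset_cancel[OF assms] by (auto intro!: left_invI right_invI simp: set_fun_def)
qed

text \<open>
 The endomorphism with a single non-zero entry, the indicator function of a double coset, satisfies
 the defining condition.  It is the only one, since the matrix determines weights and double coset.
\<close>

lemma schurB_basis_coeff:
 assumes ka: "ka \<in> weights n r" and mu: "mu \<in> weights n r" and w: "w \<in> WB r"
  and A: "A = coset_matrix n ka w mu"
 shows "schurB_basis n r A \<in> carrier (schurB n r)"
  and "ka' \<in> weights n r ==> nu \<in> weights n r ==> schur_coeff n r (schurB_basis n r A) ka' nu
   = (if ka' = ka \<and> nu = mu then set_fun (double_coset n r ka w mu) else 0)"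
proof -
 let ?D = "double_coset n r ka w mu"
 let ?T = "\<Oplus>\<^bsub>hecke r\<^esub>w\<in>?D. hecke_T r w"
 have DW: "?D \<subseteq> WB r" using double_coset_WB[OF ka mu w] by blast
 have wD: "w \<in> ?D" unfolding double_coset_def
  by (intro CollectI exI[of _ id] conjI parabolic_id[OF ka] parabolic_id[OF mu]) simp
 obtain d where d: "d \<in> ?D" "\<And>e. e \<in> ?D ==> weyl_length r d \<le> weyl_length r e"
  using arg_min_nat_lemma[of "\<lambda>d. d \<in> ?D" w "weyl_length r"] wD by blast
 have dW: "d \<in> WB r" using d(1) DW by blast
 have Dd: "double_coset n r ka d mu = ?D" by (rule double_coset_eq[OF ka mu w d(1)])
 have mind: "min_double_coset_rep n r ka d mu" unfolding min_double_coset_rep_def Dd using dW d(2) by blast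
 have Ad: "coset_matrix n ka d mu = A" unfolding A by (rule coset_matrix_double_coset[OF ka mu w d(1)])
 let ?phi = "\<lambda>ka' nu. if ka' = ka \<and> nu = mu then set_fun ?D else 0"
 let ?spec = "\<lambda>f ka mu d. \<forall>nu\<in>weights n r. \<forall>h\<in>carrier (hecke r).
     f (tspace_inj n r nu (hecke_x n r nu \<odot> h)) =
      tspace_inj n r ka
       (if mu = nu
        then (\<Oplus>\<^bsub>hecke r\<^esub>w\<in>double_coset n r ka d mu. hecke_T r w) \<odot> h
        else \<zero>\<^bsub>hecke r\<^esub>)"
 have Tc: "?T \<in> carrier (hecke r)" by (rule hecke_coeff_finsum_T(1)[OF r2 DW])
 obtain f where f: "f \<in> carrier (schurB n r)" "\<And>ka' nu. ka' \<in> weights n r ==> nu \<in> weights n r ==> schur_coeff n r f ka' nu = ?phi ka' nu"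
 proof -
  have "(0 :: (nat => nat) => int poly) \<in> right_inv n r nu" for nu by (simp add: right_inv_def coeffs_zero fun_apply)
  hence "?phi ka' nu \<in> left_inv n r ka' \<and> ?phi ka' nu \<in> right_inv n r nu" for ka' nu
   using double_coset_inv[OF ka mu w] left_inv_zero by (cases "ka' = ka \<and> nu = mu") simp_all
  from schur_exists[OF this] show ?thesis using that by blast
 qed
 have fspec: "?spec f ka mu d"
 proof (intro ballI)
  fix nu h assume nu: "nu \<in> weights n r" and h: "h \<in> carrier (hecke r)"
  let ?y = "if mu = nu then (\<Oplus>\<^bsub>hecke r\<^esub>w\<in>double_coset n r ka d mu. hecke_T r w) \<odot> h else \<zero>\<^bsub>hecke r\<^esub>"
  let ?m = "f (tspace_inj n r nu (xx nu \<odot> h))"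
  have m: "?m \<in> tspace n r" by (rule schurB_maps[OF f(1) tspace_inj_closed[OF nu h]])
  have yc: "?y \<in> carrier (hecke r)" using Tc h unfolding Dd by auto
  show "?m = tspace_inj n r ka ?y"
  proof (rule extensionalityI[OF tspaceD(2)[OF m]])
   show "tspace_inj n r ka ?y \<in> extensional (weights n r)" by (simp add: tspace_inj_def)
   fix ka' assume ka': "ka' \<in> weights n r"
   show "?m ka' = tspace_inj n r ka ?y ka'"
   proof (rule hecke_coeff_inj[OF r2 tspace_closed[OF m ka']])
    show "tspace_inj n r ka ?y ka' \<in> carrier (hecke r)" unfolding tspace_inj_apply[OF ka'] using yc by simp
    show "hecke_coeff r (?m ka') = hecke_coeff r (tspace_inj n r ka ?y ka')"
     unfolding schur_coeff_inj[OF f(1) nu ka' h] f(2)[OF ka' nu] tspace_inj_apply[OF ka'] Dd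
     using hecke_coeff_mult[OF r2 Tc h] hecke_coeff_finsum_T(2)[OF r2 DW] hecke_coeff_zero[OF r2] hecke_act_zero_right[OF r2, of h]
     by auto
   qed
  qed
 qed
 have uniq: "f' = f" if P: "\<exists>ka\<in>weights n r. \<exists>mu\<in>weights n r. \<exists>d.
    min_double_coset_rep n r ka d mu \<and> coset_matrix n ka d mu = A \<and> f' \<in> carrier (schurB n r) \<and> ?spec f' ka mu d" for f'
 proof -
  obtain ka1 mu1 d1 where 1: "ka1 \<in> weights n r" "mu1 \<in> weights n r" "min_double_coset_rep n r ka1 d1 mu1"
   "coset_matrix n ka1 d1 mu1 = A" "f' \<in> carrier (schurB n r)" "?spec f' ka1 mu1 d1" using P by blast
  have d1: "d1 \<in> WB r" using 1(3) by (simp add: min_double_coset_rep_def)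
  note E = coset_matrix_eq_imp[OF ka mu dW 1(1,2) d1, unfolded Ad 1(4), OF refl]
  have DD: "double_coset n r ka1 d1 mu1 = double_coset n r ka d mu"
   unfolding E(1,2) by (rule double_coset_eq[OF ka mu dW E(3)])
  show "f' = f"
  proof (rule schur_eqI[OF 1(5) f(1)])
   fix ka' nu assume ka': "ka' \<in> weights n r" and nu: "nu \<in> weights n r"
   have x1: "xx nu \<odot> \<one>\<^bsub>hecke r\<^esub> = xx nu" using xx_closed[OF nu] by simp
   have "f' (tspace_inj n r nu (xx nu \<odot> \<one>\<^bsub>hecke r\<^esub>)) = f (tspace_inj n r nu (xx nu \<odot> \<one>\<^bsub>hecke r\<^esub>))"
    using 1(6)[rule_format, OF nu H.one_closed] fspec[rule_format, OF nu H.one_closed] unfolding E(1,2) DD[unfolded E(1,2)] by simp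
   thus "schur_coeff n r f' ka' nu = schur_coeff n r f ka' nu" unfolding x1 schur_coeff_def by simp
  qed
 qed
 have "schurB_basis n r A = f"
  unfolding schurB_basis_def
 proof (rule the_equality)
  show "\<exists>ka\<in>weights n r. \<exists>mu\<in>weights n r. \<exists>d.
    min_double_coset_rep n r ka d mu \<and> coset_matrix n ka d mu = A \<and> f \<in> carrier (schurB n r) \<and> ?spec f ka mu d"
   using ka mu mind Ad f(1) fspec by blast
 qed (rule uniq)
 thus "schurB_basis n r A \<in> carrier (schurB n r)"
  "ka' \<in> weights n r ==> nu \<in> weights n r ==> schur_coeff n r (schurB_basis n r A) ka' nu
   = (if ka' = ka \<and> nu = mu then set_fun ?D else 0)" using f by simp_all
qed

end

section \<open>Hyperbolic frames\<close>


lemma orth_form_add_left: "orth_form r (x + y) z = orth_form r x z + orth_form r y z"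
 by (simp add: orth_form_def fun_apply distrib_right sum.distrib)

lemma orth_form_scale_left: "orth_form r (fun_scale c x) z = c * orth_form r x z"
 by (simp add: orth_form_def fun_scale_def sum_distrib_left mult.assoc)

lemma orth_form_sym: "orth_form r x y = orth_form r y x"
 unfolding orth_form_def
 by (rule sum.reindex_bij_witness[of _ "\<lambda>i. 2*r + 1 - i" "\<lambda>i. 2*r + 1 - i"]) (auto simp: mult.commute)

lemma orth_form_add_right: "orth_form r z (x + y) = orth_form r z x + orth_form r z y"
 using orth_form_add_left[of r x y z] by (simp only: orth_form_sym)

lemma orth_form_scale_right: "orth_form r z (fun_scale c x) = c * orth_form r z x"
 using orth_form_scale_left[of r c x z] by (simp only: orth_form_sym)

lemma orth_form_zero [simp]: "orth_form r 0 x = 0" "orth_form r x 0 = 0"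
 by (simp_all add: orth_form_def fun_apply)

lemma orth_form_diff_left: "orth_form r (x - y) z = orth_form r x z - orth_form r y z"
 by (simp add: orth_form_def left_diff_distrib sum_subtractf)

lemma orth_form_diff_right: "orth_form r z (x - y) = orth_form r z x - orth_form r z y"
 by (simp add: orth_form_def right_diff_distrib sum_subtractf)

lemma orth_form_sum_left: "orth_form r (\<Sum>a\<in>A. x a) z = (\<Sum>a\<in>A. orth_form r (x a) z)"
 by (induction A rule: infinite_finite_induct) (simp_all add: orth_form_add_left)

lemmas orth_form_linear = orth_form_add_left orth_form_scale_left orth_form_diff_left orth_form_sum_left
 orth_form_add_right orth_form_scale_right orth_form_diff_right

lemma fun_scale_apply: "fun_scale c v i = c * v i" by (simp add: fun_scale_def)

lemma coord_space_subspace: "fun_space.subspace (coord_space d)"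
 by (rule fun_space.subspaceI) (auto simp: coord_space_def fun_scale_apply fun_apply)

lemma coord_space_closed:
 "x \<in> coord_space d ==> y \<in> coord_space d ==> x + y \<in> coord_space d"
 "x \<in> coord_space d ==> y \<in> coord_space d ==> x - y \<in> coord_space d"
 "x \<in> coord_space d ==> fun_scale c x \<in> coord_space d"
 "(\<And>a. a \<in> A ==> f a \<in> coord_space d) ==> (\<Sum>a\<in>A. f a) \<in> coord_space d"
 "0 \<in> coord_space d"
 using coord_space_subspace[of d]
 by (auto intro: fun_space.subspace_add fun_space.subspace_diff fun_space.subspace_scale fun_space.subspace_sum fun_space.subspace_0)

text \<open>A hyperbolic basis, indexed so that \<open>a\<close> and \<open>2*r + 1 - a\<close> are dual to each other.\<close>

definition frame :: "nat => (nat => nat => 'f::{field,finite}) => bool" where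
 "frame r e \<longleftrightarrow> (\<forall>a\<in>{1..2*r}. e a \<in> coord_space (2*r)) \<and>
   (\<forall>a\<in>{1..2*r}. \<forall>b\<in>{1..2*r}. orth_form r (e a) (e b) = (if a + b = 2*r + 1 then 1 else 0))"

text \<open>Coordinates are values of the form against the dual basis vector.\<close>

definition coord :: "nat => (nat => nat => 'f::{field,finite}) => (nat => 'f) => nat => 'f" where
 "coord r e v a = orth_form r v (e (2*r + 1 - a))"

definition fspan :: "nat => (nat => nat => 'f::{field,finite}) => nat set => (nat => 'f) set" where
 "fspan r e A = {v \<in> coord_space (2*r). \<forall>a\<in>{1..2*r} - A. coord r e v a = 0}"

lemma frame_space: "frame r e ==> a \<in> {1..2*r} ==> e a \<in> coord_space (2*r)"
 by (simp add: frame_def)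

lemma frame_form: "frame r e ==> a \<in> {1..2*r} ==> b \<in> {1..2*r} ==>
  orth_form r (e a) (e b) = (if a + b = 2*r + 1 then 1 else 0)"
 by (simp add: frame_def)

lemma coord_basis:
 "frame r e ==> a \<in> {1..2*r} ==> b \<in> {1..2*r} ==> coord r e (e b) a = (if a = b then 1 else 0)"
 unfolding coord_def by (subst frame_form) auto

lemma coord_linear:
 "coord r e (x + y) a = coord r e x a + coord r e y a"
 "coord r e (x - y) a = coord r e x a - coord r e y a"
 "coord r e (fun_scale c x) a = c * coord r e x a"
 "coord r e (\<Sum>i\<in>I. f i) a = (\<Sum>i\<in>I. coord r e (f i) a)"
 "coord r e 0 a = 0"
 by (simp_all add: coord_def orth_form_linear)

lemma coord_comb:
 assumes "frame r e" "A \<subseteq> {1..2*r}" "a \<in> {1..2*r}"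
 shows "coord r e (\<Sum>b\<in>A. fun_scale (c b) (e b)) a = (if a \<in> A then c a else 0)"
proof -
 have fin: "finite A" using assms(2) finite_subset by blast
 have "coord r e (\<Sum>b\<in>A. fun_scale (c b) (e b)) a = (\<Sum>b\<in>A. c b * (if a = b then 1 else 0))"
  unfolding coord_linear
  by (rule sum.cong) (use assms coord_basis[OF assms(1,3)] in auto)
 also have "\<dots> = (if a \<in> A then c a else 0)" using fin by (simp add: if_distrib[of "\<lambda>x. _ * x"] cong: if_cong)
 finally show ?thesis .
qed

lemma frame_comb_space:
 assumes "frame r e" "A \<subseteq> {1..2*r}"
 shows "(\<Sum>b\<in>A. fun_scale (c b) (e b)) \<in> coord_space (2*r)"
 by (rule coord_space_closed(4)) (use assms frame_space coord_space_closed(3) in blast)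

lemma finite_coord_space: "finite (coord_space d :: (nat => 'f::{field,finite}) set)"
 and card_coord_space: "card (coord_space d :: (nat => 'f::{field,finite}) set) = card (UNIV :: 'f set) ^ d"
proof -
 have b: "bij_betw (\<lambda>v. restrict v {1..d}) (coord_space d) ({1..d} \<rightarrow>\<^sub>E (UNIV :: 'f set))"
  by (rule bij_betwI[where g = "\<lambda>c i. if i \<in> {1..d} then c i else 0"])
   (auto simp: coord_space_def fun_eq_iff PiE_def extensional_def)
 have f: "finite ({1..d} \<rightarrow>\<^sub>E (UNIV :: 'f set))" by (rule finite_PiE) auto
 show "finite (coord_space d :: (nat => 'f) set)" using bij_betw_finite[OF b] f by blast
 show "card (coord_space d :: (nat => 'f) set) = card (UNIV :: 'f set) ^ d"
  using bij_betw_same_card[OF b] by (simp add: card_PiE)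
qed

text \<open>A hyperbolic frame is linearly independent, so over a finite field it spans by counting.\<close>

lemma frame_expansion:
 fixes e :: "nat => nat => 'f::{field,finite}"
 assumes e: "frame r e" and v: "v \<in> coord_space (2*r)"
 shows "v = (\<Sum>a\<in>{1..2*r}. fun_scale (coord r e v a) (e a))"
proof -
 let ?C = "{1..2*r} \<rightarrow>\<^sub>E (UNIV :: 'f set)"
 let ?f = "\<lambda>c. \<Sum>a\<in>{1..2*r}. fun_scale (c a) (e a)"
 have inj: "inj_on ?f ?C"
 proof (rule inj_onI)
  fix c d assume c: "c \<in> ?C" "d \<in> ?C" "?f c = ?f d"
  show "c = d"
  proof (rule extensionalityI[of c "{1..2*r}"])
   fix a assume a: "a \<in> {1..2*r}"
   show "c a = d a" using arg_cong[OF c(3), of "\<lambda>x. coord r e x a"]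
    unfolding coord_comb[OF e subset_refl a] using a by simp
  qed (use c(1,2) in \<open>auto simp: PiE_def\<close>)
 qed
 have sub: "?f ` ?C \<subseteq> coord_space (2*r)" using frame_comb_space[OF e subset_refl] by blast
 have "card (?f ` ?C) = card (coord_space (2*r) :: (nat => 'f) set)"
  unfolding card_image[OF inj] card_coord_space by (simp add: card_PiE)
 hence "?f ` ?C = coord_space (2*r)" using card_subset_eq[OF finite_coord_space sub] by blast
 then obtain c where c: "v = ?f c" using v by blast
 have "coord r e v a = c a" if "a \<in> {1..2*r}" for a
  unfolding c coord_comb[OF e subset_refl that] using that by simp
 hence "(\<Sum>a\<in>{1..2*r}. fun_scale (coord r e v a) (e a)) = ?f c" by (intro sum.cong) auto
 thus ?thesis using c by simp
qed

lemma frame_eqI: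
 assumes "frame r e" "v \<in> coord_space (2*r)" "w \<in> coord_space (2*r)"
  "\<And>a. a \<in> {1..2*r} ==> coord r e v a = coord r e w a"
 shows "v = w"
proof -
 have "(\<Sum>a\<in>{1..2*r}. fun_scale (coord r e v a) (e a)) = (\<Sum>a\<in>{1..2*r}. fun_scale (coord r e w a) (e a))"
  by (rule sum.cong) (use assms(4) in auto)
 thus ?thesis using frame_expansion[OF assms(1,2)] frame_expansion[OF assms(1,3)] by simp
qed

lemma fspan_space: "fspan r e A \<subseteq> coord_space (2*r)"
 by (auto simp: fspan_def)

lemma fspan_subspace: "fun_space.subspace (fspan r e A)"
 by (rule fun_space.subspaceI) (auto simp: fspan_def coord_linear coord_space_closed)

lemmas fspan_closed =
 fun_space.subspace_add[OF fspan_subspace] fun_space.subspace_diff[OF fspan_subspace]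
 fun_space.subspace_scale[OF fspan_subspace] fun_space.subspace_sum[OF fspan_subspace]
 fun_space.subspace_0[OF fspan_subspace]

lemma fspan_basis: "frame r e ==> a \<in> A ==> a \<in> {1..2*r} ==> e a \<in> fspan r e A"
 by (auto simp: fspan_def frame_space coord_basis)

lemma fspan_basis_iff: "frame r e ==> a \<in> {1..2*r} ==> e a \<in> fspan r e A \<longleftrightarrow> a \<in> A"
 by (auto simp: fspan_def frame_space coord_basis)

lemma fspan_UNIV: "{1..2*r} \<subseteq> A ==> fspan r e A = coord_space (2*r)"
 by (auto simp: fspan_def)

lemma fspan_Int: "fspan r e A \<inter> fspan r e B = fspan r e (A \<inter> B)"
 by (auto simp: fspan_def)

lemma fspan_mono: "A \<subseteq> B ==> fspan r e A \<subseteq> fspan r e B"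
 by (auto simp: fspan_def)

lemma fspan_expansion:
 assumes e: "frame r e" and A: "A \<subseteq> {1..2*r}" and v: "v \<in> fspan r e A"
 shows "v = (\<Sum>a\<in>A. fun_scale (coord r e v a) (e a))"
proof -
 have vs: "v \<in> coord_space (2*r)" using v fspan_space by blast
 have "(\<Sum>a\<in>A. fun_scale (coord r e v a) (e a)) = (\<Sum>a\<in>{1..2*r}. fun_scale (coord r e v a) (e a))"
  by (rule sum.mono_neutral_left) (use A v in \<open>auto simp: fspan_def\<close>)
 thus ?thesis using frame_expansion[OF e vs] by simp
qed

lemma fspan_empty:
 shows "frame r e ==> fspan r e {} = {0}"
 using fspan_expansion[of r e "{}"] fspan_closed(5)[of r e "{}"] by auto

lemma fspan_least:
 assumes e: "frame r e" and A: "A \<subseteq> {1..2*r}" and U: "fun_space.subspace U" and sub: "\<And>a. a \<in> A ==> e a \<in> U"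
 shows "fspan r e A \<subseteq> U"
proof
 fix v assume v: "v \<in> fspan r e A"
 show "v \<in> U"
  by (subst fspan_expansion[OF e A v])
   (intro fun_space.subspace_sum[OF U] fun_space.subspace_scale[OF U] sub)
qed

lemma fspan_sum:
 assumes e: "frame r e" and A: "A \<subseteq> {1..2*r}" and B: "B \<subseteq> {1..2*r}"
 shows "{u + v | u v. u \<in> fspan r e A \<and> v \<in> fspan r e B} = fspan r e (A \<union> B)"
proof
 show "{u + v | u v. u \<in> fspan r e A \<and> v \<in> fspan r e B} \<subseteq> fspan r e (A \<union> B)"
  using fspan_mono[of A "A \<union> B" r e] fspan_mono[of B "A \<union> B" r e] fspan_closed(1) by blast
 show "fspan r e (A \<union> B) \<subseteq> {u + v | u v. u \<in> fspan r e A \<and> v \<in> fspan r e B}"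
 proof (rule fspan_least[OF e])
  show "A \<union> B \<subseteq> {1..2*r}" using A B by blast
  have "{u + v | u v. u \<in> fspan r e A \<and> v \<in> fspan r e B} = {x + y |x y. x \<in> fspan r e A \<and> y \<in> fspan r e B}" by blast
  show "fun_space.subspace {u + v | u v. u \<in> fspan r e A \<and> v \<in> fspan r e B}"
   by (rule fun_space.subspace_sums) (rule fspan_subspace)+
  fix a assume "a \<in> A \<union> B"
  thus "e a \<in> {u + v | u v. u \<in> fspan r e A \<and> v \<in> fspan r e B}"
  proof
   assume a: "a \<in> A"
   hence "e a = e a + 0 \<and> e a \<in> fspan r e A \<and> 0 \<in> fspan r e B"
    using fspan_basis[OF e a] A fspan_closed(5) by auto
   thus ?thesis by blast
  next
   assume a: "a \<in> B"
   hence "e a = 0 + e a \<and> 0 \<in> fspan r e A \<and> e a \<in> fspan r e B"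
    using fspan_basis[OF e a] B fspan_closed(5) by auto
   thus ?thesis by blast
  qed
 qed
qed

lemma fspan_perp:
 fixes e :: "nat => nat => 'f::{field,finite}"
 assumes e: "frame r e" and A: "A \<subseteq> {1..2*r}"
 shows "perp r (fspan r e A) = fspan r e {a. 2*r + 1 - a \<notin> A}"
proof (rule Set.set_eqI)
 fix y :: "nat => 'f"
 have "(\<forall>x\<in>fspan r e A. orth_form r x y = 0) \<longleftrightarrow> (\<forall>b\<in>A. orth_form r (e b) y = 0)"
 proof
  assume *: "\<forall>b\<in>A. orth_form r (e b) y = 0"
  show "\<forall>x\<in>fspan r e A. orth_form r x y = 0"
  proof
   fix x assume x: "x \<in> fspan r e A"
   have "orth_form r x y = orth_form r (\<Sum>a\<in>A. fun_scale (coord r e x a) (e a)) y"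
    using fspan_expansion[OF e A x] by simp
   thus "orth_form r x y = 0" using * by (simp add: orth_form_linear)
  qed
 qed (use fspan_basis[OF e] A in blast)
 also have "\<dots> \<longleftrightarrow> (\<forall>a\<in>{1..2*r} - {a. 2*r + 1 - a \<notin> A}. coord r e y a = 0)"
 proof
  assume *: "\<forall>b\<in>A. orth_form r (e b) y = 0"
  thus "\<forall>a\<in>{1..2*r} - {a. 2*r + 1 - a \<notin> A}. coord r e y a = 0"
   by (auto simp: coord_def orth_form_sym[of r y])
 next
  assume *: "\<forall>a\<in>{1..2*r} - {a. 2*r + 1 - a \<notin> A}. coord r e y a = 0"
  show "\<forall>b\<in>A. orth_form r (e b) y = 0"
  proof
   fix b assume b: "b \<in> A"
   have "b \<in> {1..2*r}" using b A by blast
   hence b': "2*r + 1 - (2*r + 1 - b) = b" "2*r + 1 - b \<in> {1..2*r}" by auto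
   hence "coord r e y (2*r + 1 - b) = 0" using bspec[OF *, of "2*r + 1 - b"] b by simp
   with b'(1) show "orth_form r (e b) y = 0" by (simp add: coord_def orth_form_sym[of r y])
  qed
 qed
 finally show "y \<in> perp r (fspan r e A) \<longleftrightarrow> y \<in> fspan r e {a. 2*r + 1 - a \<notin> A}"
  by (auto simp: perp_def fspan_def)
qed

lemma frame_inj_on:
 fixes e :: "nat => nat => 'f::{field,finite}"
 assumes e: "frame r e"
 shows "inj_on e {1..2*r}"
proof (rule inj_onI)
 fix a b assume ab: "a \<in> {1..2*r}" "b \<in> {1..2*r}" "e a = e b"
 have "coord r e (e b) a = (1::'f)" unfolding ab(3)[symmetric] coord_basis[OF e ab(1,1)] by simp
 thus "a = b" unfolding coord_basis[OF e ab(1,2)] by (simp split: if_splits)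
qed

lemma fspan_dim:
 assumes e: "frame r e" and A: "A \<subseteq> {1..2*r}"
 shows "fun_space.dim (fspan r e A) = card A"
proof (rule fun_space.dim_unique[of "e ` A"])
 have inj: "inj_on e A" by (rule inj_on_subset[OF frame_inj_on[OF e] A])
 have fin: "finite A" using A finite_subset by blast
 show "e ` A \<subseteq> fspan r e A" using fspan_basis[OF e] A by blast
 show "fspan r e A \<subseteq> fun_space.span (e ` A)"
  by (rule fspan_least[OF e A fun_space.subspace_span]) (rule fun_space.span_base, simp)
 show "card (e ` A) = card A" by (rule card_image[OF inj])
 show "fun_space.independent (e ` A)"
 proof (rule fun_space.independent_if_scalars_zero)
  fix f x assume 0: "(\<Sum>x\<in>e ` A. fun_scale (f x) x) = 0" and x: "x \<in> e ` A"
  then obtain a where a: "a \<in> A" "x = e a" by blast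
  have "(\<Sum>b\<in>A. fun_scale (f (e b)) (e b)) = 0" using 0 by (simp add: sum.reindex[OF inj])
  hence "coord r e (\<Sum>b\<in>A. fun_scale (f (e b)) (e b)) a = 0" by (simp only: coord_linear)
  thus "f x = 0" using coord_comb[OF e A, of a] a A by auto
 qed (simp add: fin)
qed

lemma fspan_card:
 fixes e :: "nat => nat => 'f::{field,finite}"
 assumes e: "frame r e" and A: "A \<subseteq> {1..2*r}"
 shows "card (fspan r e A) = card (UNIV :: 'f set) ^ card A"
proof -
 have fin: "finite A" using A finite_subset by blast
 have "bij_betw (\<lambda>c. \<Sum>a\<in>A. fun_scale (c a) (e a)) (A \<rightarrow>\<^sub>E (UNIV :: 'f set)) (fspan r e A)"
 proof (rule bij_betwI[where g = "\<lambda>v. restrict (coord r e v) A"])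
  show "(\<lambda>c. \<Sum>a\<in>A. fun_scale (c a) (e a)) \<in> (A \<rightarrow>\<^sub>E (UNIV :: 'f set)) \<rightarrow> fspan r e A"
   by (auto simp: fspan_def coord_comb[OF e A] frame_comb_space[OF e A])
  show "(\<lambda>v. restrict (coord r e v) A) \<in> fspan r e A \<rightarrow> (A \<rightarrow>\<^sub>E (UNIV :: 'f set))" by auto
  show "restrict (coord r e (\<Sum>a\<in>A. fun_scale (c a) (e a))) A = c" if "c \<in> A \<rightarrow>\<^sub>E (UNIV :: 'f set)" for c
   by (rule extensionalityI[of _ A]) (use that A in \<open>auto simp: coord_comb[OF e A] PiE_def\<close>)
  show "(\<Sum>a\<in>A. fun_scale (restrict (coord r e v) A a) (e a)) = v" if "v \<in> fspan r e A" for v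
   using fspan_expansion[OF e A that] by (simp cong: sum.cong)
 qed
 from bij_betw_same_card[OF this] show ?thesis using fin by (simp add: card_PiE)
qed

lemma frame_comp:
 assumes e: "frame r e" and w: "w \<in> WB r"
 shows "frame r (e o w)"
proof -
 have "orth_form r (e (w a)) (e (w b)) = (if a + b = 2*r + 1 then 1 else 0)" if ab: "a \<in> {1..2*r}" "b \<in> {1..2*r}" for a b
 proof -
  have "w a + w b = 2*r + 1 \<longleftrightarrow> a + b = 2*r + 1"
  proof -
   have "w a + w b = 2*r + 1 \<longleftrightarrow> w b = w (2*r + 1 - a)" using WB_mirror[OF w, of a] WB_range[OF w, of a] ab(1) by auto
   thus ?thesis using ab unfolding WB_inj[OF w] by auto
  qed
  thus ?thesis using frame_form[OF e] WB_range[OF w] ab by auto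
 qed
 thus ?thesis using frame_space[OF e] WB_range[OF w] unfolding frame_def by simp
qed

lemma coord_comp:
 assumes "w \<in> WB r" "a \<in> {1..2*r}"
 shows "coord r (e o w) v a = coord r e v (w a)"
 unfolding coord_def using WB_mirror[OF assms(1), of a] assms(2) by simp

lemma fspan_comp:
 assumes w: "w \<in> WB r"
 shows "fspan r (e o w) A = fspan r e (w ` A)"
proof -
 have "(\<forall>a\<in>{1..2*r} - A. coord r (e o w) v a = 0) \<longleftrightarrow> (\<forall>a\<in>{1..2*r} - w ` A. coord r e v a = 0)" for v
 proof -
  have "{1..2*r} - w ` A = w ` ({1..2*r} - A)"
   using inj_on_image_set_diff[of w UNIV "{1..2*r}" A] bij_betw_WB[OF w] WB_inj[OF w] unfolding bij_betw_def inj_on_def by auto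
  hence "(\<forall>a\<in>{1..2*r} - w ` A. coord r e v a = 0) \<longleftrightarrow> (\<forall>a\<in>{1..2*r} - A. coord r e v (w a) = 0)" by simp
  moreover have "(\<forall>a\<in>{1..2*r} - A. coord r (e o w) v a = 0) \<longleftrightarrow> (\<forall>a\<in>{1..2*r} - A. coord r e v (w a) = 0)"
   by (rule ball_cong[OF refl]) (simp add: coord_comp[OF w])
  ultimately show ?thesis by blast
 qed
 thus ?thesis unfolding fspan_def by simp
qed

section \<open>Complete isotropic flags and their relative position\<close>

definition full_flag :: "nat => (nat => nat => 'f::{field,finite}) => 'f flag" where
 "full_flag r e i = fspan r e {1..i}"

lemma fspan_cong: "A \<inter> {1..2*r} = B \<inter> {1..2*r} ==> fspan r e A = fspan r e B"
 unfolding fspan_def by blast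

lemma full_flag_mono: "i \<le> j ==> full_flag r e i \<subseteq> full_flag r e j"
 unfolding full_flag_def by (rule fspan_mono) auto

lemma full_flag_perp:
 assumes e: "frame r e" and i: "i \<le> 2*r"
 shows "perp r (full_flag r e i) = full_flag r e (2*r - i)"
proof -
 have "{1..i} \<subseteq> {1..2*r}" using i by auto
 show ?thesis unfolding full_flag_def fspan_perp[OF e \<open>{1..i} \<subseteq> {1..2*r}\<close>]
  by (rule fspan_cong) (use i in auto)
qed

lemma full_flag_eqI_at:
 assumes e: "frame r e" and f: "frame r f" and i: "i \<le> 2*r"
  and sub: "\<And>a. 1 \<le> a ==> a \<le> i ==> f a \<in> full_flag r e i"
 shows "full_flag r f i = full_flag r e i"
proof (rule card_subset_eq)
 have A: "{1..i} \<subseteq> {1..2*r}" using i by auto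
 show "finite (full_flag r e i)"
  unfolding full_flag_def by (rule finite_subset[OF fspan_space finite_coord_space])
 show "full_flag r f i \<subseteq> full_flag r e i"
  unfolding full_flag_def
  by (rule fspan_least[OF f A fspan_subspace]) (use sub in \<open>auto simp: full_flag_def\<close>)
 show "card (full_flag r f i) = card (full_flag r e i)"
  unfolding full_flag_def fspan_card[OF e A] fspan_card[OF f A] ..
qed

text \<open>The steps above \<open>r\<close> are the orthogonal complements of those below.\<close>

lemma full_flag_eqI:
 assumes e: "frame r e" and f: "frame r f" and eq: "\<And>i. i \<le> r ==> full_flag r f i = full_flag r e i"
 shows "full_flag r f = full_flag r e"
proof
 fix i
 consider "i \<le> r" | "r < i" "i \<le> 2*r" | "2*r < i" by linarith
 thus "full_flag r f i = full_flag r e i"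
 proof cases
  case 2
  have "perp r (full_flag r f (2*r - i)) = perp r (full_flag r e (2*r - i))" using eq[of "2*r - i"] 2 by simp
  thus ?thesis using full_flag_perp[OF f, of "2*r - i"] full_flag_perp[OF e, of "2*r - i"] 2 by simp
 next
  case 3
  thus ?thesis unfolding full_flag_def by (subst (1 2) fspan_UNIV) auto
 qed (rule eq)
qed

lemma full_flag_0:
 shows "frame r e ==> full_flag r e 0 = {0}"
 by (simp add: full_flag_def fspan_empty)

text \<open>
 Exchanges the basis vector at \<open>a\<close> for \<open>v\<close> and corrects the others by multiples of the dual vector, so
 that they become orthogonal to \<open>v\<close>.
\<close>

definition frame_move :: "nat => (nat => nat => 'f::{field,finite}) => nat => (nat => 'f) => nat => nat => 'f" where
 "frame_move r e a v b =
  (if b = a then v else if b = 2*r + 1 - a then e b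
   else e b - fun_scale (orth_form r v (e b)) (e (2*r + 1 - a)))"

lemma frame_move_frame:
 assumes e: "frame r e" and a: "a \<in> {1..2*r}" and v: "v \<in> coord_space (2*r)" "orth_form r v v = 0"
  and va: "orth_form r v (e (2*r + 1 - a)) = 1"
 shows "frame r (frame_move r e a v)"
proof -
 let ?a = "2*r + 1 - a"
 have a': "?a \<in> {1..2*r}" "?a \<noteq> a" using a by auto presburger
 have sv: "orth_form r (e b) v = orth_form r v (e b)" for b by (rule orth_form_sym)
 have ff: "orth_form r (e ?a) (e b) = (if b = a then 1 else 0)" "orth_form r (e b) (e ?a) = (if b = a then 1 else 0)"
  if "b \<in> {1..2*r}" for b
  using frame_form[OF e a'(1) that] frame_form[OF e that a'(1)] a that by auto
 have "orth_form r (frame_move r e a v b) (frame_move r e a v c) = (if b + c = 2*r + 1 then 1 else 0)"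
  if b: "b \<in> {1..2*r}" and c: "c \<in> {1..2*r}" for b c
 proof -
  have bc: "b = a ==> (b + c = 2*r + 1) = (c = ?a)" "c = a ==> (b + c = 2*r + 1) = (b = ?a)"
   "b = ?a ==> (b + c = 2*r + 1) = (c = a)" "c = ?a ==> (b + c = 2*r + 1) = (b = a)" using a b c by auto
  consider "b = a" "c = a" | "b = a" "c = ?a" | "b = a" "c \<noteq> a" "c \<noteq> ?a"
   | "b = ?a" "c = a" | "b = ?a" "c \<noteq> a" | "b \<noteq> a" "b \<noteq> ?a" "c = a" | "b \<noteq> a" "b \<noteq> ?a" "c = ?a"
   | "b \<noteq> a" "b \<noteq> ?a" "c \<noteq> a" "c \<noteq> ?a" by blast
  thus ?thesis
  proof cases
   case 1 thus ?thesis using bc(1) v a' by (simp add: frame_move_def)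
  next
   case 2 thus ?thesis using bc(1) va a' by (simp add: frame_move_def)
  next
   case 3 thus ?thesis using bc(1) va a' by (simp add: frame_move_def orth_form_linear)
  next
   case 4 thus ?thesis using bc(3) va a' by (simp add: frame_move_def sv)
  next
   case 5 thus ?thesis using bc(3) a' ff[OF c] ff[OF a'(1)] by (simp add: frame_move_def orth_form_linear)
  next
   case 6 thus ?thesis using bc(2) va a' by (simp add: frame_move_def orth_form_linear sv)
  next
   case 7 thus ?thesis using bc(4) a' ff[OF b] ff[OF a'(1)] by (simp add: frame_move_def orth_form_linear)
  next
   case 8 thus ?thesis using a' ff[OF b] ff[OF c] ff[OF a'(1)] frame_form[OF e b c]
    by (simp add: frame_move_def orth_form_linear)
  qed
 qed
 moreover have "frame_move r e a v b \<in> coord_space (2*r)" if "b \<in> {1..2*r}" for b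
  unfolding frame_move_def
  by (simp add: v(1) frame_space[OF e that] frame_space[OF e a'(1)] coord_space_closed(2,3) del: One_nat_def)
 ultimately show ?thesis unfolding frame_def by blast
qed

text \<open>The corrections only involve basis vectors of earlier steps, because \<open>v\<close> itself lies in step \<open>a\<close>.\<close>

lemma frame_move_flag:
 assumes e: "frame r e" and a: "a \<in> {1..2*r}" and v: "v \<in> full_flag r e a" "orth_form r v v = 0"
  and va: "orth_form r v (e (2*r + 1 - a)) = 1"
 shows "frame r (frame_move r e a v)" "full_flag r (frame_move r e a v) = full_flag r e"
proof -
 have vs: "v \<in> coord_space (2*r)" using v(1) fspan_space unfolding full_flag_def by blast
 show m: "frame r (frame_move r e a v)" by (rule frame_move_frame[OF e a vs v(2) va])
 show "full_flag r (frame_move r e a v) = full_flag r e"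
 proof (rule full_flag_eqI[OF e m])
  fix i assume i: "i \<le> r"
  show "full_flag r (frame_move r e a v) i = full_flag r e i"
  proof (rule full_flag_eqI_at[OF e m])
   show "i \<le> 2*r" using i by simp
   fix b assume b: "1 \<le> b" "b \<le> i"
   have b': "b \<in> {1..2*r}" using b i by simp
   have eb: "e b \<in> full_flag r e i" unfolding full_flag_def using fspan_basis[OF e _ b'] b by simp
   consider "b = a" | "b \<noteq> a" "b = 2*r + 1 - a" | "b \<noteq> a" "b \<noteq> 2*r + 1 - a" "2*r + 1 - a \<le> b"
    | "b \<noteq> a" "b \<noteq> 2*r + 1 - a" "b < 2*r + 1 - a" by linarith
   thus "frame_move r e a v b \<in> full_flag r e i"
   proof cases
    case 1 thus ?thesis using v(1) full_flag_mono[of a i r e] b by (auto simp: frame_move_def)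
   next
    case 2 thus ?thesis using eb by (simp add: frame_move_def)
   next
    case 3
    have "e (2*r + 1 - a) \<in> full_flag r e i"
     unfolding full_flag_def by (rule fspan_basis[OF e]) (use 3 a b i in auto)
    hence "e b - fun_scale (orth_form r v (e b)) (e (2*r + 1 - a)) \<in> full_flag r e i"
     using eb unfolding full_flag_def by (intro fspan_closed(2) fspan_closed(3))
    thus ?thesis using 3 by (simp add: frame_move_def)
   next
    case 4
    have "coord r e v (2*r + 1 - b) = 0"
    proof -
     have "2*r + 1 - b \<in> {1..2*r} - {1..a}" using 4 b' a by auto
     thus ?thesis using v(1) unfolding full_flag_def fspan_def by blast
    qed
    hence "orth_form r v (e b) = 0" using b' by (simp add: coord_def)
    thus ?thesis using 4 eb by (simp add: frame_move_def)
   qed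
  qed
 qed
qed

lemma frame_move_comp:
 assumes w: "w \<in> WB r" and a: "a \<in> {1..2*r}"
 shows "frame_move r (e o w) a v = frame_move r e (w a) v o w"
proof
 fix b
 have m: "w (2*r + 1 - a) = 2*r + 1 - w a" using WB_mirror[OF w, of a] a by auto
 have "w b = w (2*r + 1 - a) \<longleftrightarrow> b = 2*r + 1 - a" unfolding WB_inj[OF w] ..
 thus "frame_move r (e o w) a v b = (frame_move r e (w a) v o w) b"
  unfolding frame_move_def comp_apply WB_inj[OF w] m[symmetric] by simp
qed

lemma WB_swap:
 assumes c: "c \<in> {1..2*r}" and a: "a \<in> {1..2*r}"
 obtains \<tau> where "\<tau> \<in> WB r" "\<tau> c = a" "\<And>b. b \<notin> {c, a, 2*r + 1 - c, 2*r + 1 - a} ==> \<tau> b = b"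
proof -
 define a' c' where "a' = 2*r + 1 - a" and "c' = 2*r + 1 - c"
 have ac: "a' = 2*r + 1 - a" "c' = 2*r + 1 - c" "a + a' = 2*r + 1" "c + c' = 2*r + 1" "a \<noteq> a'" "c \<noteq> c'"
  using a c unfolding a'_def c'_def by (auto, presburger+)
 (* Exchanges a with c and their mirror images; the two exchanges coincide if a mirrors c. *)
 define \<tau> where "\<tau> b = (if b = c then a else if b = a then c
  else if b = a' then c' else if b = c' then a' else b)" for b
 have cs: "(a = c \<and> a' = c' \<and> a \<noteq> a') \<or> (a = c' \<and> c = a' \<and> a \<noteq> a') \<or> distinct [a, a', c, c']"
  using ac(3-6) by (cases "a = c"; cases "a = c'") auto
 have inv: "\<tau> (\<tau> b) = b" for b using cs unfolding \<tau>_def by fastforce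
 have mirror: "\<tau> b + \<tau> (2*r + 1 - b) = 2*r + 1" if b: "b \<in> {1..2*r}" for b
 proof -
  define b' where "b' = 2*r + 1 - b"
  have bb: "b + b' = 2*r + 1" using b unfolding b'_def by auto
  have b's: "b' = c \<longleftrightarrow> b = c'" "b' = a \<longleftrightarrow> b = a'" "b' = a' \<longleftrightarrow> b = a" "b' = c' \<longleftrightarrow> b = c"
   using ac(3,4) bb by linarith+
  have "\<tau> b + \<tau> b' = 2*r + 1"
  proof -
   consider "b = c" | "b = a" "b \<noteq> c" | "b = a'" "b \<noteq> a" "b \<noteq> c" | "b = c'" "b \<noteq> a" "b \<noteq> c" "b \<noteq> a'"
    | "b \<notin> {a, c, a', c'}" by blast
   thus ?thesis
   proof cases
    case 1
    have "\<tau> b = a" "\<tau> b' = a'" using cs 1 b's unfolding \<tau>_def by auto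
    thus ?thesis using ac(3) by simp
   next
    case 2
    have "\<tau> b = c" "\<tau> b' = c'" using cs 2 b's unfolding \<tau>_def by auto
    thus ?thesis using ac(4) by simp
   next
    case 3
    have "\<tau> b = c'" "\<tau> b' = c" using cs 3 b's unfolding \<tau>_def by auto
    thus ?thesis using ac(4) by simp
   next
    case 4
    have "\<tau> b = a'" "\<tau> b' = a" using cs 4 b's unfolding \<tau>_def by auto
    thus ?thesis using ac(3) by simp
   next
    case 5
    have "\<tau> b = b" "\<tau> b' = b'" using 5 b's unfolding \<tau>_def by auto
    thus ?thesis using bb by simp
   qed
  qed
  thus ?thesis unfolding b'_def .
 qed
 have out: "\<tau> b = b" if "b \<notin> {1..2*r}" for b using that a c unfolding \<tau>_def a'_def c'_def by auto
 have "bij \<tau>" by (rule bijI') (metis inv)+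
 hence "\<tau> permutes {1..2*r}" using out by (simp add: permutes_def bij_iff)
 hence "\<tau> \<in> WB r" using mirror by (simp add: WB_iff)
 moreover have "\<tau> c = a" by (simp add: \<tau>_def)
 moreover have "\<tau> b = b" if "b \<notin> {c, a, 2*r + 1 - c, 2*r + 1 - a}" for b using that by (auto simp: \<tau>_def a'_def c'_def)
 ultimately show ?thesis using that by blast
qed

text \<open>
 An isotropic vector orthogonal to step \<open>k\<close> of the second flag can be made its next basis vector
 without changing the first flag: among the basis vectors that occur in \<open>v\<close> outside step \<open>k\<close>,
 exchange the one that is highest in the first flag.
\<close>

lemma frame_step:
 assumes g: "frame r g" and w: "w \<in> WB r" and k: "k < r" and v: "v \<in> coord_space (2*r)" "orth_form r v v = 0"
  and orth: "\<And>x. x \<in> full_flag r (g o w) k ==> orth_form r v x = 0" and out: "v \<notin> full_flag r (g o w) k"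
 obtains g' w' d u where "frame r g'" "w' \<in> WB r" "full_flag r g' = full_flag r g"
  "\<And>j. j \<le> k ==> full_flag r (g' o w') j = full_flag r (g o w) j"
  "d \<noteq> 0" "u \<in> full_flag r (g o w) k" "(g' o w') (k + 1) = fun_scale d (v - u)"
proof -
 define h where "h = g o w"
 have h: "frame r h" unfolding h_def by (rule frame_comp[OF g w])
 let ?c = "coord r h v"
 have basis: "h b \<in> full_flag r h k" if "b \<in> {1..k}" for b
  unfolding full_flag_def by (rule fspan_basis[OF h that]) (use that k in auto)
 have c0: "?c a = 0" if "2*r - k < a" "a \<le> 2*r" for a
  unfolding coord_def by (rule orth[folded h_def], rule basis) (use that k in auto)
 let ?S = "{a \<in> {k+1..2*r - k}. ?c a \<noteq> 0}"
 have "\<exists>a\<in>{1..2*r} - {1..k}. ?c a \<noteq> 0"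
  using out v(1) unfolding h_def[symmetric] full_flag_def fspan_def by blast
 then obtain a1 where "a1 \<in> {1..2*r} - {1..k}" "?c a1 \<noteq> 0" by blast
 moreover from this have "a1 \<le> 2*r - k" using c0[of a1] by force
 ultimately have ne: "?S \<noteq> {}" by (intro ex_in_conv[THEN iffD1] exI[of _ a1]) auto
 have fin: "finite ?S" by simp
 (* Taking the index highest in the first flag keeps v0 inside step w a of that flag. *)
 define a where "a = arg_max_on w ?S"
 have aS: "a \<in> ?S" and amax: "\<And>b. b \<in> ?S ==> w b \<le> w a"
 proof -
  have "Max (w ` ?S) \<in> w ` ?S" using fin ne by (intro Max_in) auto
  then obtain a0 where a0: "a0 \<in> ?S" "w a0 = Max (w ` ?S)" by (metis (no_types, lifting) imageE)
  have "is_arg_max w (\<lambda>x. x \<in> ?S) a0"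
   unfolding is_arg_max_linorder using a0 Max_ge[of "w ` ?S"] fin by auto
  hence "is_arg_max w (\<lambda>x. x \<in> ?S) a" unfolding a_def arg_max_on_def arg_max_def by (rule someI)
  thus "a \<in> ?S" "\<And>b. b \<in> ?S ==> w b \<le> w a" unfolding is_arg_max_linorder by blast+
 qed
 have ar: "a \<in> {1..2*r}" "k < a" "k < 2*r + 1 - a" and ca: "?c a \<noteq> 0" using aS k by auto
 define u where "u = (\<Sum>b\<in>{1..k}. fun_scale (?c b) (h b))"
 have kA: "{1..k} \<subseteq> {1..2*r}" using k by auto
 have u: "u \<in> full_flag r h k"
  unfolding u_def full_flag_def by (intro fspan_closed(4) fspan_closed(3)) (use basis in \<open>auto simp: full_flag_def\<close>)
 have us: "u \<in> coord_space (2*r)" using u fspan_space unfolding full_flag_def by blast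
 have cu: "coord r h u b = (if b \<in> {1..k} then ?c b else 0)" if "b \<in> {1..2*r}" for b
  unfolding u_def by (rule coord_comb[OF h kA that])
 have uu: "orth_form r u x = 0" if "x \<in> full_flag r h k" for x
 proof -
  have "full_flag r h k \<subseteq> perp r (full_flag r h k)"
   unfolding full_flag_perp[OF h, of k, OF less_imp_le[OF less_le_trans[OF k]], simplified] by (rule full_flag_mono) (use k in simp)
  thus ?thesis using that u unfolding perp_def by blast
 qed
 define v0 where "v0 = fun_scale (1 / ?c a) (v - u)"
 have v0s: "v0 \<in> coord_space (2*r)" unfolding v0_def by (intro coord_space_closed v us)
 have v0: "orth_form r v0 v0 = 0"
  unfolding v0_def using v(2) orth[folded h_def, OF u] uu[OF u] orth_form_sym[of r u v] by (simp add: orth_form_linear)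
 have c1: "coord r h v0 b = (if b \<in> {1..k} then 0 else ?c b / ?c a)" if "b \<in> {1..2*r}" for b
  unfolding v0_def coord_linear cu[OF that] by simp
 have v0f: "v0 \<in> full_flag r g (w a)"
  unfolding full_flag_def fspan_def
 proof (intro CollectI conjI v0s ballI)
  fix x assume x: "x \<in> {1..2*r} - {1..w a}"
  obtain b where b: "b \<in> {1..2*r}" "x = w b" using bij_betw_WB[OF w] x unfolding bij_betw_def by blast
  have "coord r g v0 x = coord r h v0 b" unfolding h_def b(2) coord_comp[OF w b(1)] ..
  also have "\<dots> = 0"
  proof (cases "b \<in> {1..k}")
   case False
   have "b \<notin> ?S" using amax[of b] x b by auto
   hence "?c b = 0" using c0[of b] False b(1) by force
   thus ?thesis using c1[OF b(1)] by simp
  qed (simp add: c1[OF b(1)])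
  finally show "coord r g v0 x = 0" .
 qed
 have wa: "w a \<in> {1..2*r}" using WB_range[OF w, of a] ar by simp
 have v0a: "orth_form r v0 (g (2*r + 1 - w a)) = 1"
 proof -
  have "coord r h v0 a = 1" using c1[OF ar(1)] ca ar by simp
  thus ?thesis unfolding h_def coord_comp[OF w ar(1)] unfolding coord_def .
 qed
 let ?g = "frame_move r g (w a) v0"
 note mv = frame_move_flag[OF g wa v0f v0 v0a]
 have gh: "?g o w = frame_move r h a v0" unfolding h_def by (rule frame_move_comp[OF w ar(1), symmetric])
 have low: "(?g o w) b = h b" if b: "b \<in> {1..k}" for b
 proof -
  have "orth_form r v0 (h b) = 0"
   unfolding v0_def using orth[folded h_def, OF basis[OF b]] uu[OF basis[OF b]] by (simp add: orth_form_linear)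
  moreover have "b \<noteq> a" "b \<noteq> 2*r + 1 - a" using b ar by auto
  ultimately show ?thesis unfolding gh frame_move_def by (simp add: fun_scale_def fun_eq_iff zero_fun_def)
 qed
 have k1: "k + 1 \<in> {1..2*r}" using k by simp
 obtain \<tau> where \<tau>: "\<tau> \<in> WB r" "\<tau> (k + 1) = a" "\<And>b. b \<notin> {k + 1, a, 2*r + 1 - (k + 1), 2*r + 1 - a} ==> \<tau> b = b"
  using WB_swap[OF k1 ar(1)] by metis
 have \<tau>low: "\<tau> b = b" if "b \<in> {1..k}" for b by (rule \<tau>(3)) (use that ar k in auto)
 show ?thesis
 proof (rule that[of ?g "w o \<tau>" "1 / ?c a" u])
  show "frame r ?g" "full_flag r ?g = full_flag r g" by (fact mv)+
  show w\<tau>: "w o \<tau> \<in> WB r" by (rule comp_WB[OF w \<tau>(1)])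
  show "full_flag r (?g o (w o \<tau>)) j = full_flag r (g o w) j" if j: "j \<le> k" for j
   unfolding h_def[symmetric]
  proof (rule full_flag_eqI_at[OF h frame_comp[OF mv(1) w\<tau>]])
   show "j \<le> 2*r" using j k by simp
   fix b assume b: "1 \<le> b" "b \<le> j"
   have "(?g o (w o \<tau>)) b = h b" using low[of b] \<tau>low[of b] b j by simp
   thus "(?g o (w o \<tau>)) b \<in> full_flag r h j"
    unfolding full_flag_def using fspan_basis[OF h, of b "{1..j}"] b j k by simp
  qed
  show "1 / ?c a \<noteq> 0" using ca by simp
  show "u \<in> full_flag r (g o w) k" using u unfolding h_def .
  have "(?g o (w o \<tau>)) (k + 1) = (?g o w) a" using \<tau>(2) by simp
  thus "(?g o (w o \<tau>)) (k + 1) = fun_scale (1 / ?c a) (v - u)"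
   unfolding gh v0_def[symmetric] by (simp add: frame_move_def)
 qed
qed

text \<open>Starting from a frame of the first flag, the steps of the second are installed one after another.\<close>

lemma bruhat:
 assumes e: "frame r e" and f: "frame r f"
 obtains g w where "frame r g" "w \<in> WB r" "full_flag r g = full_flag r e" "full_flag r (g o w) = full_flag r f"
proof -
 have "\<exists>g w. frame r g \<and> w \<in> WB r \<and> full_flag r g = full_flag r e \<and> (\<forall>j\<le>k. full_flag r (g o w) j = full_flag r f j)"
  if "k \<le> r" for k
  using that
 proof (induction k)
  case 0
  show ?case
   using e full_flag_0[OF e] full_flag_0[OF f] id_WB[of r]
   by (intro exI[of _ e] exI[of _ id]) (simp only: comp_id le_zero_eq, simp)
 next
  case (Suc k)
  obtain g w where gw: "frame r g" "w \<in> WB r" "full_flag r g = full_flag r e"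
   "\<And>j. j \<le> k ==> full_flag r (g o w) j = full_flag r f j" using Suc.IH[OF Suc_leD[OF Suc.prems]] by blast
  have k: "k < r" and k1: "k + 1 \<in> {1..2*r}" using Suc by auto
  let ?v = "f (k + 1)"
  have vs: "?v \<in> coord_space (2*r)" by (rule frame_space[OF f k1])
  have vv: "orth_form r ?v ?v = 0" unfolding frame_form[OF f k1 k1] using k by simp
  have fk: "full_flag r (g o w) k = full_flag r f k" by (rule gw(4)) simp
  have orth: "orth_form r ?v x = 0" if x: "x \<in> full_flag r (g o w) k" for x
  proof -
   have "?v \<in> full_flag r f (2*r - k)" unfolding full_flag_def by (rule fspan_basis[OF f _ k1]) (use k in auto)
   hence "?v \<in> perp r (full_flag r f k)" using full_flag_perp[OF f, of k] k by simp
   thus ?thesis using x unfolding fk perp_def using orth_form_sym[of r ?v x] by simp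
  qed
  have out: "?v \<notin> full_flag r (g o w) k" unfolding fk unfolding full_flag_def fspan_basis_iff[OF f k1] by simp
  obtain g' w' d u where g': "frame r g'" "w' \<in> WB r" "full_flag r g' = full_flag r g"
   "\<And>j. j \<le> k ==> full_flag r (g' o w') j = full_flag r (g o w) j"
   "d \<noteq> 0" "u \<in> full_flag r (g o w) k" "(g' o w') (k + 1) = fun_scale d (?v - u)"
   using frame_step[OF gw(1,2) k vs vv orth out] by blast
  have h': "frame r (g' o w')" by (rule frame_comp[OF g'(1,2)])
  have "full_flag r (g' o w') j = full_flag r f j" if j: "j \<le> Suc k" for j
  proof (cases "j \<le> k")
   case True
   thus ?thesis using g'(4) gw(4) by simp
  next
   case False
   show ?thesis
   proof (rule full_flag_eqI_at[OF f h'])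
    show "j \<le> 2*r" using j k by simp
    fix a assume a: "1 \<le> a" "a \<le> j"
    show "(g' o w') a \<in> full_flag r f j"
    proof (cases "a \<le> k")
     case True
     have "(g' o w') a \<in> full_flag r (g' o w') k"
      unfolding full_flag_def by (rule fspan_basis[OF h']) (use a True k in auto)
     hence "(g' o w') a \<in> full_flag r f k" using g'(4)[of k] fk by simp
     thus ?thesis using full_flag_mono[of k j r f] False by auto
    next
     case False
     hence aj: "a = k + 1" "j = k + 1" using a j \<open>\<not> j \<le> k\<close> by auto
     have "u \<in> full_flag r f j" using g'(6) fk full_flag_mono[of k j r f] aj by auto
     moreover have "?v \<in> full_flag r f j" unfolding full_flag_def using fspan_basis[OF f _ k1] aj by simp
     ultimately show ?thesis unfolding aj(1) g'(7) unfolding full_flag_def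
      by (intro fspan_closed(3) fspan_closed(2))
    qed
   qed
  qed
  thus ?case using g'(1,2,3) gw(3) by metis
 qed
 from this[of r] obtain g w where gw: "frame r g" "w \<in> WB r" "full_flag r g = full_flag r e"
  "\<And>j. j \<le> r ==> full_flag r (g o w) j = full_flag r f j" by auto
 have "full_flag r (g o w) = full_flag r f"
  by (rule full_flag_eqI[OF f frame_comp[OF gw(1,2)] gw(4)])
 thus ?thesis using that gw by blast
qed

definition full_flags :: "nat => 'f::{field,finite} flag set" where
 "full_flags r = full_flag r ` Collect (frame r)"

definition pos :: "nat => 'f::{field,finite} flag => 'f flag => nat => nat" where
 "pos r y z = (THE w. w \<in> WB r \<and> (\<exists>g. frame r g \<and> full_flag r g = y \<and> full_flag r (g o w) = z))"

lemma full_flagI: "frame r g ==> full_flag r g \<in> full_flags r"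
 by (simp add: full_flags_def)

lemma finite_full_flags: "finite (full_flags r :: 'f::{field,finite} flag set)"
proof -
 let ?P = "{1..2*r} \<rightarrow>\<^sub>E (coord_space (2*r) :: (nat => 'f) set)"
 have "full_flags r \<subseteq> full_flag r ` ?P"
 proof
  fix y :: "'f flag" assume "y \<in> full_flags r"
  then obtain e where e: "frame r e" "y = full_flag r e" by (auto simp: full_flags_def)
  have "coord r (restrict e {1..2*r}) v a = coord r e v a" if "a \<in> {1..2*r}" for v a
  proof -
   have "2*r + 1 - a \<in> {1..2*r}" using that by auto
   thus ?thesis unfolding coord_def by (simp only: restrict_apply if_True)
  qed
  hence "y = full_flag r (restrict e {1..2*r})"
   unfolding e(2) full_flag_def fspan_def by auto
  moreover have "restrict e {1..2*r} \<in> ?P" using frame_space[OF e(1)] by auto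
  ultimately show "y \<in> full_flag r ` ?P" by blast
 qed
 moreover have "finite ?P" by (intro finite_PiE finite_coord_space) simp
 ultimately show ?thesis using finite_subset by blast
qed

lemma card_initial_image_step:
 assumes w: "w \<in> WB r" and j: "1 \<le> j" "j \<le> 2*r"
 shows "w j \<le> i \<longleftrightarrow> card ({1..i} \<inter> w ` {1..j}) = Suc (card ({1..i} \<inter> w ` {1..j - 1}))"
proof -
 have e: "{1..j} = insert j {1..j - 1}" using j by auto
 have nj: "w j \<notin> w ` {1..j - 1}" using WB_inj[OF w] j by auto
 have r1: "1 \<le> w j" by (rule WB_range(1)[OF w j])
 show ?thesis
 proof (cases "w j \<le> i")
  case True
  hence "{1..i} \<inter> w ` {1..j} = insert (w j) ({1..i} \<inter> w ` {1..j - 1})" using r1 unfolding e by auto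
  thus ?thesis using nj True by simp
 next
  case False
  hence "{1..i} \<inter> w ` {1..j} = {1..i} \<inter> w ` {1..j - 1}" unfolding e by auto
  thus ?thesis using False by simp
 qed
qed

lemma full_flag_Int_dim:
 assumes g: "frame r g" and w: "w \<in> WB r" and i: "i \<le> 2*r"
 shows "fun_space.dim (full_flag r g i \<inter> full_flag r (g o w) j) = card ({1..i} \<inter> w ` {1..j})"
 unfolding full_flag_def fspan_comp[OF w] fspan_Int
 by (rule fspan_dim[OF g]) (use i in auto)

text \<open>The permutation is visible in the dimensions of the intersections of the steps.\<close>

lemma pos_unique:
 assumes g: "frame r g" "frame r g1" and w: "w \<in> WB r" "w1 \<in> WB r"
  and eq: "full_flag r g = full_flag r g1" "full_flag r (g o w) = full_flag r (g1 o w1)"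
 shows "w = w1"
proof
 fix j
 show "w j = w1 j"
 proof (cases "1 \<le> j \<and> j \<le> 2*r")
  case True
  hence j: "1 \<le> j" "j \<le> 2*r" by auto
  have c: "card ({1..i} \<inter> w ` {1..j}) = card ({1..i} \<inter> w1 ` {1..j})" if "i \<le> 2*r" for i j
   using full_flag_Int_dim[OF g(1) w(1) that, of j] full_flag_Int_dim[OF g(2) w(2) that, of j] unfolding eq by simp
  have le: "w j \<le> i \<longleftrightarrow> w1 j \<le> i" if "i \<le> 2*r" for i
   unfolding card_initial_image_step[OF w(1) j] card_initial_image_step[OF w(2) j] c[OF that] ..
  show ?thesis using le[OF WB_range(2)[OF w(1) j]] le[OF WB_range(2)[OF w(2) j]] by simp
 next
  case False
  hence "j \<notin> {1..2*r}" by auto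
  thus ?thesis using WB_outside[OF w(1)] WB_outside[OF w(2)] by simp
 qed
qed

lemma pos:
 assumes "frame r g" "w \<in> WB r"
 shows "pos r (full_flag r g) (full_flag r (g o w)) = w"
 unfolding pos_def
proof (rule the_equality)
 show "w \<in> WB r \<and> (\<exists>ga. frame r ga \<and> full_flag r ga = full_flag r g \<and> full_flag r (ga o w) = full_flag r (g o w))"
  using assms by blast
 show "v = w" if "v \<in> WB r \<and> (\<exists>ga. frame r ga \<and> full_flag r ga = full_flag r g \<and> full_flag r (ga o v) = full_flag r (g o w))" for v
  using that pos_unique[OF _ assms(1) _ assms(2)] by blast
qed

lemma full_flags_adapted:
 assumes "y \<in> full_flags r" "z \<in> full_flags r"
 obtains g where "frame r g" "pos r y z \<in> WB r" "y = full_flag r g" "z = full_flag r (g o pos r y z)"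
proof -
 obtain e f where ef: "frame r e" "frame r f" "y = full_flag r e" "z = full_flag r f"
  using assms by (auto simp: full_flags_def)
 obtain g w where gw: "frame r g" "w \<in> WB r" "full_flag r g = y" "full_flag r (g o w) = z"
  using bruhat[OF ef(1,2)] ef(3,4) by metis
 have "pos r y z = w" using pos[OF gw(1,2)] unfolding gw(3,4) .
 from that[OF gw(1), unfolded this, OF gw(2) gw(3)[symmetric] gw(4)[symmetric]] show ?thesis .
qed

lemma pos_WB: "y \<in> full_flags r ==> z \<in> full_flags r ==> pos r y z \<in> WB r"
 for y z :: "'f::{field,finite} flag"
 by (rule full_flags_adapted)

lemma pos_id_iff:
 assumes "y \<in> full_flags r" "z \<in> full_flags r"
 shows "pos r y z = id \<longleftrightarrow> y = z"
proof
 assume 1: "pos r y z = id"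
 obtain g where "y = full_flag r g" "z = full_flag r (g o pos r y z)" by (rule full_flags_adapted[OF assms])
 thus "y = z" unfolding 1 comp_id by simp
next
 assume "y = z"
 obtain g where g: "frame r g" "y = full_flag r g" by (rule full_flags_adapted[OF assms])
 show "pos r y z = id" using pos[OF g(1) id_WB] unfolding comp_id \<open>y = z\<close>[symmetric] g(2) .
qed

section \<open>Neighbouring flags\<close>

text \<open>Spans the line that replaces the one of \<open>h i\<close> in step \<open>i\<close>.\<close>

definition nb_vector :: "(nat => nat => 'f::{field,finite}) => nat => 'f => nat => 'f" where
 "nb_vector h i t = h (i + 1) + fun_scale t (h i)"

definition nb_frame :: "nat => (nat => nat => 'f::{field,finite}) => nat => 'f => nat => nat => 'f" where
 "nb_frame r h i t = frame_move r h (i + 1) (nb_vector h i t) o srefl r i"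

lemma nb_vector:
 assumes h: "frame r h" and i: "i \<in> {1..r}" and t: "i < r \<or> t = 0"
 shows "i + 1 \<in> {1..2*r}" "nb_vector h i t \<in> full_flag r h (i + 1)"
  "orth_form r (nb_vector h i t) (nb_vector h i t) = 0"
  "orth_form r (nb_vector h i t) (h (2*r + 1 - (i + 1))) = 1"
  "\<And>b. 1 \<le> b ==> b < r \<or> b \<noteq> i \<and> b = r ==> orth_form r (nb_vector h i t) (h b) = 0"
proof -
 have i': "i \<in> {1..2*r}" "i + 1 \<in> {1..2*r}" "2*r + 1 - (i + 1) \<in> {1..2*r}" using i by auto
 show "i + 1 \<in> {1..2*r}" by (rule i'(2))
 have m: "h b \<in> full_flag r h (i + 1)" if "b \<in> {1..i + 1}" for b
  unfolding full_flag_def by (rule fspan_basis[OF h that]) (use that i in auto)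
 show "nb_vector h i t \<in> full_flag r h (i + 1)"
  unfolding nb_vector_def using m[of i] m[of "i + 1"] i
  unfolding full_flag_def by (intro fspan_closed(1) fspan_closed(3)) auto
 have f: "orth_form r (nb_vector h i t) (h b) = (if i + 1 + b = 2*r + 1 then 1 else 0) + t * (if i + b = 2*r + 1 then 1 else 0)"
  if "b \<in> {1..2*r}" for b
  unfolding nb_vector_def orth_form_linear frame_form[OF h i'(2) that] frame_form[OF h i'(1) that] ..
 show "orth_form r (nb_vector h i t) (nb_vector h i t) = 0"
 proof -
  have "orth_form r (nb_vector h i t) (nb_vector h i t)
    = orth_form r (nb_vector h i t) (h (i + 1)) + t * orth_form r (nb_vector h i t) (h i)"
   by (subst (2) nb_vector_def) (simp only: orth_form_linear)
  moreover have "i + 1 + (i + 1) \<noteq> 2*r + 1" "i + i \<noteq> 2*r + 1" by presburger+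
  ultimately show ?thesis unfolding f[OF i'(1)] f[OF i'(2)] using t i by auto
 qed
 show "orth_form r (nb_vector h i t) (h (2*r + 1 - (i + 1))) = 1"
  unfolding f[OF i'(3)] using i by auto
 show "orth_form r (nb_vector h i t) (h b) = 0" if "1 \<le> b" "b < r \<or> b \<noteq> i \<and> b = r" for b
 proof -
  have "b \<in> {1..2*r}" using that by auto
  thus ?thesis using f[of b] that i by auto
 qed
qed

lemma nb_frame:
 assumes h: "frame r h" and i: "i \<in> {1..r}" and t: "i < r \<or> t = 0"
 shows "frame r (nb_frame r h i t)"
  and "pos r (full_flag r h) (full_flag r (nb_frame r h i t)) = srefl r i"
  and "\<And>b. b \<in> {1..r} ==> nb_frame r h i t b =
   (if b = i then nb_vector h i t else if b = i + 1 then h i else h b)"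
proof -
 note nv = nb_vector[OF assms]
 note mv = frame_move_flag[OF h nv(1-4)]
 show "frame r (nb_frame r h i t)"
  unfolding nb_frame_def by (rule frame_comp[OF mv(1) simple_refl_WB[OF i]])
 show "pos r (full_flag r h) (full_flag r (nb_frame r h i t)) = srefl r i"
  unfolding nb_frame_def mv(2)[symmetric] by (rule pos[OF mv(1) simple_refl_WB[OF i]])
 have low: "frame_move r h (i + 1) (nb_vector h i t) b = h b" if b: "1 \<le> b" "b \<le> r" "b \<noteq> i + 1" for b
 proof (cases "b = 2*r + 1 - (i + 1)")
  case False
  have "b < r \<or> b \<noteq> i \<and> b = r" using False b i by auto
  from nv(5)[OF b(1) this] show ?thesis using b False
   by (simp add: frame_move_def fun_scale_def zero_fun_def[symmetric])
 qed (use b in \<open>simp add: frame_move_def\<close>)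
 show "nb_frame r h i t b = (if b = i then nb_vector h i t else if b = i + 1 then h i else h b)"
  if b: "b \<in> {1..r}" for b
 proof -
  have s: "srefl r i b = (if b = i then i + 1 else if b = i + 1 then i else b)"
   unfolding simple_refl_apply[OF i] using b i by auto
  show ?thesis
   unfolding nb_frame_def comp_apply s using low[of b] low[of i] b i by (auto simp: frame_move_def)
 qed
qed

lemma nb_flag_other:
 assumes h: "frame r h" and i: "i \<in> {1..r}" and t: "i < r \<or> t = 0" and j: "j \<le> r" "j \<noteq> i"
 shows "full_flag r (nb_frame r h i t) j = full_flag r h j"
proof (rule full_flag_eqI_at[OF h nb_frame(1)[OF h i t]])
 show "j \<le> 2*r" using j by simp
 fix b assume b: "1 \<le> b" "b \<le> j"
 have m: "h c \<in> full_flag r h j" if "1 \<le> c" "c \<le> j" for c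
  unfolding full_flag_def by (rule fspan_basis[OF h]) (use that j in auto)
 have b': "b \<in> {1..r}" using b j by simp
 consider "b = i" | "b = i + 1" | "b \<noteq> i" "b \<noteq> i + 1" by blast
 thus "nb_frame r h i t b \<in> full_flag r h j"
 proof cases
  case 1
  hence "full_flag r h (i + 1) \<subseteq> full_flag r h j" using b j by (intro full_flag_mono) simp
  thus ?thesis using nb_frame(3)[OF h i t b'] nb_vector(2)[OF h i t] 1 by auto
 next
  case 2
  thus ?thesis using nb_frame(3)[OF h i t b'] m[of i] b i by simp
 next
  case 3
  thus ?thesis using nb_frame(3)[OF h i t b'] m[of b] b by simp
 qed
qed

lemma nb_inj:
 assumes h: "frame r h" and i: "i \<in> {1..r}" and t: "i < r \<or> t = 0" and u: "i < r \<or> u = 0"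
  and eq: "full_flag r (nb_frame r h i t) = full_flag r (nb_frame r h i u)"
 shows "t = u"
proof (rule ccontr)
 assume tu: "t \<noteq> u"
 hence ir: "i < r" using t u by blast
 let ?U = "full_flag r (nb_frame r h i t) i"
 have i2: "i \<in> {1..2*r}" "i + 1 \<in> {1..2*r}" "i \<in> {1..r}" "i + 1 \<in> {1..r}" using i ir by auto
 have m: "nb_vector h i s \<in> full_flag r (nb_frame r h i s) i" if s: "i < r \<or> s = 0" for s
  using fspan_basis[OF nb_frame(1)[OF h i s], of i "{1..i}"] nb_frame(3)[OF h i s i2(3)] i i2
  unfolding full_flag_def by simp
 have "nb_vector h i t - nb_vector h i u \<in> ?U"
  using m[OF t] m[OF u] unfolding eq unfolding full_flag_def by (rule fspan_closed(2))
 moreover have "nb_vector h i t - nb_vector h i u = fun_scale (t - u) (h i)"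
  by (simp add: nb_vector_def fun_scale_def fun_eq_iff fun_apply algebra_simps)
 ultimately have "fun_scale (1 / (t - u)) (fun_scale (t - u) (h i)) \<in> ?U"
  unfolding full_flag_def by (metis fspan_closed(3))
 moreover have "fun_scale (1 / (t - u)) (fun_scale (t - u) (h i)) = nb_frame r h i t (i + 1)"
  unfolding nb_frame(3)[OF h i t i2(4)] using tu by (simp add: fun_scale_def)
 ultimately have "nb_frame r h i t (i + 1) \<in> ?U" by simp
 thus False
  unfolding full_flag_def using fspan_basis_iff[OF nb_frame(1)[OF h i t] i2(2)] by simp
qed

text \<open>
 A neighbour differs in step \<open>i\<close> only, hence comes from a line in the plane between steps \<open>i - 1\<close>
 and \<open>i + 1\<close>.  For \<open>i = r\<close> this plane is hyperbolic and, \<open>2\<close> being invertible, has just two isotropic lines,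
 which leaves only the parameter \<open>0\<close>.
\<close>

lemma nb_surj:
 fixes h :: "nat => nat => 'f::{field,finite}"
 assumes h: "frame r h" and i: "i \<in> {1..r}" and g: "frame r g" and gh: "full_flag r g = full_flag r h"
  and two: "(1::'f) + 1 \<noteq> 0"
 obtains t where "i < r \<or> t = 0" "full_flag r (g o srefl r i) = full_flag r (nb_frame r h i t)"
proof -
 let ?v = "g (i + 1)"
 have i2: "i \<in> {1..2*r}" "i + 1 \<in> {1..2*r}" "i \<in> {1..r}" using i by auto
 have A: "{1..i + 1} \<subseteq> {1..2*r}" "{1..i - 1} \<subseteq> {1..2*r}" using i by auto
 let ?c = "coord r h ?v"
 have v: "?v \<in> full_flag r h (i + 1)"
  unfolding gh[symmetric] full_flag_def by (rule fspan_basis[OF g _ i2(2)]) simp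
 have vs: "?v \<in> coord_space (2*r)" by (rule frame_space[OF g i2(2)])
 have "?v \<notin> full_flag r h i"
  unfolding gh[symmetric] unfolding full_flag_def fspan_basis_iff[OF g i2(2)] by simp
 then obtain a where a: "a \<in> {1..2*r} - {1..i}" "?c a \<noteq> 0" using vs unfolding full_flag_def fspan_def by blast
 have "a = i + 1"
 proof (rule ccontr)
  assume "a \<noteq> i + 1"
  hence "a \<in> {1..2*r} - {1..i + 1}" using a by auto
  thus False using v a(2) unfolding full_flag_def fspan_def by blast
 qed
 hence c1: "?c (i + 1) \<noteq> 0" using a by simp
 (* The coefficient of h (i + 1) does not vanish, as otherwise the vector would lie in step i. *)
 define t where "t = ?c i / ?c (i + 1)"
 define u where "u = (\<Sum>b\<in>{1..i - 1}. fun_scale (?c b) (h b))"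
 have exp: "?v = fun_scale (?c (i + 1)) (nb_vector h i t) + u"
 proof -
  have "?v = (\<Sum>b\<in>{1..i + 1}. fun_scale (?c b) (h b))"
   by (rule fspan_expansion[OF h A(1)]) (use v in \<open>simp add: full_flag_def\<close>)
  also have "{1..i + 1} = insert (i + 1) (insert i {1..i - 1})" using i by auto
  also have "(\<Sum>b\<in>\<dots>. fun_scale (?c b) (h b)) = fun_scale (?c (i + 1)) (h (i + 1)) + (fun_scale (?c i) (h i) + u)"
   unfolding u_def using i by (subst sum.insert, simp, force)+ simp
  also have "\<dots> = fun_scale (?c (i + 1)) (nb_vector h i t) + u"
   using c1 by (simp add: nb_vector_def t_def fun_scale_def fun_eq_iff fun_apply algebra_simps)
  finally show ?thesis .
 qed
 have t: "i < r \<or> t = 0"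
 proof (rule disjCI)
  assume "t \<noteq> 0"
  show "i < r"
  proof (rule ccontr)
   assume "\<not> i < r"
   hence ir: "i = r" using i by simp
   have hu: "orth_form r (h b) (h b') = (if b + b' = 2*r + 1 then 1 else 0)" if "b \<in> {1..r + 1}" "b' \<in> {1..r + 1}" for b b'
    by (rule frame_form[OF h]) (use that i in auto)
   have low: "orth_form r x u = 0" if x: "x = h r \<or> x = h (r + 1) \<or> x = u" for x
   proof -
    have "u \<in> fspan r h {1..r - 1}"
     unfolding u_def ir by (intro fspan_closed(4) fspan_closed(3) fspan_basis[OF h]) (use i in auto)
    moreover have "x \<in> perp r (fspan r h {1..r - 1})"
    proof -
     have "x \<in> fspan r h {1..r + 1}"
     proof -
      have "u \<in> fspan r h {1..r + 1}"
       by (rule subsetD[OF fspan_mono \<open>u \<in> fspan r h {1..r - 1}\<close>]) auto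
      moreover have "h r \<in> fspan r h {1..r + 1}" "h (r + 1) \<in> fspan r h {1..r + 1}"
       by (rule fspan_basis[OF h]; use i in auto)+
      ultimately show ?thesis using x by blast
     qed
     moreover have "{1..r - 1} \<subseteq> {1..2*r}" by auto
     moreover have "fspan r h {1..r + 1} \<subseteq> fspan r h {a. 2*r + 1 - a \<notin> {1..r - 1}}"
      by (rule fspan_mono) auto
     ultimately show ?thesis using fspan_perp[OF h] by blast
    qed
    ultimately show ?thesis unfolding perp_def using orth_form_sym[of r u x] by simp
   qed
   have vr: "?v = fun_scale (?c (r + 1)) (h (r + 1)) + (fun_scale (?c r) (h r) + u)"
    using exp c1 unfolding ir by (simp add: nb_vector_def t_def ir fun_scale_def fun_eq_iff fun_apply algebra_simps)
   have low': "orth_form r u (h r) = 0" "orth_form r u (h (r + 1)) = 0"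
    using low[of "h r"] low[of "h (r + 1)"] orth_form_sym[of r u] by auto
   have "orth_form r ?v ?v = ?c (r + 1) * ?c r + ?c r * ?c (r + 1)"
    by (subst (1 2) vr) (use low low' hu i ir in \<open>simp add: orth_form_linear\<close>)
   moreover have "orth_form r ?v ?v = 0" unfolding frame_form[OF g i2(2) i2(2)] using ir by simp
   ultimately have "(1 + 1) * (?c (r + 1) * ?c r) = 0" by (simp add: algebra_simps)
   hence "?c r = 0" using two c1 ir by simp
   thus False using \<open>t \<noteq> 0\<close> ir by (simp add: t_def)
  qed
 qed
 let ?n = "nb_frame r h i t"
 note n = nb_frame[OF h i t]
 let ?s = "srefl r i"
 have gs: "frame r (g o ?s)" by (rule frame_comp[OF g simple_refl_WB[OF i]])
 have "full_flag r (g o ?s) = full_flag r ?n"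
 proof (rule full_flag_eqI[OF n(1) gs])
  fix j assume j: "j \<le> r"
  show "full_flag r (g o ?s) j = full_flag r ?n j"
  proof (rule full_flag_eqI_at[OF n(1) gs])
   show "j \<le> 2*r" using j by simp
   fix b assume b: "1 \<le> b" "b \<le> j"
   have s: "?s b = (if b = i then i + 1 else if b = i + 1 then i else b)"
    unfolding simple_refl_apply[OF i] using b j i by auto
   have gb: "g c \<in> full_flag r ?n k" if "1 \<le> c" "c \<le> k" "k \<le> r" "k \<noteq> i" for c k
    unfolding nb_flag_other[OF h i t that(3,4)] gh[symmetric] unfolding full_flag_def
    by (rule fspan_basis[OF g]) (use that in auto)
   show "(g o ?s) b \<in> full_flag r ?n j"
   proof (cases "j = i")
    case False
    have "1 \<le> ?s b" "?s b \<le> j" using s b False i by auto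
    thus ?thesis using gb[of "?s b" j] j False by simp
   next
    case True
    show ?thesis
    proof (cases "b = i")
     case False
     hence b1: "b \<le> i - 1" "?s b = b" using b True s by auto
     have "g b \<in> full_flag r ?n (i - 1)" by (rule gb) (use b b1 i in auto)
     thus ?thesis using full_flag_mono[of "i - 1" j r ?n] True b1 by auto
    next
     case bi: True
     have "nb_vector h i t \<in> full_flag r ?n i"
      using fspan_basis[OF n(1), of i "{1..i}"] n(3)[OF i] i i2(1) unfolding full_flag_def by simp
     moreover have "u \<in> full_flag r ?n i"
     proof -
      have "h b \<in> full_flag r ?n i" if "b \<in> {1..i - 1}" for b
      proof -
       have "b \<in> {1..r}" "b \<noteq> i" "b \<noteq> i + 1" "b \<in> {1..i}" "b \<in> {1..2*r}" using i that by auto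
       thus ?thesis using fspan_basis[OF n(1), of b "{1..i}"] n(3)[of b] unfolding full_flag_def by simp
      qed
      thus ?thesis unfolding u_def full_flag_def by (intro fspan_closed(4) fspan_closed(3)) auto
     qed
     ultimately have "?v \<in> full_flag r ?n i"
      by (subst exp) (simp only: full_flag_def, intro fspan_closed(1) fspan_closed(3))
     thus ?thesis using bi True s by simp
    qed
   qed
  qed
 qed
 thus ?thesis using that t by blast
qed

text \<open>
 The new vector lies in step \<open>w (i + 1)\<close> of the first flag, so a frame in which it replaces the basis
 vector at \<open>w (i + 1)\<close> is still adapted to the first flag.
\<close>

lemma nb_pos_ascent:
 assumes g: "frame r g" and w: "w \<in> WB r" and i: "i \<in> {1..r}" and t: "i < r \<or> t = 0"
  and up: "w i < w (i + 1) \<or> t = 0"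
 shows "pos r (full_flag r g) (full_flag r (nb_frame r (g o w) i t)) = w o srefl r i"
proof -
 define h where "h = g o w"
 have h: "frame r h" unfolding h_def by (rule frame_comp[OF g w])
 note nv = nb_vector[OF h i t]
 have wi: "w (i + 1) \<in> {1..2*r}" using WB_range[OF w, of "i + 1"] nv(1) by simp
 have wi': "w i \<in> {1..2*r}" using WB_range[OF w, of i] i by simp
 have m: "w (2*r + 1 - (i + 1)) = 2*r + 1 - w (i + 1)" using WB_mirror(1)[OF w, of "i + 1"] nv(1) by simp
 have e: "frame_move r h (i + 1) (nb_vector h i t) = frame_move r g (w (i + 1)) (nb_vector h i t) o w"
  unfolding h_def by (rule frame_move_comp[OF w nv(1)])
 have b1: "g (w (i + 1)) \<in> full_flag r g (w (i + 1))"
  unfolding full_flag_def by (rule fspan_basis[OF g _ wi]) (use wi in simp)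
 have "nb_vector h i t \<in> full_flag r g (w (i + 1))"
 proof (cases "t = 0")
  case True
  hence "nb_vector h i t = g (w (i + 1))" by (simp add: nb_vector_def h_def fun_scale_def fun_eq_iff fun_apply)
  thus ?thesis using b1 by simp
 next
  case False
  hence "g (w i) \<in> full_flag r g (w (i + 1))"
   unfolding full_flag_def using fspan_basis[OF g _ wi'] up wi' by simp
  thus ?thesis using b1 unfolding nb_vector_def h_def comp_apply full_flag_def
   by (intro fspan_closed(1) fspan_closed(3))
 qed
 moreover have "orth_form r (nb_vector h i t) (g (2*r + 1 - w (i + 1))) = 1"
  using nv(4) unfolding h_def comp_apply m .
 ultimately have mv: "frame r (frame_move r g (w (i + 1)) (nb_vector h i t))"
  "full_flag r (frame_move r g (w (i + 1)) (nb_vector h i t)) = full_flag r g"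
  using frame_move_flag[OF g wi _ nv(3)] by blast+
 show ?thesis
  unfolding h_def[symmetric] nb_frame_def e comp_assoc
  using pos[OF mv(1) WB_refl[OF w i]] unfolding mv(2) .
qed

text \<open>
 For \<open>t \<noteq> 0\<close> the line is also spanned by \<open>h i + (1/t) h (i + 1)\<close>.  Along a descent this vector can take
 the place of \<open>h i\<close> in the frame, so the position does not change.
\<close>

lemma nb_pos_descent:
 assumes g: "frame r g" and w: "w \<in> WB r" and i: "i \<in> {1..r}" and t: "i < r" "t \<noteq> 0"
  and down: "w (i + 1) < w i"
 shows "pos r (full_flag r g) (full_flag r (nb_frame r (g o w) i t)) = w"
proof -
 define h where "h = g o w"
 have h: "frame r h" unfolding h_def by (rule frame_comp[OF g w])
 have t': "i < r \<or> t = 0" using t by simp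
 note n = nb_frame[OF h i t']
 let ?n = "nb_frame r h i t"
 define v where "v = h i + fun_scale (1 / t) (h (i + 1))"
 have i2: "i \<in> {1..2*r}" "i + 1 \<in> {1..2*r}" "i + 1 \<in> {1..r}" using i t by auto
 have f: "orth_form r v (h b) = (if i + b = 2*r + 1 then 1 else 0) + 1 / t * (if i + 1 + b = 2*r + 1 then 1 else 0)"
  if "b \<in> {1..2*r}" for b
  unfolding v_def orth_form_linear frame_form[OF h i2(2) that] frame_form[OF h i2(1) that] ..
 have vv: "orth_form r v v = 0"
 proof -
  have "orth_form r v v = orth_form r v (h i) + 1 / t * orth_form r v (h (i + 1))"
   by (subst (2) v_def) (simp only: orth_form_linear)
  thus ?thesis unfolding f[OF i2(1)] f[OF i2(2)] using t i by auto
 qed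
 have low: "orth_form r v (h b) = 0" if "b \<in> {1..r}" for b using f[of b] that t i by auto
 have va: "orth_form r v (h (2*r + 1 - i)) = 1"
 proof -
  have "2*r + 1 - i \<in> {1..2*r}" using i by auto
  from f[OF this] show ?thesis using i by auto
 qed
 have wi: "w i \<in> {1..2*r}" "w (i + 1) \<in> {1..2*r}" using WB_range[OF w, of i] WB_range[OF w, of "i + 1"] i2 by auto
 have m: "w (2*r + 1 - i) = 2*r + 1 - w i" using WB_mirror(1)[OF w, of i] i2 by simp
 have e: "frame_move r h i v = frame_move r g (w i) v o w" unfolding h_def by (rule frame_move_comp[OF w i2(1)])
 have "g (w i) \<in> full_flag r g (w i)" "g (w (i + 1)) \<in> full_flag r g (w i)"
  unfolding full_flag_def using fspan_basis[OF g _ wi(1)] fspan_basis[OF g _ wi(2)] wi down by simp_all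
 hence "v \<in> full_flag r g (w i)"
  unfolding v_def h_def comp_apply full_flag_def by (intro fspan_closed(1) fspan_closed(3))
 moreover have "orth_form r v (g (2*r + 1 - w i)) = 1" using va unfolding h_def comp_apply m .
 ultimately have mv: "frame r (frame_move r g (w i) v)" "full_flag r (frame_move r g (w i) v) = full_flag r g"
  using frame_move_flag[OF g wi(1) _ vv] by blast+
 let ?f = "frame_move r h i v"
 have ff: "frame r ?f" unfolding e by (rule frame_comp[OF mv(1) w])
 have fv: "?f b = (if b = i then v else h b)" if b: "b \<in> {1..r}" for b
 proof -
  have "b \<noteq> 2*r + 1 - i" using b i t by auto
  thus ?thesis using low[OF b] by (simp add: frame_move_def fun_scale_def zero_fun_def[symmetric])
 qed
 have "full_flag r ?n = full_flag r ?f"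
 proof (rule full_flag_eqI[OF ff n(1)])
  fix j assume j: "j \<le> r"
  show "full_flag r ?n j = full_flag r ?f j"
  proof (rule full_flag_eqI_at[OF ff n(1)])
   show "j \<le> 2*r" using j by simp
   fix b assume b: "1 \<le> b" "b \<le> j"
   have bf: "?f c \<in> full_flag r ?f j" if "1 \<le> c" "c \<le> j" for c
    unfolding full_flag_def by (rule fspan_basis[OF ff]) (use that j in auto)
   have vi: "v \<in> full_flag r ?f j" if "i \<le> j" using bf[of i] fv[OF i] i that by simp
   have br: "b \<in> {1..r}" using b j by simp
   consider "b = i" | "b = i + 1" | "b \<noteq> i" "b \<noteq> i + 1" by blast
   thus "?n b \<in> full_flag r ?f j"
   proof cases
    case 1
    have "?n b = fun_scale t v" using n(3)[OF br] 1 t(2)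
     by (simp add: nb_vector_def v_def fun_scale_def fun_eq_iff fun_apply algebra_simps)
    moreover have "fun_scale t v \<in> full_flag r ?f j"
     using vi 1 b unfolding full_flag_def by (intro fspan_closed(3)) simp
    ultimately show ?thesis by simp
   next
    case 2
    have "?n b = v - fun_scale (1 / t) (?f (i + 1))"
     using n(3)[OF br] fv[OF i2(3)] 2 by (simp add: v_def)
    moreover have "v - fun_scale (1 / t) (?f (i + 1)) \<in> full_flag r ?f j"
     using vi bf[of "i + 1"] 2 b unfolding full_flag_def
     by (intro fspan_closed(2) fspan_closed(3)) simp_all
    ultimately show ?thesis by simp
   next
    case 3
    thus ?thesis using n(3)[OF br] fv[OF br] bf[OF b] by simp
   qed
  qed
 qed
 thus ?thesis
  unfolding h_def[symmetric] e using pos[OF mv(1) w] unfolding mv(2) by simp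
qed

definition neighbours :: "nat => nat => 'f::{field,finite} flag => 'f flag set" where
 "neighbours r i y = {z \<in> full_flags r. pos r y z = srefl r i}"

text \<open>
 The quadratic relation and the length additive products of the Hecke algebra at the order of the
 field: the sum over neighbours is right multiplication by \<open>T\<^sub>i\<close>.
\<close>

lemma neighbour_sum:
 fixes y y' :: "'f::{field,finite} flag" and phi :: "(nat => nat) => int"
 assumes y: "y \<in> full_flags r" "y' \<in> full_flags r" and i: "i \<in> {1..r}" and two: "(1::'f) + 1 \<noteq> 0"
  and q: "q = (if i < r then int (card (UNIV :: 'f set)) else 1)"
 defines "w \<equiv> pos r y y'"
 shows "(\<Sum>z\<in>neighbours r i y'. phi (pos r y z)) =
  (if w i < w (i + 1) then q * phi (w o srefl r i) else phi (w o srefl r i) + (q - 1) * phi w)"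
proof -
 obtain g where g: "frame r g" "w \<in> WB r" "y = full_flag r g" "y' = full_flag r (g o w)"
  unfolding w_def by (rule full_flags_adapted[OF y])
 let ?h = "g o w"
 have h: "frame r ?h" by (rule frame_comp[OF g(1,2)])
 define T where "T = (if i < r then (UNIV :: 'f set) else {0})"
 have T: "i < r \<or> t = 0" if "t \<in> T" for t using that by (auto simp: T_def split: if_splits)
 have Tf: "finite T" "0 \<in> T" "int (card T) = q" by (simp_all add: T_def q)
 let ?n = "\<lambda>t. full_flag r (nb_frame r ?h i t)"
 have N: "neighbours r i y' = ?n ` T"
 proof
  show "?n ` T \<subseteq> neighbours r i y'"
   unfolding neighbours_def g(4) using nb_frame(1,2)[OF h i T] full_flagI by blast
  show "neighbours r i y' \<subseteq> ?n ` T"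
  proof
   fix z assume "z \<in> neighbours r i y'"
   hence z: "z \<in> full_flags r" "pos r y' z = srefl r i" by (simp_all add: neighbours_def)
   obtain f where f: "frame r f" "y' = full_flag r f" "z = full_flag r (f o pos r y' z)"
    by (rule full_flags_adapted[OF y(2) z(1)])
   obtain t where "i < r \<or> t = 0" "full_flag r (f o srefl r i) = ?n t"
    by (rule nb_surj[OF h i f(1) _ two]) (use f(2) g(4) in simp)
   thus "z \<in> ?n ` T" using f(3) z(2) by (auto simp: T_def)
  qed
 qed
 have inj: "inj_on ?n T" by (rule inj_onI) (rule nb_inj[OF h i T T])
 have "(\<Sum>z\<in>neighbours r i y'. phi (pos r y z)) = (\<Sum>t\<in>T. phi (pos r y (?n t)))"
  unfolding N by (simp add: sum.reindex[OF inj])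
 also have "\<dots> = (if w i < w (i + 1) then q * phi (w o srefl r i) else phi (w o srefl r i) + (q - 1) * phi w)"
 proof (cases "w i < w (i + 1)")
  case True
  have "(\<Sum>t\<in>T. phi (pos r y (?n t))) = (\<Sum>t\<in>T. phi (w o srefl r i))"
  proof (rule sum.cong[OF refl])
   fix t assume "t \<in> T"
   show "phi (pos r y (?n t)) = phi (w o srefl r i)"
    unfolding g(3) using nb_pos_ascent[OF g(1,2) i T[OF \<open>t \<in> T\<close>]] True by simp
  qed
  thus ?thesis using True Tf(3) by simp
 next
  case False
  hence down: "w (i + 1) < w i" using descent_or_ascent[OF g(2) i] by blast
  have "(\<Sum>t\<in>T. phi (pos r y (?n t))) = phi (pos r y (?n 0)) + (\<Sum>t\<in>T - {0}. phi (pos r y (?n t)))"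
   by (rule sum.remove[OF Tf(1,2)])
  also have "(\<Sum>t\<in>T - {0}. phi (pos r y (?n t))) = (\<Sum>t\<in>T - {0}. phi w)"
  proof (rule sum.cong[OF refl])
   fix t assume t: "t \<in> T - {0}"
   have "i < r" "t \<noteq> 0" using t T[of t] by auto
   from nb_pos_descent[OF g(1,2) i this down]
   show "phi (pos r y (?n t)) = phi w" unfolding g(3) by simp
  qed
  also have "\<dots> = (q - 1) * phi w"
  proof -
   have "card T = Suc (card (T - {0}))" using card.remove[OF Tf(1,2)] .
   hence "int (card (T - {0})) = q - 1" using Tf(3) by simp
   thus ?thesis by simp
  qed
  also have "pos r y (?n 0) = w o srefl r i"
   unfolding g(3) by (rule nb_pos_ascent[OF g(1,2) i]) simp_all
  finally show ?thesis using False by (simp add: comp_def)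
 qed
 finally show ?thesis .
qed

section \<open>Partial isotropic flags\<close>

definition coarsen :: "nat => (nat => nat) => ('f::{field,finite}) flag => 'f flag" where
 "coarsen n nu y = (\<lambda>i\<in>{0..2*n + 1}. y (hat_sum n nu i))"

lemma isotropic_flagsD:
 assumes "F \<in> isotropic_flags n r"
 shows "F \<in> extensional {0..2*n + 1}" "i \<le> 2*n + 1 ==> fun_space.subspace (F i)" "F 0 = {0}"
  "F (2*n + 1) = coord_space (2*r)" "i \<le> 2*n ==> F i \<subseteq> F (i + 1)"
  "1 \<le> i ==> i \<le> n ==> F i \<subseteq> perp r (F i)" "1 \<le> i ==> i \<le> n ==> F (2*n + 1 - i) = perp r (F i)"
 using assms unfolding isotropic_flags_def by auto

lemma isotropic_flags_eqI:
 assumes F: "F \<in> isotropic_flags n r" and F': "F' \<in> isotropic_flags n r"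
  and eq: "\<And>i. 1 \<le> i ==> i \<le> n ==> F i = F' i"
 shows "F = F'"
proof (rule extensionalityI[OF isotropic_flagsD(1)[OF F] isotropic_flagsD(1)[OF F']])
 fix i assume "i \<in> {0..2*n + 1}"
 then consider "i = 0" | "1 \<le> i" "i \<le> n" | "n < i" "i \<le> 2*n" | "i = 2*n + 1" by fastforce
 thus "F i = F' i"
 proof cases
  case 1
  thus ?thesis using isotropic_flagsD(3)[OF F] isotropic_flagsD(3)[OF F'] by simp
 next
  case 2
  thus ?thesis by (rule eq)
 next
  case 3
  hence "1 \<le> 2*n + 1 - i" "2*n + 1 - i \<le> n" "2*n + 1 - (2*n + 1 - i) = i" by auto
  thus ?thesis using isotropic_flagsD(7)[OF F, of "2*n + 1 - i"] isotropic_flagsD(7)[OF F', of "2*n + 1 - i"]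
   eq[of "2*n + 1 - i"] by simp
 next
  case 4
  thus ?thesis using isotropic_flagsD(4)[OF F] isotropic_flagsD(4)[OF F'] by simp
 qed
qed

lemma coarsen_isotropic:
 assumes nu: "nu \<in> weights n r" and y: "y \<in> full_flags r"
 shows "coarsen n nu y \<in> isotropic_flags n r"
proof -
 obtain e where e: "frame r e" "y = full_flag r e" using y by (auto simp: full_flags_def)
 have sub: "fun_space.subspace (full_flag r e i)" for i unfolding full_flag_def by (rule fspan_subspace)
 have top: "full_flag r e (2*r) = coord_space (2*r)" unfolding full_flag_def by (rule fspan_UNIV) simp
 have mir: "full_flag r e (hat_sum n nu (2*n + 1 - i)) = perp r (full_flag r e (hat_sum n nu i))" if "i \<le> n" for i
 proof -
  have "hat_sum n nu (2*n + 1 - i) = 2*r - hat_sum n nu i" "hat_sum n nu i \<le> 2*r"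
   using hat_sum_mirror[OF nu, of i] hat_sum_le[OF nu, of i] that by auto
  thus ?thesis using full_flag_perp[OF e(1)] by simp
 qed
 have iso: "full_flag r e (hat_sum n nu i) \<subseteq> perp r (full_flag r e (hat_sum n nu i))" if "i \<le> n" for i
  unfolding mir[OF that, symmetric] by (intro full_flag_mono hat_sum_mono) (use that in simp)
 show ?thesis
  unfolding isotropic_flags_def
 proof (intro CollectI conjI ballI)
  show "coarsen n nu y \<in> extensional {0..2*n + 1}" by (simp add: coarsen_def)
  show "fun_space.subspace (coarsen n nu y i)" if "i \<in> {0..2*n + 1}" for i
   unfolding coarsen_def e(2) using sub that by simp
  show "coarsen n nu y 0 = {0}" unfolding coarsen_def e(2) using full_flag_0[OF e(1)] by simp
  show "coarsen n nu y (2*n + 1) = coord_space (2*r)"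
   unfolding coarsen_def e(2) using top hat_sum_total[OF nu] by simp
  show "coarsen n nu y i \<subseteq> coarsen n nu y (i + 1)" if "i \<in> {0..2*n}" for i
  proof -
   have "full_flag r e (hat_sum n nu i) \<subseteq> full_flag r e (hat_sum n nu (i + 1))"
    by (intro full_flag_mono hat_sum_mono) simp
   thus ?thesis unfolding coarsen_def e(2) using that by simp
  qed
  show "coarsen n nu y i \<subseteq> perp r (coarsen n nu y i)" if "i \<in> {1..n}" for i
   unfolding coarsen_def e(2) using iso[of i] that by simp
  show "coarsen n nu y (2*n + 1 - i) = perp r (coarsen n nu y i)" if "i \<in> {1..n}" for i
   unfolding coarsen_def e(2) using mir[of i] that by simp
 qed
qed

text \<open>
 Any vector of \<open>U\<close> outside step \<open>k\<close> is isotropic and orthogonal to that step, so it can be made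
 the next basis vector, until \<open>U\<close> is exhausted.
\<close>

lemma isotropic_extend:
 assumes h: "frame r h" and k: "k \<le> r" and U: "fun_space.subspace U" "U \<subseteq> perp r U" and sub: "full_flag r h k \<subseteq> U"
 shows "\<exists>h' m. frame r h' \<and> k \<le> m \<and> m \<le> r \<and> (\<forall>j\<le>k. full_flag r h' j = full_flag r h j) \<and> full_flag r h' m = U"
 using h k sub
proof (induction "r - k" arbitrary: h k rule: less_induct)
 case less
 note h = less.prems(1) and k = less.prems(2) and sub = less.prems(3)
 show ?case
 proof (cases "full_flag r h k = U")
  case True
  thus ?thesis using h k by blast
 next
  case False
  then obtain v where v: "v \<in> U" "v \<notin> full_flag r h k" using sub by blast
  have vs: "v \<in> coord_space (2*r)" and vU: "\<And>x. x \<in> U ==> orth_form r v x = 0"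
   using U(2) v(1) orth_form_sym[of r v] unfolding perp_def by auto
  have kr: "k < r"
  proof (rule ccontr)
   assume "\<not> k < r"
   hence "k = r" using k by simp
   have "U \<subseteq> perp r (full_flag r h k)" using U(2) sub unfolding perp_def by blast
   also have "\<dots> = full_flag r h k" using full_flag_perp[OF h, of k] \<open>k = r\<close> by simp
   finally show False using v by blast
  qed
  obtain g' w' d u where g': "frame r g'" "w' \<in> WB r" "full_flag r g' = full_flag r h"
   "\<And>j. j \<le> k ==> full_flag r (g' o w') j = full_flag r (h o id) j"
   "d \<noteq> 0" "u \<in> full_flag r (h o id) k" "(g' o w') (k + 1) = fun_scale d (v - u)"
  proof (rule frame_step[OF h id_WB kr vs])
   show "orth_form r v v = 0" by (rule vU[OF v(1)])
   show "orth_form r v x = 0" if "x \<in> full_flag r (h o id) k" for x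
    using vU[of x] that sub unfolding comp_id by blast
   show "v \<notin> full_flag r (h o id) k" using v(2) unfolding comp_id .
  qed (rule that)
  define h1 where "h1 = g' o w'"
  have h1: "frame r h1" unfolding h1_def by (rule frame_comp[OF g'(1,2)])
  have low: "full_flag r h1 j = full_flag r h j" if "j \<le> k" for j
   unfolding h1_def using g'(4)[OF that] unfolding comp_id .
  have "u \<in> U" using g'(6) sub unfolding comp_id by blast
  hence top: "h1 (k + 1) \<in> U" unfolding h1_def g'(7)
   using v(1) by (intro fun_space.subspace_scale[OF U(1)] fun_space.subspace_diff[OF U(1)])
  have "full_flag r h1 (k + 1) \<subseteq> U"
   unfolding full_flag_def
  proof (rule fspan_least[OF h1 _ U(1)])
   show "{1..k + 1} \<subseteq> {1..2*r}" using kr by auto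
   fix a assume a: "a \<in> {1..k + 1}"
   show "h1 a \<in> U"
   proof (cases "a = k + 1")
    case False
    have "h1 a \<in> full_flag r h1 k" unfolding full_flag_def by (rule fspan_basis[OF h1]) (use a False kr in auto)
    thus ?thesis using low[of k] sub by blast
   qed (use top in simp)
  qed
  moreover have "r - (k + 1) < r - k" "k + 1 \<le> r" using kr by auto
  ultimately obtain h' m where h': "frame r h'" "k + 1 \<le> m" "m \<le> r" "\<And>j. j \<le> k + 1 ==> full_flag r h' j = full_flag r h1 j"
   "full_flag r h' m = U" using less.hyps[OF _ h1] by blast
  have "\<forall>j\<le>k. full_flag r h' j = full_flag r h j" using h'(4) low by simp
  moreover have "k \<le> m" using h'(2) by simp
  ultimately show ?thesis using h'(1,3,5) by blast
 qed
qed

lemma standard_frame: "frame r (\<lambda>a i. if i = a then (1::'f::{field,finite}) else 0)"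
proof -
 have "orth_form r (\<lambda>i. if i = a then (1::'f) else 0) (\<lambda>i. if i = b then 1 else 0) = (if a + b = 2*r + 1 then 1 else 0)"
  if "a \<in> {1..2*r}" "b \<in> {1..2*r}" for a b
 proof -
  have "orth_form r (\<lambda>i. if i = a then (1::'f) else 0) (\<lambda>i. if i = b then 1 else 0)
    = (\<Sum>i = 1..2*r. if i = a then (if 2*r + 1 - i = b then 1 else 0) else 0)"
   unfolding orth_form_def by (rule sum.cong) auto
  also have "\<dots> = (if 2*r + 1 - a = b then 1 else 0)" using that by (subst sum.delta) auto
  finally show ?thesis using that by auto
 qed
 thus ?thesis unfolding frame_def coord_space_def by auto
qed

text \<open>
 The first \<open>n\<close> subspaces are installed one after another in a frame; the others are orthogonal
 complements.
\<close>

lemma isotropic_coarsen: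
 assumes F: "F \<in> isotropic_flags n r"
 obtains nu y where "nu \<in> weights n r" "y \<in> full_flags r" "F = coarsen n nu y"
proof -
 note D = isotropic_flagsD[OF F]
 have "\<exists>h m. frame r h \<and> m 0 = 0 \<and> (\<forall>j\<le>i. m j \<le> r \<and> F j = full_flag r h (m j)) \<and> (\<forall>j j'. j \<le> j' \<longrightarrow> j' \<le> i \<longrightarrow> m j \<le> m j')"
  if "i \<le> n" for i
  using that
 proof (induction i)
  case 0
  show ?case
   using standard_frame[of r] full_flag_0[OF standard_frame] D(3)
   by (intro exI[of _ "\<lambda>a i. if i = a then 1 else 0"] exI[of _ "\<lambda>_. 0"]) auto
 next
  case (Suc i)
  obtain h m where hm: "frame r h" "m 0 = 0" "\<And>j. j \<le> i ==> m j \<le> r" "\<And>j. j \<le> i ==> F j = full_flag r h (m j)"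
   "\<And>j j'. j \<le> j' ==> j' \<le> i ==> m j \<le> m j'" using Suc.IH Suc.prems by (meson Suc_leD)
  have sub: "full_flag r h (m i) \<subseteq> F (Suc i)" using D(5)[of i] hm(4)[of i] Suc.prems by simp
  have iso: "fun_space.subspace (F (Suc i))" "F (Suc i) \<subseteq> perp r (F (Suc i))"
   using D(2)[of "Suc i"] D(6)[of "Suc i"] Suc.prems by auto
  obtain h' k where h': "frame r h'" "m i \<le> k" "k \<le> r" "\<And>j. j \<le> m i ==> full_flag r h' j = full_flag r h j"
   "full_flag r h' k = F (Suc i)" using isotropic_extend[OF hm(1) hm(3)[OF order_refl] iso sub] by blast
  let ?m = "m(Suc i := k)"
  have "?m j \<le> r \<and> F j = full_flag r h' (?m j)" if "j \<le> Suc i" for j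
   using that hm(3,4)[of j] h'(3-5) hm(5)[of j i] by (cases "j = Suc i") auto
  moreover have "?m j \<le> ?m j'" if "j \<le> j'" "j' \<le> Suc i" for j j'
   using that hm(5)[of j j'] hm(5)[of j i] h'(2) by (cases "j' = Suc i"; cases "j = Suc i") auto
  moreover have "?m 0 = 0" using hm(2) by simp
  ultimately show ?case using h'(1) by blast
 qed
 from this[OF order_refl] obtain h m where hm: "frame r h" "m 0 = 0" "\<And>j. j \<le> n ==> m j \<le> r" "\<And>j. j \<le> n ==> F j = full_flag r h (m j)"
   "\<And>j j'. j \<le> j' ==> j' \<le> n ==> m j \<le> m j'" by metis
 define nu where "nu = (\<lambda>k\<in>{1..n + 1}. if k \<le> n then m k - m (k - 1) else r - m n)"
 have ps: "psum nu i = m i" if "i \<le> n" for i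
  using that
 proof (induction i)
  case (Suc i)
  hence "psum nu i = m i" "m i \<le> m (Suc i)" using hm(5)[of i "Suc i"] by simp_all
  moreover have "nu (Suc i) = m (Suc i) - m i" using Suc.prems by (simp add: nu_def)
  ultimately show ?case unfolding psum_Suc by simp
 qed (simp add: hm(2))
 have "(\<Sum>i = 1..n + 1. nu i) = psum nu (Suc n)" by (simp add: psum_def)
 also have "\<dots> = r" unfolding psum_Suc ps[OF order_refl] using hm(3)[OF order_refl] by (simp add: nu_def)
 finally have nu: "nu \<in> weights n r" by (simp add: weights_def nu_def)
 have "F = coarsen n nu (full_flag r h)"
 proof (rule isotropic_flags_eqI[OF F coarsen_isotropic[OF nu full_flagI[OF hm(1)]]])
  fix i assume i: "1 \<le> i" "i \<le> n"
  hence "coarsen n nu (full_flag r h) i = full_flag r h (hat_sum n nu i)" by (simp add: coarsen_def)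
  thus "F i = coarsen n nu (full_flag r h) i" using hm(4)[OF i(2)] hat_sum_low[OF i(2), of nu] ps[OF i(2)] by simp
 qed
 thus ?thesis using that[OF nu full_flagI[OF hm(1)]] by blast
qed

text \<open>All subspaces involved are spanned by parts of one frame, so that dimensions count indices.\<close>

lemma relative_position_frame:
 assumes g: "frame r g" and w: "w \<in> WB r" and ka: "ka \<in> weights n r" and mu: "mu \<in> weights n r"
 shows "relative_position n (coarsen n ka (full_flag r g), coarsen n mu (full_flag r (g o w))) = coset_matrix n ka w mu"
proof -
 let ?F = "coarsen n ka (full_flag r g)" and ?F' = "coarsen n mu (full_flag r (g o w))"
 let ?H = "hat_sum n ka" and ?H' = "hat_sum n mu"
 let ?S = "\<lambda>i j. {1..?H (i - 1)} \<union> ({1..?H i} \<inter> w ` {1..?H' j})"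
 have dim: "fun_space.dim (flag_cell ?F ?F' i j) = card (?S i j)" and sub: "?S i j \<subseteq> {1..2*r}"
  if i: "1 \<le> i" "i \<le> 2*n + 1" and j: "j \<le> 2*n + 1" for i j
 proof -
  have r1: "{1..?H (i - 1)} \<subseteq> {1..2*r}" "{1..?H i} \<subseteq> {1..2*r}"
   using hat_sum_le[OF ka, of "i - 1"] hat_sum_le[OF ka, of i] i by auto
  thus sub: "?S i j \<subseteq> {1..2*r}" by blast
  have i': "i - 1 \<in> {0..2*n + 1}" "i \<in> {0..2*n + 1}" "j \<in> {0..2*n + 1}" using i j by auto
  have "flag_cell ?F ?F' i j = {u + v | u v. u \<in> fspan r g {1..?H (i - 1)} \<and> v \<in> fspan r g {1..?H i} \<inter> fspan r g (w ` {1..?H' j})}"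
   unfolding flag_cell_def coarsen_def restrict_apply'[OF i'(1)] restrict_apply'[OF i'(2)] restrict_apply'[OF i'(3)]
    full_flag_def fspan_comp[OF w] ..
  also have "\<dots> = fspan r g (?S i j)"
   unfolding fspan_Int by (rule fspan_sum[OF g r1(1)]) (use r1 in blast)
  finally show "fun_space.dim (flag_cell ?F ?F' i j) = card (?S i j)" using fspan_dim[OF g sub] by simp
 qed
 show ?thesis
  unfolding relative_position_def coset_matrix_def split
 proof (rule restrict_ext, clarify)
  fix i j :: nat assume "i \<in> {1..2*n + 1}" "j \<in> {1..2*n + 1}"
  hence i: "1 \<le> i" "i \<le> 2*n + 1" and j: "1 \<le> j" "j \<le> 2*n + 1" "j - 1 \<le> 2*n + 1" by auto
  have Hi: "?H (i - 1) \<le> ?H i" and Hj: "?H' (j - 1) \<le> ?H' j" by (rule hat_sum_mono, simp)+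
  have mono: "?S i (j - 1) \<subseteq> ?S i j" using Hj by (intro Un_mono Int_mono image_mono) auto
  have fin: "finite (?S i (j - 1))" using sub[OF i j(3)] finite_subset by blast
  have "fun_space.dim (flag_cell ?F ?F' i j) - fun_space.dim (flag_cell ?F ?F' i (j - 1)) = card (?S i j - ?S i (j - 1))"
   unfolding dim[OF i j(2)] dim[OF i j(3)] card_Diff_subset[OF fin mono] ..
  also have "?S i j - ?S i (j - 1) = weight_block n ka i \<inter> w ` weight_block n mu j"
  proof (rule Set.set_eqI)
   fix a
   have "w b \<in> w ` T \<longleftrightarrow> b \<in> T" for b T using WB_inj[OF w] by auto
   thus "a \<in> ?S i j - ?S i (j - 1) \<longleftrightarrow> a \<in> weight_block n ka i \<inter> w ` weight_block n mu j"
    unfolding weight_block_hat_sum[OF i(1)] weight_block_hat_sum[OF j(1)] using Hi Hj by (auto simp: not_le WB_inj[OF w])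
  qed
  finally show "fun_space.dim (flag_cell ?F ?F' i j) - fun_space.dim (flag_cell ?F ?F' i (j - 1))
   = card (weight_block n ka i \<inter> w ` weight_block n mu j)" .
 qed
qed

lemma relative_position_coarsen:
 assumes y: "y \<in> full_flags r" "y' \<in> full_flags r" and "ka \<in> weights n r" "mu \<in> weights n r"
 shows "relative_position n (coarsen n ka y, coarsen n mu y') = coset_matrix n ka (pos r y y') mu"
proof -
 obtain g where g: "frame r g" "pos r y y' \<in> WB r" "y = full_flag r g" "y' = full_flag r (g o pos r y y')"
  by (rule full_flags_adapted[OF y])
 from relative_position_frame[OF g(1,2) assms(3,4)] show ?thesis unfolding g(3,4)[symmetric] .
qed

lemma coarsen_parabolic:
 assumes g: "frame r g" and nu: "nu \<in> weights n r" and u: "u \<in> parabolic n r nu"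
 shows "coarsen n nu (full_flag r (g o u)) = coarsen n nu (full_flag r g)"
proof -
 have uW: "u \<in> WB r" by (rule parabolic_WB[OF nu u])
 note us = u[unfolded parabolic_stabilizer[OF nu]]
 show ?thesis
 proof (rule isotropic_flags_eqI[OF coarsen_isotropic[OF nu full_flagI[OF frame_comp[OF g uW]]] coarsen_isotropic[OF nu full_flagI[OF g]]])
  fix i assume i: "1 \<le> i" "i \<le> n"
  thus "coarsen n nu (full_flag r (g o u)) i = coarsen n nu (full_flag r g) i"
   by (simp add: coarsen_def full_flag_def hat_sum_low fspan_comp[OF uW] initial_stabilizerD(2)[OF us i] del: One_nat_def)
 qed
qed

lemma double_coset_id:
 assumes nu: "nu \<in> weights n r"
 shows "double_coset n r nu id nu = parabolic n r nu"
proof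
 show "double_coset n r nu id nu \<subseteq> parabolic n r nu"
  unfolding double_coset_def comp_id using parabolic_comp[OF nu] by blast
 show "parabolic n r nu \<subseteq> double_coset n r nu id nu"
 proof
  fix u assume u: "u \<in> parabolic n r nu"
  show "u \<in> double_coset n r nu id nu" unfolding double_coset_def
   by (intro CollectI exI[of _ u] exI[of _ id] conjI u parabolic_id[OF nu]) simp
 qed
qed

text \<open>
 If the coarsenings agree, they have the relative position of a flag with itself, whose double
 coset is the parabolic subgroup.
\<close>

lemma coarsen_eq_iff:
 assumes y: "y \<in> full_flags r" "z \<in> full_flags r" and nu: "nu \<in> weights n r"
 shows "coarsen n nu y = coarsen n nu z \<longleftrightarrow> pos r y z \<in> parabolic n r nu"
proof
 assume eq: "coarsen n nu y = coarsen n nu z"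
 have "pos r y y = id" using pos_id_iff[OF y(1) y(1)] by blast
 hence "coset_matrix n nu id nu = coset_matrix n nu (pos r y z) nu"
  using relative_position_coarsen[OF y(1) y(1) nu nu] relative_position_coarsen[OF y(1) y(2) nu nu] eq by simp
 from coset_matrix_eq_imp(3)[OF nu nu id_WB nu nu pos_WB[OF y] this]
 show "pos r y z \<in> parabolic n r nu" unfolding double_coset_id[OF nu] .
next
 assume u: "pos r y z \<in> parabolic n r nu"
 obtain g where g: "frame r g" "y = full_flag r g" "z = full_flag r (g o pos r y z)"
  by (rule full_flags_adapted[OF y])
 show "coarsen n nu y = coarsen n nu z" using coarsen_parabolic[OF g(1) nu u] unfolding g(2,3)[symmetric] by simp
qed

section \<open>Orbits of the orthogonal group on pairs of flags\<close>

lemma orth_group_carrier: "\<gamma> \<in> carrier (orth_group r) \<longleftrightarrow> \<gamma> \<in> Bij (coord_space (2*r)) \<and>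
  (\<forall>x\<in>coord_space (2*r). \<forall>y\<in>coord_space (2*r). \<gamma> (x + y) = \<gamma> x + \<gamma> y) \<and>
  (\<forall>c. \<forall>x\<in>coord_space (2*r). \<gamma> (fun_scale c x) = fun_scale c (\<gamma> x)) \<and>
  (\<forall>x\<in>coord_space (2*r). \<forall>y\<in>coord_space (2*r). orth_form r (\<gamma> x) (\<gamma> y) = orth_form r x y)"
 by (simp add: orth_group_def)

lemma orth_group_frame:
 assumes \<gamma>: "\<gamma> \<in> carrier (orth_group r)" and e: "frame r e"
 shows "frame r (\<gamma> o e)" "\<gamma> ` fspan r e A = fspan r (\<gamma> o e) A"
proof -
 have bij: "bij_betw \<gamma> (coord_space (2*r)) (coord_space (2*r))" using \<gamma> by (simp add: orth_group_carrier Bij_def)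
 have form: "orth_form r (\<gamma> x) (\<gamma> y) = orth_form r x y" if "x \<in> coord_space (2*r)" "y \<in> coord_space (2*r)" for x y
  using \<gamma> that by (simp add: orth_group_carrier)
 have mp: "\<gamma> x \<in> coord_space (2*r)" if "x \<in> coord_space (2*r)" for x using bij that by (rule bij_betwE[THEN bspec])
 show "frame r (\<gamma> o e)" unfolding frame_def using frame_space[OF e] frame_form[OF e] form mp by simp
 have co: "coord r (\<gamma> o e) (\<gamma> x) a = coord r e x a" if "x \<in> coord_space (2*r)" "a \<in> {1..2*r}" for x a
 proof -
  have "2*r + 1 - a \<in> {1..2*r}" using that by auto
  from form[OF that(1) frame_space[OF e this]] show ?thesis unfolding coord_def by simp
 qed
 show "\<gamma> ` fspan r e A = fspan r (\<gamma> o e) A"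
 proof
  show "\<gamma> ` fspan r e A \<subseteq> fspan r (\<gamma> o e) A" unfolding fspan_def using co mp by auto
  show "fspan r (\<gamma> o e) A \<subseteq> \<gamma> ` fspan r e A"
  proof
   fix v assume v: "v \<in> fspan r (\<gamma> o e) A"
   hence "v \<in> coord_space (2*r)" using fspan_space by blast
   then obtain x where x: "x \<in> coord_space (2*r)" "v = \<gamma> x" using bij unfolding bij_betw_def by blast
   have "x \<in> fspan r e A" using v x(1) co[OF x(1)] unfolding x(2) fspan_def by simp
   thus "v \<in> \<gamma> ` fspan r e A" using x(2) by blast
  qed
 qed
qed

lemma flag_action_coarsen:
 assumes \<gamma>: "\<gamma> \<in> carrier (orth_group r)" and e: "frame r e"
 shows "flag_action n \<gamma> (coarsen n nu (full_flag r e)) = coarsen n nu (full_flag r (\<gamma> o e))"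
 unfolding flag_action_def
proof (rule extensionalityI[of _ "{0..2*n + 1}"])
 fix i assume i: "i \<in> {0..2*n + 1}"
 thus "(\<lambda>i\<in>{0..2*n + 1}. \<gamma> ` coarsen n nu (full_flag r e) i) i = coarsen n nu (full_flag r (\<gamma> o e)) i"
  unfolding coarsen_def full_flag_def orth_group_frame(2)[OF assms, symmetric] by simp
qed (simp_all add: coarsen_def)

lemma orth_form_expansion:
 assumes e: "frame r e" and x: "x \<in> coord_space (2*r)"
 shows "orth_form r x y = (\<Sum>a\<in>{1..2*r}. coord r e x a * coord r e y (2*r + 1 - a))"
proof -
 have "orth_form r x y = orth_form r (\<Sum>a\<in>{1..2*r}. fun_scale (coord r e x a) (e a)) y"
  using frame_expansion[OF e x] by simp
 also have "\<dots> = (\<Sum>a\<in>{1..2*r}. coord r e x a * coord r e y (2*r + 1 - a))"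
  unfolding orth_form_linear
 proof (rule sum.cong[OF refl])
  fix a assume "a \<in> {1..2*r}"
  hence "2*r + 1 - (2*r + 1 - a) = a" by auto
  thus "coord r e x a * orth_form r (e a) y = coord r e x a * coord r e y (2*r + 1 - a)"
   using orth_form_sym[of r "e a" y] by (simp add: coord_def)
 qed
 finally show ?thesis .
qed

text \<open>
 The linear map that matches the coordinates is an isometry, as the form is expressed by coordinates
 in the same way in every hyperbolic frame.
\<close>

lemma frame_isometry:
 fixes e f :: "nat => nat => 'f::{field,finite}"
 assumes e: "frame r e" and f: "frame r f"
 obtains \<gamma> where "\<gamma> \<in> carrier (orth_group r)" "\<And>a. a \<in> {1..2*r} ==> \<gamma> (e a) = f a"
proof -
 let ?V = "coord_space (2*r) :: (nat => 'f) set"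
 define T where "T e f = (\<lambda>v\<in>?V. \<Sum>a\<in>{1..2*r}. fun_scale (coord r e v a) (f a))" for e f :: "nat => nat => 'f"
 have Tc: "T e f v \<in> ?V" "\<And>a. a \<in> {1..2*r} ==> coord r f (T e f v) a = coord r e v a"
  if "frame r f" "v \<in> ?V" for e f v
  unfolding T_def restrict_apply'[OF that(2)] coord_comb[OF that(1) subset_refl]
  using frame_comb_space[OF that(1) subset_refl] by simp_all
 have TT: "T f e (T e f v) = v" if "frame r e" "frame r f" "v \<in> ?V" for e f v
 proof (rule frame_eqI[OF that(1) Tc(1)[OF that(1) Tc(1)[OF that(2,3)]] that(3)])
  fix a assume a: "a \<in> {1..2*r}"
  show "coord r e (T f e (T e f v)) a = coord r e v a"
   using Tc(2)[OF that(1) Tc(1)[OF that(2,3)] a] Tc(2)[OF that(2,3) a] by simp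
 qed
 have "T e f \<in> carrier (orth_group r)"
  unfolding orth_group_carrier
 proof (intro conjI ballI allI)
  have "bij_betw (T e f) ?V ?V"
   by (rule bij_betwI[where g = "T f e"]) (use Tc(1) e f TT in auto)
  thus "T e f \<in> Bij ?V" by (simp add: Bij_def T_def)
  fix x assume x: "x \<in> ?V"
  show "T e f (x + y) = T e f x + T e f y" if y: "y \<in> ?V" for y
  proof (rule frame_eqI[OF f Tc(1)[OF f coord_space_closed(1)[OF x y]] coord_space_closed(1)[OF Tc(1)[OF f x] Tc(1)[OF f y]]])
   show "coord r f (T e f (x + y)) a = coord r f (T e f x + T e f y) a" if a: "a \<in> {1..2*r}" for a
    unfolding coord_linear Tc(2)[OF f coord_space_closed(1)[OF x y] a] Tc(2)[OF f x a] Tc(2)[OF f y a] ..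
  qed
  show "T e f (fun_scale c x) = fun_scale c (T e f x)" for c
  proof (rule frame_eqI[OF f Tc(1)[OF f coord_space_closed(3)[OF x]] coord_space_closed(3)[OF Tc(1)[OF f x]]])
   show "coord r f (T e f (fun_scale c x)) a = coord r f (fun_scale c (T e f x)) a" if a: "a \<in> {1..2*r}" for a
    unfolding coord_linear Tc(2)[OF f coord_space_closed(3)[OF x] a] Tc(2)[OF f x a] ..
  qed
  show "orth_form r (T e f x) (T e f y) = orth_form r x y" if y: "y \<in> ?V" for y
   unfolding orth_form_expansion[OF e x] orth_form_expansion[OF f Tc(1)[OF f x]]
  proof (rule sum.cong[OF refl])
   fix a assume a: "a \<in> {1..2*r}"
   hence "2*r + 1 - a \<in> {1..2*r}" by auto
   thus "coord r f (T e f x) a * coord r f (T e f y) (2*r + 1 - a)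
    = coord r e x a * coord r e y (2*r + 1 - a)"
    using Tc(2)[OF f x a] Tc(2)[OF f y] by simp
  qed
 qed
 moreover have "T e f (e a) = f a" if a: "a \<in> {1..2*r}" for a
 proof (rule frame_eqI[OF f Tc(1)[OF f frame_space[OF e a]] frame_space[OF f a]])
  show "coord r f (T e f (e a)) b = coord r f (f a) b" if b: "b \<in> {1..2*r}" for b
   using Tc(2)[OF f frame_space[OF e a] b] coord_basis[OF e b a] coord_basis[OF f b a] by simp
 qed
 ultimately show ?thesis using that by blast
qed

lemma full_flag_agree:
 assumes "\<And>a. a \<in> {1..2*r} ==> e a = f a"
 shows "full_flag r e = full_flag r f"
proof -
 have "coord r e v a = coord r f v a" if "a \<in> {1..2*r}" for v a
 proof -
  have "2*r + 1 - a \<in> {1..2*r}" using that by auto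
  from assms[OF this] show ?thesis unfolding coord_def by simp
 qed
 thus ?thesis unfolding full_flag_def fspan_def by (intro ext Collect_cong conj_cong ball_cong refl) auto
qed

lemma isotropic_pair:
 assumes F: "F \<in> isotropic_flags n r" and F': "F' \<in> isotropic_flags n r"
 obtains ka mu g w where "ka \<in> weights n r" "mu \<in> weights n r" "frame r g" "w \<in> WB r"
  "F = coarsen n ka (full_flag r g)" "F' = coarsen n mu (full_flag r (g o w))"
proof -
 obtain ka y where 1: "ka \<in> weights n r" "y \<in> full_flags r" "F = coarsen n ka y" by (rule isotropic_coarsen[OF F])
 obtain mu z where 2: "mu \<in> weights n r" "z \<in> full_flags r" "F' = coarsen n mu z" by (rule isotropic_coarsen[OF F'])
 obtain g where g: "frame r g" "pos r y z \<in> WB r" "y = full_flag r g" "z = full_flag r (g o pos r y z)"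
  by (rule full_flags_adapted[OF 1(2) 2(2)])
 show ?thesis by (rule that[OF 1(1) 2(1) g(1,2)]) (use 1(3) 2(3) g(3,4) in simp_all)
qed

text \<open>
 Isometries carry frames to frames and hence preserve relative positions.  Conversely, equal matrices
 give the same double coset; after absorbing its left factor into a frame, an isometry between frames
 moves one pair to the other.
\<close>

lemma flag_pair_orbit:
 fixes F1 F2 :: "'f::{field,finite} flag"
 assumes F: "F1 \<in> isotropic_flags n r" "F2 \<in> isotropic_flags n r"
 shows "orbit (orth_group r) (diag_action (flag_action n)) (F1, F2)
  = {p \<in> isotropic_flags n r \<times> isotropic_flags n r. relative_position n p = relative_position n (F1, F2)}"
proof -
 obtain ka mu g w where 1: "ka \<in> weights n r" "mu \<in> weights n r" "frame r g" "w \<in> WB r"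
  "F1 = coarsen n ka (full_flag r g)" "F2 = coarsen n mu (full_flag r (g o w))" by (rule isotropic_pair[OF F])
 have gw: "frame r (g o w)" by (rule frame_comp[OF 1(3,4)])
 have p1: "relative_position n (F1, F2) = coset_matrix n ka w mu"
  unfolding 1(5,6) by (rule relative_position_frame[OF 1(3,4,1,2)])
 show ?thesis
 proof
  show "orbit (orth_group r) (diag_action (flag_action n)) (F1, F2)
   \<subseteq> {p \<in> isotropic_flags n r \<times> isotropic_flags n r. relative_position n p = relative_position n (F1, F2)}"
  proof
   fix p assume "p \<in> orbit (orth_group r) (diag_action (flag_action n)) (F1, F2)"
   then obtain \<gamma> where \<gamma>: "\<gamma> \<in> carrier (orth_group r)" "p = (flag_action n \<gamma> F1, flag_action n \<gamma> F2)"
    by (auto simp: orbit_def diag_action_def)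
   have p: "p = (coarsen n ka (full_flag r (\<gamma> o g)), coarsen n mu (full_flag r (\<gamma> o g o w)))"
    unfolding \<gamma>(2) 1(5,6) flag_action_coarsen[OF \<gamma>(1) 1(3)] flag_action_coarsen[OF \<gamma>(1) gw] comp_assoc ..
   have \<gamma>g: "frame r (\<gamma> o g)" by (rule orth_group_frame(1)[OF \<gamma>(1) 1(3)])
   have "relative_position n p = relative_position n (F1, F2)"
    unfolding p1 p by (rule relative_position_frame[OF \<gamma>g 1(4,1,2)])
   moreover have "p \<in> isotropic_flags n r \<times> isotropic_flags n r"
    unfolding p using coarsen_isotropic[OF 1(1) full_flagI[OF \<gamma>g]] coarsen_isotropic[OF 1(2) full_flagI[OF frame_comp[OF \<gamma>g 1(4)]]]
    by blast
   ultimately show "p \<in> {p \<in> isotropic_flags n r \<times> isotropic_flags n r. relative_position n p = relative_position n (F1, F2)}" by blast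
  qed
  show "{p \<in> isotropic_flags n r \<times> isotropic_flags n r. relative_position n p = relative_position n (F1, F2)}
   \<subseteq> orbit (orth_group r) (diag_action (flag_action n)) (F1, F2)"
  proof (clarify)
   fix E1 E2 :: "'f flag"
   assume E: "E1 \<in> isotropic_flags n r" "E2 \<in> isotropic_flags n r"
    and eq: "relative_position n (E1, E2) = relative_position n (F1, F2)"
   obtain ka' mu' h w' where 2: "ka' \<in> weights n r" "mu' \<in> weights n r" "frame r h" "w' \<in> WB r"
    "E1 = coarsen n ka' (full_flag r h)" "E2 = coarsen n mu' (full_flag r (h o w'))" by (rule isotropic_pair[OF E])
   have "coset_matrix n ka w mu = coset_matrix n ka' w' mu'"
    using relative_position_frame[OF 2(3,4,1,2)] p1 eq unfolding 2(5,6) by simp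
   from coset_matrix_eq_imp[OF 1(1,2,4) 2(1,2,4) this] obtain u v where uv: "ka' = ka" "mu' = mu"
    "u \<in> parabolic n r ka" "v \<in> parabolic n r mu" "w' = u o w o v" unfolding double_coset_def by blast
   have uW: "u \<in> WB r" by (rule parabolic_WB[OF 1(1) uv(3)])
   have hu: "frame r (h o u)" by (rule frame_comp[OF 2(3) uW])
   have E1: "E1 = coarsen n ka (full_flag r (h o u))"
    unfolding 2(5) uv(1) by (rule coarsen_parabolic[OF 2(3) 1(1) uv(3), symmetric])
   have E2: "E2 = coarsen n mu (full_flag r (h o u o w))"
    unfolding 2(6) uv(2) uv(5) comp_assoc[symmetric] by (rule coarsen_parabolic[OF frame_comp[OF hu 1(4)] 1(2) uv(4)])
   obtain \<gamma> where \<gamma>: "\<gamma> \<in> carrier (orth_group r)" "\<And>a. a \<in> {1..2*r} ==> \<gamma> (g a) = (h o u) a"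
    using frame_isometry[OF 1(3) hu] by blast
   have "full_flag r (\<gamma> o g) = full_flag r (h o u)" by (rule full_flag_agree) (use \<gamma>(2) in simp)
   moreover have "full_flag r (\<gamma> o (g o w)) = full_flag r (h o u o w)"
    by (rule full_flag_agree) (use \<gamma>(2) WB_range[OF 1(4)] in simp)
   ultimately have "flag_action n \<gamma> F1 = E1" "flag_action n \<gamma> F2 = E2"
    unfolding 1(5,6) E1 E2 flag_action_coarsen[OF \<gamma>(1) 1(3)] flag_action_coarsen[OF \<gamma>(1) gw] by simp_all
   hence "(E1, E2) = diag_action (flag_action n) \<gamma> (F1, F2)" by (simp add: diag_action_def)
   thus "(E1, E2) \<in> orbit (orth_group r) (diag_action (flag_action n)) (F1, F2)"
    unfolding orbit_def using \<gamma>(1) by blast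
  qed
 qed
qed

lemma flag_orbit_eq:
 assumes A: "A \<in> Xi (2*n + 1) (2*r)"
 shows "flag_orbit n r A = {p \<in> isotropic_flags n r \<times> (isotropic_flags n r :: 'f::{field,finite} flag set). relative_position n p = A}"
proof -
 let ?X = "isotropic_flags n r :: 'f flag set"
 let ?O = "{p \<in> ?X \<times> ?X. relative_position n p = A}"
 obtain ka mu d where d: "ka \<in> weights n r" "mu \<in> weights n r" "d \<in> WB r" "coset_matrix n ka d mu = A"
  using coset_matrix_surj[OF A] by blast
 let ?e = "\<lambda>a i. if i = a then (1::'f) else 0"
 note e = standard_frame[of r, where 'f = 'f]
 let ?F1 = "coarsen n ka (full_flag r ?e)" and ?F2 = "coarsen n mu (full_flag r (?e o d))"
 have F: "?F1 \<in> ?X" "?F2 \<in> ?X"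
  by (rule coarsen_isotropic[OF d(1) full_flagI[OF e]], rule coarsen_isotropic[OF d(2) full_flagI[OF frame_comp[OF e d(3)]]])
 have rel: "relative_position n (?F1, ?F2) = A" unfolding d(4)[symmetric] by (rule relative_position_frame[OF e d(3,1,2)])
 show ?thesis
  unfolding flag_orbit_def
 proof (rule the_equality)
  show "?O \<in> orbits (orth_group r) (?X \<times> ?X) (diag_action (flag_action n)) \<and> (\<forall>p\<in>?O. relative_position n p = A)"
  proof
   show "?O \<in> orbits (orth_group r) (?X \<times> ?X) (diag_action (flag_action n))"
    unfolding orbits_def using flag_pair_orbit[OF F] F unfolding rel by blast
  qed blast
  fix C assume C: "C \<in> orbits (orth_group r) (?X \<times> ?X) (diag_action (flag_action n)) \<and> (\<forall>p\<in>C. relative_position n p = A)"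
  then obtain E1 E2 where E: "E1 \<in> ?X" "E2 \<in> ?X" "C = orbit (orth_group r) (diag_action (flag_action n)) (E1, E2)"
   unfolding orbits_def by blast
  have "(E1, E2) \<in> C" unfolding E(3) flag_pair_orbit[OF E(1,2)] using E(1,2) by blast
  hence "relative_position n (E1, E2) = A" using C by blast
  thus "C = ?O" unfolding E(3) flag_pair_orbit[OF E(1,2)] by simp
 qed
qed

lemma invariant_fun_carrier:
 fixes f :: "'f::{field,finite} flag \<times> 'f flag => int" and n r :: nat
 defines "X \<equiv> isotropic_flags n r"
 shows "f \<in> carrier (invariant_fun_ring (orth_group r) X (flag_action n)) \<longleftrightarrow>
  f \<in> extensional (X \<times> X) \<and> (\<forall>p\<in>X \<times> X. \<forall>p'\<in>X \<times> X. relative_position n p = relative_position n p' \<longrightarrow> f p = f p')"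
proof -
 let ?orb = "orbit (orth_group r) (diag_action (flag_action n))"
 have o: "?orb p0 = {p \<in> X \<times> X. relative_position n p = relative_position n p0}" if "p0 \<in> X \<times> X" for p0
 proof -
  have F: "fst p0 \<in> X" "snd p0 \<in> X" using that by auto
  show ?thesis using flag_pair_orbit[OF F[unfolded X_def]] unfolding X_def by simp
 qed
 have "(\<forall>C\<in>orbits (orth_group r) (X \<times> X) (diag_action (flag_action n)). \<forall>p\<in>C. \<forall>p'\<in>C. f p = f p') \<longleftrightarrow>
   (\<forall>p\<in>X \<times> X. \<forall>p'\<in>X \<times> X. relative_position n p = relative_position n p' \<longrightarrow> f p = f p')"
 proof (intro iffI ballI impI)
  fix p p' assume *: "\<forall>C\<in>orbits (orth_group r) (X \<times> X) (diag_action (flag_action n)). \<forall>p\<in>C. \<forall>p'\<in>C. f p = f p'"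
   and p: "p \<in> X \<times> X" "p' \<in> X \<times> X" "relative_position n p = relative_position n p'"
  have "?orb p \<in> orbits (orth_group r) (X \<times> X) (diag_action (flag_action n))" unfolding orbits_def using p(1) by blast
  moreover have "p \<in> ?orb p" "p' \<in> ?orb p" unfolding o[OF p(1)] using p by simp_all
  ultimately show "f p = f p'" using * by blast
 next
  fix C p p' assume *: "\<forall>p\<in>X \<times> X. \<forall>p'\<in>X \<times> X. relative_position n p = relative_position n p' \<longrightarrow> f p = f p'"
   and C: "C \<in> orbits (orth_group r) (X \<times> X) (diag_action (flag_action n))" and p: "p \<in> C" "p' \<in> C"
  obtain p0 where p0: "p0 \<in> X \<times> X" "C = ?orb p0" using C unfolding orbits_def by blast
  have "p \<in> X \<times> X" "p' \<in> X \<times> X" "relative_position n p = relative_position n p'"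
   using p unfolding p0(2) o[OF p0(1)] by simp_all
  thus "f p = f p'" using * by blast
 qed
 thus ?thesis unfolding invariant_fun_ring_def by (simp add: PiE_def)
qed

section \<open>The Hecke action as convolution over complete flags\<close>

lemma neighbour_sum_refl_op:
 fixes y y' :: "'f::{field,finite} flag"
 assumes y: "y \<in> full_flags r" "y' \<in> full_flags r" and i: "i \<in> {1..r}" and two: "(1::'f) + 1 \<noteq> 0"
  and Q: "Q = int (card (UNIV :: 'f set))"
 shows "(\<Sum>z\<in>neighbours r i y'. poly (phi (pos r y z)) Q) = poly (refl_op r i phi (pos r y y')) Q"
 using neighbour_sum[OF y i two refl, of "\<lambda>w. poly (phi w) Q"] pos_WB[OF y] i
 by (simp add: refl_op_def par_def qvar_def Q)

text \<open>Summing over the neighbours of \<open>y'\<close> commutes with convolution from the left.\<close>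

lemma convolution_refl_op:
 fixes y y' :: "'f::{field,finite} flag" and a :: "'f flag => int"
 assumes y': "y' \<in> full_flags r" and i: "i \<in> {1..r}" and two: "(1::'f) + 1 \<noteq> 0"
  and Q: "Q = int (card (UNIV :: 'f set))"
 shows "(\<Sum>z\<in>full_flags r. a z * poly (refl_op r i \<eta> (pos r z y')) Q)
  = (\<Sum>x\<in>neighbours r i y'. \<Sum>z\<in>full_flags r. a z * poly (\<eta> (pos r z x)) Q)"
proof -
 have "(\<Sum>z\<in>full_flags r. a z * poly (refl_op r i \<eta> (pos r z y')) Q)
   = (\<Sum>z\<in>full_flags r. \<Sum>x\<in>neighbours r i y'. a z * poly (\<eta> (pos r z x)) Q)"
 proof (rule sum.cong[OF refl])
  fix z :: "'f flag" assume z: "z \<in> full_flags r"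
  show "a z * poly (refl_op r i \<eta> (pos r z y')) Q = (\<Sum>x\<in>neighbours r i y'. a z * poly (\<eta> (pos r z x)) Q)"
   unfolding neighbour_sum_refl_op[OF z y' i two Q, symmetric] sum_distrib_left ..
 qed
 thus ?thesis by (subst sum.swap) simp
qed

lemma convolution_word_op:
 fixes y y' :: "'f::{field,finite} flag" and a :: "'f flag => int"
 assumes y: "y \<in> full_flags r" and two: "(1::'f) + 1 \<noteq> 0" and Q: "Q = int (card (UNIV :: 'f set))"
  and "is": "is \<in> lists {1..r}"
  and eq: "\<And>y'. y' \<in> full_flags r ==> (\<Sum>z\<in>full_flags r. a z * poly (\<eta> (pos r z y')) Q) = poly (psi (pos r y y')) Q"
  and y': "y' \<in> full_flags r"
 shows "(\<Sum>z\<in>full_flags r. a z * poly (word_op r is \<eta> (pos r z y')) Q) = poly (word_op r is psi (pos r y y')) Q"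
 using "is" eq y'
proof (induction "is" arbitrary: \<eta> psi y' rule: list.induct)
 case Nil
 thus ?case by simp
next
 case (Cons i "is")
 have i: "i \<in> {1..r}" "is \<in> lists {1..r}" using Cons.prems(1) by simp_all
 have "(\<Sum>z\<in>full_flags r. a z * poly (refl_op r i \<eta> (pos r z x)) Q) = poly (refl_op r i psi (pos r y x)) Q"
  if x: "x \<in> full_flags r" for x
 proof -
  have "(\<Sum>z\<in>full_flags r. a z * poly (refl_op r i \<eta> (pos r z x)) Q)
    = (\<Sum>x\<in>neighbours r i x. poly (psi (pos r y x)) Q)"
   unfolding convolution_refl_op[OF x i(1) two Q]
   by (rule sum.cong[OF refl], rule Cons.prems(2)) (simp add: neighbours_def)
  thus ?thesis unfolding neighbour_sum_refl_op[OF y x i(1) two Q] .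
 qed
 from Cons.IH[OF i(2) this Cons.prems(3)] show ?case by simp
qed

text \<open>
 Words act by iterated sums over neighbours, and the statement is linear in \<open>h\<close>; for the empty word
 only \<open>z = y'\<close> contributes.
\<close>

lemma hecke_convolution:
 fixes y y' :: "'f::{field,finite} flag"
 assumes r2: "2 \<le> r" and two: "(1::'f) + 1 \<noteq> 0" and Q: "Q = int (card (UNIV :: 'f set))"
  and h: "h \<in> carrier (hecke r)" and y: "y \<in> full_flags r" "y' \<in> full_flags r"
 shows "(\<Sum>z\<in>full_flags r. poly (phi (pos r y z)) Q * poly (hecke_coeff r h (pos r z y')) Q)
  = poly (hecke_act r h phi (pos r y y')) Q"
proof -
 let ?a = "\<lambda>z. poly (phi (pos r y z)) Q"
 have base: "(\<Sum>z\<in>full_flags r. ?a z * poly (basis_fun id (pos r z x)) Q) = poly (phi (pos r y x)) Q"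
  if x: "x \<in> full_flags r" for x :: "'f flag"
 proof -
  have "(\<Sum>z\<in>full_flags r. ?a z * poly (basis_fun id (pos r z x)) Q) = (\<Sum>z\<in>full_flags r. if z = x then ?a z else 0)"
  proof (rule sum.cong[OF refl])
   fix z :: "'f flag" assume z: "z \<in> full_flags r"
   show "?a z * poly (basis_fun id (pos r z x)) Q = (if z = x then ?a z else 0)"
    unfolding basis_fun_def pos_id_iff[OF z x] by simp
  qed
  also have "\<dots> = ?a x" using x by (simp add: finite_full_flags)
  finally show ?thesis .
 qed
 define \<beta> where "\<beta> = basis_fun id"
 have "keys (hecke_rep r h) \<subseteq> lists {1..r}" using hecke_rep(1)[OF r2 h] by (simp add: free_algebra_carrier)
 hence "(\<Sum>z\<in>full_flags r. ?a z * poly (free_act r (hecke_rep r h) (\<beta>) (pos r z y')) Q)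
  = poly (free_act r (hecke_rep r h) phi (pos r y y')) Q"
 proof (induction rule: keys_induct)
  case zero
  show ?case by (simp add: fun_apply)
 next
  case (add "is" c f)
  have w: "(\<Sum>z\<in>full_flags r. ?a z * poly (word_op r is (\<beta>) (pos r z y')) Q) = poly (word_op r is phi (pos r y y')) Q"
   by (rule convolution_word_op[OF y(1) two Q add(1) base[folded \<beta>_def] y(2)])
  have "(\<Sum>z\<in>full_flags r. ?a z * poly (free_act r (single is c + f) (\<beta>) (pos r z y')) Q)
    = poly c Q * (\<Sum>z\<in>full_flags r. ?a z * poly (word_op r is (\<beta>) (pos r z y')) Q)
     + (\<Sum>z\<in>full_flags r. ?a z * poly (free_act r f (\<beta>) (pos r z y')) Q)"
   by (simp add: free_act_add free_act_single fun_apply distrib_left sum.distrib sum_distrib_left mult.left_commute)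
  thus ?case unfolding w add(3) by (simp add: free_act_add free_act_single fun_apply)
 qed
 thus ?thesis unfolding hecke_coeff_def hecke_act_def \<beta>_def .
qed

section \<open>From the q-Schur algebra to invariant functions\<close>

lemma inv_double_coset:
 assumes ka: "ka \<in> weights n r" and mu: "mu \<in> weights n r" and w: "w \<in> WB r"
  and phi: "phi \<in> left_inv n r ka" "phi \<in> right_inv n r mu" and w': "w' \<in> double_coset n r ka w mu"
 shows "phi w' = phi w"
proof -
 obtain u v where uv: "u \<in> parabolic n r ka" "v \<in> parabolic n r mu" "w' = u o w o v" using w' unfolding double_coset_def by blast
 have uw: "u o w \<in> WB r" by (rule comp_WB[OF parabolic_WB[OF ka uv(1)] w])
 show ?thesis unfolding uv(3) right_inv_parabolic[OF mu phi(2) uv(2) uw] left_inv_parabolic[OF ka phi(1) uv(1) w] ..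
qed

definition flag_weight :: "nat => nat => 'f::{field,finite} flag => nat => nat" where
 "flag_weight n r F = (SOME nu. nu \<in> weights n r \<and> (\<exists>y\<in>full_flags r. F = coarsen n nu y))"

definition flag_refine :: "nat => nat => 'f::{field,finite} flag => 'f flag" where
 "flag_refine n r F = (SOME y. y \<in> full_flags r \<and> F = coarsen n (flag_weight n r F) y)"

lemma flag_refine:
 assumes "F \<in> isotropic_flags n r"
 shows "flag_weight n r F \<in> weights n r" "flag_refine n r F \<in> full_flags r"
  "coarsen n (flag_weight n r F) (flag_refine n r F) = F"
proof -
 have "\<exists>nu. nu \<in> weights n r \<and> (\<exists>y\<in>full_flags r. F = coarsen n nu y)" using isotropic_coarsen[OF assms] by blast
 from someI_ex[OF this, folded flag_weight_def]
 have 1: "flag_weight n r F \<in> weights n r" "\<exists>y. y \<in> full_flags r \<and> F = coarsen n (flag_weight n r F) y" by blast+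
 from someI_ex[OF 1(2), folded flag_refine_def] 1(1)
 show "flag_weight n r F \<in> weights n r" "flag_refine n r F \<in> full_flags r"
  "coarsen n (flag_weight n r F) (flag_refine n r F) = F" by auto
qed

lemma flag_weight_coarsen:
 assumes nu: "nu \<in> weights n r" and y: "y \<in> full_flags r"
 shows "flag_weight n r (coarsen n nu y) = nu"
proof -
 let ?F = "coarsen n nu y"
 note F = flag_refine[OF coarsen_isotropic[OF assms]]
 have "coset_matrix n (flag_weight n r ?F) (pos r (flag_refine n r ?F) (flag_refine n r ?F)) (flag_weight n r ?F)
   = coset_matrix n nu (pos r y y) nu"
  using relative_position_coarsen[OF F(2) F(2) F(1) F(1)] relative_position_coarsen[OF y y nu nu] unfolding F(3) by simp
 from coset_matrix_eq_imp(1)[OF nu nu pos_WB[OF y y] F(1) F(1) pos_WB[OF F(2) F(2)] this[symmetric]]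
 show ?thesis .
qed

lemma finite_isotropic_flags: "finite (isotropic_flags n r :: 'f::{field,finite} flag set)"
proof -
 have "(isotropic_flags n r :: 'f flag set) \<subseteq> (\<lambda>(nu, y). coarsen n nu y) ` (weights n r \<times> full_flags r)"
 proof
  fix F :: "'f flag" assume "F \<in> isotropic_flags n r"
  then obtain nu y where "nu \<in> weights n r" "y \<in> full_flags r" "F = coarsen n nu y" by (rule isotropic_coarsen)
  thus "F \<in> (\<lambda>(nu, y). coarsen n nu y) ` (weights n r \<times> full_flags r)" by force
 qed
 thus ?thesis
  by (rule finite_subset) (intro finite_imageI finite_cartesian_product finite_weights finite_full_flags)
qed

text \<open>
 The matrix of an endomorphism, evaluated at \<open>Q\<close> on positions of complete refinements.  The choice
 of the refinements is immaterial because the coefficient functions are constant on double cosets.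
\<close>

definition schur_fun :: "nat => nat => int => (tspace_elem => tspace_elem) => ('f::{field,finite}) flag \<times> 'f flag => int" where
 "schur_fun n r Q s = (\<lambda>(F, F')\<in>isotropic_flags n r \<times> isotropic_flags n r.
   poly (schur_coeff n r s (flag_weight n r F) (flag_weight n r F') (pos r (flag_refine n r F) (flag_refine n r F'))) Q)"

lemma schur_fun_coarsen:
 assumes r2: "2 \<le> r" and s: "s \<in> carrier (schurB n r)" and ka: "ka \<in> weights n r" and mu: "mu \<in> weights n r"
  and y: "y \<in> full_flags r" "y' \<in> full_flags r"
 shows "schur_fun n r Q s (coarsen n ka y, coarsen n mu y') = poly (schur_coeff n r s ka mu (pos r y y')) Q"
proof -
 let ?F = "coarsen n ka y" and ?F' = "coarsen n mu y'"
 have X: "?F \<in> isotropic_flags n r" "?F' \<in> isotropic_flags n r"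
  by (rule coarsen_isotropic[OF ka y(1)], rule coarsen_isotropic[OF mu y(2)])
 note F = flag_refine[OF X(1)] and F' = flag_refine[OF X(2)]
 note wt = flag_weight_coarsen[OF ka y(1)] flag_weight_coarsen[OF mu y(2)]
 have "coset_matrix n ka (pos r y y') mu = coset_matrix n ka (pos r (flag_refine n r ?F) (flag_refine n r ?F')) mu"
  using relative_position_coarsen[OF y ka mu] relative_position_coarsen[OF F(2) F'(2) ka mu] F(3) F'(3) unfolding wt by simp
 from coset_matrix_eq_imp(3)[OF ka mu pos_WB[OF y] ka mu pos_WB[OF F(2) F'(2)] this]
 have "schur_coeff n r s ka mu (pos r (flag_refine n r ?F) (flag_refine n r ?F')) = schur_coeff n r s ka mu (pos r y y')"
  by (rule inv_double_coset[OF ka mu pos_WB[OF y] schur_coeff_left_inv[OF r2 s mu ka] schur_coeff_right_inv[OF r2 s mu ka]])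
 thus ?thesis using X by (simp add: schur_fun_def wt)
qed

lemma fun_ring_simps:
 "f \<otimes>\<^bsub>invariant_fun_ring G X phi\<^esub> f' = (\<lambda>(x, y)\<in>X \<times> X. \<Sum>z\<in>X. f (x, z) * f' (z, y))"
 "f \<oplus>\<^bsub>invariant_fun_ring G X phi\<^esub> f' = (\<lambda>p\<in>X \<times> X. f p + f' p)"
 "\<one>\<^bsub>invariant_fun_ring G X phi\<^esub> = (\<lambda>(x, y)\<in>X \<times> X. if x = y then 1 else 0)"
 "\<zero>\<^bsub>invariant_fun_ring G X phi\<^esub> = (\<lambda>p\<in>X \<times> X. 0)"
 by (simp_all add: invariant_fun_ring_def)

abbreviation flag_fun_ring :: "nat => nat => (('f::{field,finite}) flag \<times> 'f flag => int) ring" where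
 "flag_fun_ring n r \<equiv> invariant_fun_ring (orth_group r) (isotropic_flags n r) (flag_action n)"

lemma schur_fun_closed:
 assumes r2: "2 \<le> r" and s: "s \<in> carrier (schurB n r)"
 shows "(schur_fun n r Q s :: 'f::{field,finite} flag \<times> 'f flag => int) \<in> carrier (flag_fun_ring n r)"
 unfolding invariant_fun_carrier
proof (intro conjI ballI impI)
 let ?X = "isotropic_flags n r :: 'f flag set"
 show "schur_fun n r Q s \<in> extensional (?X \<times> ?X)" by (simp add: schur_fun_def)
 fix p p' assume p: "p \<in> ?X \<times> ?X" "p' \<in> ?X \<times> ?X" and rel: "relative_position n p = relative_position n p'"
 obtain F F' where F: "p = (F, F')" "F \<in> ?X" "F' \<in> ?X" using p(1) by blast
 obtain E E' where E: "p' = (E, E')" "E \<in> ?X" "E' \<in> ?X" using p(2) by blast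
 obtain ka y where 1: "ka \<in> weights n r" "y \<in> full_flags r" "F = coarsen n ka y" by (rule isotropic_coarsen[OF F(2)])
 obtain mu y' where 2: "mu \<in> weights n r" "y' \<in> full_flags r" "F' = coarsen n mu y'" by (rule isotropic_coarsen[OF F(3)])
 obtain ka1 z where 3: "ka1 \<in> weights n r" "z \<in> full_flags r" "E = coarsen n ka1 z" by (rule isotropic_coarsen[OF E(2)])
 obtain mu1 z' where 4: "mu1 \<in> weights n r" "z' \<in> full_flags r" "E' = coarsen n mu1 z'" by (rule isotropic_coarsen[OF E(3)])
 have "coset_matrix n ka (pos r y y') mu = coset_matrix n ka1 (pos r z z') mu1"
  using rel unfolding F(1) E(1) 1(3) 2(3) 3(3) 4(3)
   relative_position_coarsen[OF 1(2) 2(2) 1(1) 2(1)] relative_position_coarsen[OF 3(2) 4(2) 3(1) 4(1)] .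
 note c = coset_matrix_eq_imp[OF 1(1) 2(1) pos_WB[OF 1(2) 2(2)] 3(1) 4(1) pos_WB[OF 3(2) 4(2)] this]
 have "schur_coeff n r s ka mu (pos r z z') = schur_coeff n r s ka mu (pos r y y')"
  by (rule inv_double_coset[OF 1(1) 2(1) pos_WB[OF 1(2) 2(2)]
   schur_coeff_left_inv[OF r2 s 2(1) 1(1)] schur_coeff_right_inv[OF r2 s 2(1) 1(1)] c(3)])
 thus "schur_fun n r Q s p = schur_fun n r Q s p'"
  unfolding F(1) E(1) 1(3) 2(3) 3(3) 4(3)
  using schur_fun_coarsen[OF r2 s 1(1) 2(1) 1(2) 2(2), of Q] schur_fun_coarsen[OF r2 s 3(1) 4(1) 3(2) 4(2), of Q] c(1,2) by simp
qed

lemma pair_fun_eqI: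
 fixes f f' :: "'f::{field,finite} flag \<times> 'f flag => int"
 assumes "f \<in> extensional (isotropic_flags n r \<times> isotropic_flags n r)" "f' \<in> extensional (isotropic_flags n r \<times> isotropic_flags n r)"
  and eq: "\<And>ka mu y y'. ka \<in> weights n r ==> mu \<in> weights n r ==> y \<in> full_flags r ==> y' \<in> full_flags r ==>
   f (coarsen n ka y, coarsen n mu y') = f' (coarsen n ka y, coarsen n mu y')"
 shows "f = f'"
proof (rule extensionalityI[OF assms(1,2)])
 fix p :: "'f flag \<times> 'f flag" assume "p \<in> isotropic_flags n r \<times> isotropic_flags n r"
 then obtain F F' where F: "p = (F, F')" "F \<in> isotropic_flags n r" "F' \<in> isotropic_flags n r" by blast
 obtain ka y where 1: "ka \<in> weights n r" "y \<in> full_flags r" "F = coarsen n ka y" by (rule isotropic_coarsen[OF F(2)])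
 obtain mu y' where 2: "mu \<in> weights n r" "y' \<in> full_flags r" "F' = coarsen n mu y'" by (rule isotropic_coarsen[OF F(3)])
 show "f p = f' p" unfolding F(1) 1(3) 2(3) by (rule eq[OF 1(1) 2(1) 1(2) 2(2)])
qed

lemma schur_fun_eqI:
 fixes f :: "'f::{field,finite} flag \<times> 'f flag => int"
 assumes r2: "2 \<le> r" and s: "s \<in> carrier (schurB n r)" and f: "f \<in> extensional (isotropic_flags n r \<times> isotropic_flags n r)"
  and eq: "\<And>ka mu y y'. ka \<in> weights n r ==> mu \<in> weights n r ==> y \<in> full_flags r ==> y' \<in> full_flags r ==>
   (coarsen n ka y, coarsen n mu y') \<in> isotropic_flags n r \<times> isotropic_flags n r ==>
   f (coarsen n ka y, coarsen n mu y') = poly (schur_coeff n r s ka mu (pos r y y')) Q"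
 shows "schur_fun n r Q s = f"
proof (rule pair_fun_eqI[OF _ f])
 fix ka mu and y y' :: "'f flag"
 assume *: "ka \<in> weights n r" "mu \<in> weights n r" "y \<in> full_flags r" "y' \<in> full_flags r"
 show "schur_fun n r Q s (coarsen n ka y, coarsen n mu y') = f (coarsen n ka y, coarsen n mu y')"
  using eq[OF *] schur_fun_coarsen[OF r2 s *] coarsen_isotropic[OF *(1,3)] coarsen_isotropic[OF *(2,4)] by simp
qed (simp add: schur_fun_def)

text \<open>
 The right hand side is a sum over partial flags \<open>E\<close>, grouped by weight.  By the Hecke action the second
 factor is a sum over the complete flags that refine \<open>E\<close>, on which the first factor is constant; what
 results is a convolution over all complete flags.
\<close>

lemma schur_fun_mult:
 assumes r2: "2 \<le> r" and two: "(1::'f::{field,finite}) + 1 \<noteq> 0" and Q: "Q = int (card (UNIV :: 'f set))"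
  and s: "s \<in> carrier (schurB n r)" "s' \<in> carrier (schurB n r)"
 shows "(schur_fun n r Q (s \<otimes>\<^bsub>schurB n r\<^esub> s') :: 'f flag \<times> 'f flag => int)
  = schur_fun n r Q s \<otimes>\<^bsub>flag_fun_ring n r\<^esub> schur_fun n r Q s'"
proof (rule schur_fun_eqI[OF r2 schurB_mult_closed[OF r2 s]])
 let ?X = "isotropic_flags n r :: 'f flag set" and ?Y = "full_flags r :: 'f flag set"
 show "schur_fun n r Q s \<otimes>\<^bsub>flag_fun_ring n r\<^esub> schur_fun n r Q s' \<in> extensional (?X \<times> ?X)"
  by (simp add: fun_ring_simps)
 fix ka mu and y y' :: "'f flag"
 assume ka: "ka \<in> weights n r" and mu: "mu \<in> weights n r" and y: "y \<in> full_flags r" "y' \<in> full_flags r"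
 let ?F = "coarsen n ka y" and ?F' = "coarsen n mu y'"
 assume X: "(?F, ?F') \<in> ?X \<times> ?X"
 obtain h where h: "\<And>nu. nu \<in> weights n r ==> h nu \<in> carrier (hecke r)"
  "\<And>nu. nu \<in> weights n r ==> schur_coeff n r s' nu mu = hecke_act r (h nu) (set_fun (parabolic n r nu))"
  "schur_coeff n r (s \<otimes>\<^bsub>schurB n r\<^esub> s') ka mu = (\<Sum>nu\<in>weights n r. hecke_act r (h nu) (schur_coeff n r s ka nu))"
  using schur_coeff_mult[OF r2 s ka mu] by blast
 define k where "k nu x = poly (schur_coeff n r s ka nu (pos r y x)) Q * poly (hecke_coeff r (h nu) (pos r x y')) Q" for nu x
 have cell: "schur_fun n r Q s (?F, E) * schur_fun n r Q s' (E, ?F') = (\<Sum>x\<in>{x \<in> ?Y. coarsen n nu x = E}. k nu x)"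
  if E: "E \<in> ?X" and nu: "flag_weight n r E = nu" for E nu
 proof -
  let ?z = "flag_refine n r E"
  note R = flag_refine[OF E, unfolded nu]
  have "schur_fun n r Q s' (E, ?F') = poly (schur_coeff n r s' nu mu (pos r ?z y')) Q"
   using schur_fun_coarsen[OF r2 s(2) R(1) mu R(2) y(2), of Q] unfolding R(3) .
  also have "\<dots> = (\<Sum>x\<in>?Y. poly (set_fun (parabolic n r nu) (pos r ?z x)) Q * poly (hecke_coeff r (h nu) (pos r x y')) Q)"
   unfolding h(2)[OF R(1)] by (rule hecke_convolution[OF r2 two Q h(1)[OF R(1)] R(2) y(2), symmetric])
  also have "\<dots> = (\<Sum>x\<in>?Y. if coarsen n nu x = E then poly (hecke_coeff r (h nu) (pos r x y')) Q else 0)"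
  proof (rule sum.cong[OF refl])
   fix x :: "'f flag" assume x: "x \<in> ?Y"
   have "pos r ?z x \<in> parabolic n r nu \<longleftrightarrow> coarsen n nu x = E"
    using coarsen_eq_iff[OF R(2) x R(1)] unfolding R(3) by auto
   thus "poly (set_fun (parabolic n r nu) (pos r ?z x)) Q * poly (hecke_coeff r (h nu) (pos r x y')) Q
    = (if coarsen n nu x = E then poly (hecke_coeff r (h nu) (pos r x y')) Q else 0)"
    by (simp add: set_fun_def)
  qed
  also have "\<dots> = (\<Sum>x\<in>{x \<in> ?Y. coarsen n nu x = E}. poly (hecke_coeff r (h nu) (pos r x y')) Q)"
   by (rule sum.inter_filter[OF finite_full_flags, symmetric])
  finally have "schur_fun n r Q s (?F, E) * schur_fun n r Q s' (E, ?F')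
   = (\<Sum>x\<in>{x \<in> ?Y. coarsen n nu x = E}. schur_fun n r Q s (?F, E) * poly (hecke_coeff r (h nu) (pos r x y')) Q)"
   by (simp only: sum_distrib_left)
  also have "\<dots> = (\<Sum>x\<in>{x \<in> ?Y. coarsen n nu x = E}. k nu x)"
  proof (rule sum.cong[OF refl])
   fix x assume "x \<in> {x \<in> ?Y. coarsen n nu x = E}"
   hence x: "x \<in> ?Y" "coarsen n nu x = E" by simp_all
   show "schur_fun n r Q s (?F, E) * poly (hecke_coeff r (h nu) (pos r x y')) Q = k nu x"
    using schur_fun_coarsen[OF r2 s(1) ka R(1) y(1) x(1), of Q] unfolding x(2) k_def by simp
  qed
  finally show ?thesis .
 qed
 have "(schur_fun n r Q s \<otimes>\<^bsub>flag_fun_ring n r\<^esub> schur_fun n r Q s') (?F, ?F')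
   = (\<Sum>E\<in>?X. schur_fun n r Q s (?F, E) * schur_fun n r Q s' (E, ?F'))"
  using X by (simp add: fun_ring_simps)
 also have "\<dots> = (\<Sum>nu\<in>weights n r. \<Sum>E\<in>{E \<in> ?X. flag_weight n r E = nu}. schur_fun n r Q s (?F, E) * schur_fun n r Q s' (E, ?F'))"
  by (rule sum.group[OF finite_isotropic_flags finite_weights, symmetric]) (use flag_refine(1) in blast)
 also have "\<dots> = (\<Sum>nu\<in>weights n r. \<Sum>x\<in>?Y. k nu x)"
 proof (rule sum.cong[OF refl])
  fix nu assume nu: "nu \<in> weights n r"
  have "(\<Sum>E\<in>{E \<in> ?X. flag_weight n r E = nu}. schur_fun n r Q s (?F, E) * schur_fun n r Q s' (E, ?F'))
    = (\<Sum>E\<in>{E \<in> ?X. flag_weight n r E = nu}. \<Sum>x\<in>{x \<in> ?Y. coarsen n nu x = E}. k nu x)"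
   by (rule sum.cong[OF refl], rule cell) simp_all
  also have "\<dots> = (\<Sum>x\<in>?Y. k nu x)"
   by (rule sum.group[OF finite_full_flags finite_subset[OF _ finite_isotropic_flags[of n r]]])
    (use coarsen_isotropic[OF nu] flag_weight_coarsen[OF nu] in blast)+
  finally show "(\<Sum>E\<in>{E \<in> ?X. flag_weight n r E = nu}. schur_fun n r Q s (?F, E) * schur_fun n r Q s' (E, ?F')) = (\<Sum>x\<in>?Y. k nu x)" .
 qed
 also have "\<dots> = (\<Sum>nu\<in>weights n r. poly (hecke_act r (h nu) (schur_coeff n r s ka nu) (pos r y y')) Q)"
  unfolding k_def by (rule sum.cong[OF refl], rule hecke_convolution[OF r2 two Q h(1) y])
 also have "\<dots> = poly (schur_coeff n r (s \<otimes>\<^bsub>schurB n r\<^esub> s') ka mu (pos r y y')) Q"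
  unfolding h(3) sum_fun_eval poly_sum ..
 finally show "(schur_fun n r Q s \<otimes>\<^bsub>flag_fun_ring n r\<^esub> schur_fun n r Q s') (?F, ?F')
   = poly (schur_coeff n r (s \<otimes>\<^bsub>schurB n r\<^esub> s') ka mu (pos r y y')) Q" .
qed

lemma schur_fun_one:
 assumes r2: "2 \<le> r"
 shows "(schur_fun n r Q \<one>\<^bsub>schurB n r\<^esub> :: 'f::{field,finite} flag \<times> 'f flag => int) = \<one>\<^bsub>flag_fun_ring n r\<^esub>"
proof (rule schur_fun_eqI[OF r2 schurB_one_closed[OF r2]])
 fix ka mu and y y' :: "'f flag"
 assume ka: "ka \<in> weights n r" and mu: "mu \<in> weights n r" and y: "y \<in> full_flags r" "y' \<in> full_flags r"
  and X: "(coarsen n ka y, coarsen n mu y') \<in> isotropic_flags n r \<times> isotropic_flags n r"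
 have "coarsen n ka y = coarsen n mu y' \<longleftrightarrow> ka = mu \<and> pos r y y' \<in> parabolic n r mu"
 proof (cases "ka = mu")
  case True
  thus ?thesis using coarsen_eq_iff[OF y mu] by simp
 next
  case False
  thus ?thesis using flag_weight_coarsen[OF ka y(1)] flag_weight_coarsen[OF mu y(2)] by auto
 qed
 thus "\<one>\<^bsub>flag_fun_ring n r\<^esub> (coarsen n ka y, coarsen n mu y') = poly (schur_coeff n r \<one>\<^bsub>schurB n r\<^esub> ka mu (pos r y y')) Q"
  unfolding schur_coeff_one[OF r2 ka mu] using X by (simp add: fun_ring_simps set_fun_def fun_apply)
qed (simp add: fun_ring_simps)

lemma schur_fun_add:
 assumes r2: "2 \<le> r" and s: "s \<in> carrier (schurB n r)" "s' \<in> carrier (schurB n r)"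
 shows "(schur_fun n r Q (s \<oplus>\<^bsub>schurB n r\<^esub> s') :: 'f::{field,finite} flag \<times> 'f flag => int)
  = schur_fun n r Q s \<oplus>\<^bsub>flag_fun_ring n r\<^esub> schur_fun n r Q s'"
proof (rule schur_fun_eqI[OF r2 schurB_add_closed[OF r2 s]])
 fix ka mu and y y' :: "'f flag"
 assume *: "ka \<in> weights n r" "mu \<in> weights n r" "y \<in> full_flags r" "y' \<in> full_flags r"
  and X: "(coarsen n ka y, coarsen n mu y') \<in> isotropic_flags n r \<times> isotropic_flags n r"
 show "(schur_fun n r Q s \<oplus>\<^bsub>flag_fun_ring n r\<^esub> schur_fun n r Q s') (coarsen n ka y, coarsen n mu y')
   = poly (schur_coeff n r (s \<oplus>\<^bsub>schurB n r\<^esub> s') ka mu (pos r y y')) Q"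
  unfolding schur_coeff_add[OF r2 s *(1,2)]
  using X by (simp add: fun_ring_simps schur_fun_coarsen[OF r2 s(1) *] schur_fun_coarsen[OF r2 s(2) *] fun_apply)
qed (simp add: fun_ring_simps)

lemma schur_fun_scalar:
 assumes r2: "2 \<le> r" and s: "s \<in> carrier (schurB n r)"
 shows "(schur_fun n r Q (schurB_scalar n r a \<otimes>\<^bsub>schurB n r\<^esub> s) :: 'f::{field,finite} flag \<times> 'f flag => int)
  = (\<lambda>p\<in>isotropic_flags n r \<times> isotropic_flags n r. poly a Q * schur_fun n r Q s p)"
proof (rule schur_fun_eqI[OF r2 schurB_mult_closed[OF r2 schurB_scalar_closed[OF r2] s]])
 let ?X = "isotropic_flags n r :: 'f flag set"
 fix ka mu and y y' :: "'f flag"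
 assume *: "ka \<in> weights n r" "mu \<in> weights n r" "y \<in> full_flags r" "y' \<in> full_flags r" and X: "(coarsen n ka y, coarsen n mu y') \<in> ?X \<times> ?X"
 show "(\<lambda>p\<in>?X \<times> ?X. poly a Q * schur_fun n r Q s p) (coarsen n ka y, coarsen n mu y')
   = poly (schur_coeff n r (schurB_scalar n r a \<otimes>\<^bsub>schurB n r\<^esub> s) ka mu (pos r y y')) Q"
  unfolding schur_coeff_scalar[OF r2 s *(1,2)] restrict_apply'[OF X] by (simp add: schur_fun_coarsen[OF r2 s *])
qed simp

lemma inv_reflect:
 assumes "phi \<in> left_inv n r ka" "phi \<in> right_inv n r mu" and psi: "\<And>w. w \<in> WB r ==> psi w = f (phi w)" "psi \<in> coeffs r"
 shows "psi \<in> left_inv n r ka" "psi \<in> right_inv n r mu"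
proof -
 have W: "srefl r l o w \<in> WB r" "w o srefl r l \<in> WB r" if "l \<in> {1..r}" "w \<in> WB r" for l w
  using comp_WB[OF simple_refl_WB[OF that(1)] that(2)] WB_refl[OF that(2,1)] by blast+
 show "psi \<in> left_inv n r ka" using assms(1) psi W(1) unfolding left_inv_def by simp
 show "psi \<in> right_inv n r mu" using assms(2) psi W(2) unfolding right_inv_def by simp
qed

text \<open>
 Coefficients vanishing at \<open>Q\<close> are divisible by \<open>q - Q\<close>, and the quotients inherit the invariance, so
 they are again the coefficients of an endomorphism.
\<close>

lemma schur_fun_kernel:
 assumes r2: "2 \<le> r" and s: "s \<in> carrier (schurB n r)"
  and 0: "(schur_fun n r Q s :: 'f::{field,finite} flag \<times> 'f flag => int) = \<zero>\<^bsub>flag_fun_ring n r\<^esub>"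
 shows "\<exists>s'\<in>carrier (schurB n r). s = schurB_scalar n r [:- Q, 1:] \<otimes>\<^bsub>schurB n r\<^esub> s'"
proof -
 let ?X = "isotropic_flags n r :: 'f flag set"
 have dvd: "[:- Q, 1:] dvd schur_coeff n r s ka mu w"
  if ka: "ka \<in> weights n r" and mu: "mu \<in> weights n r" and w: "w \<in> WB r" for ka mu w
 proof -
  let ?e = "\<lambda>a i. if i = a then (1::'f) else 0"
  note e = standard_frame[of r, where 'f = 'f]
  have y: "full_flag r ?e \<in> full_flags r" "full_flag r (?e o w) \<in> full_flags r" by (intro full_flagI e frame_comp w)+
  have X: "coarsen n ka (full_flag r ?e) \<in> ?X" "coarsen n mu (full_flag r (?e o w)) \<in> ?X"
   by (rule coarsen_isotropic[OF ka y(1)], rule coarsen_isotropic[OF mu y(2)])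
  have "poly (schur_coeff n r s ka mu w) Q = 0"
   using schur_fun_coarsen[OF r2 s ka mu y, of Q] X unfolding 0 pos[OF e w] by (simp add: fun_ring_simps)
  thus ?thesis by (simp add: poly_eq_0_iff_dvd)
 qed
 define phi where "phi ka mu w = (if w \<in> WB r then schur_coeff n r s ka mu w div [:- Q, 1:] else 0)" for ka mu w
 have phi: "phi ka mu \<in> left_inv n r ka \<and> phi ka mu \<in> right_inv n r mu" if "ka \<in> weights n r" "mu \<in> weights n r" for ka mu
  using inv_reflect[OF schur_coeff_left_inv[OF r2 s that(2,1)] schur_coeff_right_inv[OF r2 s that(2,1)],
   of "phi ka mu" "\<lambda>p. p div [:- Q, 1:]"] by (simp add: phi_def coeffs_def)
 obtain s' where s': "s' \<in> carrier (schurB n r)" "\<And>ka mu. ka \<in> weights n r ==> mu \<in> weights n r ==> schur_coeff n r s' ka mu = phi ka mu"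
  using schur_exists[OF r2 phi] by blast
 have "s = schurB_scalar n r [:- Q, 1:] \<otimes>\<^bsub>schurB n r\<^esub> s'"
 proof (rule schur_eqI[OF r2 s schurB_mult_closed[OF r2 schurB_scalar_closed[OF r2] s'(1)]])
  fix ka mu assume ka: "ka \<in> weights n r" and mu: "mu \<in> weights n r"
  show "schur_coeff n r s ka mu = schur_coeff n r (schurB_scalar n r [:- Q, 1:] \<otimes>\<^bsub>schurB n r\<^esub> s') ka mu"
   unfolding schur_coeff_scalar[OF r2 s'(1) ka mu] s'(2)[OF ka mu]
  proof
   fix w
   show "schur_coeff n r s ka mu w = [:- Q, 1:] * phi ka mu w"
   proof (cases "w \<in> WB r")
    case True
    thus ?thesis using dvd[OF ka mu True] by (simp only: phi_def if_True dvd_mult_div_cancel)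
   next
    case False
    thus ?thesis using left_inv_space[OF schur_coeff_left_inv[OF r2 s mu ka]] by (simp add: phi_def coeffs_def)
   qed
  qed
 qed
 thus ?thesis using s'(1) by blast
qed

text \<open>
 An invariant function, restricted to coarsenings of the flags of one frame and its permutations,
 is a matrix of functions on the Weyl group constant on double cosets.
\<close>

lemma schur_fun_surj:
 assumes r2: "2 \<le> r" and f: "f \<in> carrier (flag_fun_ring n r)"
 shows "\<exists>s\<in>carrier (schurB n r). (schur_fun n r Q s :: 'f::{field,finite} flag \<times> 'f flag => int) = f"
proof -
 let ?X = "isotropic_flags n r :: 'f flag set"
 let ?e = "\<lambda>a i. if i = a then (1::'f) else 0"
 note e = standard_frame[of r, where 'f = 'f]
 have fX: "f \<in> extensional (?X \<times> ?X)" and fr: "\<And>p p'. p \<in> ?X \<times> ?X ==> p' \<in> ?X \<times> ?X ==>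
  relative_position n p = relative_position n p' ==> f p = f p'"
  using f unfolding invariant_fun_carrier by blast+
 let ?P = "\<lambda>ka mu w. (coarsen n ka (full_flag r ?e), coarsen n mu (full_flag r (?e o w)))"
 define phi where "phi ka mu w = (if w \<in> WB r then [:f (?P ka mu w):] else 0)" for ka mu w
 have P: "?P ka mu w \<in> ?X \<times> ?X" "relative_position n (?P ka mu w) = coset_matrix n ka w mu"
  if "ka \<in> weights n r" "mu \<in> weights n r" "w \<in> WB r" for ka mu w
  using coarsen_isotropic[OF that(1) full_flagI[OF e]] coarsen_isotropic[OF that(2) full_flagI[OF frame_comp[OF e that(3)]]]
   relative_position_frame[OF e that(3,1,2)] by blast+
 have dc: "phi ka mu w' = phi ka mu w" if ka: "ka \<in> weights n r" and mu: "mu \<in> weights n r" and w: "w \<in> WB r" and w': "w' \<in> double_coset n r ka w mu"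
  for ka mu w w'
 proof -
  have w'W: "w' \<in> WB r" by (rule double_coset_WB[OF ka mu w w'])
  have "f (?P ka mu w') = f (?P ka mu w)"
   by (rule fr[OF P(1)[OF ka mu w'W] P(1)[OF ka mu w]])
    (simp only: P(2)[OF ka mu w'W] P(2)[OF ka mu w] coset_matrix_double_coset[OF ka mu w w'])
  thus ?thesis using w w'W by (simp add: phi_def)
 qed
 have phi: "phi ka mu \<in> left_inv n r ka \<and> phi ka mu \<in> right_inv n r mu" if ka: "ka \<in> weights n r" and mu: "mu \<in> weights n r" for ka mu
 proof -
  have sp: "phi ka mu \<in> coeffs r" by (simp add: phi_def coeffs_def)
  have l: "phi ka mu (u o w) = phi ka mu w" if "u \<in> parabolic n r ka" "w \<in> WB r" for u w
  proof (rule dc[OF ka mu that(2)])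
   show "u o w \<in> double_coset n r ka w mu" unfolding double_coset_def
    by (intro CollectI exI[of _ u] exI[of _ id] conjI that(1) parabolic_id[OF mu]) simp
  qed
  have r: "phi ka mu (w o u) = phi ka mu w" if "u \<in> parabolic n r mu" "w \<in> WB r" for u w
  proof (rule dc[OF ka mu that(2)])
   show "w o u \<in> double_coset n r ka w mu" unfolding double_coset_def
    by (intro CollectI exI[of _ id] exI[of _ u] conjI that(1) parabolic_id[OF ka]) simp
  qed
  show ?thesis unfolding left_inv_def right_inv_def using sp l r by blast
 qed
 obtain s where s: "s \<in> carrier (schurB n r)" "\<And>ka mu. ka \<in> weights n r ==> mu \<in> weights n r ==> schur_coeff n r s ka mu = phi ka mu"
  using schur_exists[OF r2 phi] by blast
 have "schur_fun n r Q s = f"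
 proof (rule schur_fun_eqI[OF r2 s(1) fX])
  fix ka mu and y y' :: "'f flag"
  assume ka: "ka \<in> weights n r" and mu: "mu \<in> weights n r" and y: "y \<in> full_flags r" "y' \<in> full_flags r"
   and X: "(coarsen n ka y, coarsen n mu y') \<in> ?X \<times> ?X"
  note w = pos_WB[OF y]
  have "f (?P ka mu (pos r y y')) = f (coarsen n ka y, coarsen n mu y')"
   by (rule fr[OF P(1)[OF ka mu w] X]) (simp only: P(2)[OF ka mu w] relative_position_coarsen[OF y ka mu])
  thus "f (coarsen n ka y, coarsen n mu y') = poly (schur_coeff n r s ka mu (pos r y y')) Q"
   unfolding s(2)[OF ka mu] using w by (simp add: phi_def)
 qed
 thus ?thesis using s(1) by blast
qed

text \<open>
 Closure under convolution and associativity are inherited through the surjection from the q-Schur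
 algebra.
\<close>

lemma ring_flag_fun_ring:
 assumes r2: "2 \<le> r" and two: "(1::'f::{field,finite}) + 1 \<noteq> 0"
 shows "ring (flag_fun_ring n r :: ('f flag \<times> 'f flag => int) ring)"
proof -
 let ?R = "flag_fun_ring n r :: ('f flag \<times> 'f flag => int) ring" and ?X = "isotropic_flags n r :: 'f flag set"
 let ?Q = "int (card (UNIV :: 'f set))"
 let ?psi = "schur_fun n r ?Q :: _ => 'f flag \<times> 'f flag => int"
 interpret S: monoid "schurB n r" by (rule monoid_schurB[OF r2])
 note mult = schur_fun_mult[OF r2 two refl]
 have ext: "f \<in> extensional (?X \<times> ?X)" if "f \<in> carrier ?R" for f using that unfolding invariant_fun_carrier by blast
 have surj: "\<exists>s\<in>carrier (schurB n r). f = ?psi s" if "f \<in> carrier ?R" for f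
  using schur_fun_surj[OF r2 that, of ?Q] by metis
 have mc: "f \<otimes>\<^bsub>?R\<^esub> g \<in> carrier ?R" if fg: "f \<in> carrier ?R" "g \<in> carrier ?R" for f g
 proof -
  obtain s s' where "s \<in> carrier (schurB n r)" "f = ?psi s" "s' \<in> carrier (schurB n r)" "g = ?psi s'" using surj fg by metis
  thus ?thesis using mult schur_fun_closed[OF r2 S.m_closed] by metis
 qed
 have const: "f p = f p'" if "f \<in> carrier ?R" "p \<in> ?X \<times> ?X" "p' \<in> ?X \<times> ?X" "relative_position n p = relative_position n p'" for f p p'
  using that unfolding invariant_fun_carrier by blast
 have ac: "f \<oplus>\<^bsub>?R\<^esub> g \<in> carrier ?R" if "f \<in> carrier ?R" "g \<in> carrier ?R" for f g
  unfolding invariant_fun_carrier fun_ring_simps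
 proof (intro conjI ballI impI restrict_extensional)
  fix p p' assume p: "p \<in> ?X \<times> ?X" "p' \<in> ?X \<times> ?X" "relative_position n p = relative_position n p'"
  show "(\<lambda>p\<in>?X \<times> ?X. f p + g p) p = (\<lambda>p\<in>?X \<times> ?X. f p + g p) p'"
   unfolding restrict_apply'[OF p(1)] restrict_apply'[OF p(2)] const[OF that(1) p] const[OF that(2) p] ..
 qed
 have nc: "(\<lambda>p\<in>?X \<times> ?X. - f p) \<in> carrier ?R" if "f \<in> carrier ?R" for f
  unfolding invariant_fun_carrier
 proof (intro conjI ballI impI restrict_extensional)
  fix p p' assume p: "p \<in> ?X \<times> ?X" "p' \<in> ?X \<times> ?X" "relative_position n p = relative_position n p'"
  show "(\<lambda>p\<in>?X \<times> ?X. - f p) p = (\<lambda>p\<in>?X \<times> ?X. - f p) p'"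
   unfolding restrict_apply'[OF p(1)] restrict_apply'[OF p(2)] const[OF that p] ..
 qed
 have zc: "\<zero>\<^bsub>?R\<^esub> \<in> carrier ?R" unfolding invariant_fun_carrier by (auto simp: fun_ring_simps)
 have oc: "\<one>\<^bsub>?R\<^esub> \<in> carrier ?R" using schur_fun_closed[OF r2 S.one_closed] unfolding schur_fun_one[OF r2] .
 show ?thesis
 proof (rule ringI)
  show "abelian_group ?R"
  proof (rule abelian_groupI)
   fix f g h assume fgh: "f \<in> carrier ?R" "g \<in> carrier ?R" "h \<in> carrier ?R"
   show "f \<oplus>\<^bsub>?R\<^esub> g \<in> carrier ?R" by (rule ac[OF fgh(1,2)])
   show "f \<oplus>\<^bsub>?R\<^esub> g \<oplus>\<^bsub>?R\<^esub> h = f \<oplus>\<^bsub>?R\<^esub> (g \<oplus>\<^bsub>?R\<^esub> h)"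
    unfolding fun_ring_simps by (rule restrict_ext) simp
   show "f \<oplus>\<^bsub>?R\<^esub> g = g \<oplus>\<^bsub>?R\<^esub> f" unfolding fun_ring_simps by (rule restrict_ext) simp
  next
   fix f assume f: "f \<in> carrier ?R"
   show "\<zero>\<^bsub>?R\<^esub> \<oplus>\<^bsub>?R\<^esub> f = f"
    by (rule extensionalityI[OF _ ext[OF f]]) (simp_all add: fun_ring_simps)
   show "\<exists>g\<in>carrier ?R. g \<oplus>\<^bsub>?R\<^esub> f = \<zero>\<^bsub>?R\<^esub>"
    by (rule bexI[OF _ nc[OF f]]) (simp add: fun_ring_simps cong: restrict_cong)
  qed (rule zc)
  show "monoid ?R"
  proof (rule monoidI)
   fix f g h assume fgh: "f \<in> carrier ?R" "g \<in> carrier ?R" "h \<in> carrier ?R"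
   show "f \<otimes>\<^bsub>?R\<^esub> g \<in> carrier ?R" by (rule mc[OF fgh(1,2)])
   obtain s s' s'' where s: "s \<in> carrier (schurB n r)" "f = ?psi s" "s' \<in> carrier (schurB n r)" "g = ?psi s'"
    "s'' \<in> carrier (schurB n r)" "h = ?psi s''" using surj fgh by metis
   show "f \<otimes>\<^bsub>?R\<^esub> g \<otimes>\<^bsub>?R\<^esub> h = f \<otimes>\<^bsub>?R\<^esub> (g \<otimes>\<^bsub>?R\<^esub> h)"
    unfolding s(2,4,6) mult[OF s(1,3), symmetric] mult[OF s(3,5), symmetric] mult[OF S.m_closed[OF s(1,3)] s(5), symmetric]
     mult[OF s(1) S.m_closed[OF s(3,5)], symmetric] S.m_assoc[OF s(1,3,5)] ..
  next
   fix f assume "f \<in> carrier ?R"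
   then obtain s where s: "s \<in> carrier (schurB n r)" "f = ?psi s" using surj by blast
   show "\<one>\<^bsub>?R\<^esub> \<otimes>\<^bsub>?R\<^esub> f = f"
    unfolding s(2) schur_fun_one[OF r2, of n ?Q, symmetric] mult[OF S.one_closed s(1), symmetric] S.l_one[OF s(1)] ..
   show "f \<otimes>\<^bsub>?R\<^esub> \<one>\<^bsub>?R\<^esub> = f"
    unfolding s(2) schur_fun_one[OF r2, of n ?Q, symmetric] mult[OF s(1) S.one_closed, symmetric] S.r_one[OF s(1)] ..
  qed (rule oc)
  fix f g h assume fgh: "f \<in> carrier ?R" "g \<in> carrier ?R" "h \<in> carrier ?R"
  show "(f \<oplus>\<^bsub>?R\<^esub> g) \<otimes>\<^bsub>?R\<^esub> h = f \<otimes>\<^bsub>?R\<^esub> h \<oplus>\<^bsub>?R\<^esub> g \<otimes>\<^bsub>?R\<^esub> h"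
   unfolding fun_ring_simps by (rule restrict_ext) (auto simp: distrib_right sum.distrib)
  show "h \<otimes>\<^bsub>?R\<^esub> (f \<oplus>\<^bsub>?R\<^esub> g) = h \<otimes>\<^bsub>?R\<^esub> f \<oplus>\<^bsub>?R\<^esub> h \<otimes>\<^bsub>?R\<^esub> g"
   unfolding fun_ring_simps by (rule restrict_ext) (auto simp: distrib_left sum.distrib)
 qed
qed

lemma flag_fun_add_pow:
 assumes R: "ring (flag_fun_ring n r :: ('f::{field,finite} flag \<times> 'f flag => int) ring)"
  and f: "(f :: 'f flag \<times> 'f flag => int) \<in> carrier (flag_fun_ring n r)"
 shows "add_pow (flag_fun_ring n r) (m::int) f = (\<lambda>p\<in>isotropic_flags n r \<times> isotropic_flags n r. m * f p)"
proof -
 let ?R = "flag_fun_ring n r :: ('f flag \<times> 'f flag => int) ring" and ?X = "isotropic_flags n r :: 'f flag set"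
 interpret R: ring ?R by (rule R)
 have step: "add_pow ?R (i + 1) f = add_pow ?R i f \<oplus>\<^bsub>?R\<^esub> f" for i :: int
  using R.add.int_pow_mult[OF f, of i 1] R.add.int_pow_1[OF f] by simp
 have "add_pow ?R m f p = m * f p" if p: "p \<in> ?X \<times> ?X" for p
 proof (induction m rule: int_induct[of _ 0])
  case base
  show ?case using p by (simp add: add_pow_def fun_ring_simps)
 next
  case (step1 i)
  thus ?case unfolding step using p by (simp add: fun_ring_simps distrib_right)
 next
  case (step2 i)
  have "add_pow ?R i f p = add_pow ?R (i - 1) f p + f p"
   using step[of "i - 1"] p by (simp add: fun_ring_simps)
  thus ?case using step2.IH by (simp add: left_diff_distrib)
 qed
 moreover have "add_pow ?R m f \<in> extensional (?X \<times> ?X)"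
  using R.add.int_pow_closed[OF f, of m] unfolding invariant_fun_carrier by blast
 ultimately show ?thesis by (intro extensionalityI[of _ "?X \<times> ?X"]) simp_all
qed

lemma schur_fun_basis:
 assumes r2: "2 \<le> r" and A: "A \<in> Xi (2*n + 1) (2*r)"
 shows "schurB_basis n r A \<in> carrier (schurB n r)"
  and "(schur_fun n r Q (schurB_basis n r A) :: 'f::{field,finite} flag \<times> 'f flag => int) = char_fun (isotropic_flags n r) (flag_orbit n r A)"
proof -
 let ?X = "isotropic_flags n r :: 'f flag set"
 obtain ka mu w where w: "ka \<in> weights n r" "mu \<in> weights n r" "w \<in> WB r" "coset_matrix n ka w mu = A"
  using coset_matrix_surj[OF A] by blast
 note b = schurB_basis_coeff[OF r2 w(1,2,3) w(4)[symmetric]]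
 show c: "schurB_basis n r A \<in> carrier (schurB n r)" by (rule b(1))
 show "(schur_fun n r Q (schurB_basis n r A) :: 'f flag \<times> 'f flag => int) = char_fun ?X (flag_orbit n r A)"
 proof (rule schur_fun_eqI[OF r2 c])
  show "char_fun ?X (flag_orbit n r A) \<in> extensional (?X \<times> ?X)" by (simp add: char_fun_def)
  fix ka' mu' and y y' :: "'f flag"
  assume ka': "ka' \<in> weights n r" and mu': "mu' \<in> weights n r" and y: "y \<in> full_flags r" "y' \<in> full_flags r"
   and X: "(coarsen n ka' y, coarsen n mu' y') \<in> ?X \<times> ?X"
  let ?v = "pos r y y'"
  have "coset_matrix n ka' ?v mu' = A \<longleftrightarrow> (ka' = ka \<and> mu' = mu) \<and> ?v \<in> double_coset n r ka w mu"
  proof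
   assume "coset_matrix n ka' ?v mu' = A"
   hence "coset_matrix n ka w mu = coset_matrix n ka' ?v mu'" using w(4) by simp
   from coset_matrix_eq_imp[OF w(1-3) ka' mu' pos_WB[OF y] this]
   show "(ka' = ka \<and> mu' = mu) \<and> ?v \<in> double_coset n r ka w mu" by blast
  next
   assume *: "(ka' = ka \<and> mu' = mu) \<and> ?v \<in> double_coset n r ka w mu"
   thus "coset_matrix n ka' ?v mu' = A" using coset_matrix_double_coset[OF w(1-3), of ?v] w(4) by simp
  qed
  thus "char_fun ?X (flag_orbit n r A) (coarsen n ka' y, coarsen n mu' y')
   = poly (schur_coeff n r (schurB_basis n r A) ka' mu' (pos r y y')) Q"
   unfolding b(2)[OF ka' mu'] flag_orbit_eq[OF A]
   using X relative_position_coarsen[OF y ka' mu'] by (simp add: char_fun_def set_fun_def fun_apply)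
 qed
qed

text \<open>Otherwise \<open>x \<mapsto> x + 1\<close> would pair off the elements of the field.\<close>

lemma odd_card_two_nonzero:
 assumes "odd (card (UNIV :: 'f::{field,finite} set))"
 shows "(1::'f) + 1 \<noteq> 0"
proof
 assume 0: "(1::'f) + 1 = 0"
 have xx: "x + 1 + 1 = x" for x :: 'f using 0 by (simp add: add.assoc)
 let ?P = "(\<lambda>x::'f. {x, x + 1}) ` UNIV"
 have "card (UNIV :: 'f set) = card (\<Union>?P)" by (rule arg_cong[of _ _ card]) auto
 also have "\<dots> = (\<Sum>p\<in>?P. card p)"
 proof (rule card_Union_disjoint)
  show "pairwise disjnt ?P"
  proof (rule pairwiseI)
   fix p p' assume p: "p \<in> ?P" "p' \<in> ?P" "p \<noteq> p'"
   then obtain x x' where x: "p = {x, x + 1}" "p' = {x', x' + 1}" by blast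
   have "x \<noteq> x'" "x \<noteq> x' + 1" "x + 1 \<noteq> x'" using p(3) unfolding x by (auto simp: xx)
   thus "disjnt p p'" unfolding x by (auto simp: disjnt_def)
  qed
 qed auto
 also have "\<dots> = (\<Sum>p\<in>?P. 2)" by (rule sum.cong) auto
 finally show False using assms by simp
qed

theorem theorem3p10:
  fixes n r q p k :: nat
    and X :: "('f::{field,finite}) flag set"
  assumes "n \<ge> 1" and "r \<ge> 2"
    and "prime p" and "odd p" and "k \<ge> 1" and "q = p ^ k"
    and "card (UNIV :: 'f set) = q"
    and "X = isotropic_flags n r"
  shows "\<exists>\<Phi> \<in> ring_iso (schurB_spec n r q) (invariant_fun_ring (orth_group r) X (flag_action n)).
           \<forall>A \<in> Xi (2*n + 1) (2*r). \<Phi> (schurB_spec_basis n r q A) = char_fun X (flag_orbit n r A)"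
proof -
 note r2 = assms(2) and X = assms(8)
 have two: "(1::'f) + 1 \<noteq> 0" by (rule odd_card_two_nonzero) (use assms(4,6,7) in simp)
 let ?S = "schurB n r" and ?R = "flag_fun_ring n r :: ('f flag \<times> 'f flag => int) ring"
 let ?ev = "\<lambda>a. poly a (int q)" and ?psi = "schur_fun n r (int q) :: _ => 'f flag \<times> 'f flag => int"
 have Q: "int q = int (card (UNIV :: 'f set))" using assms(7) by simp
 have hom: "?psi \<in> ring_hom ?S ?R"
  by (rule ring_hom_memI) (simp_all only: schur_fun_closed[OF r2] schur_fun_mult[OF r2 two Q] schur_fun_add[OF r2] schur_fun_one[OF r2])
 have surj: "?psi ` carrier ?S = carrier ?R"
  using schur_fun_closed[OF r2, of _ n "int q"] schur_fun_surj[OF r2, of _ n "int q"] by blast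
 have scal: "?psi (schurB_scalar n r a \<otimes>\<^bsub>?S\<^esub> s) = add_pow ?R (?ev a) (?psi s)" if s: "s \<in> carrier ?S" for a s
 proof -
  have "?psi s \<in> carrier ?R" by (rule schur_fun_closed[OF r2 s])
  from flag_fun_add_pow[OF ring_flag_fun_ring[OF r2 two] this, of "?ev a"]
  show ?thesis unfolding schur_fun_scalar[OF r2 s] by simp
 qed
 have ker: "\<exists>a s'. ?ev a = 0 \<and> s' \<in> carrier ?S \<and> s = schurB_scalar n r a \<otimes>\<^bsub>?S\<^esub> s'"
  if "s \<in> carrier ?S" "?psi s = \<zero>\<^bsub>?R\<^esub>" for s
 proof -
  have "?ev [:- int q, 1:] = 0" by simp
  thus ?thesis using schur_fun_kernel[OF r2 that] by blast
 qed
 have ev: "?ev (of_int m) = m" for m by (simp add: of_int_poly)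
 obtain \<Phi> where \<Phi>: "\<Phi> \<in> ring_iso (tensor_algebra ?S (schurB_scalar n r) \<Z> ?ev) ?R"
  "\<And>s. s \<in> carrier ?S ==> \<Phi> (pure_tensor ?S (schurB_scalar n r) \<Z> ?ev s 1) = ?psi s"
  using tensor_algebra_iso[OF monoid_schurB[OF r2] schurB_add_closed[OF r2] schurB_scalar_closed[OF r2]
   ring_flag_fun_ring[OF r2 two] hom surj scal ev ker] by blast
 show ?thesis
 proof (rule bexI)
  show "\<Phi> \<in> ring_iso (schurB_spec n r q) (invariant_fun_ring (orth_group r) X (flag_action n))"
   using \<Phi>(1) unfolding schurB_spec_def X .
  show "\<forall>A \<in> Xi (2*n + 1) (2*r). \<Phi> (schurB_spec_basis n r q A) = char_fun X (flag_orbit n r A)"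
   unfolding schurB_spec_basis_def X using \<Phi>(2) schur_fun_basis[OF r2] by metis
 qed
qed

end
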